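(* Let $K$ be an algebraically closed field and let $C\subset \mathbb{P}^2_K$ be a reduced plane curve of degree $d$. Let $\Gamma$ be any set of singular points of $C$, and let $I_\Gamma\subset S=K[x_0,x_1,x_2]$ be its homogeneous (saturated, reduced) ideal. Then $\operatorname{reg} I_\Gamma\le d-1$. If, moreover, $\Gamma$ contains the points (if any) at which distinct irreducible components of $C$ meet, and all these points of intersection are ordinary nodes of $C$, then the minimal number of homogeneous generating syzygies of $I_\Gamma$ of degree $d$ is precisely the number of irreducible components of $C$ minus $1$.
   Context: $\operatorname{reg}$ denotes Castelnuovo-Mumford regularity of a finitely generated graded $S$-module. A point of $C$ is an ordinary node if $C$ has local analytic equation $xy=0$ there, i.e. the completed local ring of $C$ at the point is isomorphic to $K[[x,y]]/(xy)$. The syzygies of an ideal $I\subset S$ are the elements of its first syzygy module (the kernel of a minimal homogeneous free cover $F_0\to I$); the minimal number of homogeneous generating syzygies of degree $d$ is the number of elements of degree $d$ in a minimal homogeneous generating set of this module, i.e. $\dim_K \operatorname{Tor}_1^S(I,K)_d$. *)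

theory Defs
  imports
    "HOL-Analysis.Analysis"
    "HOL-Library.Poly_Mapping"
    "HOL-Library.Numeral_Type"
    "HOL-Computational_Algebra.Computational_Algebra"
    "HOL-Algebra.QuotRing"
    "HOL-Algebra.Ideal_Product"
begin

section \<open>The graded ring \<open>S = K[x\<^sub>0, x\<^sub>1, x\<^sub>2]\<close>\<close>

text \<open>The variables are indexed by the three-element type \<open>3\<close>, with elements 0, 1, 2.\<close>

type_synonym 'k poly3 = "(3 \<Rightarrow>\<^sub>0 nat) \<Rightarrow>\<^sub>0 'k"

definition mon_deg :: "(3 \<Rightarrow>\<^sub>0 nat) \<Rightarrow> nat" where
  "mon_deg m = (\<Sum>i\<in>UNIV. Poly_Mapping.lookup m i)"

text \<open>Degrees are integers since shifts occur in resolutions; \<open>0\<close> is homogeneous of every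
  degree and is the only homogeneous element of a negative degree.\<close>

definition homog :: "int \<Rightarrow> 'k::zero poly3 set" where
  "homog n = {f. \<forall>m\<in>Poly_Mapping.keys f. int (mon_deg m) = n}"

definition eval3 :: "'k::comm_ring_1 poly3 \<Rightarrow> 'k ^ 3 \<Rightarrow> 'k" where
  "eval3 f v = (\<Sum>m\<in>Poly_Mapping.keys f.
     Poly_Mapping.lookup f m * (\<Prod>i\<in>UNIV. (v $ i) ^ Poly_Mapping.lookup m i))"

definition partial_deriv :: "3 \<Rightarrow> 'k::comm_ring_1 poly3 \<Rightarrow> 'k poly3" where
  "partial_deriv i f = (\<Sum>m\<in>Poly_Mapping.keys f.
     Poly_Mapping.single (m - Poly_Mapping.single i 1)
       (of_nat (Poly_Mapping.lookup m i) * Poly_Mapping.lookup f m))"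

section \<open>The projective plane and plane curves\<close>

text \<open>Points are the lines through the origin of \<open>K\<^sup>3\<close>.\<close>

definition proj_plane :: "('k::field ^ 3) set set" where
  "proj_plane = {vec.span {v} | v. v \<noteq> 0}"

definition vanishes_at :: "'k::field poly3 \<Rightarrow> ('k ^ 3) set \<Rightarrow> bool" where
  "vanishes_at f p \<longleftrightarrow> (\<forall>v\<in>p - {0}. eval3 f v = 0)"

definition zero_locus :: "'k::field poly3 set \<Rightarrow> ('k ^ 3) set set" where
  "zero_locus T = {p \<in> proj_plane. \<forall>f\<in>T. vanishes_at f p}"

definition vanishing_ideal :: "('k::field ^ 3) set set \<Rightarrow> 'k poly3 set" where
  "vanishing_ideal X = {f. \<forall>p\<in>X. vanishes_at f p}"

definition zariski_closed :: "('k::field ^ 3) set set \<Rightarrow> bool" where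
  "zariski_closed Z \<longleftrightarrow> (\<exists>T. T \<subseteq> (\<Union>n. homog n) \<and> Z = zero_locus T)"

definition irreducible_closed :: "('k::field ^ 3) set set \<Rightarrow> bool" where
  "irreducible_closed Z \<longleftrightarrow> zariski_closed Z \<and> Z \<noteq> {} \<and>
     (\<forall>A B. zariski_closed A \<and> zariski_closed B \<and> Z \<subseteq> A \<union> B \<longrightarrow> Z \<subseteq> A \<or> Z \<subseteq> B)"

definition irreducible_components :: "('k::field ^ 3) set set \<Rightarrow> ('k ^ 3) set set set" where
  "irreducible_components X = {Z. irreducible_closed Z \<and> Z \<subseteq> X \<and>
     (\<forall>Y. irreducible_closed Y \<and> Y \<subseteq> X \<and> Z \<subseteq> Y \<longrightarrow> Y = Z)}"

text \<open>A reduced plane curve of degree \<open>d\<close> is given by its equation, a form of degree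
  \<open>d > 0\<close> without multiple factors.\<close>

definition reduced_plane_curve :: "nat \<Rightarrow> 'k::field poly3 \<Rightarrow> bool" where
  "reduced_plane_curve d F \<longleftrightarrow> d > 0 \<and> F \<in> homog (int d) \<and> squarefree F"

abbreviation curve_points :: "'k::field poly3 \<Rightarrow> ('k ^ 3) set set" where
  "curve_points F \<equiv> zero_locus {F}"

text \<open>The condition that \<open>F\<close> itself vanishes is not redundant when the characteristic divides
  the degree.\<close>

definition singular_points :: "'k::field poly3 \<Rightarrow> ('k ^ 3) set set" where
  "singular_points F = {p \<in> curve_points F. \<forall>i. vanishes_at (partial_deriv i F) p}"

section \<open>Completed local rings and ordinary nodes\<close>

definition type_ring :: "'a::comm_ring_1 ring" where
  "type_ring = \<lparr>carrier = UNIV, mult = (*), one = 1, zero = 0, add = (+)\<rparr>"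

text \<open>The local ring of the plane at \<open>p\<close> consists of the quotients \<open>a / b\<close> of forms of the same
  degree with \<open>b(p) \<noteq> 0\<close>; in it, the curve is cut out by the \<open>a / b\<close> with \<open>F\<close> dividing \<open>a\<close>.\<close>

definition plane_local_ring :: "('k::field ^ 3) set \<Rightarrow> 'k poly3 fract ring" where
  "plane_local_ring p =
     \<lparr>carrier = {Fract a b | a b n. a \<in> homog n \<and> b \<in> homog n \<and> \<not> vanishes_at b p},
      mult = (*), one = 1, zero = 0, add = (+)\<rparr>"

definition curve_local_ideal :: "'k::field poly3 \<Rightarrow> ('k ^ 3) set \<Rightarrow> 'k poly3 fract set" where
  "curve_local_ideal F p =
     {Fract a b | a b n. a \<in> homog n \<and> b \<in> homog n \<and> \<not> vanishes_at b p \<and> F dvd a}"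

definition curve_local_ring :: "'k::field poly3 \<Rightarrow> ('k ^ 3) set \<Rightarrow> 'k poly3 fract set ring" where
  "curve_local_ring F p = plane_local_ring p Quot curve_local_ideal F p"

primrec ideal_power :: "('a, 'b) ring_scheme \<Rightarrow> 'a set \<Rightarrow> nat \<Rightarrow> 'a set" where
  "ideal_power R I 0 = carrier R"
| "ideal_power R I (Suc n) = ideal_prod R I (ideal_power R I n)"

text \<open>The inverse limit of the rings \<open>R/I\<^sup>n\<close>. The map from \<open>R/I\<^bsup>n+1\<^esup>\<close> to \<open>R/I\<^sup>n\<close> sends a coset to
  the coset containing it.\<close>

definition adic_completion :: "('a, 'b) ring_scheme \<Rightarrow> 'a set \<Rightarrow> (nat \<Rightarrow> 'a set) ring" where
  "adic_completion R I =
     \<lparr>carrier = {c. \<forall>n. c n \<in> carrier (R Quot ideal_power R I n) \<and> c (Suc n) \<subseteq> c n},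
      mult = (\<lambda>a b n. a n \<otimes>\<^bsub>R Quot ideal_power R I n\<^esub> b n),
      one = (\<lambda>n. \<one>\<^bsub>R Quot ideal_power R I n\<^esub>),
      zero = (\<lambda>n. \<zero>\<^bsub>R Quot ideal_power R I n\<^esub>),
      add = (\<lambda>a b n. a n \<oplus>\<^bsub>R Quot ideal_power R I n\<^esub> b n)\<rparr>"

text \<open>The maximal ideal of a local ring is its set of non-units.\<close>

definition local_completion :: "('a, 'b) ring_scheme \<Rightarrow> (nat \<Rightarrow> 'a set) ring" where
  "local_completion R = adic_completion R (carrier R - Units R)"

text \<open>\<open>K[[x,y]]\<close> is \<open>K[[x]][[y]]\<close>, with \<open>x = fps_const fps_X\<close> and \<open>y = fps_X\<close>.\<close>

definition node_ring :: "'k::field itself \<Rightarrow> 'k fps fps set ring" where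
  "node_ring _ = type_ring Quot (PIdl\<^bsub>type_ring\<^esub> (fps_const fps_X * fps_X :: 'k fps fps))"

definition ordinary_node :: "'k::field poly3 \<Rightarrow> ('k ^ 3) set \<Rightarrow> bool" where
  "ordinary_node F p \<longleftrightarrow> p \<in> curve_points F \<and>
     local_completion (curve_local_ring F p) \<simeq> node_ring TYPE('k)"

section \<open>Minimal free resolutions of graded \<open>S\<close>-modules\<close>

text \<open>
  A graded \<open>S\<close>-module is a submodule \<open>M\<close> of a type \<open>'b\<close> with scalar multiplication \<open>s\<close>, with
  \<open>gr n\<close> the homogeneous elements of degree \<open>n\<close>. The graded free module with
  generators in degrees \<open>a 0, \<dots>, a (r - 1)\<close> consists of the \<open>u :: nat \<Rightarrow>\<^sub>0 'k poly3\<close> with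
  support in \<open>{..<r}\<close>.
\<close>

definition free_scale :: "'k::comm_ring_1 poly3 \<Rightarrow> (nat \<Rightarrow>\<^sub>0 'k poly3) \<Rightarrow> (nat \<Rightarrow>\<^sub>0 'k poly3)" where
  "free_scale c u = Poly_Mapping.map ((*) c) u"

definition free_grading :: "(nat \<Rightarrow> int) \<Rightarrow> int \<Rightarrow> (nat \<Rightarrow>\<^sub>0 'k::zero poly3) set" where
  "free_grading a n = {u. \<forall>j. Poly_Mapping.lookup u j \<in> homog (n - a j)}"

text \<open>\<open>g 0, \<dots>, g (r - 1)\<close> is a minimal homogeneous generating set of \<open>M\<close>, with \<open>g j\<close> of
  degree \<open>a j\<close>.\<close>

definition min_homog_gens ::
  "('k::comm_ring_1 poly3 \<Rightarrow> 'b \<Rightarrow> 'b) \<Rightarrow> (int \<Rightarrow> 'b set) \<Rightarrow> 'b::ab_group_add set \<Rightarrow>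
   nat \<Rightarrow> (nat \<Rightarrow> int) \<Rightarrow> (nat \<Rightarrow> 'b) \<Rightarrow> bool" where
  "min_homog_gens s gr M r a g \<longleftrightarrow>
     (\<forall>j<r. g j \<in> gr (a j)) \<and>
     Modules.module.span s (g ` {..<r}) = M \<and>
     (\<forall>j<r. g j \<notin> Modules.module.span s (g ` ({..<r} - {j})))"

text \<open>The kernel of the map from the free module on \<open>r\<close> generators given by \<open>g\<close>.\<close>

definition syzygies ::
  "('k::comm_ring_1 poly3 \<Rightarrow> 'b \<Rightarrow> 'b) \<Rightarrow> nat \<Rightarrow> (nat \<Rightarrow> 'b::ab_group_add) \<Rightarrow>
   (nat \<Rightarrow>\<^sub>0 'k poly3) set" where
  "syzygies s r g =
     {u. Poly_Mapping.keys u \<subseteq> {..<r} \<and> (\<Sum>j<r. s (Poly_Mapping.lookup u j) (g j)) = 0}"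

text \<open>
  A minimal free resolution: the \<open>i\<close>-th free module has rank \<open>r i\<close> and generators in degrees
  \<open>a i j\<close>, \<open>j < r i\<close>. The generators of the \<open>0\<close>-th one are sent to the minimal generators \<open>g\<close> of
  \<open>M\<close>, those of the \<open>(i+1)\<close>-st one to minimal generators \<open>h i\<close> of the preceding kernel. The
  sequence is indexed by all \<open>i\<close>, with \<open>r i = 0\<close> beyond the length of the resolution.
\<close>

definition min_free_resolution ::
  "('k::comm_ring_1 poly3 \<Rightarrow> 'b \<Rightarrow> 'b) \<Rightarrow> (int \<Rightarrow> 'b set) \<Rightarrow> 'b::ab_group_add set \<Rightarrow>
   (nat \<Rightarrow> nat) \<Rightarrow> (nat \<Rightarrow> nat \<Rightarrow> int) \<Rightarrow> (nat \<Rightarrow> 'b) \<Rightarrow> (nat \<Rightarrow> nat \<Rightarrow> (nat \<Rightarrow>\<^sub>0 'k poly3)) \<Rightarrow> bool"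
  where
  "min_free_resolution s gr M r a g h \<longleftrightarrow>
     min_homog_gens s gr M (r 0) (a 0) g \<and>
     (\<forall>i. min_homog_gens free_scale (free_grading (a i))
        (case i of 0 \<Rightarrow> syzygies s (r 0) g | Suc k \<Rightarrow> syzygies free_scale (r i) (h k))
        (r (Suc i)) (a (Suc i)) (h i))"

text \<open>The number of generators of degree \<open>n\<close> of the \<open>i\<close>-th free module in a minimal free
  resolution. It does not depend on the resolution, and is the dimension of
  \<open>Tor\<^sub>i(M,K)\<close> in degree \<open>n\<close>.\<close>

definition graded_betti ::
  "('k::comm_ring_1 poly3 \<Rightarrow> 'b \<Rightarrow> 'b) \<Rightarrow> (int \<Rightarrow> 'b set) \<Rightarrow> 'b::ab_group_add set \<Rightarrow>
   nat \<Rightarrow> int \<Rightarrow> nat" where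
  "graded_betti s gr M i n =
     (THE b. \<exists>r a g h. min_free_resolution s gr M r a g h \<and> b = card {j. j < r i \<and> a i j = n})"

text \<open>Extended real valued: the zero module has regularity \<open>-\<infinity>\<close>.\<close>

definition regularity ::
  "('k::comm_ring_1 poly3 \<Rightarrow> 'b \<Rightarrow> 'b) \<Rightarrow> (int \<Rightarrow> 'b set) \<Rightarrow> 'b::ab_group_add set \<Rightarrow> ereal" where
  "regularity s gr M =
     Sup {ereal (real_of_int (n - int i)) | i n. graded_betti s gr M i n \<noteq> 0}"

definition ideal_reg :: "'k::comm_ring_1 poly3 set \<Rightarrow> ereal" where
  "ideal_reg I = regularity (*) homog I"

definition num_min_syzygies :: "'k::comm_ring_1 poly3 set \<Rightarrow> int \<Rightarrow> nat" where
  "num_min_syzygies I n = graded_betti (*) homog I 1 n"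

end

(* Let g_j be minimal generators of I of degrees a_j, and N their syzygy module, with minimal
   generators h_k of degrees b_k. Since I is saturated, N is free on the h_k. Write F = sum w_i g_i.
   For a linear form phi on N, psi_j = sum_i w_i phi(g_i e_j - g_j e_i) satisfies psi(u) = F phi(u)
   for u in N, so that g_j -> psi_j is a homomorphism from I to S/F. Because F is singular along
   Gamma, comparing gradients shows that all its values lie in I, so it can be iterated. Applied to
   the coordinate of h_k, of degree b_k - d, iteration shows: if b_k > d, the degrees eventually
   become negative, so F divides all psi_j, which contradicts the minimality of h_k. Hence b_k <= d,
   and a_j < b_k for some k gives a_j <= d - 1.

   If b_k = d the homomorphism has degree 0, and together with the inclusion these form a basis of
   the homomorphisms of degree 0 from I to S/F. On each component such a homomorphism is a scalar,
   having a minimal polynomial over K. When the components P and F/P meet transversally in points of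
   Gamma, Max Noether's theorem gives I <= (P, F/P), so that the scalars on the components can be
   prescribed independently, and the dimension is also the number of components. *)

theory Submission
  imports Defs "Berlekamp_Zassenhaus.Unique_Factorization_Poly"
begin

text \<open>The map psi is a preimage of phi under the connecting map from Hom(I, S/F) to Ext(I, S)
  that belongs to multiplication by F on S: as F lies in I, it kills Ext(I, S), so every class,
  given by a linear form on N, has a preimage. The shift by d in the degrees is the degree of F. A
  homomorphism from I to S/F is multiplication by a fraction whose denominator is any form of I
  prime to F; its iterates are powers of that fraction and S/F is reduced, which is why iteration
  controls it. Saturation enters only through a line missing Gamma: its equation is a nonzerodivisor
  on S/I, and with a second linear form it cuts out a point at which graded vectors are evaluated. A
  vector vanishing there is a combination of the two linear forms with coefficients again in the
  module, of degree one less; freeness and finite generation follow by this descent. Noether's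
  theorem is reduced to a single point by a simultaneous eigenvector of the coordinates on the
  quotient.\<close>

no_notation fps_nth (infixl "$" 75)
no_notation Matrix.vec_index (infixl "$" 100)

section \<open>Monomials and induction on polynomials\<close>

lemma mon_deg_0 [simp]: "mon_deg 0 = 0"
  by (simp add: mon_deg_def)

lemma mon_deg_add [simp]: "mon_deg (a + b) = mon_deg a + mon_deg b"
  by (simp add: mon_deg_def lookup_add sum.distrib)

lemma mon_deg_single [simp]: "mon_deg (Poly_Mapping.single i n) = n"
  by (simp add: mon_deg_def lookup_single when_def)

lemma mon_deg_eq_0_iff [simp]: "mon_deg m = 0 \<longleftrightarrow> m = 0"
  by (auto simp: mon_deg_def poly_mapping_eq_iff fun_eq_iff)

lemma poly_mapping_eq_sum_singles:
  "f = (\<Sum>m\<in>Poly_Mapping.keys f. Poly_Mapping.single m (Poly_Mapping.lookup f m))"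
  by (rule poly_mapping_eqI)
     (simp add: lookup_sum lookup_single when_def in_keys_iff)

lemma poly3_induct [case_names single add]:
  fixes f :: "'k::comm_ring_1 poly3"
  assumes "\<And>m c. P (Poly_Mapping.single m c)" and "\<And>f g. P f \<Longrightarrow> P g \<Longrightarrow> P (f + g)"
  shows "P f"
proof -
  have "P (\<Sum>m\<in>A. Poly_Mapping.single m (Poly_Mapping.lookup f m))" if "finite A" for A
    using that
  proof (induction A)
    case empty
    show ?case using assms(1)[of 0 0] by simp
  qed (use assms in auto)
  thus ?thesis using poly_mapping_eq_sum_singles[of f] by (metis finite_keys)
qed

subsection \<open>Evaluation homomorphisms\<close>

definition var :: "3 \<Rightarrow> 'k::comm_ring_1 poly3" where
  "var i = Poly_Mapping.single (Poly_Mapping.single i 1) 1"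

definition const3 :: "'k::comm_ring_1 \<Rightarrow> 'k poly3" where
  "const3 c = Poly_Mapping.single 0 c"

text \<open>Kept general in the coefficient map and in the values: point evaluation, restriction to
  a line, Taylor expansion and the passage to iterated univariate polynomials are all instances, so
  one proof of the homomorphism laws serves them.\<close>

definition pm_eval :: "('k::comm_ring_1 \<Rightarrow> 'r::comm_ring_1) \<Rightarrow> (3 \<Rightarrow> 'r) \<Rightarrow> 'k poly3 \<Rightarrow> 'r" where
  "pm_eval c s f =
     (\<Sum>m\<in>Poly_Mapping.keys f. c (Poly_Mapping.lookup f m) * (\<Prod>i\<in>UNIV. s i ^ Poly_Mapping.lookup m i))"

lemma const3_0 [simp]: "const3 0 = 0"
  by (simp add: const3_def)

lemma const3_1 [simp]: "const3 1 = 1"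
  by (simp add: const3_def)

lemma const3_add: "const3 (a + b) = const3 a + const3 b"
  by (simp add: const3_def single_add)

lemma const3_mult: "const3 (a * b) = const3 a * const3 b"
  by (simp add: const3_def mult_single)

lemma const3_uminus: "const3 (- a) = - const3 a"
  by (simp add: const3_def single_uminus)

lemma const3_diff: "const3 (a - b) = const3 a - const3 b"
  by (simp add: const3_def single_diff)

lemma const3_power: "const3 (a ^ n) = const3 a ^ n"
  by (induction n) (auto simp: const3_mult)

lemma const3_eq_iff [simp]: "const3 a = const3 b \<longleftrightarrow> a = b"
  unfolding const3_def by (metis lookup_single_eq)

lemma const3_eq_0_iff [simp]: "const3 a = 0 \<longleftrightarrow> a = 0"
  using const3_eq_iff[of a 0] by (simp del: const3_eq_iff)

lemma const3_sum: "const3 (sum h A) = (\<Sum>x\<in>A. const3 (h x))"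
  by (induction A rule: infinite_finite_induct) (auto simp: const3_add)

lemma const3_prod: "const3 (prod h A) = (\<Prod>x\<in>A. const3 (h x))"
  by (induction A rule: infinite_finite_induct) (auto simp: const3_mult)

lemma lookup_const3_mult: "Poly_Mapping.lookup (const3 c * f) m = c * Poly_Mapping.lookup f m"
  unfolding const3_def mult_map_scale_conv_mult[symmetric]
  by (simp add: Poly_Mapping.map.rep_eq when_def)

locale coef_hom =
  fixes c :: "'k::comm_ring_1 \<Rightarrow> 'r::comm_ring_1"
  assumes c_1 [simp]: "c 1 = 1"
    and c_add: "c (a + b) = c a + c b"
    and c_mult: "c (a * b) = c a * c b"
begin

lemma c_0 [simp]: "c 0 = 0"
  using c_add[of 0 0] by simp

lemma eval_superset:
  assumes "finite A" "Poly_Mapping.keys f \<subseteq> A"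
  shows "pm_eval c s f = (\<Sum>m\<in>A. c (Poly_Mapping.lookup f m) * (\<Prod>i\<in>UNIV. s i ^ Poly_Mapping.lookup m i))"
  unfolding pm_eval_def
  by (rule sum.mono_neutral_left) (use assms in \<open>auto simp: in_keys_iff\<close>)

lemma eval_single: "pm_eval c s (Poly_Mapping.single m a) = c a * (\<Prod>i\<in>UNIV. s i ^ Poly_Mapping.lookup m i)"
  by (subst eval_superset[where A = "{m}"]) auto

lemma eval_0 [simp]: "pm_eval c s 0 = 0"
  by (simp add: pm_eval_def)

lemma eval_add: "pm_eval c s (f + g) = pm_eval c s f + pm_eval c s g"
proof -
  let ?A = "Poly_Mapping.keys f \<union> Poly_Mapping.keys g"
  have "Poly_Mapping.keys (f + g) \<subseteq> ?A"
    by (rule Poly_Mapping.keys_add)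
  thus ?thesis
    by (simp add: eval_superset[where A = ?A] lookup_add c_add distrib_right sum.distrib)
qed

lemma eval_1 [simp]: "pm_eval c s 1 = 1"
  using eval_single[of s 0 1] by simp

lemma eval_const3: "pm_eval c s (const3 a) = c a"
  by (simp add: const3_def eval_single)

lemma eval_var: "pm_eval c s (var j) = s j"
proof -
  have "(\<Prod>i\<in>UNIV. s i ^ Poly_Mapping.lookup (Poly_Mapping.single j (1::nat)) i) = (\<Prod>i\<in>UNIV. if i = j then s i else 1)"
    by (rule prod.cong) (auto simp: lookup_single)
  thus ?thesis by (simp add: var_def eval_single)
qed

lemma eval_mult: "pm_eval c s (f * g) = pm_eval c s f * pm_eval c s g"
proof (induction f rule: poly3_induct)
  case (single m a)
  show ?case
  proof (induction g rule: poly3_induct)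
    case (single m' a')
    show ?case
      by (simp add: mult_single eval_single c_mult lookup_add power_add prod.distrib)
  qed (simp add: distrib_left eval_add)
qed (simp add: distrib_right eval_add)

lemma eval_uminus: "pm_eval c s (- f) = - pm_eval c s f"
  using eval_add[of s f "- f"] by (simp add: eq_neg_iff_add_eq_0 add.commute)

lemma eval_diff: "pm_eval c s (f - g) = pm_eval c s f - pm_eval c s g"
  using eval_add[of s f "- g"] by (simp add: eval_uminus)

lemma eval_sum: "pm_eval c s (sum f A) = (\<Sum>x\<in>A. pm_eval c s (f x))"
  by (induction A rule: infinite_finite_induct) (auto simp: eval_add)

lemma eval_prod: "pm_eval c s (prod f A) = (\<Prod>x\<in>A. pm_eval c s (f x))"
  by (induction A rule: infinite_finite_induct) (auto simp: eval_mult)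

lemma eval_power: "pm_eval c s (f ^ n) = pm_eval c s f ^ n"
  by (induction n) (auto simp: eval_mult)

lemmas eval_simps = eval_add eval_mult eval_uminus eval_diff eval_sum eval_prod eval_power eval_const3 eval_var

end

lemma single_eq_monomial:
  "Poly_Mapping.single m a = const3 a * (\<Prod>i\<in>UNIV. var i ^ Poly_Mapping.lookup m i)"
proof -
  have *: "(\<Prod>i\<in>A. var i ^ Poly_Mapping.lookup m i :: 'a poly3) =
      Poly_Mapping.single (\<Sum>i\<in>A. Poly_Mapping.single i (Poly_Mapping.lookup m i)) 1" if "finite A" for A
    using that
  proof (induction A)
    case (insert x A)
    have "var x ^ n = (Poly_Mapping.single (Poly_Mapping.single x n) 1 :: 'a poly3)" for n
      by (induction n) (simp_all add: var_def mult_single single_add[symmetric])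
    thus ?case using insert by (simp add: mult_single)
  qed simp
  have "(\<Sum>i\<in>UNIV. Poly_Mapping.single i (Poly_Mapping.lookup m i)) = m"
    by (rule poly_mapping_eqI) (simp add: lookup_sum lookup_single when_def)
  thus ?thesis by (simp add: * const3_def mult_single)
qed

lemma poly3_ring_induct [case_names const var add mult]:
  fixes f :: "'k::comm_ring_1 poly3"
  assumes c: "\<And>a. P (const3 a)" and v: "\<And>i. P (var i)"
    and a: "\<And>f g. P f \<Longrightarrow> P g \<Longrightarrow> P (f + g)" and m: "\<And>f g. P f \<Longrightarrow> P g \<Longrightarrow> P (f * g)"
  shows "P f"
proof (induction f rule: poly3_induct)
  case (single m a)
  have 1: "P 1" using c[of 1] by simp
  have "P (var i ^ n)" for i n
    by (induction n) (auto simp: 1 v m)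
  hence "P (\<Prod>i\<in>A. var i ^ Poly_Mapping.lookup m i)" for A
    by (induction A rule: infinite_finite_induct) (auto simp: 1 assms(4))
  thus ?case by (simp add: single_eq_monomial c assms(4))
qed (rule a)

lemma coef_hom_id: "coef_hom (\<lambda>x::'k::comm_ring_1. x)"
  by standard auto

lemma coef_hom_const3: "coef_hom (const3 :: 'k::comm_ring_1 \<Rightarrow> _)"
  by standard (auto simp: const3_add const3_mult)

lemma eval3_eq_pm_eval: "eval3 f v = pm_eval (\<lambda>x. x) (\<lambda>i. v $ i) f"
  by (simp add: eval3_def pm_eval_def)

lemmas eval3_simps [simp] =
  coef_hom.eval_0[OF coef_hom_id, of "\<lambda>i. v $ i" for v, folded eval3_eq_pm_eval]
  coef_hom.eval_1[OF coef_hom_id, of "\<lambda>i. v $ i" for v, folded eval3_eq_pm_eval]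
  coef_hom.eval_simps[OF coef_hom_id, of "\<lambda>i. v $ i" for v, folded eval3_eq_pm_eval]

subsection \<open>Homogeneous polynomials\<close>

lemma homog_0 [simp]: "0 \<in> homog n"
  by (simp add: homog_def)

lemma homog_add: "f \<in> homog n \<Longrightarrow> g \<in> homog n \<Longrightarrow> f + g \<in> homog n"
  using Poly_Mapping.keys_add[of f g] by (auto simp: homog_def)

lemma homog_uminus: "f \<in> homog n \<Longrightarrow> - f \<in> homog (n :: int)" for f :: "'k::comm_ring_1 poly3"
  by (auto simp: homog_def in_keys_iff)

lemma homog_diff: "f \<in> homog n \<Longrightarrow> g \<in> homog n \<Longrightarrow> f - g \<in> homog n" for f :: "'k::comm_ring_1 poly3"
  using homog_add[of f n "- g"] homog_uminus[of g n] by simp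

lemma homog_mult: "f \<in> homog n \<Longrightarrow> g \<in> homog m \<Longrightarrow> f * g \<in> homog (n + m)"
  for f :: "'k::comm_ring_1 poly3"
  using Poly_Mapping.keys_mult[of f g] by (fastforce simp: homog_def)

lemma homog_sum: "(\<And>x. x \<in> A \<Longrightarrow> f x \<in> homog n) \<Longrightarrow> sum f A \<in> homog n"
  by (induction A rule: infinite_finite_induct) (auto simp: homog_add)

lemma homog_const3 [simp]: "const3 c \<in> homog 0"
  by (auto simp: homog_def const3_def in_keys_iff lookup_single when_def)

lemma homog_1 [simp]: "(1 :: 'k::comm_ring_1 poly3) \<in> homog 0"
  using homog_const3[of "1::'k"] by simp

lemma homog_var [simp]: "var i \<in> homog 1"
  by (auto simp: homog_def var_def in_keys_iff lookup_single when_def)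

lemma homog_const3_mult: "f \<in> homog n \<Longrightarrow> const3 c * f \<in> homog n"
  using homog_mult[of "const3 c" 0 f n] by simp

lemma homog_power: "f \<in> homog n \<Longrightarrow> f ^ k \<in> homog (int k * n)" for f :: "'k::comm_ring_1 poly3"
proof (induction k)
  case (Suc k)
  thus ?case using homog_mult[of f n "f ^ k" "int k * n"] by (simp add: algebra_simps)
qed simp

lemma homog_prod:
  fixes f :: "'a \<Rightarrow> 'k::comm_ring_1 poly3"
  shows "(\<And>x. x \<in> A \<Longrightarrow> f x \<in> homog (n x)) \<Longrightarrow> prod f A \<in> homog (sum n A)"
  by (induction A rule: infinite_finite_induct) (auto simp: homog_mult)

lemma homog_neg: "n < 0 \<Longrightarrow> f \<in> homog n \<Longrightarrow> f = 0"
  by (rule poly_mapping_eqI) (force simp: homog_def in_keys_iff)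

lemma homog_0_const:
  fixes f :: "'k::comm_ring_1 poly3"
  assumes "f \<in> homog 0"
  shows "f = const3 (Poly_Mapping.lookup f 0)"
proof (rule poly_mapping_eqI)
  fix m
  show "Poly_Mapping.lookup f m = Poly_Mapping.lookup (const3 (Poly_Mapping.lookup f 0)) m"
  proof (cases "m = 0")
    case False
    hence "m \<notin> Poly_Mapping.keys f" using assms by (auto simp: homog_def)
    thus ?thesis using False by (simp add: const3_def lookup_single in_keys_iff)
  qed (simp add: const3_def)
qed

lemma homog_unique: "f \<in> homog n \<Longrightarrow> f \<in> homog m \<Longrightarrow> f \<noteq> 0 \<Longrightarrow> n = m"
  by (auto simp: homog_def)

definition hcomp :: "int \<Rightarrow> 'k::comm_ring_1 poly3 \<Rightarrow> 'k poly3" where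
  "hcomp n f = (\<Sum>m\<in>{m \<in> Poly_Mapping.keys f. int (mon_deg m) = n}. Poly_Mapping.single m (Poly_Mapping.lookup f m))"

lemma lookup_hcomp:
  "Poly_Mapping.lookup (hcomp n f) m = (if int (mon_deg m) = n then Poly_Mapping.lookup f m else 0)"
  by (auto simp: hcomp_def lookup_sum lookup_single when_def in_keys_iff)

lemma homog_iff_lookup: "f \<in> homog n \<longleftrightarrow> (\<forall>m. int (mon_deg m) \<noteq> n \<longrightarrow> Poly_Mapping.lookup f m = 0)"
  by (auto simp: homog_def in_keys_iff)

lemma hcomp_homog [simp]: "hcomp n f \<in> homog n"
  by (simp add: homog_iff_lookup lookup_hcomp)

lemma hcomp_add: "hcomp n (f + g) = hcomp n f + hcomp n g"
  by (rule poly_mapping_eqI) (simp add: lookup_hcomp lookup_add)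

lemma hcomp_0 [simp]: "hcomp n 0 = 0"
  by (rule poly_mapping_eqI) (simp add: lookup_hcomp)

lemma hcomp_sum: "hcomp n (sum f A) = (\<Sum>x\<in>A. hcomp n (f x))"
  by (induction A rule: infinite_finite_induct) (auto simp: hcomp_add)

lemma hcomp_of_homog: "f \<in> homog m \<Longrightarrow> hcomp n f = (if n = m then f else 0)"
  by (rule poly_mapping_eqI) (auto simp: lookup_hcomp homog_iff_lookup)

lemma hcomp_same [simp]: "f \<in> homog n \<Longrightarrow> hcomp n f = f"
  by (simp add: hcomp_of_homog)

text \<open>The inserted 0 gives \<open>Max\<close> a value at the zero polynomial.\<close>

definition tdeg :: "'k::comm_ring_1 poly3 \<Rightarrow> nat" where
  "tdeg f = Max (insert 0 (mon_deg ` Poly_Mapping.keys f))"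

lemma sum_hcomp: "tdeg f \<le> N \<Longrightarrow> (\<Sum>n\<le>N. hcomp (int n) f) = f"
proof (rule poly_mapping_eqI)
  fix m assume N: "tdeg f \<le> N"
  have "mon_deg m \<le> N" if "Poly_Mapping.lookup f m \<noteq> 0"
    using that N by (force simp: tdeg_def in_keys_iff)
  thus "Poly_Mapping.lookup (\<Sum>n\<le>N. hcomp (int n) f) m = Poly_Mapping.lookup f m"
    by (auto simp: lookup_sum lookup_hcomp)
qed

text \<open>Together with \<open>hcomp_same\<close> this turns any representation of a form as a
  combination of forms into one with homogeneous coefficients. Components of negative degree are 0,
  hence the integer index.\<close>

lemma hcomp_mult_homog:
  fixes f g :: "'k::comm_ring_1 poly3"
  assumes "g \<in> homog k"
  shows "hcomp n (g * f) = g * hcomp (n - k) f"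
proof -
  have "hcomp n (g * f) = (\<Sum>i\<le>tdeg f. hcomp n (g * hcomp (int i) f))"
    by (subst (1) sum_hcomp[OF order.refl, of f, symmetric]) (simp add: sum_distrib_left hcomp_sum)
  also have "\<dots> = (\<Sum>i\<le>tdeg f. g * hcomp (n - k) (hcomp (int i) f))"
  proof (rule sum.cong)
    fix i
    have "g * hcomp (int i) f \<in> homog (k + int i)" by (simp add: homog_mult assms)
    thus "hcomp n (g * hcomp (int i) f) = g * hcomp (n - k) (hcomp (int i) f)"
      by (simp add: hcomp_of_homog[of _ "k + int i"] hcomp_of_homog[of _ "int i"])
  qed simp
  also have "\<dots> = g * hcomp (n - k) f"
    by (simp add: sum_distrib_left[symmetric] hcomp_sum[symmetric] sum_hcomp)
  finally show ?thesis .
qed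

lemma hcomp_mult_homog_right:
  fixes f g :: "'k::comm_ring_1 poly3"
  assumes "g \<in> homog k"
  shows "hcomp n (f * g) = hcomp (n - k) f * g"
  using hcomp_mult_homog[OF assms, of n f] by (simp add: mult.commute)

lemma eval3_homog_scale:
  fixes f :: "'k::field poly3"
  assumes "f \<in> homog (int n)"
  shows "eval3 f (c *s v) = c ^ n * eval3 f v"
proof -
  have "eval3 f (c *s v) = (\<Sum>m\<in>Poly_Mapping.keys f. c ^ n * (Poly_Mapping.lookup f m * (\<Prod>i\<in>UNIV. (v $ i) ^ Poly_Mapping.lookup m i)))"
    unfolding eval3_def
  proof (rule sum.cong)
    fix m assume "m \<in> Poly_Mapping.keys f"
    hence "mon_deg m = n" using assms by (auto simp: homog_def)
    hence "(\<Prod>i\<in>UNIV. c ^ Poly_Mapping.lookup m i) = c ^ n"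
      by (simp add: power_sum[symmetric] mon_deg_def)
    thus "Poly_Mapping.lookup f m * (\<Prod>i\<in>UNIV. ((c *s v) $ i) ^ Poly_Mapping.lookup m i) =
      c ^ n * (Poly_Mapping.lookup f m * (\<Prod>i\<in>UNIV. (v $ i) ^ Poly_Mapping.lookup m i))"
      by (simp add: power_mult_distrib prod.distrib)
  qed simp
  thus ?thesis by (simp add: eval3_def sum_distrib_left)
qed

lemma vanishes_at_span:
  fixes f :: "'k::field poly3"
  assumes "f \<in> homog n" "v \<noteq> 0"
  shows "vanishes_at f (vec.span {v}) \<longleftrightarrow> eval3 f v = 0"
proof (cases "n < 0")
  case True
  hence "f = 0" using assms homog_neg by blast
  thus ?thesis by (simp add: vanishes_at_def)
next
  case False
  then obtain k where k: "n = int k" by (metis nonneg_int_cases not_less)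
  have "v \<in> vec.span {v} - {0}" using assms by (simp add: vec.span_base)
  thus ?thesis using assms(1)
    by (auto simp: vanishes_at_def k eval3_homog_scale vec.span_singleton)
qed

text \<open>In a domain the lowest components of a and b, and likewise the highest, have a nonzero
  product. As \<open>a * b\<close> has only one degree, so has each factor.\<close>

lemma homog_mult_cancel:
  fixes a b :: "'k::idom poly3"
  assumes "a * b \<in> homog n" "a * b \<noteq> 0"
  obtains k where "a \<in> homog k" "b \<in> homog (n - k)"
proof -
  have nz: "a \<noteq> 0" "b \<noteq> 0" using assms by auto
  define da where "da f = mon_deg ` Poly_Mapping.keys (f :: 'k poly3)" for f
  have fin: "finite (da f)" for f by (simp add: da_def)
  have ne: "da f \<noteq> {}" if "f \<noteq> 0" for f using that by (simp add: da_def)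
  have comp_nz: "hcomp (int i) f \<noteq> 0 \<longleftrightarrow> i \<in> da f" for i f
  proof -
    have "hcomp (int i) f \<noteq> 0 \<longleftrightarrow> (\<exists>m. Poly_Mapping.lookup (hcomp (int i) f) m \<noteq> 0)"
      by (auto simp: poly_mapping_eq_iff fun_eq_iff)
    thus ?thesis by (auto simp: lookup_hcomp da_def in_keys_iff image_iff)
  qed
  have expand: "hcomp k (a * b) = (\<Sum>i\<le>tdeg a. hcomp (int i) a * hcomp (k - int i) b)" for k
  proof -
    have "hcomp k (a * b) = hcomp k ((\<Sum>i\<le>tdeg a. hcomp (int i) a) * b)"
      by (simp add: sum_hcomp)
    also have "\<dots> = (\<Sum>i\<le>tdeg a. hcomp k (hcomp (int i) a * b))"
      by (simp add: sum_distrib_right hcomp_sum)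
    finally show ?thesis by (simp add: hcomp_mult_homog[OF hcomp_homog])
  qed
  have le_tdeg: "i \<le> tdeg a" if "i \<in> da a" for i
    using that by (auto simp: tdeg_def da_def)
  let ?A = "Max (da a)" and ?B = "Max (da b)" and ?a = "Min (da a)" and ?b = "Min (da b)"
  have z: "hcomp (int i) f = 0" if "i \<notin> da f" for i f using comp_nz that by blast
  have z': "hcomp j f = 0" if "\<forall>i\<in>da f. j \<noteq> int i" for j f
  proof (cases "j < 0")
    case True thus ?thesis by (rule homog_neg[OF _ hcomp_homog])
  next
    case False
    then obtain i where "j = int i" by (metis nonneg_int_cases not_less)
    thus ?thesis using that z by auto
  qed
  have "hcomp (int (?A + ?B)) (a * b) = hcomp (int ?A) a * hcomp (int ?B) b"
  proof -
    have "hcomp (int i) a * hcomp (int (?A + ?B) - int i) b = 0" if "i \<noteq> ?A" for i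
    proof (cases "i \<in> da a")
      case True
      hence "i < ?A" using that fin Max_ge by (metis order_neq_le_trans)
      hence "\<forall>j\<in>da b. int (?A + ?B) - int i \<noteq> int j"
        using Max_ge[OF fin, of _ b] by (smt (verit) of_nat_add of_nat_less_iff of_nat_mono)
      thus ?thesis using z' by auto
    qed (simp add: z)
    hence "hcomp (int (?A + ?B)) (a * b) = (\<Sum>i\<in>{?A}. hcomp (int i) a * hcomp (int (?A + ?B) - int i) b)"
      unfolding expand using le_tdeg[OF Max_in[OF fin ne[OF nz(1)]]]
      by (intro sum.mono_neutral_right) auto
    thus ?thesis by simp
  qed
  moreover have "hcomp (int (?a + ?b)) (a * b) = hcomp (int ?a) a * hcomp (int ?b) b"
  proof -
    have "hcomp (int i) a * hcomp (int (?a + ?b) - int i) b = 0" if "i \<noteq> ?a" for i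
    proof (cases "i \<in> da a")
      case True
      hence "i > ?a" using that fin Min_le by (metis order_neq_le_trans)
      hence "\<forall>j\<in>da b. int (?a + ?b) - int i \<noteq> int j"
        using Min_le[OF fin, of _ b] by (smt (verit) of_nat_add of_nat_less_iff of_nat_mono)
      thus ?thesis using z' by auto
    qed (simp add: z)
    hence "hcomp (int (?a + ?b)) (a * b) = (\<Sum>i\<in>{?a}. hcomp (int i) a * hcomp (int (?a + ?b) - int i) b)"
      unfolding expand using le_tdeg[OF Min_in[OF fin ne[OF nz(1)]]]
      by (intro sum.mono_neutral_right) auto
    thus ?thesis by simp
  qed
  moreover have "hcomp (int ?A) a * hcomp (int ?B) b \<noteq> 0" "hcomp (int ?a) a * hcomp (int ?b) b \<noteq> 0"
    using comp_nz Max_in[OF fin ne] Min_in[OF fin ne] nz by auto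
  ultimately have eqs: "int (?A + ?B) = n" "int (?a + ?b) = n"
    using assms(1) by (metis hcomp_of_homog)+
  have "?a \<le> ?A" "?b \<le> ?B" using Min_le[OF fin Max_in[OF fin ne]] nz by auto
  hence AB: "?a = ?A" "?b = ?B" using eqs by linarith+
  have H: "f \<in> homog (int (Max (da f)))" if "Min (da f) = Max (da f)" for f
  proof -
    have "mon_deg m = Max (da f)" if m: "m \<in> Poly_Mapping.keys f" for m
    proof -
      have "mon_deg m \<in> da f" using m by (simp add: da_def)
      thus ?thesis using Min_le[OF fin] Max_ge[OF fin] \<open>Min (da f) = Max (da f)\<close> by (metis order_antisym)
    qed
    thus ?thesis by (auto simp: homog_def)
  qed
  have "a \<in> homog (int ?A)" "b \<in> homog (int ?B)"
    using H AB by metis+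
  moreover have "int ?B = n - int ?A" using eqs by simp
  ultimately show ?thesis using that by metis
qed

lemma pm_eval_multiples:
  fixes f :: "'k::comm_ring_1 poly3"
  assumes "f \<in> homog (int n)"
  shows "pm_eval const3 (\<lambda>j. const3 (u $ j) * y) f = const3 (eval3 f u) * y ^ n"
proof -
  have "pm_eval const3 (\<lambda>j. const3 (u $ j) * y) f =
      (\<Sum>m\<in>Poly_Mapping.keys f. const3 (Poly_Mapping.lookup f m * (\<Prod>j\<in>UNIV. (u $ j) ^ Poly_Mapping.lookup m j)) * y ^ n)"
    unfolding pm_eval_def
  proof (rule sum.cong)
    fix m assume "m \<in> Poly_Mapping.keys f"
    hence "mon_deg m = n" using assms by (auto simp: homog_def)
    hence n: "(\<Sum>j\<in>UNIV. Poly_Mapping.lookup m j) = n" by (simp only: mon_deg_def)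
    have "(\<Prod>j\<in>UNIV. (const3 (u $ j) * y) ^ Poly_Mapping.lookup m j) =
       const3 (\<Prod>j\<in>UNIV. (u $ j) ^ Poly_Mapping.lookup m j) * (\<Prod>j\<in>UNIV. y ^ Poly_Mapping.lookup m j)"
      by (simp add: power_mult_distrib const3_power prod.distrib const3_prod)
    also have "(\<Prod>j\<in>UNIV. y ^ Poly_Mapping.lookup m j) = y ^ n"
      by (simp add: power_sum[symmetric] n)
    finally show "const3 (Poly_Mapping.lookup f m) * (\<Prod>j\<in>UNIV. (const3 (u $ j) * y) ^ Poly_Mapping.lookup m j) =
        const3 (Poly_Mapping.lookup f m * (\<Prod>j\<in>UNIV. (u $ j) ^ Poly_Mapping.lookup m j)) * y ^ n"
      by (simp add: const3_mult mult.assoc)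
  qed simp
  thus ?thesis by (simp add: eval3_def const3_sum sum_distrib_right)
qed

lemma pm_eval_congruent:
  fixes f :: "'k::comm_ring_1 poly3"
  assumes J: "\<And>j. var j - s j \<in> J" and J0: "0 \<in> J"
    and Jadd: "\<And>a b. a \<in> J \<Longrightarrow> b \<in> J \<Longrightarrow> a + b \<in> J" and Jmult: "\<And>a b. a \<in> J \<Longrightarrow> b * a \<in> J"
  shows "f - pm_eval const3 s f \<in> J"
proof (induction f rule: poly3_ring_induct)
  interpret c3: coef_hom "const3 :: 'k \<Rightarrow> _" by (rule coef_hom_const3)
  case (add f g)
  thus ?case using Jadd[OF add.IH] by (simp add: c3.eval_add algebra_simps)
next
  interpret c3: coef_hom "const3 :: 'k \<Rightarrow> _" by (rule coef_hom_const3)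
  case (mult f g)
  have "f * g - pm_eval const3 s (f * g) = g * (f - pm_eval const3 s f) + pm_eval const3 s f * (g - pm_eval const3 s g)"
    by (simp add: c3.eval_mult algebra_simps)
  thus ?case using Jadd Jmult mult.IH by metis
qed (simp_all add: coef_hom.eval_const3[OF coef_hom_const3] coef_hom.eval_var[OF coef_hom_const3] J J0)

text \<open>Modulo the linear forms that vanish at v each variable is a multiple of
  \<open>var i\<close>, so substitution leaves a single power of \<open>var i\<close>. Only closure
  properties of J are assumed, so that several ideals can be inserted.\<close>

lemma form_mod_point:
  fixes f :: "'k::field poly3"
  assumes f: "f \<in> homog (int n)" and vi: "v $ i \<noteq> 0"
    and J: "\<And>j. const3 (v $ i) * var j - const3 (v $ j) * var i \<in> J"
    and J0: "0 \<in> J"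
    and Jadd: "\<And>a b. a \<in> J \<Longrightarrow> b \<in> J \<Longrightarrow> a + b \<in> J" and Jmult: "\<And>a b. a \<in> J \<Longrightarrow> b * a \<in> J"
  shows "f - const3 (eval3 f v / (v $ i) ^ n) * var i ^ n \<in> J"
proof -
  define u where "u = (1 / v $ i) *s v"
  have "var j - const3 (u $ j) * var i \<in> J" for j
  proof -
    have "const3 (1 / v $ i) * (const3 (v $ i) * var j - const3 (v $ j) * var i) \<in> J"
      by (intro Jmult J)
    also have "const3 (1 / v $ i) * (const3 (v $ i) * var j - const3 (v $ j) * var i) = var j - const3 (u $ j) * var i"
      using vi by (simp add: right_diff_distrib u_def const3_mult[symmetric] flip: mult.assoc)
    finally show ?thesis .
  qed
  from pm_eval_congruent[OF this J0 Jadd Jmult]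
  have "f - pm_eval const3 (\<lambda>j. const3 (u $ j) * var i) f \<in> J" .
  hence "f - const3 (eval3 f u) * var i ^ n \<in> J" by (simp only: pm_eval_multiples[OF f])
  moreover have "eval3 f u = eval3 f v / (v $ i) ^ n"
    unfolding u_def eval3_homog_scale[OF f] by (simp add: power_divide)
  ultimately show ?thesis by simp
qed

subsection \<open>Unique factorization\<close>

lemma comm_ring_hom_poly_map_poly:
  assumes "comm_ring_hom h"
  shows "comm_ring_hom (\<lambda>p. poly (map_poly h p) x)"
proof -
  interpret h: comm_ring_hom h by fact
  interpret map_poly_comm_ring_hom h ..
  show ?thesis by unfold_locales (simp_all add: hom_distribs)
qed

text \<open>\<open>\<Phi>\<close> carries S onto an iterated univariate polynomial ring over a
  field, where irreducible elements are known to be prime; \<open>h3\<close> inverts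
  \<open>\<Phi>\<close>, so divisibility is the same on both sides.\<close>

lemma irreducible_imp_prime_elem_poly3:
  fixes f :: "'k::field poly3"
  assumes f: "irreducible f"
  shows "prime_elem f"
proof -
  define s :: "3 \<Rightarrow> 'k poly poly poly" where
    "s i = (if i = 1 then [:[:[:0, 1:]:]:] else if i = 2 then [:[:0, 1:]:] else [:0, 1:])" for i
  define \<Phi> where "\<Phi> = pm_eval (\<lambda>a::'k. [:[:[:a:]:]:]) s"
  interpret \<Phi>: coef_hom "\<lambda>a::'k. [:[:[:a:]:]:]"
    by standard simp_all
  define h1 where "h1 q = poly (map_poly const3 q) (var 1)" for q :: "'k poly"
  define h2 where "h2 q = poly (map_poly h1 q) (var 2)" for q
  define h3 where "h3 q = poly (map_poly h2 q) (var 3)" for q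
  have c0: "comm_ring_hom (const3 :: 'k \<Rightarrow> _)"
    by unfold_locales (auto simp: const3_add const3_mult)
  have c1: "comm_ring_hom h1" unfolding h1_def by (rule comm_ring_hom_poly_map_poly[OF c0])
  have c2: "comm_ring_hom h2" unfolding h2_def by (rule comm_ring_hom_poly_map_poly[OF c1])
  have c3: "comm_ring_hom h3" unfolding h3_def by (rule comm_ring_hom_poly_map_poly[OF c2])
  interpret h1: comm_ring_hom h1 by fact
  interpret h2: comm_ring_hom h2 by fact
  interpret h3: comm_ring_hom h3 by fact
  have m0: "map_poly const3 [:a, b:] = [:const3 a, const3 b:]" for a b :: 'k
    by (simp add: Polynomial.map_poly_pCons)
  have m1: "map_poly h1 [:a, b:] = [:h1 a, h1 b:]" "map_poly h1 [:a:] = [:h1 a:]" for a b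
    by (simp_all add: Polynomial.map_poly_pCons)
  have m2: "map_poly h2 [:a, b:] = [:h2 a, h2 b:]" "map_poly h2 [:a:] = [:h2 a:]" for a b
    by (simp_all add: Polynomial.map_poly_pCons)
  have h1c: "h1 [:a:] = const3 a" for a by (simp add: h1_def Polynomial.map_poly_pCons)
  have left: "h3 (\<Phi> g) = g" for g
  proof (induction g rule: poly3_ring_induct)
    case (const a)
    show ?case by (simp add: \<Phi>_def \<Phi>.eval_const3 h3_def m2 h2_def m1 h1c)
  next
    case (var i)
    show ?case using exhaust_3[of i]
      by (auto simp: \<Phi>_def \<Phi>.eval_var s_def h3_def m2 h2_def m1 h1_def m0)
  qed (simp_all add: \<Phi>_def \<Phi>.eval_simps h3.hom_add h3.hom_mult)
  have r1: "\<Phi> (h1 q) = [:[:q:]:]" for q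
  proof (induction q)
    case 0 thus ?case by (simp add: \<Phi>_def)
  next
    case (pCons a q)
    have "h1 (pCons a q) = const3 a + var 1 * h1 q"
      by (simp add: h1_def Polynomial.map_poly_pCons)
    thus ?case using pCons by (simp add: \<Phi>_def \<Phi>.eval_simps s_def)
  qed
  have r2: "\<Phi> (h2 q) = [:q:]" for q
  proof (induction q)
    case 0 thus ?case by (simp add: \<Phi>_def)
  next
    case (pCons a q)
    have "h2 (pCons a q) = h1 a + var 2 * h2 q"
      by (simp add: h2_def Polynomial.map_poly_pCons)
    thus ?case using pCons r1[of a] by (simp add: \<Phi>_def \<Phi>.eval_simps s_def)
  qed
  have r3: "\<Phi> (h3 q) = q" for q
  proof (induction q)
    case 0 thus ?case by (simp add: \<Phi>_def)
  next
    case (pCons a q)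
    have "h3 (pCons a q) = h2 a + var 3 * h3 q"
      by (simp add: h3_def Polynomial.map_poly_pCons)
    thus ?case using pCons r2[of a] by (simp add: \<Phi>_def \<Phi>.eval_simps s_def)
  qed
  have dvd: "\<Phi> a dvd \<Phi> b \<longleftrightarrow> a dvd b" for a b
  proof
    assume "\<Phi> a dvd \<Phi> b"
    then obtain c where "\<Phi> b = \<Phi> a * c" by (auto simp: dvd_def)
    hence "b = a * h3 c" using left h3.hom_mult by metis
    thus "a dvd b" by simp
  next
    assume "a dvd b" thus "\<Phi> a dvd \<Phi> b" by (auto simp: dvd_def \<Phi>_def \<Phi>.eval_mult)
  qed
  have one: "\<Phi> 1 = 1" by (simp add: \<Phi>_def)
  have mult: "\<Phi> (a * b) = \<Phi> a * \<Phi> b" for a b by (simp add: \<Phi>_def \<Phi>.eval_mult)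
  have nz: "\<Phi> g \<noteq> 0" if "g \<noteq> 0" for g using left[of g] that by auto
  have "irreducible (\<Phi> f)"
  proof (rule irreducibleI)
    show "\<Phi> f \<noteq> 0" using f nz by (auto simp: irreducible_def)
    show "\<not> \<Phi> f dvd 1" using f dvd[of f 1] one by (auto simp: irreducible_def)
    fix a b assume "\<Phi> f = a * b"
    hence "f = h3 a * h3 b" using left h3.hom_mult by metis
    hence "h3 a dvd 1 \<or> h3 b dvd 1" using f by (auto simp: irreducible_def)
    thus "a dvd 1 \<or> b dvd 1" using dvd[of _ 1] one r3 by metis
  qed
  hence p: "prime_elem (\<Phi> f)" by simp
  show ?thesis
  proof (rule prime_elemI)
    show "f \<noteq> 0" "\<not> f dvd 1" using f by (auto simp: irreducible_def)
    fix a b assume "f dvd a * b"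
    hence "\<Phi> f dvd \<Phi> a * \<Phi> b" using dvd mult by metis
    thus "f dvd a \<or> f dvd b" using p dvd prime_elem_dvd_mult_iff by metis
  qed
qed

lemma homog_decomp2:
  fixes f :: "'k::comm_ring_1 poly3"
  assumes "f \<in> homog n" "a \<in> homog p" "b \<in> homog q" "f = a * A + b * B"
  shows "\<exists>A B. A \<in> homog (n - p) \<and> B \<in> homog (n - q) \<and> f = a * A + b * B"
proof -
  have "f = hcomp n f" using assms(1) by simp
  also have "\<dots> = a * hcomp (n - p) A + b * hcomp (n - q) B"
    using assms(2,3) by (subst assms(4)) (simp add: hcomp_add hcomp_mult_homog)
  finally show ?thesis using hcomp_homog by blast
qed

lemma vec3_eq_0_iff: "(w :: 'a::zero ^ 3) = 0 \<longleftrightarrow> w $ 1 = 0 \<and> w $ 2 = 0 \<and> w $ 3 = 0"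
  by (simp add: Finite_Cartesian_Product.vec_eq_iff forall_3)

subsection \<open>The lines \<open>x\<^sub>1 + t x\<^sub>2 + t\<^sup>2 x\<^sub>3 = 0\<close>\<close>

text \<open>A point lies on at most two lines of this family, t being then a root of a nonzero
  polynomial of degree at most 2. The coefficient 1 at \<open>var 1\<close> makes restriction to the
  line the elimination of this variable.\<close>

definition line :: "'k::comm_ring_1 \<Rightarrow> 'k poly3" where
  "line t = var 1 + const3 t * var 2 + const3 (t ^ 2) * var 3"

definition subst_line :: "'k::comm_ring_1 \<Rightarrow> 'k poly3 \<Rightarrow> 'k poly3" where
  "subst_line t = pm_eval const3 (\<lambda>i. if i = 1 then - (const3 t * var 2) - const3 (t ^ 2) * var 3 else var i)"

text \<open>For a point w of the line, the linear form that together with \<open>line t\<close> cuts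
  out w; it involves only the variables fixed by \<open>subst_line\<close>.\<close>

definition pt_line :: "'k::comm_ring_1 ^ 3 \<Rightarrow> 'k poly3" where
  "pt_line w = const3 (w $ 3) * var 2 - const3 (w $ 2) * var 3"

lemma line_homog [simp]: "line t \<in> homog 1"
  unfolding line_def by (intro homog_add homog_const3_mult homog_var)

lemma pt_line_homog [simp]: "pt_line w \<in> homog 1"
  unfolding pt_line_def by (intro homog_diff homog_const3_mult homog_var)

lemma eval3_line: "eval3 (line t) w = w $ 1 + t * w $ 2 + t ^ 2 * w $ 3"
  by (simp add: line_def)

lemma subst_line_simps:
  "subst_line t (f + g) = subst_line t f + subst_line t g"
  "subst_line t (f * g) = subst_line t f * subst_line t g"
  "subst_line t (const3 c) = const3 c"
  "subst_line t 0 = 0"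
  "subst_line t (- f) = - subst_line t f"
  "subst_line t (f - g) = subst_line t f - subst_line t g"
  by (simp_all add: subst_line_def coef_hom.eval_simps[OF coef_hom_const3] coef_hom.eval_0[OF coef_hom_const3])

lemma subst_line_var [simp]: "subst_line t (var 2) = var 2" "subst_line t (var 3) = var 3"
  "subst_line t (var 1) = - (const3 t * var 2) - const3 (t ^ 2) * var 3"
  by (simp_all add: subst_line_def coef_hom.eval_simps[OF coef_hom_const3])

lemma subst_line_line [simp]: "subst_line t (line t) = 0"
  by (simp add: line_def subst_line_simps)

lemma line_dvd_diff_subst: "line t dvd f - subst_line t f"
proof (induction f rule: poly3_ring_induct)
  case (var i)
  have "var 1 - subst_line t (var 1) = line t" by (simp add: line_def)
  thus ?case using exhaust_3[of i] by auto
next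
  case (add f g)
  have "f + g - subst_line t (f + g) = (f - subst_line t f) + (g - subst_line t g)"
    by (simp add: subst_line_simps)
  thus ?case using add dvd_add by metis
next
  case (mult f g)
  have "f * g - subst_line t (f * g) = (f - subst_line t f) * g + subst_line t f * (g - subst_line t g)"
    by (simp add: subst_line_simps algebra_simps)
  thus ?case using mult by (metis dvd_add dvd_mult dvd_mult2)
qed (simp add: subst_line_simps)

lemma line_dvd_iff: "line t dvd f \<longleftrightarrow> subst_line t f = 0"
proof
  assume "line t dvd f" thus "subst_line t f = 0"
    by (auto simp: dvd_def subst_line_simps)
next
  assume "subst_line t f = 0" thus "line t dvd f" using line_dvd_diff_subst[of t f] by simp
qed

text \<open>Divisibility by the line is vanishing under a ring homomorphism into a domain.\<close>

lemma line_dvd_mult_iff: "line t dvd f * g \<longleftrightarrow> line t dvd f \<or> line t dvd g"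
  for f g :: "'k::idom poly3"
  by (simp add: line_dvd_iff subst_line_simps)

lemma var_nz [simp]: "var i \<noteq> (0 :: 'k::comm_ring_1 poly3)"
  unfolding var_def by (metis lookup_single_eq lookup_zero zero_neq_one)

lemma line_nz [simp]: "line t \<noteq> (0 :: 'k::comm_ring_1 poly3)"
proof
  assume "line t = (0 :: 'k poly3)"
  hence "eval3 (line t) (\<chi> i. if i = 1 then 1 else 0) = (0 :: 'k)" by simp
  thus False by (simp add: eval3_line)
qed

lemma pt_line_not_dvd:
  fixes w :: "'k::field ^ 3"
  assumes "w \<noteq> 0" "eval3 (line t) w = 0"
  shows "\<not> line t dvd pt_line w"
proof
  assume "line t dvd pt_line w"
  hence 0: "pt_line w = 0" by (simp add: line_dvd_iff pt_line_def subst_line_simps)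
  have "eval3 (pt_line w) (\<chi> i. if i = 2 then 1 else 0) = w $ 3"
     "eval3 (pt_line w) (\<chi> i. if i = 3 then 1 else 0) = - w $ 2"
    by (simp_all add: pt_line_def)
  hence "w $ 3 = 0" "w $ 2 = 0" using 0 by simp_all
  thus False using assms by (simp add: vec3_eq_0_iff eval3_line)
qed

text \<open>On the line the first coordinate is determined by the other two, so one of these is
  nonzero at w. With it, \<open>line t\<close> and \<open>pt_line w\<close> generate the linear
  forms vanishing at w, and \<open>form_mod_point\<close> applies.\<close>

lemma form_vanishing_on_line_point:
  fixes f :: "'k::field poly3"
  assumes f: "f \<in> homog n" and w: "w \<noteq> 0" "eval3 (line t) w = 0" "eval3 f w = 0"
  shows "\<exists>A B. A \<in> homog (n - 1) \<and> B \<in> homog (n - 1) \<and> f = line t * A + pt_line w * B"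
proof (cases "n < 0")
  case True
  hence "f = 0" using f homog_neg by blast
  thus ?thesis using homog_0 by (metis add_0 mult_zero_right)
next
  case False
  then obtain k where k: "n = int k" by (metis nonneg_int_cases not_less)
  define J where "J = {line t * A + pt_line w * B | A B. True}"
  have Jadd: "a + b \<in> J" if "a \<in> J" "b \<in> J" for a b
  proof -
    obtain A B C D where "a = line t * A + pt_line w * B" "b = line t * C + pt_line w * D"
      using \<open>a \<in> J\<close> \<open>b \<in> J\<close> J_def by auto
    hence "a + b = line t * (A + C) + pt_line w * (B + D)" by (simp add: algebra_simps)
    thus ?thesis unfolding J_def by blast
  qed
  have Jmult: "b * a \<in> J" if "a \<in> J" for a b
  proof -
    obtain A B where "a = line t * A + pt_line w * B" using \<open>a \<in> J\<close> J_def by auto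
    hence "b * a = line t * (b * A) + pt_line w * (b * B)" by (simp add: algebra_simps)
    thus ?thesis unfolding J_def by blast
  qed
  have "line t = line t * 1 + pt_line w * 0" "pt_line w = line t * 0 + pt_line w * 1" "0 = line t * 0 + pt_line w * 0"
    by simp_all
  hence gens: "line t \<in> J" "pt_line w \<in> J" "0 \<in> J" unfolding J_def by blast+
  have w1: "w $ 1 = - t * w $ 2 - t ^ 2 * w $ 3"
    using arg_cong[OF w(2)[unfolded eval3_line], of "\<lambda>x. x - t * w $ 2 - t ^ 2 * w $ 3"] by simp
  have "w $ 2 \<noteq> 0 \<or> w $ 3 \<noteq> 0" using w(1) w1 by (auto simp: vec3_eq_0_iff)
  hence "f \<in> J"
  proof
    assume w2: "w $ 2 \<noteq> 0"
    have "const3 (w $ 2) * var j - const3 (w $ j) * var 2 \<in> J" for j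
    proof -
      consider "j = 1" | "j = 2" | "j = 3" using exhaust_3 by blast
      thus ?thesis
      proof cases
        case 1
        have "const3 (w $ 2) * var 1 - const3 (w $ 1) * var 2 = const3 (w $ 2) * line t + const3 (t^2) * pt_line w"
          unfolding w1 line_def pt_line_def
          by (simp add: const3_diff const3_mult const3_uminus algebra_simps)
        thus ?thesis using 1 Jadd Jmult gens by metis
      next
        case 3
        have "const3 (w $ 2) * var 3 - const3 (w $ 3) * var 2 = (- 1) * pt_line w"
          by (simp add: pt_line_def)
        thus ?thesis using 3 Jmult gens by metis
      qed (use gens in simp)
    qed
    from form_mod_point[OF f[unfolded k] w2 this gens(3) Jadd Jmult]
    show ?thesis by (simp add: w(3))
  next
    assume w3: "w $ 3 \<noteq> 0"
    have "const3 (w $ 3) * var j - const3 (w $ j) * var 3 \<in> J" for j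
    proof -
      consider "j = 1" | "j = 2" | "j = 3" using exhaust_3 by blast
      thus ?thesis
      proof cases
        case 1
        have "const3 (w $ 3) * var 1 - const3 (w $ 1) * var 3 = const3 (w $ 3) * line t + const3 (-t) * pt_line w"
          unfolding w1 line_def pt_line_def
          by (simp add: const3_diff const3_mult const3_uminus algebra_simps)
        thus ?thesis using 1 Jadd Jmult gens by metis
      next
        case 2
        thus ?thesis using gens(2) by (simp add: pt_line_def)
      qed (use gens in simp)
    qed
    from form_mod_point[OF f[unfolded k] w3 this gens(3) Jadd Jmult]
    show ?thesis by (simp add: w(3))
  qed
  then obtain A B where "f = line t * A + pt_line w * B" unfolding J_def by blast
  thus ?thesis using homog_decomp2[OF f line_homog pt_line_homog] by simp
qed

lemma coef_hom_pCons: "coef_hom (\<lambda>c::'k::comm_ring_1. [:c:])"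
  by standard simp_all

lemma degree_pm_eval_le:
  assumes f: "f \<in> homog (int n)" and s: "\<And>i. degree (s i) \<le> 1"
  shows "degree (pm_eval (\<lambda>c::'k::idom. [:c:]) s f) \<le> n"
  unfolding pm_eval_def
proof (rule degree_sum_le)
  fix m assume "m \<in> Poly_Mapping.keys f"
  hence n: "mon_deg m = n" using f by (auto simp: homog_def)
  have "degree (\<Prod>i\<in>UNIV. s i ^ Poly_Mapping.lookup m i) \<le> (\<Sum>i\<in>UNIV. degree (s i ^ Poly_Mapping.lookup m i))"
    using degree_prod_sum_le[of UNIV "\<lambda>i. s i ^ Poly_Mapping.lookup m i"] by (simp add: o_def)
  also have "\<dots> \<le> (\<Sum>i\<in>UNIV. Poly_Mapping.lookup m i)"
  proof (rule sum_mono)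
    fix i :: 3
    have "degree (s i ^ Poly_Mapping.lookup m i) \<le> degree (s i) * Poly_Mapping.lookup m i"
      by (rule degree_power_le)
    also have "\<dots> \<le> 1 * Poly_Mapping.lookup m i" using s by (intro mult_right_mono) auto
    finally show "degree (s i ^ Poly_Mapping.lookup m i) \<le> Poly_Mapping.lookup m i" by simp
  qed
  also have "\<dots> = n" using n by (simp only: mon_deg_def)
  finally show "degree ([:Poly_Mapping.lookup f m:] * (\<Prod>i\<in>UNIV. s i ^ Poly_Mapping.lookup m i)) \<le> n"
    by simp
qed simp

lemma poly_pm_eval:
  "poly (pm_eval (\<lambda>c::'k::comm_ring_1. [:c:]) s f) x = eval3 f (\<chi> i. poly (s i) x)"
  by (simp add: pm_eval_def eval3_def poly_sum poly_prod)

text \<open>The line is parametrized by x \<mapsto> (-t^2 - t x, x, 1), and v is its point at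
  infinity. If f does not vanish at v, its restriction is a polynomial of degree n > 0, which has a
  root.\<close>

lemma form_has_zero_on_line:
  fixes f :: "'k::alg_closed_field poly3"
  assumes f: "f \<in> homog (int n)" and n: "n > 0"
  obtains w where "w \<noteq> 0" "eval3 (line t) w = 0" "eval3 f w = 0"
proof -
  define v :: "'k ^ 3" where "v = (\<chi> i. if i = 1 then - t else if i = 2 then 1 else 0)"
  have v: "v $ 1 = - t" "v $ 2 = 1" "v $ 3 = 0" by (simp_all add: v_def)
  have vl: "v \<noteq> 0" "eval3 (line t) v = 0" by (simp_all add: vec3_eq_0_iff eval3_line v)
  show ?thesis
  proof (cases "eval3 f v = 0")
    case True
    thus ?thesis using that vl by blast
  next
    case False
    let ?c = "eval3 f v"
    \<comment> \<open>The difference vanishes at v, so modulo the line it is divisible by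
      \<open>pt_line v\<close>. That form restricts to -1, so the difference restricts to a
      polynomial of degree below n, and f keeps the leading coefficient \<open>?c\<close>.\<close>
    let ?g = "f - const3 ?c * var 2 ^ n"
    have g: "?g \<in> homog (int n)"
      using homog_power[OF homog_var, of 2 n] by (intro homog_diff f homog_const3_mult) simp
    have "eval3 ?g v = 0" by (simp add: v)
    from form_vanishing_on_line_point[OF g vl this] obtain A B where
      AB: "B \<in> homog (int n - 1)" "?g = line t * A + pt_line v * B" by blast
    define s where "s i = (if i = 1 then [: - (t ^ 2), - t :] else if i = 2 then [:0, 1:] else [:1:])" for i :: 3
    interpret e: coef_hom "\<lambda>c::'k. [:c:]" by (rule coef_hom_pCons)
    let ?e = "pm_eval (\<lambda>c::'k. [:c:]) s"
    have Bh: "B \<in> homog (int (n - 1))" using AB(1) n by (simp add: of_nat_diff)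
    have dB: "degree (?e B) \<le> n - 1"
      by (rule degree_pm_eval_le[OF Bh]) (simp add: s_def)
    have "f = const3 ?c * var 2 ^ n + line t * A + pt_line v * B" using AB(2) by (simp add: algebra_simps)
    hence "?e f = ?e (const3 ?c * var 2 ^ n + line t * A + pt_line v * B)" by (rule arg_cong)
    also have "\<dots> = [:?c:] * [:0, 1:] ^ n - ?e B"
      by (simp add: e.eval_simps line_def pt_line_def v s_def algebra_simps)
    finally have ef: "?e f = [:?c:] * [:0, 1:] ^ n - ?e B" .
    have "coeff (?e B) n = 0" using dB n by (intro coeff_eq_0) auto
    hence "coeff (?e f) n \<noteq> 0" using False by (simp add: ef monom_altdef[of 1, simplified, symmetric])
    hence "degree (?e f) \<ge> n" by (rule le_degree)
    then obtain x where "poly (?e f) x = 0" using n alg_closed_imp_poly_has_root[of "?e f"] by auto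
    hence "eval3 f (\<chi> i. poly (s i) x) = 0" by (simp only: poly_pm_eval)
    moreover have "(\<chi> i. poly (s i) x) \<noteq> 0" "eval3 (line t) (\<chi> i. poly (s i) x) = 0"
      by (simp_all add: vec3_eq_0_iff eval3_line s_def algebra_simps)
    ultimately show ?thesis using that by blast
  qed
qed

text \<open>A zero w of P on the line is split off as the factor \<open>pt_line w\<close> modulo the
  line. It divides Q too, because G does not vanish at w, and it cancels, being prime to the line;
  the degree of P has dropped. In other words, G is a nonzerodivisor modulo \<open>line t\<close>
  and P.\<close>

lemma line_mod_form_cancel:
  fixes P :: "'k::alg_closed_field poly3"
  assumes "P \<in> homog (int p)" "G \<in> homog g" "Q \<in> homog q"
    and "\<And>w. w \<noteq> 0 \<Longrightarrow> eval3 (line t) w = 0 \<Longrightarrow> eval3 P w = 0 \<Longrightarrow> eval3 G w \<noteq> 0"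
    and "G * Q = line t * A + P * B"
  shows "\<exists>A B. Q = line t * A + P * B"
  using assms
proof (induction p arbitrary: P Q q A B)
  case 0
  then obtain c where c: "P = const3 c" using homog_0_const[of P] by auto
  show ?case
  proof (cases "c = 0")
    case True
    hence "line t dvd G * Q" using 0 c by simp
    \<comment> \<open>Here P = 0, so every point of the line is a zero of P and G vanishes nowhere
      on the line.\<close>
    moreover have "\<not> line t dvd G"
    proof
      assume "line t dvd G"
      define v :: "'k ^ 3" where "v = (\<chi> i. if i = 1 then - t else if i = 2 then 1 else 0)"
      have "v \<noteq> 0" "eval3 (line t) v = 0" by (simp_all add: vec3_eq_0_iff eval3_line v_def)
      moreover have "eval3 G v = 0" using \<open>line t dvd G\<close> calculation by (auto simp: dvd_def)
      ultimately show False using 0(4)[of v] c True by simp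
    qed
    ultimately have "line t dvd Q" by (simp add: line_dvd_mult_iff)
    then obtain A where "Q = line t * A + P * 0" by (auto simp: dvd_def)
    thus ?thesis by blast
  next
    case False
    hence "Q = line t * 0 + P * (const3 (1 / c) * Q)"
      by (simp add: c mult.assoc[symmetric] const3_mult[symmetric])
    thus ?thesis by blast
  qed
next
  case (Suc p)
  obtain w where w: "w \<noteq> 0" "eval3 (line t) w = 0" "eval3 P w = 0"
    using form_has_zero_on_line[OF Suc.prems(1)] by blast
  let ?l = "line t" and ?m = "pt_line w"
  obtain A1 P' where P': "P' \<in> homog (int p)" "P = ?l * A1 + ?m * P'"
    using form_vanishing_on_line_point[OF Suc.prems(1) w] by auto
  have Gw: "eval3 G w \<noteq> 0" using Suc.prems(4) w by blast
  have "eval3 (G * Q) w = 0" unfolding Suc.prems(5) by (simp add: w)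
  hence "eval3 Q w = 0" using Gw by simp
  then obtain A2 Q' where Q': "Q' \<in> homog (q - 1)" "Q = ?l * A2 + ?m * Q'"
    using form_vanishing_on_line_point[OF Suc.prems(3) w(1,2)] by blast
  have "?m * (G * Q' - P' * B) =
      G * (?l * A2 + ?m * Q') - (?l * A1 + ?m * P') * B + ?l * (A1 * B - G * A2)"
    by (simp add: algebra_simps)
  also have "\<dots> = G * Q - P * B + ?l * (A1 * B - G * A2)"
    by (simp only: P'(2)[symmetric] Q'(2)[symmetric])
  also have "\<dots> = ?l * (A + A1 * B - G * A2)"
    unfolding Suc.prems(5) by (simp add: algebra_simps)
  finally have "?m * (G * Q' - P' * B) = ?l * (A + A1 * B - G * A2)" .
  hence "?l dvd ?m * (G * Q' - P' * B)" by simp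
  hence "?l dvd G * Q' - P' * B" using pt_line_not_dvd[OF w(1,2)] by (simp add: line_dvd_mult_iff)
  then obtain A3 where "G * Q' - P' * B = ?l * A3" by (auto simp: dvd_def)
  hence eq: "G * Q' = ?l * A3 + P' * B" by (simp add: algebra_simps)
  have nz: "eval3 G u \<noteq> 0" if "u \<noteq> 0" "eval3 ?l u = 0" "eval3 P' u = 0" for u
    by (rule Suc.prems(4)[OF that(1,2)]) (simp add: P'(2) that)
  obtain A4 B4 where Q'': "Q' = ?l * A4 + P' * B4"
    using Suc.IH[OF P'(1) Suc.prems(2) Q'(1) nz eq] by blast
  have "Q = ?l * (A2 + ?m * A4 - A1 * B4) + (?l * A1 + ?m * P') * B4"
    unfolding Q'(2) Q'' by (simp add: algebra_simps)
  hence "Q = ?l * (A2 + ?m * A4 - A1 * B4) + P * B4"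
    by (simp only: P'(2)[symmetric])
  thus ?case by blast
qed

text \<open>Regular sequences of forms can be permuted.\<close>

lemma line_nonzerodivisor:
  fixes P :: "'k::alg_closed_field poly3"
  assumes P: "P \<in> homog (int p)" and G: "G \<in> homog (int g)" "g > 0"
    and nz: "\<And>w. w \<noteq> 0 \<Longrightarrow> eval3 (line t) w = 0 \<Longrightarrow> eval3 P w = 0 \<Longrightarrow> eval3 G w \<noteq> 0"
    and Q: "Q \<in> homog q" "line t * Q = P * A + G * B"
  shows "\<exists>A B. Q = P * A + G * B"
proof -
  have "line t * Q \<in> homog (1 + q)" using Q by (intro homog_mult) auto
  from homog_decomp2[OF this P G(1) Q(2)] obtain A B where
    AB: "B \<in> homog (1 + q - int g)" "line t * Q = P * A + G * B" by blast
  \<comment> \<open>\<open>G * B\<close> lies in the ideal of the line and P, hence so does B; then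
    a multiple of G can be subtracted from Q to leave a multiple of P.\<close>
  have "G * B = line t * Q + P * (- A)" using AB by (simp add: algebra_simps)
  from line_mod_form_cancel[OF P G(1) AB(1) nz this] obtain C D where
    B: "B = line t * C + P * D" by blast
  have "line t * (Q - C * G) = line t * Q - line t * C * G" by (simp add: algebra_simps)
  also have "\<dots> = P * (A + D * G)"
    unfolding AB(2) B by (simp add: algebra_simps)
  finally have E: "line t * (Q - C * G) = P * (A + D * G)" .
  hence "line t dvd P * (A + D * G)" by (metis dvd_triv_left)
  moreover have "\<not> line t dvd P"
  proof
    assume "line t dvd P"
    moreover obtain w where "w \<noteq> 0" "eval3 (line t) w = 0" "eval3 G w = 0"
      using form_has_zero_on_line[OF G] by blast
    ultimately show False using nz by (auto simp: dvd_def)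
  qed
  ultimately have "line t dvd A + D * G" by (simp add: line_dvd_mult_iff)
  then obtain E where "A + D * G = line t * E" by (auto simp: dvd_def)
  hence "line t * (Q - C * G) = line t * (P * E)"
    using E by (simp add: mult.left_commute)
  hence "Q - C * G = P * E" by simp
  hence "Q = P * E + G * C" by (simp add: algebra_simps)
  thus ?thesis by blast
qed

subsection \<open>Derivatives at a point\<close>

definition deriv_at :: "'k::comm_ring_1 ^ 3 \<Rightarrow> 3 \<Rightarrow> 'k poly3 \<Rightarrow> 'k" where
  "deriv_at v k f = eval3 (partial_deriv k f) v"

lemma partial_deriv_superset:
  assumes "finite A" "Poly_Mapping.keys f \<subseteq> A"
  shows "partial_deriv k f = (\<Sum>m\<in>A.
     Poly_Mapping.single (m - Poly_Mapping.single k 1) (of_nat (Poly_Mapping.lookup m k) * Poly_Mapping.lookup f m))"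
  unfolding partial_deriv_def
  by (rule sum.mono_neutral_left) (use assms in \<open>auto simp: in_keys_iff\<close>)

lemma partial_deriv_add: "partial_deriv k (f + g) = partial_deriv k f + partial_deriv k g"
proof -
  let ?A = "Poly_Mapping.keys f \<union> Poly_Mapping.keys g"
  have "Poly_Mapping.keys (f + g) \<subseteq> ?A" by (rule Poly_Mapping.keys_add)
  thus ?thesis
    by (simp add: partial_deriv_superset[where A = ?A] lookup_add distrib_left single_add sum.distrib)
qed

lemma partial_deriv_single:
  "partial_deriv k (Poly_Mapping.single m a) =
     Poly_Mapping.single (m - Poly_Mapping.single k 1) (of_nat (Poly_Mapping.lookup m k) * a)"
  by (subst partial_deriv_superset[where A = "{m}"]) auto

text \<open>The restriction of f to the affine line through v in the direction of the k-th unit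
  vector. The formal partial derivative at v is its linear coefficient, so the product rule is
  inherited from univariate polynomials.\<close>

definition ray :: "'k::comm_ring_1 ^ 3 \<Rightarrow> 3 \<Rightarrow> 'k poly3 \<Rightarrow> 'k poly" where
  "ray v k = pm_eval (\<lambda>c. [:c:]) (\<lambda>i. [:v $ i, if i = k then 1 else 0:])"

lemma ray_simps:
  "ray v k (f + g) = ray v k f + ray v k g" "ray v k (f * g) = ray v k f * ray v k g"
  "ray v k (const3 c) = [:c:]" "ray v k (var i) = [:v $ i, if i = k then 1 else 0:]"
  by (simp_all add: ray_def coef_hom.eval_simps[OF coef_hom_pCons])

lemma poly_ray_0: "poly (ray v k f) 0 = eval3 f v"
  by (simp add: ray_def poly_pm_eval)

lemma deriv_at_eq: "deriv_at v k f = poly (pderiv (ray v k f)) 0"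
  for v :: "'k::idom ^ 3"
proof (induction f rule: poly3_induct)
  case (single m a)
  let ?l = "Poly_Mapping.lookup m"
  have l: "Poly_Mapping.lookup (m - Poly_Mapping.single k (Suc 0)) i = (if i = k then ?l i - 1 else ?l i)" for i
    by (simp add: minus_poly_mapping.rep_eq lookup_single)
  have pd: "pderiv ([:c, d:] ^ n) = Polynomial.smult (of_nat n * d) ([:c, d:] ^ (n - 1))" for c d :: 'k and n
    by (simp add: pderiv_power pderiv_pCons)
  have pd1: "pderiv (pCons c 1 ^ n) = Polynomial.smult (of_nat n) (pCons c 1 ^ (n - 1))" for c :: 'k and n
    using pd[of c 1 n] by simp
  define R where "R = (\<Prod>i\<in>UNIV - {k}. (v $ i) ^ ?l i)"
  have const: "(\<Prod>i\<in>A. [:v $ i:] ^ ?l i) = [:\<Prod>i\<in>A. (v $ i) ^ ?l i:]" for A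
    by (induction A rule: infinite_finite_induct) (simp_all add: poly_const_pow)
  have "(\<Prod>i\<in>UNIV. (v $ i) ^ Poly_Mapping.lookup (m - Poly_Mapping.single k 1) i) = (v $ k) ^ (?l k - 1) * R"
    by (subst prod.remove[of UNIV k]) (simp_all add: R_def l)
  moreover have "(\<Prod>i\<in>UNIV. [:v $ i, if i = k then 1 else 0:] ^ ?l i) = [:v $ k, 1:] ^ ?l k * [:R:]"
    by (subst prod.remove[of UNIV k]) (simp_all add: R_def const)
  ultimately show ?case
    by (simp add: deriv_at_def partial_deriv_single ray_def eval3_eq_pm_eval coef_hom.eval_single[OF coef_hom_id]
      coef_hom.eval_single[OF coef_hom_pCons] pderiv_mult pderiv_smult pderiv_pCons pd1 algebra_simps)
next
  case (add f g)
  thus ?case by (simp add: deriv_at_def partial_deriv_add ray_simps pderiv_add)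
qed

lemma deriv_at_simps [simp]:
  fixes v :: "'k::idom ^ 3"
  shows "deriv_at v k (f + g) = deriv_at v k f + deriv_at v k g"
    "deriv_at v k (f * g) = deriv_at v k f * eval3 g v + eval3 f v * deriv_at v k g"
    "deriv_at v k (const3 c) = 0" "deriv_at v k (var i) = (if i = k then 1 else 0)"
  by (simp_all add: deriv_at_eq ray_simps pderiv_add pderiv_mult poly_ray_0 pderiv_pCons algebra_simps)

lemma deriv_at_uminus [simp]: "deriv_at v k (- f) = - deriv_at v k f" for v :: "'k::idom ^ 3"
  using deriv_at_simps(1)[of v k f "- f"] deriv_at_simps(3)[of v k 0] by (simp add: eq_neg_iff_add_eq_0 add.commute)

lemma deriv_at_diff [simp]: "deriv_at v k (f - g) = deriv_at v k f - deriv_at v k g" for v :: "'k::idom ^ 3"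
  using deriv_at_simps(1)[of v k f "- g"] by simp

lemma partial_deriv_homog:
  fixes f :: "'k::comm_ring_1 poly3"
  assumes "f \<in> homog n"
  shows "partial_deriv k f \<in> homog (n - 1)"
  unfolding partial_deriv_def
proof (rule homog_sum)
  fix m assume m: "m \<in> Poly_Mapping.keys f"
  hence n: "int (mon_deg m) = n" using assms by (auto simp: homog_def)
  show "Poly_Mapping.single (m - Poly_Mapping.single k 1) (of_nat (Poly_Mapping.lookup m k) * Poly_Mapping.lookup f m) \<in> homog (n - 1)"
  \<comment> \<open>With exponent 0 the truncated subtraction does not lower the degree of the
    monomial, but then the coefficient is 0.\<close>
  proof (cases "Poly_Mapping.lookup m k = 0")
    case False
    have "m = (m - Poly_Mapping.single k 1) + Poly_Mapping.single k 1"
      by (rule poly_mapping_eqI) (use False in \<open>auto simp: lookup_add minus_poly_mapping.rep_eq lookup_single when_def\<close>)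
    hence "mon_deg m = mon_deg (m - Poly_Mapping.single k 1) + 1" by (metis mon_deg_add mon_deg_single)
    thus ?thesis using n by (auto simp: homog_iff_lookup lookup_single when_def)
  qed simp
qed

subsection \<open>Linear algebra over the coefficient field\<close>

interpretation pvs: vector_space "\<lambda>c f. const3 c * f :: 'k::field poly3"
  by standard (simp_all add: algebra_simps const3_add const3_mult)

definition monomials :: "nat \<Rightarrow> 'k::comm_ring_1 poly3 set" where
  "monomials n = (\<lambda>m. Poly_Mapping.single m 1) ` {m. mon_deg m = n}"

text \<open>Doubled to avoid division. The monomials are parametrized by their first two
  exponents.\<close>

lemma card_mon_deg: "finite {m. mon_deg m = n}" "2 * card {m. mon_deg m = n} = (n + 1) * (n + 2)"
proof -
  define f :: "nat \<times> nat \<Rightarrow> 3 \<Rightarrow>\<^sub>0 nat" where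
    "f = (\<lambda>(i, j). Poly_Mapping.single 1 i + Poly_Mapping.single 2 j + Poly_Mapping.single 3 (n - i - j))"
  let ?D = "Sigma {..n} (\<lambda>i. {..n - i})"
  have lf: "Poly_Mapping.lookup (f (i, j)) 1 = i" "Poly_Mapping.lookup (f (i, j)) 2 = j"
    "Poly_Mapping.lookup (f (i, j)) 3 = n - i - j" for i j
    by (simp_all add: f_def lookup_add lookup_single)
  have inj: "inj_on f ?D"
    by (rule inj_onI) (metis lf prod.exhaust_sel)
  have im: "f ` ?D = {m. mon_deg m = n}"
  proof (intro equalityI subsetI)
    fix m assume "m \<in> f ` ?D" thus "m \<in> {m. mon_deg m = n}" by (auto simp: f_def)
  next
    fix m :: "3 \<Rightarrow>\<^sub>0 nat" assume "m \<in> {m. mon_deg m = n}"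
    hence s: "Poly_Mapping.lookup m 1 + Poly_Mapping.lookup m 2 + Poly_Mapping.lookup m 3 = n"
      by (simp add: mon_deg_def sum_3)
    have "m = f (Poly_Mapping.lookup m 1, Poly_Mapping.lookup m 2)"
    proof (rule poly_mapping_eqI)
      fix i :: 3
      consider "i = 1" | "i = 2" | "i = 3" using exhaust_3 by blast
      thus "Poly_Mapping.lookup m i = Poly_Mapping.lookup (f (Poly_Mapping.lookup m 1, Poly_Mapping.lookup m 2)) i"
      proof cases
        case 3 thus ?thesis using s by (simp add: lf)
      qed (simp_all only: lf)
    qed
    moreover have "(Poly_Mapping.lookup m 1, Poly_Mapping.lookup m 2) \<in> ?D" using s by auto
    ultimately show "m \<in> f ` ?D" by blast
  qed
  show "finite {m::3 \<Rightarrow>\<^sub>0 nat. mon_deg m = n}" unfolding im[symmetric] by (intro finite_imageI finite_SigmaI) auto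
  have "card {m::3 \<Rightarrow>\<^sub>0 nat. mon_deg m = n} = card ?D"
    unfolding im[symmetric] by (rule card_image[OF inj])
  also have "\<dots> = (\<Sum>i\<le>n. n - i + 1)" by (subst card_SigmaI) auto
  also have "\<dots> = (\<Sum>i\<le>n. i + 1)"
    by (rule sum.reindex_bij_witness[where i = "\<lambda>i. n - i" and j = "\<lambda>i. n - i"]) auto
  finally have "card {m::3 \<Rightarrow>\<^sub>0 nat. mon_deg m = n} = (\<Sum>i\<le>n. i + 1)" .
  moreover have "2 * (\<Sum>i\<le>n. i + 1) = (n + 1) * (n + 2)" by (induction n) auto
  ultimately show "2 * card {m::3 \<Rightarrow>\<^sub>0 nat. mon_deg m = n} = (n + 1) * (n + 2)" by simp
qed

lemma inj_single_1: "inj (\<lambda>m. Poly_Mapping.single m (1 :: 'k::comm_ring_1))"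
  by (rule injI) (metis lookup_single_eq lookup_single_not_eq zero_neq_one)

lemma finite_monomials [simp]: "finite (monomials n)"
  by (simp add: monomials_def card_mon_deg)

lemma card_monomials: "2 * card (monomials n :: 'k::comm_ring_1 poly3 set) = (n + 1) * (n + 2)"
proof -
  have "card (monomials n :: 'k poly3 set) = card {m::3 \<Rightarrow>\<^sub>0 nat. mon_deg m = n}"
    unfolding monomials_def by (rule card_image) (use inj_single_1 in \<open>auto intro: inj_on_subset\<close>)
  thus ?thesis using card_mon_deg by simp
qed

lemma monomials_homog: "monomials n \<subseteq> homog (int n)"
  by (auto simp: monomials_def homog_iff_lookup lookup_single when_def)

lemma homog_subset_span_monomials: "homog (int n) \<subseteq> pvs.span (monomials n :: 'k::field poly3 set)"
proof
  fix f :: "'k poly3" assume f: "f \<in> homog (int n)"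
  have "f = (\<Sum>m\<in>Poly_Mapping.keys f. Poly_Mapping.single m (Poly_Mapping.lookup f m))"
    by (rule poly_mapping_eq_sum_singles)
  also have "\<dots> = (\<Sum>m\<in>Poly_Mapping.keys f. const3 (Poly_Mapping.lookup f m) * Poly_Mapping.single m 1)"
    by (simp add: const3_def mult_single)
  also have "\<dots> \<in> pvs.span (monomials n)"
    using f by (intro pvs.span_sum pvs.span_scale pvs.span_base) (auto simp: monomials_def homog_def)
  finally show "f \<in> pvs.span (monomials n)" .
qed

lemma independent_monomials: "pvs.independent (monomials n :: 'k::field poly3 set)"
proof (rule pvs.independent_if_scalars_zero)
  fix c :: "'k poly3 \<Rightarrow> 'k" and x :: "'k poly3"
  assume 0: "(\<Sum>x\<in>monomials n. const3 (c x) * x) = 0" and "x \<in> monomials n"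
  then obtain m where m: "mon_deg m = n" "x = Poly_Mapping.single m 1" by (auto simp: monomials_def)
  have "0 = Poly_Mapping.lookup (\<Sum>x\<in>monomials n. const3 (c x) * x) m" using 0 by simp
  also have "\<dots> = (\<Sum>x\<in>monomials n. c x * Poly_Mapping.lookup x m)"
    by (simp add: lookup_sum lookup_const3_mult)
  also have "\<dots> = (\<Sum>x\<in>{x}. c x * Poly_Mapping.lookup x m)"
    by (rule sum.mono_neutral_right[OF finite_monomials])
      (use m in \<open>auto simp: monomials_def lookup_single when_def split: if_splits\<close>)
  finally show "c x = 0" by (simp add: m)
qed simp

text \<open>Linear independence is phrased for families, so that the indexing need not be injective.\<close>

lemma (in vector_space) independent_family_card_le:
  assumes A: "finite A" and T: "finite T" "e ` A \<subseteq> span T"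
    and ind: "\<And>c. (\<Sum>i\<in>A. scale (c i) (e i)) = 0 \<Longrightarrow> \<forall>i\<in>A. c i = 0"
  shows "card A \<le> card T"
proof -
  have inj: "inj_on e A"
  proof (rule inj_onI, rule ccontr)
    fix i j assume ij: "i \<in> A" "j \<in> A" "e i = e j" "i \<noteq> j"
    define c :: "'c \<Rightarrow> 'a" where "c x = (if x = i then 1 else if x = j then - 1 else 0)" for x
    have "(\<Sum>x\<in>A. scale (c x) (e x)) = (\<Sum>x\<in>{i, j}. scale (c x) (e x))"
      by (rule sum.mono_neutral_right) (use A ij in \<open>auto simp: c_def\<close>)
    also have "\<dots> = 0" using ij by (simp add: c_def)
    finally have "c i = 0" by (rule ind[THEN bspec]) (rule ij(1))
    thus False by (simp add: c_def)
  qed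
  have "independent (e ` A)"
  proof (rule independent_if_scalars_zero)
    fix f x assume 0: "(\<Sum>x\<in>e ` A. scale (f x) x) = 0" and x: "x \<in> e ` A"
    have "(\<Sum>i\<in>A. scale (f (e i)) (e i)) = 0" using 0 by (simp add: sum.reindex[OF inj])
    thus "f x = 0" using ind[of "f \<circ> e"] x by auto
  qed (use A in simp)
  from independent_span_bound[OF T(1) this T(2)] show ?thesis
    using card_image[OF inj] by simp
qed

subsection \<open>Complete intersections of two plane curves\<close>

definition ideal2 :: "'k::comm_ring_1 poly3 \<Rightarrow> 'k poly3 \<Rightarrow> 'k poly3 set" where
  "ideal2 P G = {P * A + G * B | A B. True}"

lemma ideal2I: "P * A + G * B \<in> ideal2 P G"
  unfolding ideal2_def by blast

lemma ideal2_gens: "P \<in> ideal2 P G" "G \<in> ideal2 P G" "0 \<in> ideal2 P G"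
  using ideal2I[of P 1 G 0] ideal2I[of P 0 G 1] ideal2I[of P 0 G 0] by simp_all

lemma ideal2_add: "a \<in> ideal2 P G \<Longrightarrow> b \<in> ideal2 P G \<Longrightarrow> a + b \<in> ideal2 P G"
proof -
  assume "a \<in> ideal2 P G" "b \<in> ideal2 P G"
  then obtain A B C D where "a = P * A + G * B" "b = P * C + G * D" unfolding ideal2_def by blast
  hence "a + b = P * (A + C) + G * (B + D)" by (simp add: algebra_simps)
  thus ?thesis by (simp only: ideal2I)
qed

lemma ideal2_mult: "a \<in> ideal2 P G \<Longrightarrow> b * a \<in> ideal2 P G"
proof -
  assume "a \<in> ideal2 P G"
  then obtain A B where "a = P * A + G * B" unfolding ideal2_def by blast
  hence "b * a = P * (b * A) + G * (b * B)" by (simp add: algebra_simps)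
  thus ?thesis by (simp only: ideal2I)
qed

lemma ideal2_diff: "a \<in> ideal2 P G \<Longrightarrow> b \<in> ideal2 P G \<Longrightarrow> a - b \<in> ideal2 P G"
  using ideal2_add[of a P G "(- 1) * b"] ideal2_mult[of b P G "- 1"] by simp

text \<open>Coprimality in the shape needed for Hilbert functions: P is a nonzerodivisor modulo
  G.\<close>

definition coprime_forms :: "nat \<Rightarrow> nat \<Rightarrow> 'k::comm_ring_1 poly3 \<Rightarrow> 'k poly3 \<Rightarrow> bool" where
  "coprime_forms p g P G \<longleftrightarrow> P \<in> homog (int p) \<and> G \<in> homog (int g) \<and> P \<noteq> 0 \<and> G \<noteq> 0 \<and>
     (\<forall>A. G dvd P * A \<longrightarrow> G dvd A)"

text \<open>Bezout's bound, from the Hilbert function of the complete intersection.\<close>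

lemma complete_intersection_bound:
  fixes P :: "'k::field poly3"
  assumes cop: "coprime_forms p g P G" and n: "n \<ge> p + g"
    and A: "finite A" "\<And>i. i \<in> A \<Longrightarrow> e i \<in> homog (int n)"
    and ind: "\<And>c. (\<Sum>i\<in>A. const3 (c i) * e i) \<in> ideal2 P G \<Longrightarrow> \<forall>i\<in>A. c i = 0"
  shows "card A \<le> p * g"
proof -
  note c = cop[unfolded coprime_forms_def]
  let ?B = "monomials :: nat \<Rightarrow> 'k poly3 set"
  \<comment> \<open>A basis of the multiples of G in degree n - p. The set W that completes it to a
    basis of all forms of this degree represents S/G there, and multiplication by P is injective on
    S/G.\<close>
  define B1 where "B1 = (\<lambda>x. G * x) ` ?B (n - p - g)"
  have inj: "inj_on (\<lambda>x. G * x) X" for X using c by (auto intro: inj_onI)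
  have B1h: "B1 \<subseteq> homog (int (n - p))"
  proof
    fix x assume "x \<in> B1"
    then obtain b where "x = G * b" "b \<in> homog (int (n - p - g))" using monomials_homog B1_def by blast
    thus "x \<in> homog (int (n - p))" using homog_mult[of G "int g" b "int (n - p - g)"] c n
      by (simp add: of_nat_diff)
  qed
  have "pvs.independent B1"
  proof (rule pvs.independent_if_scalars_zero)
    fix f x assume 0: "(\<Sum>x\<in>B1. const3 (f x) * x) = 0" and x: "x \<in> B1"
    have "0 = (\<Sum>b\<in>?B (n - p - g). const3 (f (G * b)) * (G * b))"
      using 0 unfolding B1_def by (simp add: sum.reindex[OF inj])
    also have "\<dots> = G * (\<Sum>b\<in>?B (n - p - g). const3 (f (G * b)) * b)"
      by (simp add: sum_distrib_left mult.left_commute)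
    finally have "(\<Sum>b\<in>?B (n - p - g). const3 (f (G * b)) * b) = 0" using c by simp
    moreover obtain b where b: "b \<in> ?B (n - p - g)" "x = G * b" using x B1_def by blast
    ultimately show "f x = 0"
      using pvs.independentD[OF independent_monomials finite_monomials order.refl, where u = "\<lambda>b. f (G * b)"] by blast
  qed (simp add: B1_def)
  then obtain C where C: "B1 \<subseteq> C" "C \<subseteq> homog (int (n - p))" "pvs.independent C" "homog (int (n - p)) \<subseteq> pvs.span C"
    using pvs.maximal_independent_subset_extend[OF B1h] by metis
  have "card C = pvs.dim (homog (int (n - p)) :: 'k poly3 set)"
    by (rule pvs.basis_card_eq_dim) (use C in auto)
  also have "\<dots> = card (?B (n - p))"
    by (rule pvs.basis_card_eq_dim[OF monomials_homog homog_subset_span_monomials independent_monomials, symmetric])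
  finally have cC: "card C = card (?B (n - p))" .
  have finC: "finite C"
    using pvs.independent_span_bound[OF finite_monomials C(3)] C(2) homog_subset_span_monomials by blast
  define W where "W = C - B1"
  have cW: "card W + card (?B (n - p - g)) = card (?B (n - p))"
  proof -
    have "card B1 = card (?B (n - p - g))" unfolding B1_def by (rule card_image[OF inj])
    moreover have "card W = card C - card B1"
      unfolding W_def by (rule card_Diff_subset[OF finite_subset[OF C(1) finC] C(1)])
    ultimately show ?thesis using card_mono[OF finC C(1)] cC by simp
  qed
  have finW: "finite W" using finC W_def by simp
  \<comment> \<open>The given forms, P times W and G times all monomials are independent together in
    degree n; the bound follows by counting.\<close>
  define E where "E = case_sum e (case_sum (\<lambda>w. P * w) (\<lambda>b. G * b))"
  let ?I = "A <+> (W <+> ?B (n - g))"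
  have "card ?I \<le> card (?B n)"
  proof (rule pvs.independent_family_card_le[where e = E])
    show "finite ?I" using A finW by simp
    show "E ` ?I \<subseteq> pvs.span (?B n)"
    proof -
      have "E x \<in> homog (int n)" if x: "x \<in> ?I" for x
      proof -
        consider i where "x = Inl i" "i \<in> A" | w where "x = Inr (Inl w)" "w \<in> W" | b where "x = Inr (Inr b)" "b \<in> ?B (n - g)"
          using x by blast
        thus ?thesis
        proof cases
          case 2
          hence "w \<in> homog (int (n - p))" using C W_def by blast
          thus ?thesis using 2 homog_mult[of P "int p" w "int (n - p)"] c n by (simp add: E_def of_nat_diff)
        next
          case 3
          hence "b \<in> homog (int (n - g))" using monomials_homog by blast
          thus ?thesis using 3 homog_mult[of G "int g" b "int (n - g)"] c n by (simp add: E_def of_nat_diff)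
        qed (use A in \<open>simp add: E_def\<close>)
      qed
      thus ?thesis using homog_subset_span_monomials by blast
    qed
    fix k assume 0: "(\<Sum>i\<in>?I. const3 (k i) * E i) = 0"
    define a where "a = (\<Sum>i\<in>A. const3 (k (Inl i)) * e i)"
    define w where "w = (\<Sum>x\<in>W. const3 (k (Inr (Inl x))) * x)"
    define b where "b = (\<Sum>x\<in>?B (n - g). const3 (k (Inr (Inr x))) * x)"
    have sum0: "a + (P * w + G * b) = 0"
      using 0 A finW by (simp add: sum.Plus E_def a_def w_def b_def sum_distrib_left mult.left_commute)
    hence "a = P * (- w) + G * (- b)" by (simp add: eq_neg_iff_add_eq_0 algebra_simps)
    hence aJ: "a \<in> ideal2 P G" by (simp only: ideal2I)
    hence ka: "\<forall>i\<in>A. k (Inl i) = 0" using ind[of "\<lambda>i. k (Inl i)"] unfolding a_def by simp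
    hence "a = 0" by (simp add: a_def)
    hence PG: "P * w = G * (- b)" using sum0 by (simp add: eq_neg_iff_add_eq_0)
    hence "G dvd P * w" by (metis dvd_triv_left)
    hence "G dvd w" using c by blast
    then obtain q where q: "w = G * q" by (auto simp: dvd_def)
    have wh: "w \<in> homog (int (n - p))" unfolding w_def
      using C by (intro homog_sum homog_const3_mult) (auto simp: W_def)
    define q' where "q' = hcomp (int (n - p) - int g) q"
    have "w = G * q'" unfolding q'_def using hcomp_mult_homog[of G "int g" "int (n - p)" q] wh c q by simp
    have "int (n - p) - int g = int (n - p - g)" using n by (simp add: of_nat_diff)
    hence "q' \<in> homog (int (n - p - g))" unfolding q'_def by (metis hcomp_homog)
    then obtain d where d: "q' = (\<Sum>x\<in>?B (n - p - g). const3 (d x) * x)"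
      using homog_subset_span_monomials pvs.span_finite[OF finite_monomials] by blast
    define d' where "d' x = d (SOME b. x = G * b)" for x
    have d': "d' (G * b) = d b" for b using c by (simp add: d'_def)
    have wB1: "w = (\<Sum>x\<in>B1. const3 (d' x) * x)"
      unfolding B1_def \<open>w = G * q'\<close> d by (simp add: sum.reindex[OF inj] d' sum_distrib_left mult.left_commute)
    have "(\<Sum>x\<in>C. const3 (if x \<in> B1 then - d' x else k (Inr (Inl x))) * x) =
       (\<Sum>x\<in>W. const3 (if x \<in> B1 then - d' x else k (Inr (Inl x))) * x) +
       (\<Sum>x\<in>B1. const3 (if x \<in> B1 then - d' x else k (Inr (Inl x))) * x)"
      unfolding W_def using sum.subset_diff[OF C(1) finC] by blast
    also have "\<dots> = w - w"
      by (subst (2) wB1) (simp add: w_def W_def const3_uminus sum_negf)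
    finally have C0: "(\<Sum>x\<in>C. const3 (if x \<in> B1 then - d' x else k (Inr (Inl x))) * x) = 0" by simp
    have kw: "k (Inr (Inl x)) = 0" if "x \<in> W" for x
      using pvs.independentD[OF C(3) finC order.refl C0, of x] that by (auto simp: W_def)
    hence "w = 0" by (simp add: w_def)
    hence "b = 0" using PG c by auto
    hence kb: "k (Inr (Inr x)) = 0" if "x \<in> ?B (n - g)" for x
      using pvs.independentD[OF independent_monomials finite_monomials order.refl, of "\<lambda>x. k (Inr (Inr x))" "n - g" x] that
      unfolding b_def by blast
    show "\<forall>i\<in>?I. k i = 0" using ka kw kb by auto
  qed simp
  hence "card A + card (?B (n - p)) + card (?B (n - g)) \<le> card (?B n) + card (?B (n - p - g))"
    using cW A finW by (simp add: card_Plus)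
  moreover obtain l where l: "n = p + g + l" using n le_Suc_ex by blast
  \<comment> \<open>The mixed second difference of the Hilbert function of S is p g, whatever l
    is.\<close>
  ultimately have "2 * card A + (l + g + 1) * (l + g + 2) + (l + p + 1) * (l + p + 2)
     \<le> (l + p + g + 1) * (l + p + g + 2) + (l + 1) * (l + 2)"
    using card_monomials[where 'k = 'k, of n] card_monomials[where 'k = 'k, of "n - p"]
      card_monomials[where 'k = 'k, of "n - g"] card_monomials[where 'k = 'k, of "n - p - g"]
    by (simp add: algebra_simps)
  thus ?thesis by (simp add: algebra_simps)
qed

subsection \<open>Points and forms through them\<close>

definition rep :: "('k::field ^ 3) set \<Rightarrow> 'k ^ 3" where
  "rep p = (SOME v. v \<noteq> 0 \<and> p = vec.span {v})"

lemma rep: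
  assumes "p \<in> proj_plane"
  shows "rep p \<noteq> 0" "vec.span {rep p} = p"
proof -
  have "\<exists>v. v \<noteq> 0 \<and> p = vec.span {v}" using assms by (auto simp: proj_plane_def)
  hence "rep p \<noteq> 0 \<and> p = vec.span {rep p}" unfolding rep_def by (rule someI_ex)
  thus "rep p \<noteq> 0" "vec.span {rep p} = p" by auto
qed

lemma span_in_proj_plane: "v \<noteq> 0 \<Longrightarrow> vec.span {v} \<in> proj_plane"
  by (auto simp: proj_plane_def)

lemma vanishes_at_rep:
  assumes "f \<in> homog n" "p \<in> proj_plane"
  shows "vanishes_at f p \<longleftrightarrow> eval3 f (rep p) = 0"
  using vanishes_at_span[OF assms(1) rep(1)[OF assms(2)]] rep(2)[OF assms(2)] by simp

lemma eval3_rep_span: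
  assumes "f \<in> homog n" "v \<noteq> 0"
  shows "eval3 f (rep (vec.span {v})) = 0 \<longleftrightarrow> eval3 f v = 0"
  using vanishes_at_span[OF assms] vanishes_at_rep[OF assms(1) span_in_proj_plane[OF assms(2)]] by simp

lemma span_eq_of_proportional:
  fixes v w :: "'k::field ^ 3"
  assumes "v \<noteq> 0" "w \<noteq> 0" and proportional: "\<And>i j. w $ i * v $ j = w $ j * v $ i"
  shows "vec.span {v} = vec.span {w}"
proof -
  obtain i where i: "w $ i \<noteq> 0"
    using \<open>w \<noteq> 0\<close> by (auto simp: Finite_Cartesian_Product.vec_eq_iff)
  define c where "c = v $ i / w $ i"
  have v: "v = c *s w"
    unfolding Finite_Cartesian_Product.vec_eq_iff c_def using proportional[of i] i by (simp add: field_simps)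
  hence "c \<noteq> 0" using assms by auto
  hence w: "w = (1 / c) *s v" using v by simp
  have "v \<in> vec.span {w}" "w \<in> vec.span {v}"
    by (subst v, simp add: vec.span_base vec.span_scale) (subst w, rule vec.span_scale, simp add: vec.span_base)
  thus ?thesis by (intro equalityI vec.span_minimal) (auto simp: vec.subspace_span)
qed

lemma separating_form:
  fixes p :: "('k::field ^ 3) set"
  assumes "p \<in> proj_plane" "q \<in> proj_plane" "p \<noteq> q"
  obtains f where "f \<in> homog 1" "eval3 f (rep p) \<noteq> 0" "eval3 f (rep q) = 0"
proof -
  let ?v = "rep p" and ?w = "rep q"
  have "\<exists>i j. ?w $ i * ?v $ j \<noteq> ?w $ j * ?v $ i"
    using span_eq_of_proportional[of ?v ?w] rep assms by metis
  then obtain i j where "?w $ i * ?v $ j \<noteq> ?w $ j * ?v $ i" by blast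
  moreover have "const3 (?w $ i) * var j - const3 (?w $ j) * var i \<in> homog 1"
    by (intro homog_diff homog_const3_mult homog_var)
  ultimately show ?thesis
    by (intro that[of "const3 (?w $ i) * var j - const3 (?w $ j) * var i"]) auto
qed

lemma nonvanishing_var:
  assumes "p \<in> proj_plane" obtains i where "eval3 (var i) (rep p) \<noteq> 0"
  using rep(1)[OF assms] by (auto simp: Finite_Cartesian_Product.vec_eq_iff)

text \<open>A product of linear forms, one for each other point, padded to degree n by a power of a
  coordinate that is nonzero at p.\<close>

lemma interpolating_form:
  fixes p :: "('k::field ^ 3) set"
  assumes X: "finite X" "X \<subseteq> proj_plane" and p: "p \<in> X" and n: "card X \<le> n"
  obtains f where "f \<in> homog (int n)" "eval3 f (rep p) \<noteq> 0" "\<And>q. q \<in> X - {p} \<Longrightarrow> eval3 f (rep q) = 0"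
proof -
  have "\<exists>f. f \<in> homog 1 \<and> eval3 f (rep p) \<noteq> 0 \<and> eval3 f (rep q) = 0" if "q \<in> X - {p}" for q
    using separating_form[of p q] that X p by blast
  then obtain l where l: "\<And>q. q \<in> X - {p} \<Longrightarrow> l q \<in> homog 1 \<and> eval3 (l q) (rep p) \<noteq> 0 \<and> eval3 (l q) (rep q) = 0"
    by metis
  obtain i where i: "eval3 (var i) (rep p) \<noteq> 0" using nonvanishing_var p X by blast
  let ?f = "(\<Prod>q\<in>X - {p}. l q) * var i ^ (n - card (X - {p}))"
  have "card (X - {p}) \<le> n" using n p X by (simp add: card_Diff_singleton)
  hence "int (card (X - {p})) + int (n - card (X - {p})) * 1 = int n" by simp
  moreover have "?f \<in> homog ((\<Sum>q\<in>X - {p}. 1) + int (n - card (X - {p})) * 1)"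
    using l by (intro homog_mult homog_prod homog_power) auto
  ultimately have "?f \<in> homog (int n)" by simp
  moreover have "eval3 ?f (rep p) \<noteq> 0" using i l X by simp
  moreover have "eval3 ?f (rep q) = 0" if "q \<in> X - {p}" for q
    using l[OF that] that X by (auto intro!: prod_zero)
  ultimately show ?thesis using that by blast
qed

lemma infinite_UNIV_alg_closed: "infinite (UNIV :: 'k::alg_closed_field set)"
proof
  assume fin: "finite (UNIV :: 'k set)"
  define q :: "'k poly" where "q = (\<Prod>a\<in>UNIV. [:- a, 1:])"
  have root: "poly q a = 0" for a
    unfolding q_def poly_prod using fin by (intro prod_zero) auto
  have "degree (q + 1) > 0"
  proof (rule ccontr)
    assume "\<not> degree (q + 1) > 0"
    then obtain c where c: "q + 1 = [:c:]" by (metis neq0_conv degree_eq_zeroE)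
    have "poly (q + 1) 0 = 1" using root by simp
    hence "c = 1" by (simp add: c)
    hence "q = 0" using c by simp
    thus False using fin by (simp add: q_def)
  qed
  then obtain x where "poly (q + 1) x = 0" using alg_closed_imp_poly_has_root by blast
  thus False using root by simp
qed

lemma line_avoiding_points:
  fixes X :: "('k::alg_closed_field ^ 3) set set"
  assumes "finite X" "X \<subseteq> proj_plane"
  obtains t where "\<And>p. p \<in> X \<Longrightarrow> eval3 (line t) (rep p) \<noteq> 0"
proof -
  define pl where "pl p = [:rep p $ 1, rep p $ 2, rep p $ 3:]" for p :: "('k ^ 3) set"
  have ev: "eval3 (line t) (rep p) = poly (pl p) t" for t p
    by (simp add: eval3_line pl_def algebra_simps power2_eq_square)
  have "pl p \<noteq> 0" if "p \<in> X" for p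
    using rep(1)[of p] that assms by (auto simp: pl_def vec3_eq_0_iff)
  hence "finite (\<Union>p\<in>X. {t. poly (pl p) t = 0})"
    using assms poly_roots_finite by blast
  hence "\<exists>t. t \<notin> (\<Union>p\<in>X. {t. poly (pl p) t = 0})"
    using infinite_UNIV_alg_closed by (metis (no_types, lifting) UNIV_I finite_subset subsetI)
  thus ?thesis using that ev by auto
qed

text \<open>For \<open>p * g + 1\<close> common zeros, forms each nonzero at exactly one of them
  would be independent modulo P and G, since every element of \<open>ideal2 P G\<close> vanishes
  there; this exceeds Bezout's bound.\<close>

lemma coprime_forms_common_zeros_finite:
  fixes P :: "'k::field poly3"
  assumes cop: "coprime_forms p g P G"
  shows "finite {x \<in> proj_plane. eval3 P (rep x) = 0 \<and> eval3 G (rep x) = 0}" (is "finite ?V")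
proof (rule ccontr)
  assume "infinite ?V"
  then obtain X where X: "finite X" "card X = Suc (p * g)" "X \<subseteq> ?V"
    using infinite_arbitrarily_large by blast
  define n where "n = p + g + card X"
  have "\<exists>f. f \<in> homog (int n) \<and> eval3 f (rep x) \<noteq> 0 \<and> (\<forall>q\<in>X - {x}. eval3 f (rep q) = 0)" if x: "x \<in> X" for x
  proof -
    have Xp: "X \<subseteq> proj_plane" "card X \<le> n" using X by (auto simp: n_def)
    obtain f where "f \<in> homog (int n)" "eval3 f (rep x) \<noteq> 0" "\<And>q. q \<in> X - {x} \<Longrightarrow> eval3 f (rep q) = 0"
      using interpolating_form[OF X(1) Xp(1) x Xp(2)] by metis
    thus ?thesis by blast
  qed
  then obtain e where e: "\<And>x. x \<in> X \<Longrightarrow> e x \<in> homog (int n) \<and> eval3 (e x) (rep x) \<noteq> 0 \<and> (\<forall>q\<in>X - {x}. eval3 (e x) (rep q) = 0)"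
    by metis
  have "card X \<le> p * g"
  proof (rule complete_intersection_bound[OF cop, of n X e])
    fix c assume "(\<Sum>i\<in>X. const3 (c i) * e i) \<in> ideal2 P G"
    then obtain A B where AB: "(\<Sum>i\<in>X. const3 (c i) * e i) = P * A + G * B" unfolding ideal2_def by blast
    show "\<forall>i\<in>X. c i = 0"
    proof
      fix x assume x: "x \<in> X"
      have "eval3 (P * A + G * B) (rep x) = 0" using X x by auto
      hence "0 = (\<Sum>i\<in>X. c i * eval3 (e i) (rep x))" unfolding AB[symmetric] by simp
      also have "\<dots> = (\<Sum>i\<in>{x}. c i * eval3 (e i) (rep x))"
        by (rule sum.mono_neutral_right) (use X x e in auto)
      finally show "c x = 0" using e[OF x] by simp
    qed
  qed (use X e in \<open>auto simp: n_def\<close>)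
  thus False using X by simp
qed

subsection \<open>Socle elements\<close>

text \<open>The binary form of degree N belonging to the univariate polynomial C, taken at x and l.
  N may exceed the degree of C, which accounts for factors l.\<close>

definition homogenize :: "'k::comm_ring_1 poly3 \<Rightarrow> 'k poly3 \<Rightarrow> nat \<Rightarrow> 'k poly \<Rightarrow> 'k poly3" where
  "homogenize x l N C = (\<Sum>j\<le>N. const3 (coeff C j) * x ^ j * l ^ (N - j))"

text \<open>Lets a root of C split off a factor linear in x and l; used for eigenvectors and again
  for minimal polynomials.\<close>

lemma homogenize_linear_factor:
  assumes "degree C \<le> N"
  shows "homogenize x l (Suc N) ([:- a, 1:] * C) = (x - const3 a * l) * homogenize x l N C"
proof -
  have c: "coeff ([:- a, 1:] * C) j = - (a * coeff C j) + (case j of 0 \<Rightarrow> 0 | Suc i \<Rightarrow> coeff C i)" for j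
    by (cases j) (simp_all add: coeff_pCons)
  have top: "coeff C (Suc N) = 0" using assms by (intro coeff_eq_0) simp
  have "homogenize x l (Suc N) ([:- a, 1:] * C) =
      - (\<Sum>j\<le>Suc N. const3 (a * coeff C j) * x ^ j * l ^ (Suc N - j)) +
      (\<Sum>j\<le>Suc N. const3 (case j of 0 \<Rightarrow> 0 | Suc i \<Rightarrow> coeff C i) * x ^ j * l ^ (Suc N - j))"
    unfolding homogenize_def c
    by (simp only: const3_add const3_uminus distrib_right sum.distrib minus_mult_left[symmetric] sum_negf)
  also have "(\<Sum>j\<le>Suc N. const3 (a * coeff C j) * x ^ j * l ^ (Suc N - j)) = const3 a * l * homogenize x l N C"
    using top by (simp add: homogenize_def sum_distrib_left const3_mult Suc_diff_le mult_ac)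
  also have "(\<Sum>j\<le>Suc N. const3 (case j of 0 \<Rightarrow> 0 | Suc i \<Rightarrow> coeff C i) * x ^ j * l ^ (Suc N - j)) =
      x * homogenize x l N C"
    by (subst sum.atMost_Suc_shift) (simp add: homogenize_def sum_distrib_left mult_ac)
  finally show ?thesis by (simp add: algebra_simps)
qed

lemma homogenize_homog:
  assumes "x \<in> homog 1" "l \<in> homog 1"
  shows "homogenize x l N C \<in> homog (int N)"
  unfolding homogenize_def
proof (rule homog_sum)
  fix j assume j: "j \<in> {..N}"
  have "x ^ j * l ^ (N - j) \<in> homog (int j * 1 + int (N - j) * 1)"
    by (intro homog_mult homog_power assms)
  thus "const3 (coeff C j) * x ^ j * l ^ (N - j) \<in> homog (int N)"
    using j homog_const3_mult[of "x ^ j * l ^ (N - j)" "int N" "coeff C j"] by (simp add: mult.assoc of_nat_diff)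
qed

definition poly_ideal :: "'k::comm_ring_1 poly3 set \<Rightarrow> bool" where
  "poly_ideal J \<longleftrightarrow> 0 \<in> J \<and> (\<forall>a\<in>J. \<forall>b\<in>J. a + b \<in> J) \<and> (\<forall>a\<in>J. \<forall>b. b * a \<in> J)"

text \<open>The Hilbert function of S/J is at most D in degrees from n0 on. The index sets consist
  of natural numbers because a quantifier inside a definition needs a fixed type.\<close>

definition bounded_mod :: "'k::comm_ring_1 poly3 set \<Rightarrow> nat \<Rightarrow> nat \<Rightarrow> bool" where
  "bounded_mod J n0 D \<longleftrightarrow> (\<forall>n\<ge>n0. \<forall>(A :: nat set) e. finite A \<longrightarrow> (\<forall>i\<in>A. e i \<in> homog (int n)) \<longrightarrow>
     (\<forall>c. (\<Sum>i\<in>A. const3 (c i) * e i) \<in> J \<longrightarrow> (\<forall>i\<in>A. c i = 0)) \<longrightarrow> card A \<le> D)"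

lemma bounded_modD:
  fixes A :: "nat set"
  assumes "bounded_mod J n0 D" "n \<ge> n0" "finite A" "\<forall>i\<in>A. e i \<in> homog (int n)"
    "\<forall>c. (\<Sum>i\<in>A. const3 (c i) * e i) \<in> J \<longrightarrow> (\<forall>i\<in>A. c i = 0)"
  shows "card A \<le> D"
  using assms unfolding bounded_mod_def by simp

definition nonzerodivisor_mod :: "'k::comm_ring_1 poly3 \<Rightarrow> 'k poly3 set \<Rightarrow> bool" where
  "nonzerodivisor_mod l J \<longleftrightarrow> (\<forall>q n. q \<in> homog n \<longrightarrow> l * q \<in> J \<longrightarrow> q \<in> J)"

text \<open>A linear form acts with an eigenvector on the multiples of a form outside \<open>J\<close>, since their
  dimension is bounded.\<close>

lemma nonzerodivisor_mod_power:
  assumes "nonzerodivisor_mod l J" "l \<in> homog 1" "q \<in> homog k" "l ^ M * q \<in> J"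
  shows "q \<in> J"
  using assms(4)
proof (induction M)
  case (Suc M)
  have "l ^ M * q \<in> homog (int M * 1 + k)" by (intro homog_mult homog_power assms)
  moreover have "l * (l ^ M * q) \<in> J" using Suc.prems by (simp add: mult.assoc)
  ultimately have "l ^ M * q \<in> J" using assms(1) unfolding nonzerodivisor_mod_def by blast
  thus ?case by (rule Suc.IH)
qed simp

text \<open>The N + 1 forms \<open>x ^ j * l ^ (N - j) * q\<close> are dependent modulo J, and a
  relation is a binary form in x and l that multiplies q into J. It is peeled into linear factors
  over the algebraically closed field; the first factor whose removal leads out of J gives the
  eigenvalue.\<close>

lemma eigenform_exists:
  fixes J :: "'k::alg_closed_field poly3 set"
  assumes J: "poly_ideal J" and l: "l \<in> homog 1" "nonzerodivisor_mod l J"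
    and bound: "bounded_mod J n0 D"
    and x: "x \<in> homog 1" and q: "q \<in> homog (int k)" "q \<notin> J"
  shows "\<exists>a h m. h \<in> homog (int m) \<and> h * q \<notin> J \<and> (x - const3 a * l) * (h * q) \<in> J"
proof -
  \<comment> \<open>Large enough for more than D forms, in a degree N + k not below n0.\<close>
  define N where "N = D + n0"
  define e where "e j = x ^ j * l ^ (N - j) * q" for j
  have Jmult: "b * a \<in> J" if "a \<in> J" for a b using J that by (simp add: poly_ideal_def)
  have eh: "e j \<in> homog (int (N + k))" if "j \<le> N" for j
  proof -
    have "x ^ j * l ^ (N - j) * q \<in> homog (int j * 1 + int (N - j) * 1 + int k)"
      by (intro homog_mult homog_power x l q)
    thus ?thesis using that by (simp add: e_def of_nat_diff)
  qed
  have "\<not> card {..N} \<le> D" "N + k \<ge> n0" by (simp_all add: N_def)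
  hence "\<exists>c. (\<Sum>i\<le>N. const3 (c i) * e i) \<in> J \<and> \<not> (\<forall>i\<in>{..N}. c i = 0)"
    using bounded_modD[OF bound, of "N + k" "{..N}" e] eh by auto
  then obtain c j where c: "(\<Sum>i\<le>N. const3 (c i) * e i) \<in> J" and j: "j \<le> N" "c j \<noteq> 0" by auto
  define C where "C = (\<Sum>i\<le>N. Polynomial.monom (c i) i)"
  have cC: "coeff C i = (if i \<le> N then c i else 0)" for i
    by (simp add: C_def coeff_sum)
  have "C \<noteq> 0" using j cC[of j] by auto
  moreover have "degree C \<le> N" by (rule degree_le) (simp add: cC)
  moreover have "homogenize x l N C * q \<in> J"
    using c by (simp add: homogenize_def cC sum_distrib_right e_def mult.assoc)
  ultimately show ?thesis
  proof (induction N arbitrary: C)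
    case 0
    then obtain c where "C = [:c:]" "c \<noteq> 0" by (metis degree_eq_zeroE le_zero_eq pCons_0_0)
    hence "const3 c * q \<in> J" using 0 by (simp add: homogenize_def)
    hence "const3 (1 / c) * (const3 c * q) \<in> J" by (rule Jmult)
    hence "q \<in> J" using \<open>c \<noteq> 0\<close> by (simp add: mult.assoc[symmetric] const3_mult[symmetric])
    thus ?case using q by simp
  next
    case (Suc N)
    show ?case
    proof (cases "degree C = 0")
      case True
      then obtain c where C: "C = [:c:]" "c \<noteq> 0" using Suc.prems by (metis degree_eq_zeroE pCons_0_0)
      \<comment> \<open>Only factors l are left, and l is a nonzerodivisor modulo J.\<close>
      have "homogenize x l (Suc N) C = (\<Sum>j\<in>{0}. const3 (coeff C j) * x ^ j * l ^ (Suc N - j))"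
        unfolding homogenize_def by (rule sum.mono_neutral_right) (auto simp: C coeff_pCons split: nat.splits)
      hence "const3 (1 / c) * (const3 c * l ^ Suc N * q) \<in> J" using Suc.prems(3) C Jmult by simp
      moreover have "const3 (1 / c) * (const3 c * l ^ Suc N * q) = l ^ Suc N * q"
        using \<open>c \<noteq> 0\<close> by (simp add: mult.assoc[symmetric] const3_mult[symmetric])
      ultimately show ?thesis using nonzerodivisor_mod_power[OF l(2,1) q(1)] q(2) by metis
    next
      case False
      then obtain a where "poly C a = 0" using alg_closed_imp_poly_has_root by blast
      then obtain C' where C': "C = [:- a, 1:] * C'" by (auto simp: poly_eq_0_iff_dvd dvd_def)
      hence nz: "C' \<noteq> 0" using Suc.prems(1) by auto
      hence "degree C = Suc (degree C')" unfolding C' by (subst degree_mult_eq) auto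
      hence d: "degree C' \<le> N" using Suc.prems(2) by simp
      have eq: "(x - const3 a * l) * (homogenize x l N C' * q) \<in> J"
        using Suc.prems(3) unfolding C' homogenize_linear_factor[OF d] by (simp add: mult.assoc)
      show ?thesis
      proof (cases "homogenize x l N C' * q \<in> J")
        case True
        thus ?thesis using Suc.IH nz d by blast
      next
        case False
        thus ?thesis using eq homogenize_homog[OF x l(1)] by blast
      qed
    qed
  qed
qed

text \<open>The three variables are treated in turn; each earlier relation survives multiplication
  by the later forms because J is an ideal. The eigenvalues become the coordinates of v, which turns
  out to be a common zero in \<open>max_noether\<close>.\<close>

lemma common_eigenform_exists:
  fixes J :: "'k::alg_closed_field poly3 set"
  assumes J: "poly_ideal J" and l: "l \<in> homog 1" "nonzerodivisor_mod l J"
    and bound: "bounded_mod J n0 D" and q: "q \<in> homog (int k)" "q \<notin> J"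
  obtains v h m where "h \<in> homog (int m)" "h * q \<notin> J"
    "\<And>i. (var i - const3 (v $ i) * l) * (h * q) \<in> J"
proof -
  note step = eigenform_exists[OF J l bound]
  have Jmult: "b * a \<in> J" if "a \<in> J" for a b using J that by (simp add: poly_ideal_def)
  obtain a1 h1 m1 where 1: "h1 \<in> homog (int m1)" "h1 * q \<notin> J" "(var 1 - const3 a1 * l) * (h1 * q) \<in> J"
    using step[OF homog_var[of 1] q] by blast
  have q1: "h1 * q \<in> homog (int (m1 + k))" using homog_mult[OF 1(1) q(1)] by simp
  obtain a2 h2 m2 where 2: "h2 \<in> homog (int m2)" "h2 * (h1 * q) \<notin> J" "(var 2 - const3 a2 * l) * (h2 * (h1 * q)) \<in> J"
    using step[OF homog_var[of 2] q1 1(2)] by blast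
  have q2: "h2 * (h1 * q) \<in> homog (int (m2 + (m1 + k)))" using homog_mult[OF 2(1) q1] by simp
  obtain a3 h3 m3 where 3: "h3 \<in> homog (int m3)" "h3 * (h2 * (h1 * q)) \<notin> J" "(var 3 - const3 a3 * l) * (h3 * (h2 * (h1 * q))) \<in> J"
    using step[OF homog_var[of 3] q2 2(2)] by blast
  define v :: "'k ^ 3" where "v = (\<chi> i. if i = 1 then a1 else if i = 2 then a2 else a3)"
  have v: "v $ 1 = a1" "v $ 2 = a2" "v $ 3 = a3" by (simp_all add: v_def)
  let ?h = "h3 * h2 * h1"
  have "?h \<in> homog (int (m3 + m2 + m1))" using homog_mult[OF homog_mult[OF 3(1) 2(1)] 1(1)] by simp
  moreover have "?h * q \<notin> J" using 3(2) by (simp add: mult.assoc)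
  moreover have "(var i - const3 (v $ i) * l) * (?h * q) \<in> J" for i
  proof -
    consider (i1) "i = 1" | (i2) "i = 2" | (i3) "i = 3" using exhaust_3 by blast
    thus ?thesis
    proof cases
      case i1
      have "(h3 * h2) * ((var 1 - const3 a1 * l) * (h1 * q)) \<in> J" by (rule Jmult[OF 1(3)])
      also have "(h3 * h2) * ((var 1 - const3 a1 * l) * (h1 * q)) = (var i - const3 (v $ i) * l) * (?h * q)"
        by (simp only: i1 v mult_ac)
      finally show ?thesis .
    next
      case i2
      have "h3 * ((var 2 - const3 a2 * l) * (h2 * (h1 * q))) \<in> J" by (rule Jmult[OF 2(3)])
      also have "h3 * ((var 2 - const3 a2 * l) * (h2 * (h1 * q))) = (var i - const3 (v $ i) * l) * (?h * q)"
        by (simp only: i2 v mult_ac)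
      finally show ?thesis .
    next
      case i3
      note 3(3)
      also have "(var 3 - const3 a3 * l) * (h3 * (h2 * (h1 * q))) = (var i - const3 (v $ i) * l) * (?h * q)"
        by (simp only: i3 v mult_ac)
      finally show ?thesis .
    qed
  qed
  ultimately show ?thesis using that by blast
qed

subsection \<open>Max Noether's theorem at transversal intersections\<close>

lemma poly_ideal_ideal2: "poly_ideal (ideal2 P G)"
  by (simp add: poly_ideal_def ideal2_gens ideal2_add ideal2_mult)

lemma bounded_mod_ideal2:
  fixes P :: "'k::field poly3"
  assumes "coprime_forms p g P G"
  shows "bounded_mod (ideal2 P G) (p + g) (p * g)"
  unfolding bounded_mod_def
  by (intro allI impI, rule complete_intersection_bound[OF assms]) auto

text \<open>The Jacobian determinant of P and G in the affine chart in which the i-th coordinate is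
  constant, j and k being the other two.\<close>

definition transversal_at :: "'k::field poly3 \<Rightarrow> 'k poly3 \<Rightarrow> 'k ^ 3 \<Rightarrow> bool" where
  "transversal_at P G w \<longleftrightarrow> (\<exists>i j k. w $ i \<noteq> 0 \<and> UNIV = {i, j, k} \<and>
     deriv_at w j P * deriv_at w k G \<noteq> deriv_at w k P * deriv_at w j G)"

definition point_form :: "'k::comm_ring_1 ^ 3 \<Rightarrow> 3 \<Rightarrow> 3 \<Rightarrow> 'k poly3" where
  "point_form v i j = const3 (v $ i) * var j - const3 (v $ j) * var i"

lemma point_form_homog [simp]: "point_form v i j \<in> homog 1"
  unfolding point_form_def by (intro homog_diff homog_const3_mult homog_var)

lemma form_vanishing_at_point:
  fixes f :: "'k::field poly3"
  assumes f: "f \<in> homog n" and v: "v $ i \<noteq> 0" "UNIV = {i, j, k}" "eval3 f v = 0"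
  shows "\<exists>A B. A \<in> homog (n - 1) \<and> B \<in> homog (n - 1) \<and> f = point_form v i j * A + point_form v i k * B"
proof (cases "n < 0")
  case True
  hence "f = 0" using f homog_neg by blast
  thus ?thesis using homog_0 by (metis add_0 mult_zero_right)
next
  case False
  then obtain m where m: "n = int m" by (metis nonneg_int_cases not_less)
  have gens: "const3 (v $ i) * var l - const3 (v $ l) * var i \<in> ideal2 (point_form v i j) (point_form v i k)" for l
  proof -
    have "l \<in> {i, j, k}" using v(2) by auto
    thus ?thesis using ideal2_gens[where P = "point_form v i j" and G = "point_form v i k"]
      by (auto simp: point_form_def)
  qed
  have "f \<in> ideal2 (point_form v i j) (point_form v i k)"
    using form_mod_point[OF f[unfolded m] v(1) gens ideal2_gens(3) ideal2_add ideal2_mult]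
    by (simp add: v(3))
  then obtain A B where "f = point_form v i j * A + point_form v i k * B" unfolding ideal2_def by blast
  thus ?thesis using homog_decomp2[OF f point_form_homog point_form_homog] by simp
qed

lemma UNIV_3_distinct:
  assumes "UNIV = {i, j, k :: 3}" shows "i \<noteq> j" "i \<noteq> k" "j \<noteq> k"
proof -
  have c: "card {i, j, k} = 3" unfolding assms[symmetric] by simp
  show "i \<noteq> j" "i \<noteq> k" "j \<noteq> k" using c by (auto simp: card_insert_if split: if_splits)
qed

text \<open>A form outside the ideal has a multiple q on which every form acts by its value at one
  point v. This v is a common zero of P and G, so q, like f, vanishes at v and is a combination of
  the two linear forms of v. By Cramer's rule the Jacobian determinant multiplies these linear forms
  into \<open>ideal2 P G\<close>; so it acts on q by 0 and vanishes at v, against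
  transversality.\<close>

theorem max_noether:
  fixes P :: "'k::alg_closed_field poly3"
  assumes cop: "coprime_forms p g P G" and pg: "p > 0" "g > 0"
    and f: "f \<in> homog (int n)" "\<And>w. w \<noteq> 0 \<Longrightarrow> eval3 P w = 0 \<Longrightarrow> eval3 G w = 0 \<Longrightarrow> eval3 f w = 0"
    and trans: "\<And>w. w \<noteq> 0 \<Longrightarrow> eval3 P w = 0 \<Longrightarrow> eval3 G w = 0 \<Longrightarrow> transversal_at P G w"
  shows "f \<in> ideal2 P G"
proof (rule ccontr)
  let ?J = "ideal2 P G"
  assume "f \<notin> ?J"
  have hP: "P \<in> homog (int p)" and hG: "G \<in> homog (int g)" using cop by (auto simp: coprime_forms_def)
  obtain t where t: "\<And>x. x \<in> {x \<in> proj_plane. eval3 P (rep x) = 0 \<and> eval3 G (rep x) = 0} \<Longrightarrow> eval3 (line t) (rep x) \<noteq> 0"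
    using line_avoiding_points[OF coprime_forms_common_zeros_finite[OF cop]] by blast
  have nz: "eval3 G w \<noteq> 0" if "w \<noteq> 0" "eval3 (line t) w = 0" "eval3 P w = 0" for w
    using t[of "vec.span {w}"] that eval3_rep_span[OF hP] eval3_rep_span[OF hG] eval3_rep_span[OF line_homog]
      span_in_proj_plane[of w] by auto
  let ?l = "line t"
  have nzd: "nonzerodivisor_mod ?l ?J"
    unfolding nonzerodivisor_mod_def
  proof (intro allI impI)
    fix q m assume q: "q \<in> homog m" "?l * q \<in> ?J"
    then obtain A B where "?l * q = P * A + G * B" unfolding ideal2_def by blast
    from line_nonzerodivisor[OF hP hG pg(2) nz q(1) this] show "q \<in> ?J" unfolding ideal2_def by blast
  qed
  obtain v h m where h: "h \<in> homog (int m)" "h * f \<notin> ?J"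
    and eig: "\<And>i. (var i - const3 (v $ i) * ?l) * (h * f) \<in> ?J"
    by (rule common_eigenform_exists[OF poly_ideal_ideal2 line_homog nzd bounded_mod_ideal2[OF cop] f(1) \<open>f \<notin> ?J\<close>]) (rule that)
  define q where "q = h * f"
  have qh: "q \<in> homog (int (m + n))" unfolding q_def using homog_mult[OF h(1) f(1)] by simp
  have qJ: "q \<notin> ?J" using h(2) by (simp add: q_def)
  note pow = nonzerodivisor_mod_power[OF nzd line_homog qh]
  \<comment> \<open>The annihilator of q modulo the ideal contains every
    \<open>var j - const3 (v $ j) * ?l\<close>, so a form of degree r acts on q as its value at v
    times \<open>?l ^ r\<close>.\<close>
  define K where "K = {a. a * q \<in> ?J}"
  have K: "var j - const3 (v $ j) * ?l \<in> K" "0 \<in> K" "a \<in> K \<Longrightarrow> b \<in> K \<Longrightarrow> a + b \<in> K" "a \<in> K \<Longrightarrow> b * a \<in> K" for a b j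
    using eig[of j] ideal2_gens(3) ideal2_add ideal2_mult by (auto simp: K_def q_def distrib_right mult.assoc)
  have act: "a * q - const3 (eval3 a v) * ?l ^ r * q \<in> ?J" if "a \<in> homog (int r)" for a r
  proof -
    have "a - pm_eval const3 (\<lambda>j. const3 (v $ j) * ?l) a \<in> K"
      by (rule pm_eval_congruent) (use K in auto)
    thus ?thesis unfolding pm_eval_multiples[OF that] K_def by (simp add: left_diff_distrib)
  qed
  have zero: "eval3 a v = 0" if "a \<in> homog (int r)" "a * q \<in> ?J" for a r
  proof (rule ccontr)
    assume nz: "eval3 a v \<noteq> 0"
    have "const3 (eval3 a v) * ?l ^ r * q \<in> ?J" using ideal2_diff[OF that(2) act[OF that(1)]] by simp
    hence "const3 (1 / eval3 a v) * (const3 (eval3 a v) * ?l ^ r * q) \<in> ?J" by (rule ideal2_mult)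
    hence "?l ^ r * q \<in> ?J" using nz by (simp add: mult.assoc[symmetric] const3_mult[symmetric])
    thus False using pow qJ by blast
  qed
  have PJ: "P * b \<in> ?J" "G * b \<in> ?J" for b
    using ideal2_mult[OF ideal2_gens(1), of b P G] ideal2_mult[OF ideal2_gens(2), of b G P] by (simp_all add: mult.commute)
  have Pv: "eval3 P v = 0" "eval3 G v = 0" using zero[OF hP] zero[OF hG] PJ by auto
  have v0: "v \<noteq> 0"
  proof
    assume "v = 0"
    hence "eval3 ?l v = 0" by (simp add: eval3_line)
    hence "?l ^ 1 * q \<in> ?J" using act[of ?l 1] by simp
    thus False using pow qJ by blast
  qed
  have qv: "eval3 q v = 0" using f(2)[OF v0 Pv] by (simp add: q_def)
  obtain i j k where ijk: "v $ i \<noteq> 0" "UNIV = {i, j, k}"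
    and D: "deriv_at v j P * deriv_at v k G \<noteq> deriv_at v k P * deriv_at v j G"
    using trans[OF v0 Pv] unfolding transversal_at_def by blast
  note dist = UNIV_3_distinct[OF ijk(2)]
  let ?a = "point_form v i j" and ?b = "point_form v i k"
  obtain P1 P2 where P12: "P1 \<in> homog (int p - 1)" "P2 \<in> homog (int p - 1)" "P = ?a * P1 + ?b * P2"
    using form_vanishing_at_point[OF hP ijk Pv(1)] by blast
  obtain G1 G2 where G12: "G1 \<in> homog (int g - 1)" "G2 \<in> homog (int g - 1)" "G = ?a * G1 + ?b * G2"
    using form_vanishing_at_point[OF hG ijk Pv(2)] by blast
  obtain q1 q2 where q12: "q = ?a * q1 + ?b * q2"
    using form_vanishing_at_point[OF qh ijk qv] by blast
  \<comment> \<open>The determinant of the coefficients of P and G with respect to the two linear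
    forms of the point; at v it is the determinant of the derivatives up to the factor
    \<open>(v $ i) ^ 2\<close>.\<close>
  define Jac where "Jac = P1 * G2 - P2 * G1"
  have "Jac \<in> homog (int p - 1 + (int g - 1))" unfolding Jac_def
    by (intro homog_diff homog_mult P12 G12)
  hence Jh: "Jac \<in> homog (int (p + g - 2))" using pg by (simp add: of_nat_diff)
  have "Jac * ?a = G2 * (?a * P1 + ?b * P2) - P2 * (?a * G1 + ?b * G2)" by (simp add: Jac_def algebra_simps)
  hence "Jac * ?a = G2 * P - P2 * G" by (simp only: P12(3)[symmetric] G12(3)[symmetric])
  hence Ja: "Jac * ?a \<in> ?J" by (simp add: ideal2_diff ideal2_mult ideal2_gens)
  have "Jac * ?b = P1 * (?a * G1 + ?b * G2) - G1 * (?a * P1 + ?b * P2)" by (simp add: Jac_def algebra_simps)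
  hence "Jac * ?b = P1 * G - G1 * P" by (simp only: P12(3)[symmetric] G12(3)[symmetric])
  hence Jb: "Jac * ?b \<in> ?J" by (simp add: ideal2_diff ideal2_mult ideal2_gens)
  have "Jac * q = q1 * (Jac * ?a) + q2 * (Jac * ?b)" by (simp add: q12 algebra_simps)
  hence "Jac * q \<in> ?J" using Ja Jb by (simp add: ideal2_add ideal2_mult)
  hence "eval3 Jac v = 0" by (rule zero[OF Jh])
  moreover have ev0: "eval3 ?a v = 0" "eval3 ?b v = 0" by (simp_all add: point_form_def)
  have da: "deriv_at v j ?a = v $ i" "deriv_at v k ?a = 0" "deriv_at v j ?b = 0" "deriv_at v k ?b = v $ i"
    using dist by (simp_all add: point_form_def)
  have "deriv_at v j P = v $ i * eval3 P1 v" "deriv_at v k P = v $ i * eval3 P2 v"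
    "deriv_at v j G = v $ i * eval3 G1 v" "deriv_at v k G = v $ i * eval3 G2 v"
    unfolding P12(3) G12(3) by (simp_all add: da ev0)
  hence "deriv_at v j P * deriv_at v k G - deriv_at v k P * deriv_at v j G = (v $ i) ^ 2 * eval3 Jac v"
    by (simp add: Jac_def algebra_simps power2_eq_square)
  ultimately show False using D by simp
qed

subsection \<open>Generators of the maximal ideal at an ordinary node\<close>

lemma cring_type_ring: "cring (type_ring :: 'a::comm_ring_1 ring)"
  unfolding type_ring_def
  by (rule cringI, rule abelian_groupI, auto simp: algebra_simps intro!: comm_monoidI exI[of _ "- x" for x])

lemma fps_split_X: "h = fps_const (fps_nth h 0) + fps_X * fps_shift 1 h" for h :: "'b::comm_ring_1 fps"
  by (rule fps_ext) simp

lemma fps_fps_unit: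
  fixes f :: "'k::field fps fps"
  assumes "fps_nth (fps_nth f 0) 0 \<noteq> 0"
  obtains g where "f * g = 1"
proof -
  have "fps_nth f 0 * inverse (fps_nth f 0) = 1"
    using inverse_mult_eq_1[OF assms] by (simp add: mult.commute)
  hence "f * fps_right_inverse f (inverse (fps_nth f 0)) = 1" by (rule fps_right_inverse)
  thus ?thesis using that by blast
qed

text \<open>Inverting the isomorphism and projecting the completion to its third level gives a ring
  homomorphism \<open>\<theta>\<close> from K[[x,y]] onto R/M^3 that kills xy; the elements sought
  represent the images of the two variables. The third power is enough because only the quadratic
  part of the equation is compared later. The isomorphism is one of rings only, so units are traced
  through constant terms.\<close>

lemma node_completion_generators:
  fixes R (structure)
  assumes R: "cring R" and MI: "ideal M R" and M: "M = carrier R - Units R"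
    and iso: "local_completion R \<simeq> node_ring TYPE('k::field)"
  shows "\<exists>x\<in>M. \<exists>y\<in>M. x \<otimes> y \<in> ideal_power R M 3 \<and>
     (\<forall>a\<in>M. \<exists>s\<in>carrier R. \<exists>t\<in>carrier R. a \<ominus> (s \<otimes> x \<oplus> t \<otimes> y) \<in> ideal_power R M 3)"
proof -
  interpret R: cring R by fact
  let ?J = "ideal_power R M"
  have JI: "ideal (?J n) R" for n
  proof (induction n)
    case (Suc n) thus ?case using R.ideal_prod_is_ideal[OF MI] by simp
  qed (simp add: R.oneideal)
  have dec: "?J (Suc n) \<subseteq> ?J n" for n using R.ideal_prod_inter[OF MI JI] by auto
  have J3M: "?J 3 \<subseteq> M" using R.ideal_prod_inter[OF MI JI, of 2] by (auto simp: eval_nat_numeral)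
  have one_M: "\<one> \<notin> M" by (simp add: M)
  define T where "T = local_completion R"
  have T: "carrier T = {c. \<forall>n. c n \<in> carrier (R Quot ?J n) \<and> c (Suc n) \<subseteq> c n}"
    "mult T = (\<lambda>a b n. a n \<otimes>\<^bsub>R Quot ?J n\<^esub> b n)" "add T = (\<lambda>a b n. a n \<oplus>\<^bsub>R Quot ?J n\<^esub> b n)"
    "one T = (\<lambda>n. \<one>\<^bsub>R Quot ?J n\<^esub>)"
    by (simp_all add: T_def local_completion_def adic_completion_def M[symmetric])
  have carr: "carrier (R Quot ?J n) = {?J n +> x | x. x \<in> carrier R}" for n
    by (auto simp: FactRing_def A_RCOSETS_defs a_r_coset_def RCOSETS_def)
  have hom: "((+>) (?J n)) \<in> Ring.ring_hom R (R Quot ?J n)" for n by (rule ideal.rcos_ring_hom[OF JI])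
  have coset_mono: "?J (Suc n) +> x \<subseteq> ?J n +> x" for n x using dec[of n] by (auto simp: a_r_coset_def')
  have coset_eq: "?J n +> a = ?J n +> b \<longleftrightarrow> a \<ominus> b \<in> ?J n" if "a \<in> carrier R" "b \<in> carrier R" for n a b
    using R.quotient_eq_iff_same_a_r_cos[OF JI that] by simp
  \<comment> \<open>One representative for two consecutive levels, because compatibility in the
    completion is containment of cosets.\<close>
  have rep2: "\<exists>x\<in>carrier R. c (Suc n) = ?J (Suc n) +> x \<and> c n = ?J n +> x" if c: "c \<in> carrier T" for c n
  proof -
    interpret Jn: ideal "?J n" R by (rule JI)
    interpret JS: ideal "?J (Suc n)" R by (rule JI)
    obtain x where x: "x \<in> carrier R" "c (Suc n) = ?J (Suc n) +> x" using c T carr by blast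
    obtain y where y: "y \<in> carrier R" "c n = ?J n +> y" using c T carr by blast
    have "x \<in> c (Suc n)" using JS.a_rcos_self x by simp
    moreover have "c (Suc n) \<subseteq> c n" using c unfolding T(1) by blast
    ultimately have "x \<in> ?J n +> y" using y(2) by blast
    hence "?J n +> y = ?J n +> x" using Jn.a_repr_independence'[OF _ y(1)] by simp
    thus ?thesis using x y by auto
  qed
  have Tmult: "a \<otimes>\<^bsub>T\<^esub> b \<in> carrier T" and Tadd: "a \<oplus>\<^bsub>T\<^esub> b \<in> carrier T" if ab: "a \<in> carrier T" "b \<in> carrier T" for a b
  proof -
    have *: "(a \<otimes>\<^bsub>T\<^esub> b) n \<in> carrier (R Quot ?J n) \<and> (a \<otimes>\<^bsub>T\<^esub> b) (Suc n) \<subseteq> (a \<otimes>\<^bsub>T\<^esub> b) n \<and>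
      (a \<oplus>\<^bsub>T\<^esub> b) n \<in> carrier (R Quot ?J n) \<and> (a \<oplus>\<^bsub>T\<^esub> b) (Suc n) \<subseteq> (a \<oplus>\<^bsub>T\<^esub> b) n" for n
    proof -
      obtain x y where x: "x \<in> carrier R" "a (Suc n) = ?J (Suc n) +> x" "a n = ?J n +> x"
        and y: "y \<in> carrier R" "b (Suc n) = ?J (Suc n) +> y" "b n = ?J n +> y"
        using rep2[OF ab(1), of n] rep2[OF ab(2), of n] by blast
      have "(a \<otimes>\<^bsub>T\<^esub> b) n = ?J n +> (x \<otimes> y)" "(a \<otimes>\<^bsub>T\<^esub> b) (Suc n) = ?J (Suc n) +> (x \<otimes> y)"
        "(a \<oplus>\<^bsub>T\<^esub> b) n = ?J n +> (x \<oplus> y)" "(a \<oplus>\<^bsub>T\<^esub> b) (Suc n) = ?J (Suc n) +> (x \<oplus> y)"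
        unfolding T x y using ring_hom_mult[OF hom x(1) y(1)] ring_hom_add[OF hom x(1) y(1)]
        by (simp_all del: ideal_power.simps)
      thus ?thesis using coset_mono x(1) y(1) carr by auto
    qed
    show "a \<otimes>\<^bsub>T\<^esub> b \<in> carrier T" "a \<oplus>\<^bsub>T\<^esub> b \<in> carrier T"
      unfolding T(1) using * by blast+
  qed
  have Tconst: "(\<lambda>n. ?J n +> x) \<in> carrier T" if "x \<in> carrier R" for x
    unfolding T(1) using that carr coset_mono by blast
  have Tone: "one T = (\<lambda>n. ?J n +> \<one>)" unfolding T using ring_hom_one[OF hom] by auto
  hence Tone': "one T \<in> carrier T" using Tconst[of \<one>] by simp
  define A where "A = (type_ring :: 'k fps fps ring)"
  interpret A: cring A unfolding A_def by (rule cring_type_ring)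
  have Ac: "carrier A = UNIV" "mult A = (*)" "add A = (+)" "one A = 1" "zero A = 0"
    by (simp_all add: A_def type_ring_def)
  define X where "X = (fps_const fps_X :: 'k fps fps)"
  define Y where "Y = (fps_X :: 'k fps fps)"
  define P where "P = PIdl\<^bsub>A\<^esub> (X * Y)"
  have PI: "ideal P A" unfolding P_def by (rule A.cgenideal_ideal) (simp add: Ac)
  interpret P: ideal P A by (rule PI)
  have N: "node_ring TYPE('k) = A Quot P" by (simp add: node_ring_def A_def P_def X_def Y_def)
  have Phom: "((+>\<^bsub>A\<^esub>) P) \<in> Ring.ring_hom A (A Quot P)" by (rule P.rcos_ring_hom)
  have Pcarr: "carrier (A Quot P) = {P +>\<^bsub>A\<^esub> f | f. True}"
    by (auto simp: FactRing_def A_RCOSETS_defs a_r_coset_def RCOSETS_def Ac)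
  obtain \<phi> where \<phi>: "\<phi> \<in> ring_iso T (A Quot P)"
    using iso unfolding T_def[symmetric] N is_ring_iso_def by blast
  have \<phi>h: "\<phi> \<in> Ring.ring_hom T (A Quot P)" and \<phi>b: "bij_betw \<phi> (carrier T) (carrier (A Quot P))"
    using \<phi> by (auto simp: ring_iso_def)
  \<comment> \<open>A chosen preimage of the class of f; injectivity of \<open>\<phi>\<close> makes
    the choice additive and multiplicative.\<close>
  define \<psi> where "\<psi> f = inv_into (carrier T) \<phi> (P +>\<^bsub>A\<^esub> f)" for f
  have Pf: "P +>\<^bsub>A\<^esub> f \<in> carrier (A Quot P)" for f using Pcarr by blast
  have \<psi>c: "\<psi> f \<in> carrier T" for f unfolding \<psi>_def
    using \<phi>b Pf by (metis bij_betw_def inv_into_into)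
  have \<phi>\<psi>: "\<phi> (\<psi> f) = P +>\<^bsub>A\<^esub> f" for f unfolding \<psi>_def
    using \<phi>b Pf by (metis bij_betw_inv_into_right)
  have \<phi>inj: "c = c'" if "c \<in> carrier T" "c' \<in> carrier T" "\<phi> c = \<phi> c'" for c c'
    using \<phi>b that by (auto simp: bij_betw_def inj_on_def)
  have \<psi>mult: "\<psi> (f * g) = \<psi> f \<otimes>\<^bsub>T\<^esub> \<psi> g" for f g
    using ring_hom_mult[OF \<phi>h \<psi>c \<psi>c] ring_hom_mult[OF Phom, of f g]
    by (intro \<phi>inj) (auto simp: \<psi>c Tmult \<phi>\<psi> Ac)
  have \<psi>add: "\<psi> (f + g) = \<psi> f \<oplus>\<^bsub>T\<^esub> \<psi> g" for f g
    using ring_hom_add[OF \<phi>h \<psi>c \<psi>c] ring_hom_add[OF Phom, of f g]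
    by (intro \<phi>inj) (auto simp: \<psi>c Tadd \<phi>\<psi> Ac)
  have \<psi>one: "\<psi> 1 = one T"
    using ring_hom_one[OF \<phi>h] ring_hom_one[OF Phom]
    by (intro \<phi>inj) (auto simp: \<psi>c Tone' \<phi>\<psi> Ac)
  define B where "B = R Quot ?J 3"
  interpret B: cring B unfolding B_def by (rule ideal.quotient_is_cring[OF JI R])
  define \<theta> where "\<theta> f = \<psi> f 3" for f
  have \<theta>c: "\<theta> f \<in> carrier B" for f using \<psi>c[of f] unfolding T \<theta>_def B_def by blast
  have \<theta>mult: "\<theta> (f * g) = \<theta> f \<otimes>\<^bsub>B\<^esub> \<theta> g" for f g unfolding \<theta>_def \<psi>mult T B_def ..
  have \<theta>add: "\<theta> (f + g) = \<theta> f \<oplus>\<^bsub>B\<^esub> \<theta> g" for f g unfolding \<theta>_def \<psi>add T B_def ..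
  have \<theta>one: "\<theta> 1 = \<one>\<^bsub>B\<^esub>" unfolding \<theta>_def \<psi>one T B_def ..
  have \<theta>zero: "\<theta> 0 = \<zero>\<^bsub>B\<^esub>"
    using \<theta>add[of 0 0] \<theta>c[of 0] B.add.r_cancel_one[of "\<theta> 0" "\<theta> 0"] by simp
  have hom3: "((+>) (?J 3)) \<in> Ring.ring_hom R B" unfolding B_def by (rule hom)
  have surj: "\<exists>f. \<theta> f = ?J 3 +> x" if "x \<in> carrier R" for x
  proof -
    have "\<phi> (\<lambda>n. ?J n +> x) \<in> carrier (A Quot P)" using ring_hom_closed[OF \<phi>h Tconst[OF that]] .
    then obtain f where "\<phi> (\<lambda>n. ?J n +> x) = P +>\<^bsub>A\<^esub> f" using Pcarr by blast
    hence "\<psi> f = (\<lambda>n. ?J n +> x)" using \<phi>inj[OF \<psi>c Tconst[OF that]] \<phi>\<psi> by simp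
    thus ?thesis unfolding \<theta>_def by metis
  qed
  have "X * Y \<in> P" unfolding P_def by (rule A.cgenideal_self) (simp add: Ac)
  hence "(X * Y) \<ominus>\<^bsub>A\<^esub> 0 \<in> P" using A.minus_eq[of "X * Y" 0] by (metis A.r_zero A.minus_zero A.minus_eq Ac(1,5) UNIV_I)
  hence "P +>\<^bsub>A\<^esub> (X * Y) = P +>\<^bsub>A\<^esub> 0" using A.quotient_eq_iff_same_a_r_cos[OF PI, of "X * Y" 0] Ac by simp
  hence "\<psi> (X * Y) = \<psi> 0" unfolding \<psi>_def by simp
  hence \<theta>XY: "\<theta> X \<otimes>\<^bsub>B\<^esub> \<theta> Y = \<zero>\<^bsub>B\<^esub>" using \<theta>mult \<theta>zero unfolding \<theta>_def by metis
  have Bcarr: "carrier B = {?J 3 +> x | x. x \<in> carrier R}" unfolding B_def by (rule carr)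
  have B10: "\<one>\<^bsub>B\<^esub> \<noteq> \<zero>\<^bsub>B\<^esub>"
  proof
    assume "\<one>\<^bsub>B\<^esub> = \<zero>\<^bsub>B\<^esub>"
    moreover have "\<zero>\<^bsub>B\<^esub> = ?J 3 +> \<zero>" using ring_hom_zero[OF hom3 R.ring_axioms B.ring_axioms] by simp
    ultimately have "?J 3 +> \<one> = ?J 3 +> \<zero>" using ring_hom_one[OF hom3] by simp
    hence "\<one> \<ominus> \<zero> \<in> ?J 3" using coset_eq[of \<one> \<zero>] by simp
    thus False using J3M one_M by (auto simp: R.minus_eq)
  qed
  \<comment> \<open>An f over an element of M cannot be a unit, so its constant term is 0 and it is
    a combination of X and Y.\<close>
  have nilp: "\<exists>s t. f = X * s + Y * t" if fa: "\<theta> f = ?J 3 +> a" and a: "a \<in> M" for f a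
  proof -
    have ac: "a \<in> carrier R" using a M by simp
    have "fps_nth (fps_nth f 0) 0 = 0"
    proof (rule ccontr)
      assume "fps_nth (fps_nth f 0) 0 \<noteq> 0"
      then obtain g where "f * g = 1" by (rule fps_fps_unit)
      hence "\<theta> f \<otimes>\<^bsub>B\<^esub> \<theta> g = \<one>\<^bsub>B\<^esub>" using \<theta>mult \<theta>one by metis
      moreover obtain b where b: "b \<in> carrier R" "\<theta> g = ?J 3 +> b" using \<theta>c[of g] Bcarr by blast
      ultimately have "?J 3 +> (a \<otimes> b) = ?J 3 +> \<one>"
        using ring_hom_mult[OF hom3 ac b(1)] ring_hom_one[OF hom3] fa by simp
      hence "a \<otimes> b \<ominus> \<one> \<in> ?J 3" using coset_eq[of "a \<otimes> b" \<one>] ac b by simp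
      hence "a \<otimes> b \<ominus> \<one> \<in> M" using J3M by blast
      moreover have abM: "a \<otimes> b \<in> M" using ideal.I_r_closed[OF MI a b(1)] .
      ultimately have "a \<otimes> b \<ominus> (a \<otimes> b \<ominus> \<one>) \<in> M"
        using additive_subgroup.a_closed[OF ideal.axioms(1)[OF MI]] additive_subgroup.a_inv_closed[OF ideal.axioms(1)[OF MI]]
        by (simp add: R.minus_eq[of "a \<otimes> b" "a \<otimes> b \<ominus> \<one>"])
      moreover have "a \<otimes> b \<ominus> (a \<otimes> b \<ominus> \<one>) = \<one>" using ac b by algebra
      ultimately show False using one_M by simp
    qed
    moreover have "f = fps_const (fps_nth f 0) + Y * fps_shift 1 f" unfolding Y_def by (rule fps_split_X)
    moreover have "fps_nth f 0 = fps_const (fps_nth (fps_nth f 0) 0) + fps_X * fps_shift 1 (fps_nth f 0)" by (rule fps_split_X)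
    ultimately have "f = X * fps_const (fps_shift 1 (fps_nth f 0)) + Y * fps_shift 1 f"
      unfolding X_def by (metis add_0 fps_const_0_eq_0 fps_const_mult)
    thus ?thesis by blast
  qed
  \<comment> \<open>If x were a unit, some g would give \<open>h * g\<close> the image 1; but
    \<open>1 - h * g\<close> is a unit, h having constant term 0, and its image would be 0.\<close>
  have nonunit: "x \<in> M" if x: "x \<in> carrier R" "\<theta> h = ?J 3 +> x" and h: "fps_nth (fps_nth h 0) 0 = 0" for x h
  proof (rule ccontr)
    assume "x \<notin> M"
    hence "x \<in> Units R" using x M by blast
    then obtain u where u: "u \<in> carrier R" "x \<otimes> u = \<one>" by (auto simp: Units_def)
    obtain g where g: "\<theta> g = ?J 3 +> u" using surj u by blast
    have hg: "\<theta> (h * g) = \<one>\<^bsub>B\<^esub>"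
      using ring_hom_mult[OF hom3 x(1) u(1)] ring_hom_one[OF hom3] u(2) \<theta>mult x(2) g by simp
    have "fps_nth (fps_nth (1 - h * g) 0) 0 \<noteq> 0" using h by simp
    then obtain k where k: "(1 - h * g) * k = 1" by (rule fps_fps_unit)
    have "\<theta> 1 = \<theta> (1 - h * g) \<oplus>\<^bsub>B\<^esub> \<theta> (h * g)" using \<theta>add[of "1 - h * g" "h * g"] by simp
    hence "\<one>\<^bsub>B\<^esub> = \<theta> (1 - h * g) \<oplus>\<^bsub>B\<^esub> \<one>\<^bsub>B\<^esub>" using \<theta>one hg by simp
    hence "\<theta> (1 - h * g) = \<zero>\<^bsub>B\<^esub>" using \<theta>c B.add.r_cancel_one'[of "\<one>\<^bsub>B\<^esub>" "\<theta> (1 - h * g)"] by simp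
    hence "\<theta> 1 = \<zero>\<^bsub>B\<^esub>" using k \<theta>mult[of "1 - h * g" k] \<theta>c by simp
    thus False using \<theta>one B10 by simp
  qed
  obtain x where x: "x \<in> carrier R" "\<theta> X = ?J 3 +> x" using \<theta>c[of X] Bcarr by blast
  obtain y where y: "y \<in> carrier R" "\<theta> Y = ?J 3 +> y" using \<theta>c[of Y] Bcarr by blast
  have "x \<in> M" by (rule nonunit[OF x]) (simp add: X_def)
  moreover have "y \<in> M" by (rule nonunit[OF y]) (simp add: Y_def)
  moreover have "x \<otimes> y \<in> ?J 3"
  proof -
    have "?J 3 +> (x \<otimes> y) = ?J 3 +> \<zero>"
      using ring_hom_mult[OF hom3 x(1) y(1)] \<theta>XY x y ring_hom_zero[OF hom3 R.ring_axioms B.ring_axioms] by simp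
    hence "x \<otimes> y \<ominus> \<zero> \<in> ?J 3" using coset_eq[of "x \<otimes> y" \<zero>] x y by simp
    thus ?thesis using x y by (simp add: R.minus_eq)
  qed
  moreover have "\<exists>s\<in>carrier R. \<exists>t\<in>carrier R. a \<ominus> (s \<otimes> x \<oplus> t \<otimes> y) \<in> ?J 3" if a: "a \<in> M" for a
  proof -
    have ac: "a \<in> carrier R" using a M by simp
    obtain f where f: "\<theta> f = ?J 3 +> a" using surj[OF ac] by blast
    then obtain S U where SU: "f = X * S + Y * U" using nilp[OF f a] by blast
    obtain s where s: "s \<in> carrier R" "\<theta> S = ?J 3 +> s" using \<theta>c[of S] Bcarr by blast
    obtain t where t: "t \<in> carrier R" "\<theta> U = ?J 3 +> t" using \<theta>c[of U] Bcarr by blast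
    have "\<theta> f = \<theta> S \<otimes>\<^bsub>B\<^esub> \<theta> X \<oplus>\<^bsub>B\<^esub> \<theta> U \<otimes>\<^bsub>B\<^esub> \<theta> Y"
      unfolding SU by (simp add: \<theta>add \<theta>mult mult.commute[of X] mult.commute[of Y])
    also have "\<dots> = ?J 3 +> (s \<otimes> x \<oplus> t \<otimes> y)"
      using ring_hom_mult[OF hom3 s(1) x(1)] ring_hom_mult[OF hom3 t(1) y(1)]
        ring_hom_add[OF hom3, of "s \<otimes> x" "t \<otimes> y"] s t x y by simp
    finally have "?J 3 +> a = ?J 3 +> (s \<otimes> x \<oplus> t \<otimes> y)" using f by simp
    hence "a \<ominus> (s \<otimes> x \<oplus> t \<otimes> y) \<in> ?J 3" using coset_eq[OF ac, of "s \<otimes> x \<oplus> t \<otimes> y"] s t x y by simp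
    thus ?thesis using s t by blast
  qed
  ultimately show ?thesis by blast
qed

section \<open>Jets and local rings in an affine chart\<close>

locale point_chart =
  fixes v :: "'k::field ^ 3" and i j k :: 3
  assumes vi: "v $ i \<noteq> 0" and ijk: "UNIV = {i, j, k}"
begin

lemmas dist = UNIV_3_distinct[OF ijk]

lemma v_nz: "v \<noteq> 0" using vi by auto

text \<open>The expansion of f at v in the directions j and k, the i-th coordinate keeping its
  value. The inner polynomial variable belongs to j, the outer one to k. Coefficients replace second
  derivatives so that characteristic 2 is covered.\<close>

definition taylor :: "'k poly3 \<Rightarrow> 'k poly poly" where
  "taylor = pm_eval (\<lambda>c. [:[:c:]:])
     (\<lambda>l. if l = j then [:[:v $ j, 1:]:] else if l = k then [:[:v $ k:], [:1:]:] else [:[:v $ l:]:])"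

definition jet :: "nat \<Rightarrow> nat \<Rightarrow> 'k poly3 \<Rightarrow> 'k" where
  "jet a b f = coeff (coeff (taylor f) b) a"

lemma coef_hom_pCons2: "coef_hom (\<lambda>c::'k. [:[:c:]:])"
  by standard simp_all

lemma jet_add: "jet a b (f + g) = jet a b f + jet a b g"
  by (simp add: jet_def taylor_def coef_hom.eval_simps[OF coef_hom_pCons2])

lemma jet_mult:
  "jet 0 0 (f * g) = jet 0 0 f * jet 0 0 g"
  "jet 1 0 (f * g) = jet 1 0 f * jet 0 0 g + jet 0 0 f * jet 1 0 g"
  "jet 0 1 (f * g) = jet 0 1 f * jet 0 0 g + jet 0 0 f * jet 0 1 g"
  "jet 2 0 (f * g) = jet 2 0 f * jet 0 0 g + jet 1 0 f * jet 1 0 g + jet 0 0 f * jet 2 0 g"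
  "jet 0 2 (f * g) = jet 0 2 f * jet 0 0 g + jet 0 1 f * jet 0 1 g + jet 0 0 f * jet 0 2 g"
  "jet 1 1 (f * g) = jet 1 1 f * jet 0 0 g + jet 1 0 f * jet 0 1 g + jet 0 1 f * jet 1 0 g + jet 0 0 f * jet 1 1 g"
  unfolding jet_def taylor_def coef_hom.eval_simps[OF coef_hom_pCons2]
  by (simp_all add: coeff_mult numeral_2_eq_2 algebra_simps)

lemmas jet_mult' = jet_mult[unfolded One_nat_def]

lemma jet_const_var:
  "jet 0 0 (const3 c) = c" "jet 1 0 (const3 c) = 0" "jet 0 1 (const3 c) = 0"
  "jet 0 0 (var l) = v $ l" "jet 1 0 (var l) = (if l = j then 1 else 0)" "jet 0 1 (var l) = (if l = k then 1 else 0)"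
  using dist by (auto simp: jet_def taylor_def coef_hom.eval_simps[OF coef_hom_pCons2])

lemma jet_0: "jet 0 0 f = eval3 f v" and jet_1: "jet 1 0 f = deriv_at v j f" and jet_2: "jet 0 1 f = deriv_at v k f"
proof -
  have "jet 0 0 f = eval3 f v \<and> jet 1 0 f = deriv_at v j f \<and> jet 0 1 f = deriv_at v k f"
    by (induction f rule: poly3_ring_induct) (simp_all add: jet_const_var[unfolded One_nat_def] jet_add jet_mult')
  thus "jet 0 0 f = eval3 f v" "jet 1 0 f = deriv_at v j f" "jet 0 1 f = deriv_at v k f" by auto
qed

text \<open>The order of vanishing at v, recorded only up to 3: larger r impose nothing
  more.\<close>

definition ord_ge :: "nat \<Rightarrow> 'k poly3 \<Rightarrow> bool" where
  "ord_ge r f \<longleftrightarrow> (r \<ge> 1 \<longrightarrow> jet 0 0 f = 0) \<and> (r \<ge> 2 \<longrightarrow> jet 1 0 f = 0 \<and> jet 0 1 f = 0) \<and>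
     (r \<ge> 3 \<longrightarrow> jet 2 0 f = 0 \<and> jet 1 1 f = 0 \<and> jet 0 2 f = 0)"

lemma ord_ge_add: "ord_ge r f \<Longrightarrow> ord_ge r g \<Longrightarrow> ord_ge r (f + g)"
  by (simp add: ord_ge_def jet_add)

lemma ord_ge_mult: "ord_ge r f \<Longrightarrow> ord_ge r (f * g)"
  by (auto simp: ord_ge_def jet_mult')

lemma ord_ge_mult1: "eval3 f v = 0 \<Longrightarrow> ord_ge r g \<Longrightarrow> r \<le> 2 \<Longrightarrow> ord_ge (Suc r) (f * g)"
proof -
  assume *: "eval3 f v = 0" "ord_ge r g" "r \<le> 2"
  hence "r = 0 \<or> r = 1 \<or> r = 2" by arith
  thus ?thesis using * by (auto simp: ord_ge_def jet_mult' jet_0[symmetric])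
qed

text \<open>Numerator and denominator of an element of the local ring, kept as a pair so that jets
  of numerators can be taken.\<close>

abbreviation loc :: "'k poly3 \<Rightarrow> 'k poly3 \<Rightarrow> bool" where
  "loc a b \<equiv> \<exists>n. a \<in> homog n \<and> b \<in> homog n \<and> eval3 b v \<noteq> 0"

lemma locD: "loc a b \<Longrightarrow> b \<noteq> 0" "loc a b \<Longrightarrow> eval3 b v \<noteq> 0" by auto

lemma loc_mult: "loc a b \<Longrightarrow> loc c d \<Longrightarrow> loc (a * c) (b * d)"
  using homog_mult by (metis eval3_simps(4) no_zero_divisors)

lemma loc_add: "loc a b \<Longrightarrow> loc c d \<Longrightarrow> loc (a * d + c * b) (b * d)"
proof -
  assume "loc a b" "loc c d"
  then obtain n m where h: "a \<in> homog n" "b \<in> homog n" "eval3 b v \<noteq> 0" "c \<in> homog m" "d \<in> homog m" "eval3 d v \<noteq> 0" by blast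
  have "c * b \<in> homog (n + m)" using homog_mult[OF h(4) h(2)] by (simp add: add.commute)
  hence "a * d + c * b \<in> homog (n + m)" "b * d \<in> homog (n + m)"
    using homog_add[OF homog_mult[OF h(1,5)]] homog_mult[OF h(2,5)] by blast+
  thus ?thesis using h by auto
qed

definition PL :: "'k poly3 fract ring" where "PL = plane_local_ring (vec.span {v})"

lemma PL_simps: "mult PL = (*)" "one PL = 1" "zero PL = 0" "add PL = (+)"
  by (simp_all add: PL_def plane_local_ring_def)

lemma PL_carrier: "carrier PL = {Fract a b | a b. loc a b}"
  unfolding PL_def plane_local_ring_def using vanishes_at_span[OF _ v_nz] by fastforce

lemma PL_I: "loc a b \<Longrightarrow> Fract a b \<in> carrier PL"
  unfolding PL_carrier by blast

lemma loc_1: "loc 1 1" "loc 0 1"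
  by (rule exI[of _ 0], simp)+

lemma PL_uminus: "x \<in> carrier PL \<Longrightarrow> - x \<in> carrier PL"
proof -
  assume "x \<in> carrier PL"
  then obtain a b where "x = Fract a b" "loc a b" unfolding PL_carrier by blast
  thus ?thesis using homog_uminus by (auto intro!: PL_I) 
qed

lemma PL_add_closed: "x \<in> carrier PL \<Longrightarrow> y \<in> carrier PL \<Longrightarrow> x + y \<in> carrier PL"
proof -
  assume "x \<in> carrier PL" "y \<in> carrier PL"
  then obtain a b c d where "x = Fract a b" "loc a b" "y = Fract c d" "loc c d" unfolding PL_carrier by blast
  thus ?thesis using PL_I[OF loc_add[of a b c d]] locD(1)[of a b] locD(1)[of c d] by simp
qed

lemma PL_mult_closed: "x \<in> carrier PL \<Longrightarrow> y \<in> carrier PL \<Longrightarrow> x * y \<in> carrier PL"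
proof -
  assume "x \<in> carrier PL" "y \<in> carrier PL"
  then obtain a b c d where "x = Fract a b" "loc a b" "y = Fract c d" "loc c d" unfolding PL_carrier by blast
  thus ?thesis using PL_I[OF loc_mult[of a b c d]] by simp
qed

lemma PL_01: "0 \<in> carrier PL" "1 \<in> carrier PL"
  using PL_I[OF loc_1(1)] PL_I[OF loc_1(2)] by (simp_all add: Zero_fract_def[symmetric] One_fract_def[symmetric])

lemma cring_PL: "cring PL"
proof (rule cringI)
  show "abelian_group PL"
  proof (rule abelian_groupI)
    fix x assume "x \<in> carrier PL"
    thus "\<exists>y\<in>carrier PL. y \<oplus>\<^bsub>PL\<^esub> x = \<zero>\<^bsub>PL\<^esub>" using PL_uminus by (intro bexI[of _ "- x"]) (auto simp: PL_simps)
  qed (auto simp: PL_simps PL_01 PL_add_closed algebra_simps)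
  show "Group.comm_monoid PL"
    by (rule comm_monoidI) (auto simp: PL_simps PL_01 PL_mult_closed algebra_simps)
qed (auto simp: PL_simps algebra_simps)

end

locale chart_curve = point_chart v i j k for v :: "'k::field ^ 3" and i j k +
  fixes F :: "'k::field poly3" and d :: int
  assumes F: "F \<in> homog d" and Fv: "eval3 F v = 0"
begin

sublocale PL: cring PL by (rule cring_PL)

lemma PL_ainv: "x \<in> carrier PL \<Longrightarrow> \<ominus>\<^bsub>PL\<^esub> x = - x"
  using PL.minus_equality[of "- x" x] PL_uminus by (simp add: PL_simps)

definition aa :: "'k poly3 fract set" where "aa = curve_local_ideal F (vec.span {v})"

lemma aa_eq: "aa = {Fract a b | a b. loc a b \<and> F dvd a}"
  unfolding aa_def curve_local_ideal_def using vanishes_at_span[OF _ v_nz] by fastforce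

lemma ideal_aa: "ideal aa PL"
proof (rule idealI[OF PL.ring_axioms])
  have sub: "aa \<subseteq> carrier PL" unfolding aa_eq PL_carrier by blast
  have mult: "x * a \<in> aa" if ax: "a \<in> aa" "x \<in> carrier PL" for a x
  proof -
    obtain b c e f where *: "a = Fract b c" "loc b c" "F dvd b" "x = Fract e f" "loc e f"
      using ax unfolding aa_eq PL_carrier by blast
    have "x * a = Fract (e * b) (f * c)" "F dvd e * b" using * by auto
    thus ?thesis unfolding aa_eq using loc_mult[OF *(5,2)] by blast
  qed
  show "subgroup aa (add_monoid PL)"
  proof (rule subgroup.intro)
    show "aa \<subseteq> carrier (add_monoid PL)" using sub by simp
    show "x \<otimes>\<^bsub>add_monoid PL\<^esub> y \<in> aa" if xy: "x \<in> aa" "y \<in> aa" for x y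
    proof -
      obtain b c e f where *: "x = Fract b c" "loc b c" "F dvd b" "y = Fract e f" "loc e f" "F dvd e"
        using xy unfolding aa_eq by blast
      have "x + y = Fract (b * f + e * c) (c * f)" using * locD(1)[OF *(2)] locD(1)[OF *(5)] by simp
      moreover have "F dvd b * f + e * c" using * by auto
      ultimately have "x + y \<in> aa" unfolding aa_eq using loc_add[OF *(2,5)] by blast
      thus ?thesis by (simp add: PL_simps)
    qed
    have "0 = Fract (0 :: 'k poly3) 1" by (simp add: Zero_fract_def)
    hence "0 \<in> aa" unfolding aa_eq using loc_1 dvd_0_right by blast
    thus "\<one>\<^bsub>add_monoid PL\<^esub> \<in> aa" by (simp add: PL_simps)
    show "inv\<^bsub>add_monoid PL\<^esub> x \<in> aa" if x: "x \<in> aa" for x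
    proof -
      have "(- 1) * x \<in> aa" using mult[OF x PL_uminus[OF PL_01(2)]] .
      moreover have "inv\<^bsub>add_monoid PL\<^esub> x = - x" using PL_ainv x sub by (auto simp: a_inv_def)
      ultimately show ?thesis by simp
    qed
  qed
  show "x \<otimes>\<^bsub>PL\<^esub> a \<in> aa" "a \<otimes>\<^bsub>PL\<^esub> x \<in> aa" if "a \<in> aa" "x \<in> carrier PL" for a x
    using mult[OF that] by (simp_all add: PL_simps mult.commute)
qed

definition RR where "RR = PL Quot aa"

sublocale RR: cring RR unfolding RR_def by (rule ideal.quotient_is_cring[OF ideal_aa cring_PL])

lemma RR_eq: "RR = curve_local_ring F (vec.span {v})"
  by (simp add: RR_def PL_def aa_def curve_local_ring_def)

definition cl where "cl a b = aa +>\<^bsub>PL\<^esub> Fract a b"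

lemma RR_carrier: "carrier RR = {cl a b | a b. loc a b}"
proof -
  have "carrier RR = {aa +>\<^bsub>PL\<^esub> x | x. x \<in> carrier PL}"
    by (auto simp: RR_def FactRing_def A_RCOSETS_defs a_r_coset_def RCOSETS_def)
  thus ?thesis unfolding PL_carrier cl_def by blast
qed

lemma RR_hom: "((+>\<^bsub>PL\<^esub>) aa) \<in> Ring.ring_hom PL RR"
  unfolding RR_def by (rule ideal.rcos_ring_hom[OF ideal_aa])

lemma cl_mult: "loc a b \<Longrightarrow> loc c e \<Longrightarrow> cl a b \<otimes>\<^bsub>RR\<^esub> cl c e = cl (a * c) (b * e)"
  using ring_hom_mult[OF RR_hom PL_I PL_I] by (simp add: cl_def PL_simps)

lemma cl_add: "loc a b \<Longrightarrow> loc c e \<Longrightarrow> cl a b \<oplus>\<^bsub>RR\<^esub> cl c e = cl (a * e + c * b) (b * e)"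
proof -
  assume *: "loc a b" "loc c e"
  have "Fract a b + Fract c e = Fract (a * e + c * b) (b * e)"
    using locD(1)[OF *(1)] locD(1)[OF *(2)] by simp
  thus ?thesis using ring_hom_add[OF RR_hom PL_I[OF *(1)] PL_I[OF *(2)]] by (simp only: cl_def PL_simps)
qed

lemma cl_one: "\<one>\<^bsub>RR\<^esub> = cl 1 1"
  using ring_hom_one[OF RR_hom] by (simp add: cl_def PL_simps One_fract_def)

lemma cl_zero: "\<zero>\<^bsub>RR\<^esub> = cl 0 1"
  using ring_hom_zero[OF RR_hom PL.ring_axioms RR.ring_axioms] by (simp add: cl_def PL_simps Zero_fract_def)

text \<open>Clearing denominators: C and D are products of denominators, and C is nonzero at
  v.\<close>

lemma cl_eqD:
  assumes ab: "loc a b" and ce: "loc c e" and eq: "cl a b = cl c e"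
  shows "\<exists>C D E. eval3 C v \<noteq> 0 \<and> a * C = c * D + F * E"
proof -
  have car: "Fract a b \<in> carrier PL" "Fract c e \<in> carrier PL" using ab ce PL_I by blast+
  have "Fract a b \<ominus>\<^bsub>PL\<^esub> Fract c e \<in> aa"
    using PL.quotient_eq_iff_same_a_r_cos[OF ideal_aa car] eq by (simp add: cl_def)
  hence "Fract a b - Fract c e \<in> aa"
    by (simp only: PL.minus_eq PL_ainv[OF car(2)] PL_simps diff_conv_add_uminus)
  then obtain s t where st: "Fract a b - Fract c e = Fract s t" "loc s t" "F dvd s" unfolding aa_eq by blast
  have nz: "b \<noteq> 0" "e \<noteq> 0" "t \<noteq> 0" using ab ce st(2) by auto
  have "(a * e - c * b) * t = s * (b * e)" using st(1) nz by (simp add: eq_fract)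
  moreover obtain E where "s = F * E" using st(3) by (auto simp: dvd_def)
  ultimately have "a * (e * t) = c * (b * t) + F * (E * b * e)" by (simp add: algebra_simps)
  moreover have "eval3 (e * t) v \<noteq> 0" using ce st(2) by auto
  ultimately show ?thesis by blast
qed

definition MM where "MM = carrier RR - Units RR"

text \<open>A fraction whose numerator is nonzero at v has its reciprocal in the ring. Conversely, F
  vanishes at v, so the polynomial identity expressing an inverse, evaluated at v, forces the
  numerator to be nonzero there.\<close>

lemma MM_eq: "MM = {cl a b | a b. loc a b \<and> eval3 a v = 0}"
proof -
  have "cl a b \<in> Units RR \<longleftrightarrow> eval3 a v \<noteq> 0" if ab: "loc a b" for a b
  proof
    assume nz: "eval3 a v \<noteq> 0"
    hence ba: "loc b a" using ab by blast
    have "a \<noteq> 0" "b \<noteq> 0" using nz ab by auto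
    hence "Fract (a * b) (b * a) = Fract 1 1" "Fract (b * a) (a * b) = Fract 1 1" by (simp_all add: eq_fract mult.commute)
    hence "cl a b \<otimes>\<^bsub>RR\<^esub> cl b a = \<one>\<^bsub>RR\<^esub>" "cl b a \<otimes>\<^bsub>RR\<^esub> cl a b = \<one>\<^bsub>RR\<^esub>"
      using cl_mult[OF ab ba] cl_mult[OF ba ab] by (simp_all add: cl_def cl_one)
    thus "cl a b \<in> Units RR" unfolding Units_def RR_carrier using ab ba by blast
  next
    assume "cl a b \<in> Units RR"
    then obtain u where "u \<in> carrier RR" "cl a b \<otimes>\<^bsub>RR\<^esub> u = \<one>\<^bsub>RR\<^esub>" unfolding Units_def by blast
    then obtain c e where ce: "loc c e" "cl a b \<otimes>\<^bsub>RR\<^esub> cl c e = cl 1 1" unfolding RR_carrier cl_one by blast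
    hence "cl 1 1 = cl (a * c) (b * e)" using cl_mult[OF ab ce(1)] by simp
    from cl_eqD[OF loc_1(1) loc_mult[OF ab ce(1)] this] obtain C D E where
      C: "eval3 C v \<noteq> 0" "1 * C = a * c * D + F * E" by blast
    have "eval3 (1 * C) v = eval3 (a * c * D + F * E) v" using C(2) by (rule arg_cong)
    thus "eval3 a v \<noteq> 0" using C(1) Fv by auto
  qed
  thus ?thesis unfolding MM_def RR_carrier by blast
qed

lemma ideal_MM: "ideal MM RR"
proof (rule idealI[OF RR.ring_axioms])
  have sub: "MM \<subseteq> carrier RR" by (auto simp: MM_def)
  have mult: "x \<otimes>\<^bsub>RR\<^esub> a \<in> MM" if ax: "a \<in> MM" "x \<in> carrier RR" for a x
  proof -
    obtain b c e f where *: "a = cl b c" "loc b c" "eval3 b v = 0" "x = cl e f" "loc e f"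
      using ax unfolding MM_eq RR_carrier by blast
    have "x \<otimes>\<^bsub>RR\<^esub> a = cl (e * b) (f * c)" "eval3 (e * b) v = 0" using * cl_mult by auto
    thus ?thesis unfolding MM_eq using loc_mult[OF *(5,2)] by blast
  qed
  show "subgroup MM (add_monoid RR)"
  proof (rule subgroup.intro)
    show "MM \<subseteq> carrier (add_monoid RR)" using sub by simp
    show "x \<otimes>\<^bsub>add_monoid RR\<^esub> y \<in> MM" if xy: "x \<in> MM" "y \<in> MM" for x y
    proof -
      obtain b c e f where *: "x = cl b c" "loc b c" "eval3 b v = 0" "y = cl e f" "loc e f" "eval3 e v = 0"
        using xy unfolding MM_eq by blast
      have "x \<oplus>\<^bsub>RR\<^esub> y = cl (b * f + e * c) (c * f)" using * cl_add by simp
      moreover have "eval3 (b * f + e * c) v = 0" using * by simp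
      ultimately have "x \<oplus>\<^bsub>RR\<^esub> y \<in> MM" unfolding MM_eq using loc_add[OF *(2,5)] by blast
      thus ?thesis by simp
    qed
    have "eval3 (0 :: 'k poly3) v = 0" by simp
    hence "\<zero>\<^bsub>RR\<^esub> \<in> MM" unfolding MM_eq cl_zero using loc_1(2) by blast
    thus "\<one>\<^bsub>add_monoid RR\<^esub> \<in> MM" by simp
    show "inv\<^bsub>add_monoid RR\<^esub> x \<in> MM" if x: "x \<in> MM" for x
    proof -
      have xc: "x \<in> carrier RR" using x sub by blast
      have "(\<ominus>\<^bsub>RR\<^esub> \<one>\<^bsub>RR\<^esub>) \<otimes>\<^bsub>RR\<^esub> x \<in> MM" by (rule mult[OF x]) simp
      hence "\<ominus>\<^bsub>RR\<^esub> x \<in> MM" using xc by (simp add: RR.l_minus)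
      thus ?thesis by (simp add: a_inv_def)
    qed
  qed
  show "x \<otimes>\<^bsub>RR\<^esub> a \<in> MM" "a \<otimes>\<^bsub>RR\<^esub> x \<in> MM" if "a \<in> MM" "x \<in> carrier RR" for a x
    using mult[OF that] that sub RR.m_comm[of a x] by auto
qed

text \<open>Each factor from \<open>MM\<close> raises the order of the numerator by one, and passing
  to a common denominator does not lower it. The bound 3 is that of \<open>ord_ge\<close>.\<close>

lemma ideal_power_MM: "n \<le> 3 \<Longrightarrow> z \<in> ideal_power RR MM n \<Longrightarrow> \<exists>a b. loc a b \<and> ord_ge n a \<and> z = cl a b"
proof (induction n arbitrary: z)
  case 0
  thus ?case unfolding RR_carrier ideal_power.simps by (auto simp: ord_ge_def)
next
  case (Suc n)
  from Suc.prems(2) show ?case unfolding ideal_power.simps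
  proof (induction rule: ideal_prod.induct)
    case (prod x y)
    obtain a b where ab: "loc a b" "eval3 a v = 0" "x = cl a b" using prod(1) unfolding MM_eq by blast
    obtain c e where ce: "loc c e" "ord_ge n c" "y = cl c e" using Suc.IH[OF _ prod(2)] Suc.prems(1) by auto
    have "ord_ge (Suc n) (a * c)" using ord_ge_mult1[OF ab(2) ce(2)] Suc.prems(1) by simp
    thus ?case using loc_mult[OF ab(1) ce(1)] cl_mult[OF ab(1) ce(1)] ab(3) ce(3) by blast
  next
    case (sum x y)
    obtain a b where ab: "loc a b" "ord_ge (Suc n) a" "x = cl a b" using sum by blast
    obtain c e where ce: "loc c e" "ord_ge (Suc n) c" "y = cl c e" using sum by blast
    have "ord_ge (Suc n) (a * e + c * b)" by (intro ord_ge_add ord_ge_mult ab ce)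
    thus ?case using loc_add[OF ab(1) ce(1)] cl_add[OF ab(1) ce(1)] ab(3) ce(3) by blast
  qed
qed

text \<open>X and Y are numerators of the two generators of the maximal ideal. Their product lies in
  the third power, which gives the identity modulo F. Every linear form vanishing at v is a
  combination of the generators up to the third power, and F has order 2, so comparing linear terms
  shows that the gradients of X and Y span both directions.\<close>

lemma node_quadratic_part:
  assumes iso: "local_completion (curve_local_ring F (vec.span {v})) \<simeq> node_ring TYPE('k)"
    and F2: "ord_ge 2 F"
  shows "\<exists>X Y C a D E. eval3 X v = 0 \<and> eval3 Y v = 0 \<and> eval3 C v \<noteq> 0 \<and> ord_ge 3 a \<and> X * Y * C = a * D + F * E \<and>
    deriv_at v j X * deriv_at v k Y \<noteq> deriv_at v k X * deriv_at v j Y"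
proof -
  obtain x y where x: "x \<in> MM" and y: "y \<in> MM" and xy: "x \<otimes>\<^bsub>RR\<^esub> y \<in> ideal_power RR MM 3"
    and gen: "\<forall>a\<in>MM. \<exists>s\<in>carrier RR. \<exists>t\<in>carrier RR. a \<ominus>\<^bsub>RR\<^esub> (s \<otimes>\<^bsub>RR\<^esub> x \<oplus>\<^bsub>RR\<^esub> t \<otimes>\<^bsub>RR\<^esub> y) \<in> ideal_power RR MM 3"
    using node_completion_generators[OF RR.is_cring ideal_MM MM_def iso[folded RR_eq]] by blast
  obtain X B1 where X: "loc X B1" "eval3 X v = 0" "x = cl X B1" using x unfolding MM_eq by blast
  obtain Y B2 where Y: "loc Y B2" "eval3 Y v = 0" "y = cl Y B2" using y unfolding MM_eq by blast
  obtain a b where ab: "loc a b" "ord_ge 3 a" "x \<otimes>\<^bsub>RR\<^esub> y = cl a b" using ideal_power_MM[OF _ xy] by auto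
  have "cl (X * Y) (B1 * B2) = cl a b" using cl_mult[OF X(1) Y(1)] X(3) Y(3) ab(3) by simp
  from cl_eqD[OF loc_mult[OF X(1) Y(1)] ab(1) this] obtain C D E where
    C: "eval3 C v \<noteq> 0" "X * Y * C = a * D + F * E" by blast
  have lin: "\<exists>c s u. c \<noteq> 0 \<and> deriv_at v j A * c = deriv_at v j X * s + deriv_at v j Y * u \<and>
      deriv_at v k A * c = deriv_at v k X * s + deriv_at v k Y * u"
    if A: "A \<in> homog 1" "eval3 A v = 0" for A
  proof -
    have Al: "loc A (var i)" using A vi by (intro exI[of _ 1]) simp
    hence AM: "cl A (var i) \<in> MM" unfolding MM_eq using A by blast
    obtain s t where st: "s \<in> carrier RR" "t \<in> carrier RR"
      "cl A (var i) \<ominus>\<^bsub>RR\<^esub> (s \<otimes>\<^bsub>RR\<^esub> x \<oplus>\<^bsub>RR\<^esub> t \<otimes>\<^bsub>RR\<^esub> y) \<in> ideal_power RR MM 3"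
      using gen AM by blast
    obtain w b' where w: "loc w b'" "ord_ge 3 w"
      "cl A (var i) \<ominus>\<^bsub>RR\<^esub> (s \<otimes>\<^bsub>RR\<^esub> x \<oplus>\<^bsub>RR\<^esub> t \<otimes>\<^bsub>RR\<^esub> y) = cl w b'"
      using ideal_power_MM[OF _ st(3)] by auto
    obtain S Bs where S: "loc S Bs" "s = cl S Bs" using st(1) unfolding RR_carrier by blast
    obtain U Bt where U: "loc U Bt" "t = cl U Bt" using st(2) unfolding RR_carrier by blast
    define H where "H = S * X * (Bt * B2) + U * Y * (Bs * B1)"
    define HB where "HB = (Bs * B1) * (Bt * B2)"
    have sum: "s \<otimes>\<^bsub>RR\<^esub> x \<oplus>\<^bsub>RR\<^esub> t \<otimes>\<^bsub>RR\<^esub> y = cl H HB"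
      unfolding S U X(3) Y(3) cl_mult[OF S(1) X(1)] cl_mult[OF U(1) Y(1)]
        cl_add[OF loc_mult[OF S(1) X(1)] loc_mult[OF U(1) Y(1)]] H_def HB_def ..
    have Hl: "loc H HB" unfolding H_def HB_def by (rule loc_add[OF loc_mult[OF S(1) X(1)] loc_mult[OF U(1) Y(1)]])
    have car: "cl A (var i) \<in> carrier RR" "cl H HB \<in> carrier RR" unfolding RR_carrier using Al Hl by blast+
    have "cl A (var i) = cl H HB \<oplus>\<^bsub>RR\<^esub> (cl A (var i) \<ominus>\<^bsub>RR\<^esub> cl H HB)" using car by algebra
    hence "cl A (var i) = cl (H * b' + w * HB) (HB * b')" using w(3) unfolding sum by (simp add: cl_add[OF Hl w(1)])
    from cl_eqD[OF Al loc_add[OF Hl w(1)] this] obtain C' D' E' where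
      C': "eval3 C' v \<noteq> 0" "A * C' = (H * b' + w * HB) * D' + F * E'" by blast
    have "A * C' = X * (S * (Bt * B2) * b' * D') + Y * (U * (Bs * B1) * b' * D') + (w * (HB * D') + F * E')"
      unfolding C'(2) H_def by (simp add: algebra_simps)
    hence eq: "jet a b (A * C') = jet a b (X * (S * (Bt * B2) * b' * D')) + jet a b (Y * (U * (Bs * B1) * b' * D'))
        + (jet a b (w * (HB * D')) + jet a b (F * E'))" for a b
      by (simp only: jet_add)
    have "ord_ge 2 (w * (HB * D'))" using ord_ge_mult[OF w(2)] by (simp add: ord_ge_def)
    hence z: "jet 1 0 (w * (HB * D')) = 0" "jet 0 1 (w * (HB * D')) = 0" by (auto simp: ord_ge_def)
    have z': "jet 1 0 (F * E') = 0" "jet 0 1 (F * E') = 0" using ord_ge_mult[OF F2, of E'] by (auto simp: ord_ge_def)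
    have "deriv_at v j A * eval3 C' v = deriv_at v j X * eval3 (S * (Bt * B2) * b' * D') v + deriv_at v j Y * eval3 (U * (Bs * B1) * b' * D') v"
      using eq[of 1 0, unfolded z z', unfolded jet_1] by (simp add: X(2) Y(2) A(2))
    moreover have "deriv_at v k A * eval3 C' v = deriv_at v k X * eval3 (S * (Bt * B2) * b' * D') v + deriv_at v k Y * eval3 (U * (Bs * B1) * b' * D') v"
      using eq[of 0 1, unfolded z z', unfolded jet_2] by (simp add: X(2) Y(2) A(2))
    ultimately show ?thesis using C'(1) by blast
  qed
  have ev0: "eval3 (point_form v i l) v = 0" for l by (simp add: point_form_def)
  have da: "deriv_at v j (point_form v i j) = v $ i" "deriv_at v k (point_form v i j) = 0"
    "deriv_at v j (point_form v i k) = 0" "deriv_at v k (point_form v i k) = v $ i"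
    using dist by (simp_all add: point_form_def)
  obtain c s u where 1: "c \<noteq> 0" "v $ i * c = deriv_at v j X * s + deriv_at v j Y * u" "0 = deriv_at v k X * s + deriv_at v k Y * u"
    using lin[OF point_form_homog ev0, of j] unfolding da by auto
  obtain c' s' u' where 2: "c' \<noteq> 0" "0 = deriv_at v j X * s' + deriv_at v j Y * u'" "v $ i * c' = deriv_at v k X * s' + deriv_at v k Y * u'"
    using lin[OF point_form_homog ev0, of k] unfolding da by auto
  have "deriv_at v j X * deriv_at v k Y \<noteq> deriv_at v k X * deriv_at v j Y"
  proof
    assume eq: "deriv_at v j X * deriv_at v k Y = deriv_at v k X * deriv_at v j Y"
    let ?x1 = "deriv_at v j X" and ?x2 = "deriv_at v k X" and ?y1 = "deriv_at v j Y" and ?y2 = "deriv_at v k Y"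
    \<comment> \<open>Multiplicativity of determinants: the product of the two matrices is diagonal
      with nonzero entries.\<close>
    have "(v $ i * c) * (v $ i * c') - 0 * 0 = (?x1 * s + ?y1 * u) * (?x2 * s' + ?y2 * u') - (?x2 * s + ?y2 * u) * (?x1 * s' + ?y1 * u')"
      unfolding 1(2) 2(3) by (simp only: 1(3)[symmetric] 2(2)[symmetric])
    also have "\<dots> = (?x1 * ?y2 - ?x2 * ?y1) * (s * u' - u * s')" by (simp add: algebra_simps)
    finally show False using eq 1(1) 2(1) vi by simp
  qed
  thus ?thesis using X(2) Y(2) C ab(2) by blast
qed

end

text \<open>The quadratic parts of \<open>X * Y * C\<close> and \<open>P * G * E\<close> at v agree,
  since a has order 3. Each is a constant times a product of two linear forms, with discriminant the
  square of that constant times the square of their determinant. So the determinant of P and G is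
  nonzero because that of X and Y is, in every characteristic.\<close>

theorem ordinary_node_transversal:
  fixes P :: "'k::field poly3"
  assumes P: "P \<in> homog p" and G: "G \<in> homog g" and v: "v \<noteq> 0" "eval3 P v = 0" "eval3 G v = 0"
    and node: "ordinary_node (P * G) (vec.span {v})"
  shows "transversal_at P G v"
proof -
  obtain i where i: "v $ i \<noteq> 0" using v(1) by (auto simp: Finite_Cartesian_Product.vec_eq_iff)
  obtain j k where ijk: "UNIV = {i, j, k}"
  proof -
    consider "i = 1" | "i = 2" | "i = 3" using exhaust_3 by blast
    thus ?thesis
    proof cases
      case 1 thus ?thesis using that[of 2 3] UNIV_3 by simp
    next
      case 2 thus ?thesis using that[of 1 3] UNIV_3 by auto
    next
      case 3 thus ?thesis using that[of 1 2] UNIV_3 by auto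
    qed
  qed
  interpret chart_curve v i j k "P * G" "p + g"
    by unfold_locales (use i ijk v homog_mult[OF P G] in auto)
  have F2: "ord_ge 2 (P * G)" using v(2,3) by (simp add: ord_ge_def jet_mult' jet_0)
  obtain X Y C a D E where X: "eval3 X v = 0" "eval3 Y v = 0" "eval3 C v \<noteq> 0" "ord_ge 3 a"
    and eq: "X * Y * C = a * D + P * G * E"
    and det: "deriv_at v j X * deriv_at v k Y \<noteq> deriv_at v k X * deriv_at v j Y"
    using node_quadratic_part[OF _ F2] node unfolding ordinary_node_def by blast
  have a: "jet 0 0 a = 0" "jet 1 0 a = 0" "jet 0 1 a = 0" "jet 2 0 a = 0" "jet 1 1 a = 0" "jet 0 2 a = 0"
    using X(4) by (auto simp: ord_ge_def)
  have jeq: "jet r s (X * Y * C) = jet r s (a * D) + jet r s (P * G * E)" for r s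
    unfolding eq jet_add ..
  let ?x1 = "deriv_at v j X" and ?x2 = "deriv_at v k X" and ?y1 = "deriv_at v j Y" and ?y2 = "deriv_at v k Y"
  let ?p1 = "deriv_at v j P" and ?p2 = "deriv_at v k P" and ?g1 = "deriv_at v j G" and ?g2 = "deriv_at v k G"
  let ?C = "eval3 C v" and ?E = "eval3 E v"
  have 20: "?x1 * ?y1 * ?C = ?p1 * ?g1 * ?E"
    using jeq[of 2 0, unfolded jet_mult, unfolded a, unfolded jet_0 jet_1 jet_2] by (simp add: X v(2,3))
  have 02: "?x2 * ?y2 * ?C = ?p2 * ?g2 * ?E"
    using jeq[of 0 2, unfolded jet_mult, unfolded a, unfolded jet_0 jet_1 jet_2] by (simp add: X v(2,3))
  have 11: "(?x1 * ?y2 + ?x2 * ?y1) * ?C = (?p1 * ?g2 + ?p2 * ?g1) * ?E"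
    using jeq[of 1 1, unfolded jet_mult, unfolded a, unfolded jet_0 jet_1 jet_2] by (simp add: X v(2,3))
  have "(?x1 * ?y2 - ?x2 * ?y1) ^ 2 * ?C ^ 2 =
      ((?x1 * ?y2 + ?x2 * ?y1) * ?C) ^ 2 - 4 * (?x1 * ?y1 * ?C) * (?x2 * ?y2 * ?C)"
    by (simp add: algebra_simps power2_eq_square)
  also have "\<dots> = (?p1 * ?g2 - ?p2 * ?g1) ^ 2 * ?E ^ 2"
    unfolding 20 02 11 by (simp add: algebra_simps power2_eq_square)
  finally have "?p1 * ?g2 \<noteq> ?p2 * ?g1" using det X(3) by auto
  thus ?thesis unfolding transversal_at_def using i ijk by blast
qed

subsection \<open>Factorization of forms\<close>

lemma homog_unit_iff:
  fixes f :: "'k::field poly3"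
  assumes "f \<in> homog (int n)" "f \<noteq> 0"
  shows "f dvd 1 \<longleftrightarrow> n = 0"
proof
  assume "f dvd 1"
  then obtain g where g: "f * g = 1" by (auto simp: dvd_def)
  have "f * g \<in> homog 0" "f * g \<noteq> 0" using g by simp_all
  then obtain k where k: "f \<in> homog k" "g \<in> homog (0 - k)" by (rule homog_mult_cancel)
  have "k = int n" using homog_unique[OF k(1) assms(1,2)] .
  moreover have "\<not> 0 - k < 0" using homog_neg[OF _ k(2)] g by auto
  ultimately show "n = 0" by simp
next
  assume "n = 0"
  then obtain c where c: "f = const3 c" using homog_0_const[of f] assms by auto
  hence "f * const3 (1 / c) = 1" using assms(2) by (simp add: const3_mult[symmetric])
  thus "f dvd 1" by (metis dvd_triv_left)
qed

lemma homog_pos_degree: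
  assumes "f \<in> homog n" "f \<noteq> (0 :: 'k::comm_ring_1 poly3)"
  obtains m where "n = int m"
  using homog_neg[OF _ assms(1)] assms(2) by (metis nonneg_int_cases not_less)

text \<open>Squarefreeness lets the factors form a set. The last condition excludes associates;
  constants are absorbed in the factors, so that the product is F itself.\<close>

definition form_factors :: "'k::field poly3 \<Rightarrow> 'k poly3 set \<Rightarrow> bool" where
  "form_factors F S \<longleftrightarrow> finite S \<and> \<Prod>S = F \<and> (\<forall>P\<in>S. irreducible P \<and> (\<exists>p>0. P \<in> homog (int p))) \<and>
     (\<forall>P\<in>S. \<forall>Q\<in>S. P dvd Q \<longrightarrow> P = Q)"

lemma form_factors_exist:
  fixes F :: "'k::field poly3"
  assumes "F \<in> homog (int d)" "d > 0" "squarefree F"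
  shows "\<exists>S. form_factors F S"
  using assms
proof (induction d arbitrary: F rule: less_induct)
  case (less d)
  have sq: "P dvd 1" if "P * P dvd F" for P
    using squarefreeD[OF less.prems(3), of P] that by (simp add: power2_eq_square)
  have F0: "F \<noteq> 0"
  proof
    assume "F = 0"
    hence "var 1 dvd (1 :: 'k poly3)" by (intro sq) simp
    thus False using homog_unit_iff[of "var 1 :: 'k poly3" 1] by simp
  qed
  show ?case
  proof (cases "irreducible F")
    case True
    hence "form_factors F {F}" using less.prems by (auto simp: form_factors_def)
    thus ?thesis by blast
  next
    case False
    have "\<not> F dvd 1" using homog_unit_iff[OF less.prems(1) F0] less.prems(2) by simp
    then obtain a b where ab: "F = a * b" "\<not> a dvd 1" "\<not> b dvd 1"
      using False F0 unfolding irreducible_def by blast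
    have nz: "a \<noteq> 0" "b \<noteq> 0" using F0 ab by auto
    obtain k where k: "a \<in> homog k" "b \<in> homog (int d - k)"
      using homog_mult_cancel[of a b "int d"] less.prems(1) F0 ab(1) by metis
    obtain m where m: "k = int m" using homog_pos_degree[OF k(1) nz(1)] .
    obtain l where l: "int d - k = int l" using homog_pos_degree[OF k(2) nz(2)] .
    have "m > 0" "l > 0" using homog_unit_iff[of a m] homog_unit_iff[of b l] k m l ab nz by auto
    hence ml: "m < d" "l < d" using m l by auto
    have "squarefree a" "squarefree b"
      using squarefree_mono[OF _ less.prems(3)] ab(1) by auto
    then obtain A B where AB: "form_factors a A" "form_factors b B"
      using less.IH[OF ml(1), of a] less.IH[OF ml(2), of b] k m l \<open>m > 0\<close> \<open>l > 0\<close> by auto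
    have dvd: "P dvd a" if "P \<in> A" for P using AB(1) that by (auto simp: form_factors_def dvd_prodI)
    have dvd': "P dvd b" if "P \<in> B" for P using AB(2) that by (auto simp: form_factors_def dvd_prodI)
    \<comment> \<open>The square of a common divisor of a and b divides F, so it is a unit; this
      keeps the two sets disjoint and free of associates.\<close>
    have cross: False if PQ: "P \<in> A" "Q \<in> B" "P dvd Q \<or> Q dvd P" for P Q
    proof -
      have "\<exists>R\<in>A \<union> B. R dvd a \<and> R dvd b" using PQ dvd[of P] dvd'[of Q] dvd_trans by blast
      then obtain R where R: "R \<in> A \<union> B" "R dvd a" "R dvd b" by blast
      have "R dvd 1" by (rule sq) (use R ab(1) in \<open>simp add: mult_dvd_mono\<close>)
      thus False using R(1) AB by (auto simp: form_factors_def irreducible_def)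
    qed
    have "A \<inter> B = {}"
    proof (rule equals0I)
      fix R assume "R \<in> A \<inter> B"
      thus False using cross[of R R] by simp
    qed
    hence "\<Prod>(A \<union> B) = F" using AB by (subst prod.union_disjoint) (auto simp: form_factors_def ab(1))
    moreover have "finite (A \<union> B)" "\<forall>P\<in>A \<union> B. irreducible P \<and> (\<exists>p>0. P \<in> homog (int p))"
      using AB by (auto simp: form_factors_def)
    moreover have "\<forall>P\<in>A \<union> B. \<forall>Q\<in>A \<union> B. P dvd Q \<longrightarrow> P = Q"
    proof (intro ballI impI)
      fix P Q assume PQ: "P \<in> A \<union> B" "Q \<in> A \<union> B" "P dvd Q"
      have "\<forall>P\<in>A. \<forall>Q\<in>A. P dvd Q \<longrightarrow> P = Q" "\<forall>P\<in>B. \<forall>Q\<in>B. P dvd Q \<longrightarrow> P = Q"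
        using AB by (simp_all add: form_factors_def)
      thus "P = Q" using PQ cross[of P Q] cross[of Q P] by auto
    qed
    ultimately have "form_factors F (A \<union> B)" by (simp add: form_factors_def)
    thus ?thesis by blast
  qed
qed

lemma prime_elem_dvd_prodD:
  assumes "prime_elem (P :: 'a::idom)" "P dvd prod f S"
  shows "\<exists>x\<in>S. P dvd f x"
  using assms(2)
proof (induction S rule: infinite_finite_induct)
  case (insert x S)
  thus ?case using prime_elem_dvd_mult_iff[OF assms(1), of "f x" "prod f S"] by auto
qed (use assms(1) in \<open>auto simp: prime_elem_def\<close>)

lemma prod_primes_dvd:
  assumes "finite S" "\<And>P. P \<in> S \<Longrightarrow> prime_elem P" "\<And>P Q. P \<in> S \<Longrightarrow> Q \<in> S \<Longrightarrow> P dvd Q \<Longrightarrow> P = Q"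
    "\<And>P. P \<in> S \<Longrightarrow> P dvd (A :: 'a::idom)"
  shows "\<Prod>S dvd A"
  using assms
proof (induction S)
  case (insert P S)
  have "\<Prod>S dvd A" by (intro insert.IH insert.prems) auto
  then obtain B where B: "A = \<Prod>S * B" by (auto simp: dvd_def)
  have P: "prime_elem P" by (rule insert.prems(1)) simp
  have "P dvd \<Prod>S * B" using insert.prems(3)[of P] B by simp
  moreover have "\<not> P dvd \<Prod>S"
  proof
    assume "P dvd \<Prod>S"
    then obtain Q where "Q \<in> S" "P dvd Q" using prime_elem_dvd_prodD[OF P, of "\<lambda>x. x" S]
      by auto
    thus False using insert.prems(2)[of P Q] insert.hyps(2) by blast
  qed
  ultimately have "P dvd B" by (simp add: prime_elem_dvd_mult_iff[OF P])
  hence "P * \<Prod>S dvd A" unfolding B by (simp add: mult.commute mult_dvd_mono)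
  thus ?case using insert.hyps by simp
qed simp

lemma form_factorsD:
  assumes "form_factors F S"
  shows "finite S" "\<Prod>S = F" "\<And>P. P \<in> S \<Longrightarrow> prime_elem P" "\<And>P. P \<in> S \<Longrightarrow> irreducible P"
    "\<And>P Q. P \<in> S \<Longrightarrow> Q \<in> S \<Longrightarrow> P dvd Q \<Longrightarrow> P = Q" "\<And>P. P \<in> S \<Longrightarrow> \<exists>p>0. P \<in> homog (int p)"
    "\<And>P. P \<in> S \<Longrightarrow> P \<noteq> 0"
  using assms by (auto simp: form_factors_def intro: irreducible_imp_prime_elem_poly3)

text \<open>Lets equality in S/F be checked on each component.\<close>

lemma form_factors_dvd:
  assumes "form_factors F S" "\<And>P. P \<in> S \<Longrightarrow> P dvd A"
  shows "F dvd A"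
  using prod_primes_dvd[of S A] form_factorsD[OF assms(1)] assms(2) by blast

lemma coprime_forms_prime:
  fixes P :: "'k::field poly3"
  assumes "prime_elem P" "P \<in> homog (int p)" "f \<in> homog (int n)" "\<not> P dvd f"
  shows "coprime_forms n p f P"
  using assms by (auto simp: coprime_forms_def prime_elem_dvd_mult_iff)

lemma form_factors_coprime_cofactor:
  fixes P :: "'k::field poly3"
  assumes F: "form_factors F S" "F \<in> homog (int d)" and P: "P \<in> S"
  obtains p g where "p > 0" "P \<in> homog (int p)" "\<Prod>(S - {P}) \<in> homog (int g)"
    "coprime_forms p g P (\<Prod>(S - {P}))" "F = P * \<Prod>(S - {P})" "S \<noteq> {P} \<Longrightarrow> g > 0"
proof -
  note f = form_factorsD[OF F(1)]
  let ?G = "\<Prod>(S - {P})"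
  have FG: "F = P * ?G" using f(1,2) P prod.remove[OF f(1) P, of "\<lambda>x. x"] by simp
  obtain p where p: "p > 0" "P \<in> homog (int p)" using f(6)[OF P] by blast
  have "\<exists>e. \<forall>Q\<in>S. e Q > 0 \<and> Q \<in> homog (int (e Q))" using f(6) by metis
  then obtain e where e: "\<And>Q. Q \<in> S \<Longrightarrow> e Q > 0 \<and> Q \<in> homog (int (e Q))" by blast
  define g where "g = (\<Sum>Q\<in>S - {P}. e Q)"
  have "?G \<in> homog (\<Sum>Q\<in>S - {P}. int (e Q))" using e by (intro homog_prod) auto
  hence g: "?G \<in> homog (int g)" by (simp add: g_def)
  have dv: "\<forall>A. ?G dvd P * A \<longrightarrow> ?G dvd A"
  proof (intro allI impI)
    fix A assume A: "?G dvd P * A"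
    show "?G dvd A"
    proof (rule prod_primes_dvd)
      fix Q assume Q: "Q \<in> S - {P}"
      hence "Q dvd ?G" using f(1) by (intro dvd_prodI) auto
      hence "Q dvd P * A" using A by (rule dvd_trans)
      moreover have "\<not> Q dvd P" using f(5)[of Q P] Q P by blast
      moreover have "prime_elem Q" by (rule f(3)) (use Q in simp)
      ultimately show "Q dvd A" by (simp add: prime_elem_dvd_mult_iff)
    next
      show "finite (S - {P})" using f(1) by simp
      fix Q R assume "Q \<in> S - {P}" "R \<in> S - {P}" "Q dvd R"
      thus "Q = R" using f(5)[of Q R] by simp
    qed (use f(3) in simp)
  qed
  have G0: "?G \<noteq> 0"
  proof
    assume "?G = 0"
    hence "\<exists>Q\<in>S - {P}. Q = 0" using f(1) by (simp add: prod_zero_iff)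
    thus False using f(7) by blast
  qed
  have cop: "coprime_forms p g P ?G" unfolding coprime_forms_def
    by (intro conjI p g dv G0 f(7)[OF P])
  have gpos: "g > 0" if SP: "S \<noteq> {P}"
  proof -
    obtain Q where "Q \<in> S - {P}" using SP P by blast
    thus ?thesis using e f(1) unfolding g_def by (intro sum_pos2[of _ Q]) auto
  qed
  show ?thesis by (rule that[OF p g cop FG gpos])
qed

subsection \<open>Zero loci of forms\<close>

lemma zero_locus_form:
  assumes "f \<in> homog n"
  shows "zero_locus {f} = {x \<in> proj_plane. eval3 f (rep x) = 0}"
  using vanishes_at_rep[OF assms] by (auto simp: zero_locus_def)

text \<open>Otherwise some line would avoid all zeros, whereas P has a zero on every line.\<close>

lemma zero_locus_infinite:
  fixes P :: "'k::alg_closed_field poly3"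
  assumes "P \<in> homog (int p)" "p > 0"
  shows "infinite (zero_locus {P})"
proof
  assume fin: "finite (zero_locus {P})"
  obtain t where t: "\<And>x. x \<in> zero_locus {P} \<Longrightarrow> eval3 (line t) (rep x) \<noteq> 0"
    using line_avoiding_points[OF fin] by (auto simp: zero_locus_def)
  obtain w where w: "w \<noteq> 0" "eval3 (line t) w = 0" "eval3 P w = 0"
    using form_has_zero_on_line[OF assms] by blast
  have "vec.span {w} \<in> zero_locus {P}"
    using eval3_rep_span[OF assms(1) w(1)] w(3) span_in_proj_plane[OF w(1)] by (simp add: zero_locus_form[OF assms(1)])
  thus False using t eval3_rep_span[OF line_homog w(1)] w(2) by blast
qed

lemma finite_common_zeros:
  fixes P :: "'k::field poly3"
  assumes "prime_elem P" "P \<in> homog (int p)" "f \<in> homog n" "\<not> P dvd f"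
  shows "finite (zero_locus {P} \<inter> zero_locus {f})"
proof -
  have "f \<noteq> 0" using assms(4) by auto
  then obtain m where m: "n = int m" using homog_pos_degree[OF assms(3)] by blast
  have "zero_locus {P} \<inter> zero_locus {f} = {x \<in> proj_plane. eval3 f (rep x) = 0 \<and> eval3 P (rep x) = 0}"
    unfolding zero_locus_form[OF assms(2)] zero_locus_form[OF assms(3)] by blast
  thus ?thesis using coprime_forms_common_zeros_finite[OF coprime_forms_prime[OF assms(1,2) assms(3)[unfolded m] assms(4)]] by simp
qed

text \<open>The Nullstellensatz for a prime form, obtained from Bezout's bound: P has infinitely
  many zeros, but only finitely many in common with a form that it does not divide.\<close>

lemma dvd_of_zero_locus_subset:
  fixes P :: "'k::alg_closed_field poly3"
  assumes "prime_elem P" "P \<in> homog (int p)" "p > 0" "f \<in> homog n" "zero_locus {P} \<subseteq> zero_locus {f}"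
  shows "P dvd f"
proof (rule ccontr)
  assume "\<not> P dvd f"
  hence "finite (zero_locus {P} \<inter> zero_locus {f})" by (rule finite_common_zeros[OF assms(1,2,4)])
  moreover have "zero_locus {P} \<inter> zero_locus {f} = zero_locus {P}" using assms(5) by blast
  ultimately show False using zero_locus_infinite[OF assms(2,3)] by simp
qed

lemma zero_locus_mult:
  assumes "f \<in> homog n" "g \<in> homog m"
  shows "zero_locus {f * g} = zero_locus {f} \<union> zero_locus {g}"
  unfolding zero_locus_form[OF assms(1)] zero_locus_form[OF assms(2)] zero_locus_form[OF homog_mult[OF assms]]
  by auto

lemma zariski_closed_zero_locus: "f \<in> homog n \<Longrightarrow> zariski_closed (zero_locus {f})"
  unfolding zariski_closed_def by (rule exI[of _ "{f}"]) auto

text \<open>A closed set that does not contain the curve lies in the zeros of a form not divisible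
  by P. For two such sets the product of the forms is not divisible by the prime P, so together they
  do not cover the curve.\<close>

lemma irreducible_closed_prime_form:
  fixes P :: "'k::alg_closed_field poly3"
  assumes P: "prime_elem P" "P \<in> homog (int p)" "p > 0"
  shows "irreducible_closed (zero_locus {P})"
  unfolding irreducible_closed_def
proof (intro conjI allI impI)
  show "zariski_closed (zero_locus {P})" by (rule zariski_closed_zero_locus[OF P(2)])
  show "zero_locus {P} \<noteq> {}" using zero_locus_infinite[OF P(2,3)] by auto
  fix A B :: "('k ^ 3) set set" assume "zariski_closed A \<and> zariski_closed B \<and> zero_locus {P} \<subseteq> A \<union> B"
  then obtain T U where T: "T \<subseteq> (\<Union>n. homog n)" "A = zero_locus T" and U: "U \<subseteq> (\<Union>n. homog n)" "B = zero_locus U"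
    and sub: "zero_locus {P} \<subseteq> A \<union> B" unfolding zariski_closed_def by blast
  have witness: "\<exists>f n. f \<in> T' \<and> f \<in> homog n \<and> \<not> P dvd f"
    if T': "T' \<subseteq> (\<Union>n. homog n)" "\<not> zero_locus {P} \<subseteq> zero_locus T'" for T' :: "'k poly3 set"
  proof -
    obtain x where x: "x \<in> zero_locus {P}" "x \<notin> zero_locus T'" using T'(2) by blast
    hence xp: "x \<in> proj_plane" by (simp add: zero_locus_def)
    then obtain f where f: "f \<in> T'" "\<not> vanishes_at f x" using x(2) by (auto simp: zero_locus_def)
    have "\<not> P dvd f"
    proof
      assume "P dvd f"
      hence "vanishes_at f x" using x(1) by (auto simp: dvd_def zero_locus_def vanishes_at_def)
      thus False using f by simp
    qed
    thus ?thesis using f T'(1) by blast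
  qed
  show "zero_locus {P} \<subseteq> A \<or> zero_locus {P} \<subseteq> B"
  proof (rule ccontr)
    assume "\<not> (zero_locus {P} \<subseteq> A \<or> zero_locus {P} \<subseteq> B)"
    hence "\<not> zero_locus {P} \<subseteq> zero_locus T" "\<not> zero_locus {P} \<subseteq> zero_locus U" using T(2) U(2) by auto
    then obtain f n g m where f: "f \<in> T" "f \<in> homog n" "\<not> P dvd f" and g: "g \<in> U" "g \<in> homog m" "\<not> P dvd g"
      using witness[OF T(1)] witness[OF U(1)] by metis
    have "zero_locus {P} \<subseteq> zero_locus {f * g}"
    proof
      fix x assume "x \<in> zero_locus {P}"
      hence "x \<in> zero_locus T \<or> x \<in> zero_locus U" using sub T U by blast
      hence "x \<in> zero_locus {f} \<or> x \<in> zero_locus {g}" using f(1) g(1) by (auto simp: zero_locus_def)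
      thus "x \<in> zero_locus {f * g}" using zero_locus_mult[OF f(2) g(2)] by blast
    qed
    hence "P dvd f * g" by (rule dvd_of_zero_locus_subset[OF P homog_mult[OF f(2) g(2)]])
    thus False using f(3) g(3) prime_elem_dvd_mult_iff[OF P(1)] by simp
  qed
qed

lemma irreducible_closed_subset_factor:
  fixes Y :: "('k::field ^ 3) set set"
  assumes Y: "irreducible_closed Y" and S: "finite S" "\<And>P. P \<in> S \<Longrightarrow> \<exists>n. P \<in> homog n"
    and sub: "Y \<subseteq> zero_locus {\<Prod>S}"
  shows "\<exists>P\<in>S. Y \<subseteq> zero_locus {P}"
  using S sub
proof (induction S)
  case empty
  have "zero_locus {1 :: 'k poly3} = {}" using zero_locus_form[of "1 :: 'k poly3" 0] by simp
  thus ?case using empty Y by (auto simp: irreducible_closed_def)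
next
  case (insert P S)
  have "\<exists>e. \<forall>Q\<in>S. Q \<in> homog (e Q)" using insert.prems(1) by (intro bchoice) blast
  then obtain e where "\<forall>Q\<in>S. Q \<in> homog (e Q)" by blast
  hence G: "\<Prod>S \<in> homog (sum e S)" by (intro homog_prod) auto
  obtain n where P: "P \<in> homog n" using insert.prems(1) by blast
  have "Y \<subseteq> zero_locus {P} \<union> zero_locus {\<Prod>S}"
    using insert.prems(2) insert.hyps zero_locus_mult[OF P G] by simp
  hence "Y \<subseteq> zero_locus {P} \<or> Y \<subseteq> zero_locus {\<Prod>S}"
    using Y zariski_closed_zero_locus[OF P] zariski_closed_zero_locus[OF G] unfolding irreducible_closed_def by blast
  thus ?case using insert.IH insert.prems(1) by blast
qed

theorem irreducible_components_curve:
  fixes F :: "'k::alg_closed_field poly3"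
  assumes "form_factors F S"
  shows "irreducible_components (curve_points F) = (\<lambda>P. zero_locus {P}) ` S" (is "?L = ?R")
    and "inj_on (\<lambda>P. zero_locus {P}) S"
proof -
  note f = form_factorsD[OF assms]
  have homS: "\<exists>n. P \<in> homog n" if "P \<in> S" for P using f(6)[OF that] by blast
  have irr: "irreducible_closed (zero_locus {P})" if "P \<in> S" for P
    using irreducible_closed_prime_form[OF f(3)[OF that]] f(6)[OF that] by metis
  have eq: "P = Q" if PQ: "P \<in> S" "Q \<in> S" "zero_locus {P} \<subseteq> zero_locus {Q}" for P Q
  proof -
    obtain p n where "P \<in> homog (int p)" "p > 0" "Q \<in> homog n" using f(6)[OF PQ(1)] homS[OF PQ(2)] by blast
    thus ?thesis by (intro f(5)[OF PQ(1,2)] dvd_of_zero_locus_subset[OF f(3)[OF PQ(1)] _ _ _ PQ(3)])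
  qed
  have sub: "zero_locus {P} \<subseteq> curve_points F" if "P \<in> S" for P
  proof -
    have "P dvd F" using f(1,2) that by (auto simp: dvd_prodI)
    thus ?thesis by (auto simp: dvd_def zero_locus_def vanishes_at_def)
  qed
  show "inj_on (\<lambda>P. zero_locus {P}) S" using eq by (intro inj_onI) auto
  show "?L = ?R"
  proof (intro equalityI subsetI)
    fix Z assume "Z \<in> ?L"
    hence Z: "irreducible_closed Z" "Z \<subseteq> curve_points F"
      and max: "\<And>Y. irreducible_closed Y \<Longrightarrow> Y \<subseteq> curve_points F \<Longrightarrow> Z \<subseteq> Y \<Longrightarrow> Y = Z"
      unfolding irreducible_components_def by blast+
    obtain P where "P \<in> S" "Z \<subseteq> zero_locus {P}"
      using irreducible_closed_subset_factor[OF Z(1) f(1) homS] Z(2) f(2) by blast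
    thus "Z \<in> ?R" using max[OF irr sub] by blast
  next
    fix Z assume "Z \<in> ?R"
    then obtain P where P: "P \<in> S" "Z = zero_locus {P}" by blast
    have "Y = Z" if Y: "irreducible_closed Y" "Y \<subseteq> curve_points F" "Z \<subseteq> Y" for Y
    proof -
      obtain Q where Q: "Q \<in> S" "Y \<subseteq> zero_locus {Q}"
        using irreducible_closed_subset_factor[OF Y(1) f(1) homS] Y(2) f(2) by blast
      hence "P = Q" using eq[OF P(1) Q(1)] Y(3) P(2) by blast
      thus ?thesis using Q Y(3) P(2) by blast
    qed
    thus "Z \<in> ?L" unfolding irreducible_components_def using irr[OF P(1)] sub[OF P(1)] P(2) by blast
  qed
qed

subsection \<open>Finiteness of the singular locus\<close>

lemma CHAR_poly3: "CHAR('k::comm_ring_1 poly3) = CHAR('k)"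
proof -
  have s: "(of_nat n :: 'k poly3) = const3 (of_nat n)" for n
    by (induction n) (auto simp: const3_add)
  show ?thesis by (rule CHAR_eqI) (auto simp: s of_nat_eq_0_iff_char_dvd)
qed

text \<open>Lowering the k-th exponent is injective on the monomials in which it is positive, so the
  terms of the derivative do not cancel each other.\<close>

lemma partial_deriv_eq_0D:
  fixes f :: "'k::idom poly3"
  assumes "partial_deriv k f = 0" "m \<in> Poly_Mapping.keys f"
  shows "of_nat (Poly_Mapping.lookup m k) = (0 :: 'k::idom)"
  using assms(1)
proof (cases "Poly_Mapping.lookup m k = 0")
  case False
  let ?e = "Poly_Mapping.single k 1 :: 3 \<Rightarrow>\<^sub>0 nat"
  have shift: "n = (n - ?e) + ?e" if "Poly_Mapping.lookup n k \<noteq> 0" for n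
    by (rule poly_mapping_eqI) (use that in \<open>auto simp: lookup_add minus_poly_mapping.rep_eq lookup_single when_def\<close>)
  have "0 = Poly_Mapping.lookup (partial_deriv k f) (m - ?e)" using assms(1) by simp
  also have "\<dots> = (\<Sum>n\<in>Poly_Mapping.keys f. (of_nat (Poly_Mapping.lookup n k) * Poly_Mapping.lookup f n) when n - ?e = m - ?e)"
    by (simp add: partial_deriv_def lookup_sum lookup_single)
  also have "\<dots> = (\<Sum>n\<in>{m}. (of_nat (Poly_Mapping.lookup n k) * Poly_Mapping.lookup f n) when n - ?e = m - ?e)"
  proof (rule sum.mono_neutral_right)
    show "\<forall>n\<in>Poly_Mapping.keys f - {m}. (of_nat (Poly_Mapping.lookup n k) * Poly_Mapping.lookup f n when n - ?e = m - ?e) = 0"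
    proof
      fix n assume n: "n \<in> Poly_Mapping.keys f - {m}"
      show "(of_nat (Poly_Mapping.lookup n k) * Poly_Mapping.lookup f n when n - ?e = m - ?e) = 0"
      proof (cases "Poly_Mapping.lookup n k = 0")
        case False
        hence "n - ?e \<noteq> m - ?e" using shift[of n] shift[of m] \<open>Poly_Mapping.lookup m k \<noteq> 0\<close> n by auto
        thus ?thesis by simp
      qed simp
    qed
  qed (use assms in auto)
  finally show ?thesis using assms(2) by (simp add: in_keys_iff)
qed simp

text \<open>If all derivatives vanished, the characteristic q would divide every exponent. For q = 0
  this makes P constant. Otherwise the coefficients have q-th roots in K, and P is the q-th power of
  the polynomial Q built from them, against irreducibility.\<close>

lemma irreducible_partial_deriv_nonzero:
  fixes P :: "'k::alg_closed_field poly3"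
  assumes P: "irreducible P" "P \<in> homog (int p)" "p > 0"
  obtains k where "partial_deriv k P \<noteq> 0"
proof (rule ccontr)
  assume "\<not> thesis"
  hence all: "partial_deriv k P = 0" for k using that by blast
  have z: "CHAR('k) dvd Poly_Mapping.lookup m k" if "m \<in> Poly_Mapping.keys P" for m k
    using partial_deriv_eq_0D[OF all that] by (simp add: of_nat_eq_0_iff_char_dvd)
  define q where "q = CHAR('k)"
  have P0: "P \<noteq> 0" using P by (auto simp: irreducible_def)
  show False
  proof (cases "q = 0")
    case True
    obtain m where m: "m \<in> Poly_Mapping.keys P" using P0 by fastforce
    hence "mon_deg m = p" using P(2) by (auto simp: homog_def)
    moreover have "Poly_Mapping.lookup m k = 0" for k using z[OF m, of k] True by (simp add: q_def)
    hence "m = 0" by (intro poly_mapping_eqI) simp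
    ultimately show False using P(3) by simp
  next
    case False
    hence q: "prime q" unfolding q_def by (intro prime_CHAR_semidom) simp
    have "\<exists>y. y ^ q = c" for c :: 'k using nth_root_exists[of q c] False by simp
    then obtain r where r: "\<And>c :: 'k. r c ^ q = c" by metis
    define dv :: "(3 \<Rightarrow>\<^sub>0 nat) \<Rightarrow> 3 \<Rightarrow>\<^sub>0 nat" where "dv m = Poly_Mapping.map (\<lambda>n. n div q) m" for m
    have ldv: "Poly_Mapping.lookup (dv m) k = Poly_Mapping.lookup m k div q" for m k
      by (simp add: dv_def Poly_Mapping.map.rep_eq when_def)
    define Q where "Q = (\<Sum>m\<in>Poly_Mapping.keys P. Poly_Mapping.single (dv m) (r (Poly_Mapping.lookup P m)))"
    have pw: "Poly_Mapping.single m c ^ n = Poly_Mapping.single (\<Sum>i<n. m) (c ^ n)" for m :: "3 \<Rightarrow>\<^sub>0 nat" and c :: 'k and n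
      by (induction n) (simp_all add: mult_single add.commute del: sum_constant)
    have "Q ^ q = (\<Sum>m\<in>Poly_Mapping.keys P. Poly_Mapping.single (dv m) (r (Poly_Mapping.lookup P m)) ^ q)"
      unfolding Q_def by (rule freshmans_dream_sum) (use q in \<open>simp_all add: CHAR_poly3 q_def\<close>)
    also have "\<dots> = (\<Sum>m\<in>Poly_Mapping.keys P. Poly_Mapping.single m (Poly_Mapping.lookup P m))"
    proof (rule sum.cong)
      fix m assume m: "m \<in> Poly_Mapping.keys P"
      have "(\<Sum>i<q. dv m) = m"
        by (rule poly_mapping_eqI, unfold lookup_sum ldv) (use z[OF m] in \<open>simp add: q_def\<close>)
      thus "Poly_Mapping.single (dv m) (r (Poly_Mapping.lookup P m)) ^ q = Poly_Mapping.single m (Poly_Mapping.lookup P m)"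
        by (simp add: pw r del: sum_constant)
    qed simp
    also have "\<dots> = P" by (rule poly_mapping_eq_sum_singles[symmetric])
    finally have QP: "Q ^ q = P" .
    have "q \<ge> 2" using q by (rule prime_ge_2_nat)
    hence "P = Q * Q ^ (q - 1)" using QP by (metis power_eq_if not_numeral_le_zero)
    hence "Q dvd 1 \<or> Q ^ (q - 1) dvd 1" using P(1) by (auto simp: irreducible_def)
    moreover have "Q dvd Q ^ (q - 1)" using \<open>q \<ge> 2\<close> by (intro dvd_power) auto
    ultimately have "Q dvd 1" using dvd_trans by blast
    hence "P dvd 1" unfolding QP[symmetric] using dvd_power_same[of Q 1 q] by simp
    thus False using P(1) by (simp add: irreducible_def)
  qed
qed

lemma singular_pointsD:
  assumes "x \<in> singular_points F" "F \<in> homog n"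
  shows "x \<in> proj_plane" "eval3 F (rep x) = 0" "deriv_at (rep x) k F = 0"
  using assms vanishes_at_rep[OF assms(2)] vanishes_at_rep[OF partial_deriv_homog[OF assms(2)]]
  by (auto simp: singular_points_def zero_locus_def deriv_at_def)

text \<open>A singular point lies on some component P and, by the product rule, on its cofactor or
  on a derivative of P chosen nonzero. P divides neither of them, the derivative for reasons of
  degree, so the intersections are finite.\<close>

theorem finite_singular_points:
  fixes F :: "'k::alg_closed_field poly3"
  assumes S: "form_factors F S" and F: "F \<in> homog (int d)"
  shows "finite (singular_points F)"
proof -
  note f = form_factorsD[OF S]
  have "\<exists>k. partial_deriv k P \<noteq> 0" if "P \<in> S" for P
    using irreducible_partial_deriv_nonzero f(4)[OF that] f(6)[OF that] by metis
  then obtain k where k: "\<And>P. P \<in> S \<Longrightarrow> partial_deriv (k P) P \<noteq> 0" by metis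
  let ?X = "\<Union>P\<in>S. (zero_locus {P} \<inter> zero_locus {\<Prod>(S - {P})}) \<union> (zero_locus {P} \<inter> zero_locus {partial_deriv (k P) P})"
  have "finite ?X"
  proof (intro finite_UN_I finite_UnI f(1))
    fix P assume P: "P \<in> S"
    obtain p g where pg: "p > 0" "P \<in> homog (int p)" "\<Prod>(S - {P}) \<in> homog (int g)"
       "coprime_forms p g P (\<Prod>(S - {P}))"
      using form_factors_coprime_cofactor[OF S F P] by metis
    have "\<not> P dvd \<Prod>(S - {P})"
    proof
      assume "P dvd \<Prod>(S - {P})"
      then obtain Q where "Q \<in> S - {P}" "P dvd Q"
        using prime_elem_dvd_prodD[OF f(3)[OF P], of "\<lambda>x. x" "S - {P}"] by auto
      thus False using f(5)[OF P] by blast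
    qed
    thus "finite (zero_locus {P} \<inter> zero_locus {\<Prod>(S - {P})})"
      using finite_common_zeros[OF f(3)[OF P] pg(2,3)] by blast
    have dh: "partial_deriv (k P) P \<in> homog (int p - 1)" by (rule partial_deriv_homog[OF pg(2)])
    have "\<not> P dvd partial_deriv (k P) P"
    proof
      assume "P dvd partial_deriv (k P) P"
      then obtain A where A: "partial_deriv (k P) P = P * A" by (auto simp: dvd_def)
      hence "P * A \<in> homog (int p - 1)" "P * A \<noteq> 0" using dh k[OF P] by auto
      then obtain n where n: "P \<in> homog n" "A \<in> homog (int p - 1 - n)" by (rule homog_mult_cancel)
      have "n = int p" using homog_unique[OF n(1) pg(2) f(7)[OF P]] .
      hence "A = 0" using homog_neg[OF _ n(2)] by simp
      thus False using A k[OF P] by simp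
    qed
    thus "finite (zero_locus {P} \<inter> zero_locus {partial_deriv (k P) P})"
      using finite_common_zeros[OF f(3)[OF P] pg(2) dh] by blast
  qed
  moreover have "singular_points F \<subseteq> ?X"
  proof
    fix x assume x: "x \<in> singular_points F"
    note sx = singular_pointsD[OF x F]
    have "(\<Prod>P\<in>S. eval3 P (rep x)) = 0" using sx(2) f(2) by (metis (no_types, lifting) coef_hom.eval_prod coef_hom_id eval3_eq_pm_eval prod.cong)
    then obtain P where P: "P \<in> S" "eval3 P (rep x) = 0" using f(1) by auto
    obtain p g where pg: "P \<in> homog (int p)" "\<Prod>(S - {P}) \<in> homog (int g)" "F = P * \<Prod>(S - {P})"
      using form_factors_coprime_cofactor[OF S F P(1)] by metis
    have "deriv_at (rep x) (k P) P * eval3 (\<Prod>(S - {P})) (rep x) = 0"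
      using sx(3)[of "k P"] P(2) unfolding pg(3) by simp
    hence "x \<in> zero_locus {\<Prod>(S - {P})} \<or> x \<in> zero_locus {partial_deriv (k P) P}"
      using sx(1) unfolding zero_locus_form[OF pg(2)] zero_locus_form[OF partial_deriv_homog[OF pg(1)]] deriv_at_def
      by auto
    moreover have "x \<in> zero_locus {P}" using sx(1) P(2) zero_locus_form[OF pg(1)] by blast
    ultimately show "x \<in> ?X" using P(1) by blast
  qed
  ultimately show ?thesis by (rule finite_subset[rotated])
qed

subsection \<open>Graded submodules of free modules\<close>

lemma module_poly3: "Modules.module ((*) :: 'k::comm_ring_1 poly3 \<Rightarrow> 'k poly3 \<Rightarrow> 'k poly3)"
  by standard (simp_all add: algebra_simps)

lemma lookup_free_scale [simp]: "Poly_Mapping.lookup (free_scale c u) j = c * Poly_Mapping.lookup u j"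
  by (simp add: free_scale_def Poly_Mapping.map.rep_eq when_def)

lemma free_scale_laws:
  "free_scale c (u + w) = free_scale c u + free_scale c w"
  "free_scale (c + e) u = free_scale c u + free_scale e u"
  "free_scale c (free_scale e u) = free_scale (c * e) u"
  "free_scale 1 u = u"
  by (rule poly_mapping_eqI, simp only: lookup_free_scale lookup_add distrib_left distrib_right mult.assoc mult_1_left)+

interpretation fm: Modules.module "free_scale :: 'k::comm_ring_1 poly3 \<Rightarrow> _"
  by unfold_locales (simp_all only: free_scale_laws)

interpretation fvs: vector_space "\<lambda>c u. free_scale (const3 (c :: 'k::field)) u"
  by unfold_locales (simp_all only: free_scale_laws const3_add const3_mult const3_1)

lemma (in Modules.module) span_image_iff:
  assumes "finite A"
  shows "x \<in> span (g ` A) \<longleftrightarrow> (\<exists>c. x = (\<Sum>i\<in>A. scale (c i) (g i)))"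
proof
  assume x: "x \<in> span (g ` A)"
  let ?T = "{(\<Sum>i\<in>A. scale (c i) (g i)) | c. True}"
  have "subspace ?T"
  proof (rule subspaceI)
    show "0 \<in> ?T" by (rule CollectI) (rule exI[of _ "\<lambda>_. 0"], simp)
    fix x y assume "x \<in> ?T" "y \<in> ?T"
    then obtain c d where "x = (\<Sum>i\<in>A. scale (c i) (g i))" "y = (\<Sum>i\<in>A. scale (d i) (g i))" by blast
    hence "x + y = (\<Sum>i\<in>A. scale (c i + d i) (g i))"
      by (simp add: scale_left_distrib sum.distrib)
    thus "x + y \<in> ?T" by (intro CollectI exI[of _ "\<lambda>i. c i + d i"]) simp
  next
    fix a x assume "x \<in> ?T"
    then obtain c where "x = (\<Sum>i\<in>A. scale (c i) (g i))" by blast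
    hence "scale a x = (\<Sum>i\<in>A. scale (a * c i) (g i))" by (simp add: scale_sum_right)
    thus "scale a x \<in> ?T" by (intro CollectI exI[of _ "\<lambda>i. a * c i"]) simp
  qed
  moreover have "g ` A \<subseteq> ?T"
  proof
    fix y assume "y \<in> g ` A"
    then obtain j where j: "j \<in> A" "y = g j" by blast
    have "(\<Sum>i\<in>A. scale (if i = j then 1 else 0) (g i)) = (\<Sum>i\<in>A. if i = j then g i else 0)"
      by (rule sum.cong) auto
    also have "\<dots> = y" using j assms by simp
    finally show "y \<in> ?T" by (intro CollectI exI[of _ "\<lambda>i. if i = j then 1 else 0"]) simp
  qed
  ultimately have "span (g ` A) \<subseteq> ?T" by (rule span_minimal[rotated])
  thus "\<exists>c. x = (\<Sum>i\<in>A. scale (c i) (g i))" using x by blast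
next
  assume "\<exists>c. x = (\<Sum>i\<in>A. scale (c i) (g i))"
  then obtain c where x: "x = (\<Sum>i\<in>A. scale (c i) (g i))" ..
  show "x \<in> span (g ` A)" unfolding x by (intro span_sum span_scale span_base) simp
qed

text \<open>A homogeneous generating set of least cardinality is irredundant.\<close>

lemma minimal_generators_exist:
  fixes s :: "'k::comm_ring_1 poly3 \<Rightarrow> 'b::ab_group_add \<Rightarrow> 'b"
  assumes "Modules.module s" and fin: "finite G" "\<forall>x\<in>G. \<exists>n. x \<in> gr n" "Modules.module.span s G = M"
  shows "\<exists>r a g. min_homog_gens s gr M r a g"
proof -
  interpret Modules.module s by fact
  define C where "C n \<longleftrightarrow> (\<exists>G. finite G \<and> card G = n \<and> (\<forall>x\<in>G. \<exists>n. x \<in> gr n) \<and> span G = M)" for n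
  have "C (card G)" using fin unfolding C_def by blast
  hence "C (LEAST n. C n)" by (rule LeastI)
  then obtain G0 where G0: "finite G0" "card G0 = (LEAST n. C n)" "\<forall>x\<in>G0. \<exists>n. x \<in> gr n" "span G0 = M"
    unfolding C_def by blast
  obtain g where g: "bij_betw g {0..<card G0} G0" using ex_bij_betw_nat_finite[OF G0(1)] by blast
  define r where "r = card G0"
  have gr: "g ` {..<r} = G0" and inj: "inj_on g {..<r}"
    using g by (auto simp: bij_betw_def r_def atLeast0LessThan)
  have "\<exists>a. \<forall>j\<in>{..<r}. g j \<in> gr (a j)" using G0(3) gr by (intro bchoice) blast
  then obtain a where a: "\<forall>j\<in>{..<r}. g j \<in> gr (a j)" by blast
  have "g j \<notin> span (g ` ({..<r} - {j}))" if j: "j < r" for j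
  proof
    assume in_span: "g j \<in> span (g ` ({..<r} - {j}))"
    have eq: "g ` ({..<r} - {j}) = G0 - {g j}" using inj gr j by (auto simp: inj_on_def)
    have gj: "g j \<in> G0" using gr j by auto
    have "G0 \<subseteq> span (G0 - {g j})" using in_span unfolding eq
      by (metis Diff_iff insert_Diff_single insert_iff span_base subsetI singletonD)
    hence "span G0 \<subseteq> span (G0 - {g j})" by (rule span_minimal) (rule subspace_span)
    hence "span (G0 - {g j}) = M" using G0(4) span_mono[of "G0 - {g j}" G0] by auto
    hence "C (card (G0 - {g j}))" using G0 unfolding C_def by blast
    hence "card G0 \<le> card (G0 - {g j})" using G0(2) Least_le[of C] by simp
    thus False using card_Diff1_less[OF G0(1) gj] by simp
  qed
  hence "min_homog_gens s gr M r a g" unfolding min_homog_gens_def using a gr G0(4) by auto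
  thus ?thesis by blast
qed

definition fcomp :: "(nat \<Rightarrow> int) \<Rightarrow> int \<Rightarrow> (nat \<Rightarrow>\<^sub>0 'k::comm_ring_1 poly3) \<Rightarrow> (nat \<Rightarrow>\<^sub>0 'k poly3)" where
  "fcomp a n u = Poly_Mapping.mapp (\<lambda>j x. hcomp (n - a j) x) u"

lemma lookup_fcomp [simp]: "Poly_Mapping.lookup (fcomp a n u) j = hcomp (n - a j) (Poly_Mapping.lookup u j)"
  by (simp add: fcomp_def lookup_mapp when_def in_keys_iff)

lemma fcomp_free_grading [simp]: "fcomp a n u \<in> free_grading a n"
  by (simp add: free_grading_def)

lemma fcomp_decomposition:
  assumes "Poly_Mapping.keys u \<subseteq> {..<r}"
  obtains R where "finite R" "u = (\<Sum>n\<in>R. fcomp a n u)"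
proof -
  define R where "R = (\<Union>j<r. (\<lambda>m. a j + int (mon_deg m)) ` Poly_Mapping.keys (Poly_Mapping.lookup u j))"
  have fin: "finite R" by (simp add: R_def)
  have "u = (\<Sum>n\<in>R. fcomp a n u)"
  proof (rule poly_mapping_eqI, rule poly_mapping_eqI)
    fix j m
    show "Poly_Mapping.lookup (Poly_Mapping.lookup u j) m =
        Poly_Mapping.lookup (Poly_Mapping.lookup (\<Sum>n\<in>R. fcomp a n u) j) m"
    proof (cases "Poly_Mapping.lookup (Poly_Mapping.lookup u j) m = 0")
      case True
      thus ?thesis by (simp add: lookup_sum lookup_hcomp cong: if_cong)
    next
      case False
      hence "Poly_Mapping.lookup u j \<noteq> 0" by auto
      hence "j < r" using assms by (auto simp: in_keys_iff)
      hence "a j + int (mon_deg m) \<in> R" using False by (force simp: R_def in_keys_iff)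
      hence "Poly_Mapping.lookup (Poly_Mapping.lookup u j) m =
        (\<Sum>n\<in>R. if n = a j + int (mon_deg m) then Poly_Mapping.lookup (Poly_Mapping.lookup u j) m else 0)"
        using fin by simp
      also have "\<dots> = (\<Sum>n\<in>R. if int (mon_deg m) = n - a j then Poly_Mapping.lookup (Poly_Mapping.lookup u j) m else 0)"
        by (rule sum.cong) auto
      finally show ?thesis by (simp add: lookup_sum lookup_hcomp)
    qed
  qed
  thus ?thesis using that fin by blast
qed

lemma free_grading_add: "u \<in> free_grading a n \<Longrightarrow> w \<in> free_grading a n \<Longrightarrow> u + w \<in> free_grading a n"
  by (auto simp: free_grading_def lookup_add intro: homog_add)

lemma free_grading_scale:
  fixes c :: "'k::comm_ring_1 poly3"
  assumes "c \<in> homog k" "u \<in> free_grading a n"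
  shows "free_scale c u \<in> free_grading a (k + n)"
  using assms homog_mult[of c k] by (fastforce simp: free_grading_def algebra_simps)

lemma free_grading_diff:
  fixes u :: "nat \<Rightarrow>\<^sub>0 'k::comm_ring_1 poly3"
  shows "u \<in> free_grading a n \<Longrightarrow> w \<in> free_grading a n \<Longrightarrow> u - w \<in> free_grading a n"
  by (auto simp: free_grading_def lookup_minus intro: homog_diff)

lemma free_grading_0: "0 \<in> free_grading a n"
  by (simp add: free_grading_def)

lemma free_grading_sum: "(\<And>x. x \<in> A \<Longrightarrow> f x \<in> free_grading a n) \<Longrightarrow> sum f A \<in> free_grading a n"
  by (induction A rule: infinite_finite_induct) (auto simp: free_grading_0 intro: free_grading_add)

lemma poly_mapping_eq_sum_single_lessThan:
  fixes u :: "nat \<Rightarrow>\<^sub>0 'b::comm_monoid_add"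
  assumes "Poly_Mapping.keys u \<subseteq> {..<r}"
  shows "u = (\<Sum>j<r. Poly_Mapping.single j (Poly_Mapping.lookup u j))"
proof -
  have "(\<Sum>j<r. Poly_Mapping.single j (Poly_Mapping.lookup u j)) =
     (\<Sum>j\<in>Poly_Mapping.keys u. Poly_Mapping.single j (Poly_Mapping.lookup u j))"
    by (rule sum.mono_neutral_right) (use assms in \<open>auto simp: in_keys_iff\<close>)
  thus ?thesis using poly_mapping_eq_sum_singles[of u] by simp
qed

lemma single_sum: "Poly_Mapping.single j (sum f A) = (\<Sum>x\<in>A. Poly_Mapping.single j (f x))"
  by (induction A rule: infinite_finite_induct) (auto simp: single_add)

lemma free_scale_single: "free_scale c (Poly_Mapping.single j f) = Poly_Mapping.single j (c * f)"
  by (rule poly_mapping_eqI) (simp add: lookup_single when_def)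

lemma graded_piece_finite_span:
  "\<exists>T. finite T \<and> {u :: nat \<Rightarrow>\<^sub>0 'k::field poly3. Poly_Mapping.keys u \<subseteq> {..<r} \<and> u \<in> free_grading a n} \<subseteq> fvs.span T"
proof -
  define T :: "(nat \<Rightarrow>\<^sub>0 'k poly3) set" where
    "T = (\<Union>j<r. Poly_Mapping.single j ` monomials (nat (n - a j)))"
  have "u \<in> fvs.span T" if u: "Poly_Mapping.keys u \<subseteq> {..<r}" "u \<in> free_grading a n" for u
  proof (subst poly_mapping_eq_sum_single_lessThan[OF u(1)], rule fvs.span_sum)
    fix j assume j: "j \<in> {..<r}"
    let ?f = "Poly_Mapping.lookup u j"
    have f: "?f \<in> homog (n - a j)" using u(2) by (simp add: free_grading_def)
    show "Poly_Mapping.single j ?f \<in> fvs.span T"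
    proof (cases "n - a j < 0")
      case True
      hence "?f = 0" using f homog_neg by blast
      thus ?thesis by (simp add: fvs.span_zero)
    next
      case False
      hence "?f \<in> pvs.span (monomials (nat (n - a j)))"
        using f homog_subset_span_monomials[of "nat (n - a j)", where 'k = 'k] by auto
      then obtain c where c: "?f = (\<Sum>m\<in>monomials (nat (n - a j)). const3 (c m) * m)"
        using pvs.span_finite[OF finite_monomials] by blast
      show ?thesis unfolding c single_sum free_scale_single[symmetric]
        using j by (intro fvs.span_sum fvs.span_scale fvs.span_base) (auto simp: T_def)
    qed
  qed
  moreover have "finite T" by (simp add: T_def)
  ultimately show ?thesis by blast
qed

lemma fvs_span_subset_fm_span: "fvs.span B \<subseteq> fm.span (B :: (nat \<Rightarrow>\<^sub>0 'k::field poly3) set)"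
proof (rule fvs.span_minimal)
  show "B \<subseteq> fm.span B" by (rule fm.span_superset)
  show "fvs.subspace (fm.span B)"
    by (rule fvs.subspaceI) (auto intro: fm.span_zero fm.span_add fm.span_scale)
qed

text \<open>The values at v are kept as constant polynomials, so that the vector stays in the same
  free module and \<open>fvs\<close> applies to it.\<close>

definition fval :: "'k::comm_ring_1 ^ 3 \<Rightarrow> (nat \<Rightarrow>\<^sub>0 'k poly3) \<Rightarrow> (nat \<Rightarrow>\<^sub>0 'k poly3)" where
  "fval v u = Poly_Mapping.mapp (\<lambda>j x. const3 (eval3 x v)) u"

lemma lookup_fval [simp]: "Poly_Mapping.lookup (fval v u) j = const3 (eval3 (Poly_Mapping.lookup u j) v)"
  by (simp add: fval_def lookup_mapp when_def in_keys_iff)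

text \<open>The values at a point of the homogeneous elements of degree \<open>n\<close> of a graded submodule form an
  increasing sequence of subspaces of a finite-dimensional space, so it becomes constant.\<close>

theorem graded_submodule_finitely_generated:
  fixes M :: "(nat \<Rightarrow>\<^sub>0 'k::field poly3) set"
  assumes sub: "fm.subspace M" and keys: "\<And>u. u \<in> M \<Longrightarrow> Poly_Mapping.keys u \<subseteq> {..<r}"
    and comp: "\<And>u n. u \<in> M \<Longrightarrow> fcomp a n u \<in> M"
    and z: "z \<in> homog 1" "eval3 z v = 1"
    and sect: "\<And>n q. n \<ge> n1 \<Longrightarrow> q \<in> M \<Longrightarrow> q \<in> free_grading a n \<Longrightarrow> (\<And>j. eval3 (Poly_Mapping.lookup q j) v = 0) \<Longrightarrow>
        \<exists>A\<in>M \<inter> free_grading a (n - 1). \<exists>B\<in>M \<inter> free_grading a (n - 1). q = free_scale l A + free_scale y B"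
  shows "\<exists>G. finite G \<and> (\<forall>x\<in>G. \<exists>n. x \<in> free_grading a n) \<and> fm.span G = M"
proof -
  have "\<exists>B. finite B \<and> B \<subseteq> M \<inter> free_grading a n \<and> M \<inter> free_grading a n \<subseteq> fvs.span B" for n
  proof -
    obtain B where B: "B \<subseteq> M \<inter> free_grading a n" "fvs.independent B" "M \<inter> free_grading a n \<subseteq> fvs.span B"
      using fvs.maximal_independent_subset by metis
    obtain T :: "(nat \<Rightarrow>\<^sub>0 'k poly3) set" where T: "finite T" "{u. Poly_Mapping.keys u \<subseteq> {..<r} \<and> u \<in> free_grading a n} \<subseteq> fvs.span T"
      using graded_piece_finite_span[of r a n] by blast
    have "B \<subseteq> fvs.span T" using B(1) keys T(2) by blast
    hence "finite B" using fvs.independent_span_bound[OF T(1) B(2)] by blast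
    thus ?thesis using B by blast
  qed
  then obtain Bn where Bn: "\<And>n. finite (Bn n)" "\<And>n. Bn n \<subseteq> M \<inter> free_grading a n" "\<And>n. M \<inter> free_grading a n \<subseteq> fvs.span (Bn n)"
    by metis
  define Vals where "Vals = fval v ` {u \<in> M. \<exists>n. u \<in> free_grading a n}"
  obtain B where B: "B \<subseteq> Vals" "fvs.independent B" "Vals \<subseteq> fvs.span B"
    using fvs.maximal_independent_subset by metis
  have finB: "finite B"
  proof -
    let ?T = "(\<lambda>j. Poly_Mapping.single j (1 :: 'k poly3)) ` {..<r}"
    have "fval v u \<in> fvs.span ?T" if "u \<in> M" for u
    proof -
      have "Poly_Mapping.keys (fval v u) \<subseteq> Poly_Mapping.keys u" by (auto simp: in_keys_iff)
      hence k: "Poly_Mapping.keys (fval v u) \<subseteq> {..<r}" using keys[OF that] by blast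
      have eq: "Poly_Mapping.single j (Poly_Mapping.lookup (fval v u) j) =
          free_scale (const3 (eval3 (Poly_Mapping.lookup u j) v)) (Poly_Mapping.single j 1)" for j
        by (simp add: free_scale_single)
      show ?thesis
        by (subst poly_mapping_eq_sum_single_lessThan[OF k], unfold eq)
          (intro fvs.span_sum fvs.span_scale fvs.span_base imageI)
    qed
    hence "B \<subseteq> fvs.span ?T" using B(1) by (auto simp: Vals_def)
    thus ?thesis using fvs.independent_span_bound[OF _ B(2), of ?T] by simp
  qed
  have "\<exists>u. \<forall>b\<in>B. u b \<in> M \<and> (\<exists>n. u b \<in> free_grading a n) \<and> fval v (u b) = b"
  proof (intro bchoice ballI)
    fix b assume "b \<in> B"
    hence "b \<in> Vals" using B(1) by blast
    thus "\<exists>u. u \<in> M \<and> (\<exists>n. u \<in> free_grading a n) \<and> fval v u = b" by (auto simp: Vals_def)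
  qed
  then obtain ub where ub: "\<And>b. b \<in> B \<Longrightarrow> ub b \<in> M" "\<And>b. b \<in> B \<Longrightarrow> \<exists>n. ub b \<in> free_grading a n" "\<And>b. b \<in> B \<Longrightarrow> fval v (ub b) = b"
    by blast
  then obtain nb where nb: "\<And>b. b \<in> B \<Longrightarrow> ub b \<in> free_grading a (nb b)" by metis
  \<comment> \<open>At least the threshold for \<open>sect\<close> and the degrees of the chosen
    preimages of a basis of the values. Generators are bases of the graded pieces up to D; below
    \<open>m0\<close> the pieces are 0.\<close>
  define D where "D = Max (insert n1 (nb ` B))"
  have D: "n1 \<le> D" "\<And>b. b \<in> B \<Longrightarrow> nb b \<le> D" using finB by (auto simp: D_def)
  define m0 where "m0 = Min (insert 0 (a ` {..<r}))"
  have m0: "m0 \<le> a j" if "j < r" for j using that by (auto simp: m0_def)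
  define G where "G = (\<Union>n\<in>{m0..D}. Bn n)"
  have finG: "finite G" using Bn(1) by (simp add: G_def)
  have low: "u \<in> fm.span G" if u: "u \<in> M" "u \<in> free_grading a n" "n \<le> D" for u n
  proof (cases "n < m0")
    case True
    have "u = 0"
    proof (rule poly_mapping_eqI)
      fix j
      show "Poly_Mapping.lookup u j = Poly_Mapping.lookup 0 j"
      proof (cases "j < r")
        case T: True
        have "Poly_Mapping.lookup u j \<in> homog (n - a j)" using u by (simp add: free_grading_def)
        thus ?thesis using homog_neg[of "n - a j"] m0[OF T] True by auto
      next
        case False
        thus ?thesis using keys[OF u(1)] by (auto simp: in_keys_iff)
      qed
    qed
    thus ?thesis by (simp add: fm.span_zero)
  next
    case False
    have "u \<in> fvs.span (Bn n)" using Bn(3) u by blast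
    hence "u \<in> fm.span (Bn n)" using fvs_span_subset_fm_span by blast
    moreover have "Bn n \<subseteq> G" using False u(3) by (auto simp: G_def intro!: bexI[of _ n])
    ultimately show ?thesis using fm.span_mono by blast
  qed
  have up: "u \<in> fm.span G" if "u \<in> M" "u \<in> free_grading a (D + int k)" for u k
    using that
  proof (induction k arbitrary: u)
    case 0
    thus ?case using low by simp
  next
    case (Suc k)
    let ?n = "D + int (Suc k)"
    have "fval v u \<in> fvs.span B" using B(3) Suc.prems by (auto simp: Vals_def)
    then obtain c where c: "fval v u = (\<Sum>b\<in>B. free_scale (const3 (c b)) b)"
      using fvs.span_finite[OF finB] by blast
    \<comment> \<open>A combination of the chosen elements with the same value at v as u, raised to
      the degree of u by powers of z, which has value 1. The difference \<open>u - w\<close>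
      vanishes at v and splits into elements of lower degree.\<close>
    define w where "w = (\<Sum>b\<in>B. free_scale (const3 (c b) * z ^ nat (?n - nb b)) (ub b))"
    have wM: "w \<in> M" unfolding w_def by (intro fm.subspace_sum[OF sub] fm.subspace_scale[OF sub] ub)
    have wg: "w \<in> free_grading a ?n" unfolding w_def
    proof (rule free_grading_sum)
      fix b assume b: "b \<in> B"
      have "z ^ nat (?n - nb b) \<in> homog (int (nat (?n - nb b)) * 1)" by (rule homog_power[OF z(1)])
      hence "const3 (c b) * z ^ nat (?n - nb b) \<in> homog (?n - nb b)"
        using D(2)[OF b] homog_const3_mult by fastforce
      from free_grading_scale[OF this nb[OF b]]
      show "free_scale (const3 (c b) * z ^ nat (?n - nb b)) (ub b) \<in> free_grading a ?n" by simp
    qed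
    have ws: "w \<in> fm.span G" unfolding w_def
      using ub(1) nb D(2) low by (intro fm.span_sum fm.span_scale) blast
    have qM: "u - w \<in> M" using fm.subspace_diff[OF sub] Suc.prems wM by blast
    have qg: "u - w \<in> free_grading a ?n" using free_grading_diff Suc.prems wg by blast
    have "eval3 (Poly_Mapping.lookup (u - w) j) v = 0" for j
    proof -
      have "const3 (eval3 (Poly_Mapping.lookup u j) v) = Poly_Mapping.lookup (fval v u) j" by simp
      also have "\<dots> = (\<Sum>b\<in>B. const3 (c b) * Poly_Mapping.lookup b j)" unfolding c by (simp add: lookup_sum)
      also have "\<dots> = (\<Sum>b\<in>B. const3 (c b) * const3 (eval3 (Poly_Mapping.lookup (ub b) j) v))"
        by (rule sum.cong[OF refl]) (metis ub(3) lookup_fval)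
      also have "\<dots> = const3 (eval3 (Poly_Mapping.lookup w j) v)"
        by (simp add: w_def lookup_sum const3_sum const3_mult z(2))
      finally show ?thesis by (simp add: lookup_minus)
    qed
    from sect[OF _ qM qg this] D(1) obtain A C where AC: "A \<in> M" "A \<in> free_grading a (?n - 1)"
      "C \<in> M" "C \<in> free_grading a (?n - 1)" "u - w = free_scale l A + free_scale y C" by auto
    have "A \<in> fm.span G" "C \<in> fm.span G" using Suc.IH AC by simp_all
    hence "(free_scale l A + free_scale y C) + w \<in> fm.span G" using ws by (intro fm.span_add fm.span_scale)
    thus ?case unfolding AC(5)[symmetric] by simp
  qed
  have hom: "u \<in> fm.span G" if "u \<in> M" "u \<in> free_grading a n" for u n
  proof (cases "n \<le> D")
    case False
    hence "n = D + int (nat (n - D))" by simp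
    thus ?thesis using up that by metis
  qed (use low that in blast)
  have "fm.span G \<subseteq> M" using Bn(2) sub by (intro fm.span_minimal) (auto simp: G_def)
  moreover have "M \<subseteq> fm.span G"
  proof
    fix u assume u: "u \<in> M"
    obtain R where R: "finite R" "u = (\<Sum>n\<in>R. fcomp a n u)" using fcomp_decomposition[OF keys[OF u]] by blast
    have "(\<Sum>n\<in>R. fcomp a n u) \<in> fm.span G" using hom comp[OF u] fcomp_free_grading by (intro fm.span_sum) blast
    thus "u \<in> fm.span G" using R(2) by simp
  qed
  moreover have "\<forall>x\<in>G. \<exists>n. x \<in> free_grading a n" using Bn(2) by (auto simp: G_def)
  ultimately show ?thesis using finG by blast
qed

subsection \<open>Presentations of saturated ideals\<close>

text \<open>Saturation enters only as \<open>I_line\<close>: a linear form that is a nonzerodivisor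
  modulo I. Vectors are functions whose entries from r on are ignored.\<close>

locale presentation =
  fixes I :: "'k::alg_closed_field poly3 set" and t :: 'k
    and r :: nat and a :: "nat \<Rightarrow> int" and g :: "nat \<Rightarrow> 'k poly3"
  assumes I_gen: "f \<in> I \<longleftrightarrow> (\<exists>c. f = (\<Sum>j<r. c j * g j))"
    and g_hom: "j < r \<Longrightarrow> g j \<in> homog (a j)"
    and I_line: "line t * f \<in> I \<Longrightarrow> f \<in> I"
begin

definition comb :: "(nat \<Rightarrow> 'k poly3) \<Rightarrow> 'k poly3" where
  "comb u = (\<Sum>j<r. u j * g j)"

lemma comb_simps:
  "comb (\<lambda>j. u j + w j) = comb u + comb w" "comb (\<lambda>j. u j - w j) = comb u - comb w"
  "comb (\<lambda>j. c * u j) = c * comb u" "comb (\<lambda>j. sum (\<lambda>x. f x j) A) = (\<Sum>x\<in>A. comb (f x))"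
proof -
  show "comb (\<lambda>j. u j + w j) = comb u + comb w"
    by (simp add: comb_def distrib_right sum.distrib)
  show "comb (\<lambda>j. u j - w j) = comb u - comb w"
    by (simp add: comb_def left_diff_distrib sum_subtractf)
  show "comb (\<lambda>j. c * u j) = c * comb u"
    by (simp add: comb_def sum_distrib_left mult.assoc)
  show "comb (\<lambda>j. sum (\<lambda>x. f x j) A) = (\<Sum>x\<in>A. comb (f x))"
    unfolding comb_def sum_distrib_right by (rule sum.swap)
qed

lemma comb_cong: "(\<And>j. j < r \<Longrightarrow> u j = w j) \<Longrightarrow> comb u = comb w"
  unfolding comb_def by (rule sum.cong) auto

lemma I_iff_comb: "f \<in> I \<longleftrightarrow> (\<exists>c. f = comb c)"
  unfolding comb_def by (rule I_gen)

lemma comb_in_I: "comb c \<in> I"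
  using I_iff_comb by blast

lemma hcomp_comb: "hcomp n (comb c) = comb (\<lambda>j. hcomp (n - a j) (c j))"
  unfolding comb_def hcomp_sum by (rule sum.cong) (auto simp: hcomp_mult_homog_right[OF g_hom])

lemma I_homog_rep:
  assumes "f \<in> I" "f \<in> homog n"
  obtains c where "\<And>j. c j \<in> homog (n - a j)" "f = comb c"
proof -
  obtain c where c: "f = comb c" using assms(1) I_iff_comb by blast
  have "f = comb (\<lambda>j. hcomp (n - a j) (c j))"
    using assms(2) hcomp_comb[of n c] c by simp
  thus ?thesis using that[of "\<lambda>j. hcomp (n - a j) (c j)"] by simp
qed

text \<open>A point of the line, normalized so that multiplication by \<open>var 2\<close> raises
  degrees without changing values.\<close>

definition vv :: "'k ^ 3" where "vv = (\<chi> i. if i = 1 then - t else if i = 2 then 1 else 0)"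

lemma vv: "vv \<noteq> 0" "eval3 (line t) vv = 0" "vv $ 2 = 1"
  by (simp_all add: vec3_eq_0_iff eval3_line vv_def)

lemma cancel_line:
  assumes "line t * \<alpha> + pt_line vv * \<beta> = 0"
  obtains \<gamma> where "\<beta> = line t * \<gamma>"
proof -
  have "pt_line vv * \<beta> = line t * (- \<alpha>)" using assms by (simp add: eq_neg_iff_add_eq_0 add.commute)
  hence "line t dvd pt_line vv * \<beta>" by (metis dvd_triv_left)
  hence "line t dvd \<beta>" using pt_line_not_dvd[OF vv(1,2)] by (simp add: line_dvd_mult_iff)
  thus ?thesis using that by (auto simp: dvd_def)
qed

text \<open>The linear forms of the point \<open>vv\<close> are a regular sequence on the syzygies, since \<open>line t\<close> is a
  nonzerodivisor on \<open>S/I\<close>.\<close>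

lemma syzygy_section:
  assumes q: "comb q = 0" "\<And>j. j < r \<Longrightarrow> q j \<in> homog (n - a j)" "\<And>j. j < r \<Longrightarrow> eval3 (q j) vv = 0"
  shows "\<exists>A B. comb A = 0 \<and> comb B = 0 \<and> (\<forall>j<r. A j \<in> homog (n - 1 - a j)) \<and> (\<forall>j<r. B j \<in> homog (n - 1 - a j)) \<and>
    (\<forall>j<r. q j = line t * A j + pt_line vv * B j)"
proof -
  have "\<forall>j\<in>{..<r}. \<exists>AB. fst AB \<in> homog (n - a j - 1) \<and> snd AB \<in> homog (n - a j - 1) \<and> q j = line t * fst AB + pt_line vv * snd AB"
    using form_vanishing_on_line_point[OF q(2) vv(1,2) q(3)] by simp
  then obtain AB where AB: "\<And>j. j < r \<Longrightarrow> fst (AB j) \<in> homog (n - a j - 1)" "\<And>j. j < r \<Longrightarrow> snd (AB j) \<in> homog (n - a j - 1)"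
    "\<And>j. j < r \<Longrightarrow> q j = line t * fst (AB j) + pt_line vv * snd (AB j)"
    using bchoice[of "{..<r}" "\<lambda>j AB. fst AB \<in> homog (n - a j - 1) \<and> snd AB \<in> homog (n - a j - 1) \<and> q j = line t * fst AB + pt_line vv * snd AB"] by auto
  define A B where "A = (\<lambda>j. fst (AB j))" and "B = (\<lambda>j. snd (AB j))"
  have "comb (\<lambda>j. line t * A j + pt_line vv * B j) = comb q"
    by (rule comb_cong) (simp add: AB(3) A_def B_def)
  hence 0: "line t * comb A + pt_line vv * comb B = 0" using q(1) by (simp add: comb_simps)
  then obtain \<gamma> where \<gamma>: "comb B = line t * \<gamma>" by (rule cancel_line)
  have "\<gamma> \<in> I" using I_line[of \<gamma>] comb_in_I[of B] \<gamma> by simp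
  have Bh: "comb B \<in> homog (n - 1)"
  proof -
    have "comb B \<in> homog (n - 1)" unfolding comb_def
    proof (rule homog_sum)
      fix j assume "j \<in> {..<r}"
      thus "B j * g j \<in> homog (n - 1)" using homog_mult[OF AB(2) g_hom, of j j] by (simp add: B_def)
    qed
    thus ?thesis .
  qed
  have "hcomp (n - 2) \<gamma> = \<gamma>"
  proof -
    have "line t * hcomp (n - 2) \<gamma> = hcomp (n - 1) (line t * \<gamma>)" by (simp add: hcomp_mult_homog[OF line_homog])
    also have "\<dots> = line t * \<gamma>" using Bh \<gamma> by simp
    finally show ?thesis by simp
  qed
  hence "\<gamma> \<in> homog (n - 2)" using hcomp_homog by metis
  then obtain C where C: "\<And>j. C j \<in> homog (n - 2 - a j)" "\<gamma> = comb C" using I_homog_rep[OF \<open>\<gamma> \<in> I\<close>] by blast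
  \<comment> \<open>A Koszul correction by a representation C of \<gamma>: it does not change the
    combination of the two linear forms, and it cancels \<open>comb B\<close>, which equals
    \<open>line t * \<gamma>\<close>.\<close>
  define A' B' where "A' = (\<lambda>j. A j + pt_line vv * C j)" and "B' = (\<lambda>j. B j - line t * C j)"
  have "comb B' = 0" unfolding B'_def comb_simps using \<gamma> C(2) by simp
  moreover have "comb A' = 0"
  proof -
    have "line t * comb A' = line t * comb A + pt_line vv * (line t * comb C)"
      unfolding A'_def comb_simps by (simp add: algebra_simps)
    also have "\<dots> = 0" using 0 \<gamma> C(2) by simp
    finally show ?thesis by simp
  qed
  moreover have "A' j \<in> homog (n - 1 - a j)" "B' j \<in> homog (n - 1 - a j)" "q j = line t * A' j + pt_line vv * B' j" if j: "j < r" for j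
  proof -
    have "pt_line vv * C j \<in> homog (1 + (n - 2 - a j))" "line t * C j \<in> homog (1 + (n - 2 - a j))"
      by (intro homog_mult pt_line_homog line_homog C(1))+
    moreover have e: "1 + (n - 2 - a j) = n - 1 - a j" "n - a j - 1 = n - 1 - a j" by simp_all
    ultimately have "pt_line vv * C j \<in> homog (n - 1 - a j)" "line t * C j \<in> homog (n - 1 - a j)"
      by simp_all
    moreover have "A j \<in> homog (n - 1 - a j)" "B j \<in> homog (n - 1 - a j)"
      using AB(1,2)[OF j] e(2) by (simp_all add: A_def B_def)
    ultimately show "A' j \<in> homog (n - 1 - a j)" "B' j \<in> homog (n - 1 - a j)"
      unfolding A'_def B'_def by (auto intro: homog_add homog_diff)
    show "q j = line t * A' j + pt_line vv * B' j"
      using AB(3)[OF j] by (simp add: A'_def B'_def A_def B_def algebra_simps)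
  qed
  ultimately show ?thesis by blast
qed

definition koszul :: "nat \<Rightarrow> nat \<Rightarrow> nat \<Rightarrow> 'k poly3" where
  "koszul i j l = (if l = j then g i else 0) - (if l = i then g j else 0)"

lemma comb_unit: "j < r \<Longrightarrow> comb (\<lambda>l. if l = j then c else 0) = c * g j"
proof -
  assume "j < r"
  have "comb (\<lambda>l. if l = j then c else 0) = (\<Sum>l<r. if l = j then c * g j else 0)"
    unfolding comb_def by (rule sum.cong) auto
  thus ?thesis using \<open>j < r\<close> by simp
qed

lemma comb_koszul: "i < r \<Longrightarrow> j < r \<Longrightarrow> comb (koszul i j) = 0"
  unfolding koszul_def comb_simps by (simp add: comb_unit mult.commute)

lemma koszul_homog: "i < r \<Longrightarrow> j < r \<Longrightarrow> koszul i j l \<in> homog (a i + a j - a l)"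
  using g_hom[of i] g_hom[of j] by (auto simp: koszul_def intro!: homog_diff homog_uminus)

end

locale resolution = presentation I t r a g
  for I :: "'k::alg_closed_field poly3 set" and t :: 'k and r :: nat and a :: "nat \<Rightarrow> int" and g :: "nat \<Rightarrow> 'k poly3" +
  fixes s :: nat and b :: "nat \<Rightarrow> int" and H :: "nat \<Rightarrow> nat \<Rightarrow> 'k poly3"
  assumes H_syz: "k < s \<Longrightarrow> comb (H k) = 0"
    and H_gen: "comb u = 0 \<Longrightarrow> \<exists>c. \<forall>j<r. u j = (\<Sum>k<s. c k * H k j)"
    and H_hom: "k < s \<Longrightarrow> j < r \<Longrightarrow> H k j \<in> homog (b k - a j)"
    and H_min: "k < s \<Longrightarrow> \<not> (\<forall>j<r. H k j = (\<Sum>i\<in>{..<s} - {k}. c i * H i j))"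
begin

lemma hcomp_H: "j < r \<Longrightarrow> hcomp (n - a j) (\<Sum>k<s. c k * H k j) = (\<Sum>k<s. hcomp (n - b k) (c k) * H k j)"
  unfolding hcomp_sum by (rule sum.cong) (auto simp: hcomp_mult_homog_right[OF H_hom] algebra_simps)

lemma syzygy_homog_rep:
  assumes "comb u = 0" "\<And>j. j < r \<Longrightarrow> u j \<in> homog (n - a j)"
  obtains c where "\<And>k. c k \<in> homog (n - b k)" "\<And>j. j < r \<Longrightarrow> u j = (\<Sum>k<s. c k * H k j)"
proof -
  obtain c where c: "\<forall>j<r. u j = (\<Sum>k<s. c k * H k j)" using H_gen[OF assms(1)] by blast
  have "u j = (\<Sum>k<s. hcomp (n - b k) (c k) * H k j)" if j: "j < r" for j
  proof -
    have "u j = hcomp (n - a j) (u j)" using assms(2)[OF j] by simp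
    also have "\<dots> = hcomp (n - a j) (\<Sum>k<s. c k * H k j)" using c j by simp
    finally show ?thesis using hcomp_H[OF j] by simp
  qed
  thus ?thesis using that[of "\<lambda>k. hcomp (n - b k) (c k)"] by simp
qed

lemma no_unit_coefficient:
  assumes "\<And>j. j < r \<Longrightarrow> (\<Sum>k<s. d k * H k j) = 0" and k: "k < s" "d k = const3 x"
  shows "x = 0"
proof (rule ccontr)
  assume x: "x \<noteq> 0"
  have "H k j = (\<Sum>i\<in>{..<s} - {k}. (- const3 (1 / x) * d i) * H i j)" if j: "j < r" for j
  proof -
    have "const3 x * H k j + (\<Sum>i\<in>{..<s} - {k}. d i * H i j) = 0"
      using assms(1)[OF j] sum.remove[of "{..<s}" k "\<lambda>i. d i * H i j"] k by simp
    hence "const3 x * H k j = - (\<Sum>i\<in>{..<s} - {k}. d i * H i j)"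
      by (simp only: eq_neg_iff_add_eq_0)
    hence "const3 (1 / x) * (const3 x * H k j) = const3 (1 / x) * (- (\<Sum>i\<in>{..<s} - {k}. d i * H i j))"
      by (rule arg_cong)
    moreover have "const3 (1 / x) * (const3 x * H k j) = H k j"
      using x by (simp add: mult.assoc[symmetric] const3_mult[symmetric])
    ultimately show ?thesis by (simp add: sum_distrib_left sum_negf mult.assoc)
  qed
  thus False using H_min[OF k(1), of "\<lambda>i. - const3 (1 / x) * d i"] by blast
qed

text \<open>A graded Nakayama argument at the point \<open>vv\<close>. A relation between values is
  made homogeneous of the largest degree e involved by powers of \<open>var 2\<close>. The resulting
  syzygy vanishes at \<open>vv\<close>, hence comes from syzygies of degree e - 1, in which
  generators of degree e cannot occur; so the coefficient of such a generator is a nonzero constant,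
  against minimality.\<close>

lemma values_independent:
  assumes x: "\<And>j. j < r \<Longrightarrow> (\<Sum>k<s. x k * eval3 (H k j) vv) = 0" and k: "k < s"
  shows "x k = 0"
proof (rule ccontr)
  assume xk: "x k \<noteq> 0"
  define K where "K = {k \<in> {..<s}. x k \<noteq> 0}"
  define e where "e = Max (b ` K)"
  have finK: "finite K" "K \<noteq> {}" using k xk by (auto simp: K_def)
  have be: "b k \<le> e" if "k < s" "x k \<noteq> 0" for k
    using that finK by (auto simp: e_def K_def)
  have "e \<in> b ` K" unfolding e_def using finK by (intro Max_in) auto
  then obtain k0 where k0: "k0 < s" "x k0 \<noteq> 0" "b k0 = e" by (auto simp: K_def)
  define p where "p k = const3 (x k) * var 2 ^ nat (e - b k)" for k
  define q where "q j = (\<Sum>k<s. p k * H k j)" for j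
  have "comb q = (\<Sum>k<s. comb (\<lambda>j. p k * H k j))" unfolding q_def by (rule comb_simps(4))
  also have "\<dots> = 0" by (simp add: comb_simps H_syz)
  finally have q0: "comb q = 0" .
  have qh: "q j \<in> homog (e - a j)" if j: "j < r" for j
    unfolding q_def
  proof (rule homog_sum)
    fix k assume "k \<in> {..<s}"
    hence ks: "k < s" by simp
    show "p k * H k j \<in> homog (e - a j)"
    proof (cases "x k = 0")
      case False
      have "p k \<in> homog (int (nat (e - b k)) * 1)"
        unfolding p_def by (intro homog_const3_mult homog_power homog_var)
      from homog_mult[OF this H_hom[OF ks j]] show ?thesis using be[OF ks False] by simp
    qed (simp add: p_def)
  qed
  have qv: "eval3 (q j) vv = 0" if j: "j < r" for j
    using x[OF j] by (simp add: q_def p_def vv(3))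
  obtain A B where AB: "comb A = 0" "comb B = 0" "\<And>j. j < r \<Longrightarrow> A j \<in> homog (e - 1 - a j)" "\<And>j. j < r \<Longrightarrow> B j \<in> homog (e - 1 - a j)"
    "\<And>j. j < r \<Longrightarrow> q j = line t * A j + pt_line vv * B j"
    using syzygy_section[OF q0 qh qv] by blast
  obtain c where c: "\<And>k. c k \<in> homog (e - 1 - b k)" "\<And>j. j < r \<Longrightarrow> A j = (\<Sum>k<s. c k * H k j)"
    using syzygy_homog_rep[OF AB(1,3)] by blast
  obtain c' where c': "\<And>k. c' k \<in> homog (e - 1 - b k)" "\<And>j. j < r \<Longrightarrow> B j = (\<Sum>k<s. c' k * H k j)"
    using syzygy_homog_rep[OF AB(2,4)] by blast
  define D where "D k = p k - (line t * c k + pt_line vv * c' k)" for k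
  have "(\<Sum>k<s. D k * H k j) = 0" if j: "j < r" for j
  proof -
    have "(\<Sum>k<s. D k * H k j) = q j - (line t * A j + pt_line vv * B j)"
      by (simp add: D_def q_def c(2)[OF j] c'(2)[OF j] left_diff_distrib distrib_right sum_subtractf sum.distrib sum_distrib_left mult.assoc)
    thus ?thesis using AB(5)[OF j] by simp
  qed
  moreover have "c k0 = 0" "c' k0 = 0" using homog_neg[OF _ c(1)[of k0]] homog_neg[OF _ c'(1)[of k0]] k0(3) by auto
  hence "D k0 = const3 (x k0)" by (simp add: D_def p_def k0(3))
  ultimately show False using no_unit_coefficient[OF _ k0(1)] k0(2) by blast
qed

text \<open>Induction on the degree of the relation. By \<open>values_independent\<close> its
  coefficients vanish at \<open>vv\<close>, so they are combinations of the two linear forms; after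
  a Koszul correction as in \<open>syzygy_section\<close> both coefficient vectors are relations of
  degree one less. Below \<open>m0\<close> all coefficients have negative degree.\<close>

lemma H_independent_homog:
  assumes "\<And>k. k < s \<Longrightarrow> w k \<in> homog (n - b k)" "\<And>j. j < r \<Longrightarrow> (\<Sum>k<s. w k * H k j) = 0"
  shows "\<forall>k<s. w k = 0"
proof -
  define m0 where "m0 = Min (insert 0 (b ` {..<s}))"
  have m0: "m0 \<le> b k" if "k < s" for k using that by (auto simp: m0_def)
  have "\<forall>w n. n < m0 + int m \<longrightarrow> (\<forall>k<s. w k \<in> homog (n - b k)) \<longrightarrow> (\<forall>j<r. (\<Sum>k<s. w k * H k j) = 0) \<longrightarrow> (\<forall>k<s. w k = 0)" for m
  proof (induction m)
    case 0
    show ?case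
    proof (intro allI impI)
      fix w :: "nat \<Rightarrow> 'k poly3" and n k assume "n < m0 + int 0" "\<forall>k<s. w k \<in> homog (n - b k)" "k < s"
      thus "w k = 0" using homog_neg[of "n - b k" "w k"] m0[of k] by auto
    qed
  next
    case (Suc m)
    show ?case
    proof (intro allI impI)
      fix w :: "nat \<Rightarrow> 'k poly3" and n k
      assume n: "n < m0 + int (Suc m)" and wh: "\<forall>k<s. w k \<in> homog (n - b k)"
        and w0: "\<forall>j<r. (\<Sum>k<s. w k * H k j) = 0" and k: "k < s"
      have val: "eval3 (w k) vv = 0" if ks: "k < s" for k
      proof (rule values_independent[OF _ ks])
        fix j assume "j < r"
        hence "eval3 (\<Sum>k<s. w k * H k j) vv = 0" using w0 by simp
        thus "(\<Sum>k<s. eval3 (w k) vv * eval3 (H k j) vv) = 0" by simp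
      qed
      have "\<forall>k\<in>{..<s}. \<exists>AB. fst AB \<in> homog (n - b k - 1) \<and> snd AB \<in> homog (n - b k - 1) \<and> w k = line t * fst AB + pt_line vv * snd AB"
        using form_vanishing_on_line_point[OF _ vv(1,2) val] wh by simp
      then obtain AB where AB: "\<And>k. k < s \<Longrightarrow> fst (AB k) \<in> homog (n - b k - 1)" "\<And>k. k < s \<Longrightarrow> snd (AB k) \<in> homog (n - b k - 1)"
        "\<And>k. k < s \<Longrightarrow> w k = line t * fst (AB k) + pt_line vv * snd (AB k)"
        using bchoice[of "{..<s}" "\<lambda>k AB. fst AB \<in> homog (n - b k - 1) \<and> snd AB \<in> homog (n - b k - 1) \<and> w k = line t * fst AB + pt_line vv * snd AB"] by auto
      define A B where "A = (\<lambda>k. fst (AB k))" and "B = (\<lambda>k. snd (AB k))"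
      define \<alpha> \<beta> where "\<alpha> j = (\<Sum>k<s. A k * H k j)" and "\<beta> j = (\<Sum>k<s. B k * H k j)" for j
      have 0: "line t * \<alpha> j + pt_line vv * \<beta> j = 0" if j: "j < r" for j
      proof -
        have "0 = (\<Sum>k<s. w k * H k j)" using w0 j by simp
        also have "\<dots> = (\<Sum>k<s. line t * (A k * H k j) + pt_line vv * (B k * H k j))"
          by (rule sum.cong) (simp_all add: AB(3) A_def B_def algebra_simps)
        finally show ?thesis by (simp add: \<alpha>_def \<beta>_def sum.distrib sum_distrib_left)
      qed
      have "\<forall>j\<in>{..<r}. \<exists>\<gamma>. \<beta> j = line t * \<gamma>" using cancel_line[OF 0] by (metis lessThan_iff)
      then obtain \<gamma> where \<gamma>: "\<And>j. j < r \<Longrightarrow> \<beta> j = line t * \<gamma> j" using bchoice[of "{..<r}" "\<lambda>j \<gamma>. \<beta> j = line t * \<gamma>"] by auto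
      have "line t * comb \<gamma> = comb \<beta>"
        unfolding comb_simps(3)[symmetric] by (rule comb_cong) (simp add: \<gamma>)
      also have "\<dots> = (\<Sum>k<s. comb (\<lambda>j. B k * H k j))" unfolding \<beta>_def by (rule comb_simps(4))
      also have "\<dots> = 0" by (simp add: comb_simps H_syz)
      finally have \<gamma>0: "comb \<gamma> = 0" by simp
      have \<gamma>h: "\<gamma> j \<in> homog (n - 2 - a j)" if j: "j < r" for j
      proof -
        have "\<beta> j \<in> homog (n - 1 - a j)" unfolding \<beta>_def
        proof (rule homog_sum)
          fix k assume "k \<in> {..<s}"
          hence ks: "k < s" by simp
          show "B k * H k j \<in> homog (n - 1 - a j)"
          proof -
            have e: "n - b k - 1 + (b k - a j) = n - 1 - a j" by simp
            show ?thesis using homog_mult[OF AB(2)[OF ks] H_hom[OF ks j], unfolded e] by (simp add: B_def)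
          qed
        qed
        hence "line t * hcomp (n - 2 - a j) (\<gamma> j) = line t * \<gamma> j"
          using hcomp_mult_homog[OF line_homog, of "n - 1 - a j" t "\<gamma> j"] \<gamma>[OF j] by (simp add: algebra_simps)
        hence "hcomp (n - 2 - a j) (\<gamma> j) = \<gamma> j" by simp
        thus ?thesis using hcomp_homog by metis
      qed
      obtain \<delta> where \<delta>: "\<And>k. \<delta> k \<in> homog (n - 2 - b k)" "\<And>j. j < r \<Longrightarrow> \<gamma> j = (\<Sum>k<s. \<delta> k * H k j)"
        using syzygy_homog_rep[OF \<gamma>0 \<gamma>h] by blast
      define A' B' where "A' = (\<lambda>k. A k + pt_line vv * \<delta> k)" and "B' = (\<lambda>k. B k - line t * \<delta> k)"
      have hom: "A' k \<in> homog (n - 1 - b k)" "B' k \<in> homog (n - 1 - b k)" if ks: "k < s" for k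
      proof -
        have "pt_line vv * \<delta> k \<in> homog (1 + (n - 2 - b k))" "line t * \<delta> k \<in> homog (1 + (n - 2 - b k))"
          by (intro homog_mult pt_line_homog line_homog \<delta>(1))+
        moreover have e: "1 + (n - 2 - b k) = n - 1 - b k" "n - b k - 1 = n - 1 - b k" by simp_all
        ultimately have "pt_line vv * \<delta> k \<in> homog (n - 1 - b k)" "line t * \<delta> k \<in> homog (n - 1 - b k)"
          by simp_all
        moreover have "A k \<in> homog (n - 1 - b k)" "B k \<in> homog (n - 1 - b k)"
          using AB(1,2)[OF ks] e(2) by (simp_all add: A_def B_def)
        ultimately show "A' k \<in> homog (n - 1 - b k)" "B' k \<in> homog (n - 1 - b k)"
          unfolding A'_def B'_def by (auto intro: homog_add homog_diff)
      qed
      have B0: "(\<Sum>k<s. B' k * H k j) = 0" if j: "j < r" for j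
      proof -
        have "(\<Sum>k<s. B' k * H k j) = \<beta> j - line t * \<gamma> j"
          by (simp add: B'_def \<beta>_def \<delta>(2)[OF j] left_diff_distrib sum_subtractf sum_distrib_left mult.assoc)
        thus ?thesis using \<gamma>[OF j] by simp
      qed
      have A0: "(\<Sum>k<s. A' k * H k j) = 0" if j: "j < r" for j
      proof -
        have "(\<Sum>k<s. A' k * H k j) = \<alpha> j + pt_line vv * \<gamma> j"
          by (simp add: A'_def \<alpha>_def \<delta>(2)[OF j] distrib_right sum.distrib sum_distrib_left mult.assoc)
        hence "line t * (\<Sum>k<s. A' k * H k j) = line t * \<alpha> j + pt_line vv * \<beta> j"
          using \<gamma>[OF j] by (simp add: algebra_simps)
        thus ?thesis using 0[OF j] by simp
      qed
      have "n - 1 < m0 + int m" using n by simp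
      hence "A' k = 0" "B' k = 0" using Suc.IH[rule_format, of "n - 1"] hom A0 B0 k by blast+
      moreover have "w k = line t * A' k + pt_line vv * B' k"
        using AB(3)[OF k] by (simp add: A'_def B'_def A_def B_def algebra_simps)
      ultimately show "w k = 0" by simp
    qed
  qed
  note ind = this[of "nat (n - m0) + 1", THEN spec[of _ w], THEN spec[of _ n], THEN mp]
  have "n < m0 + int (nat (n - m0) + 1)" by simp
  from ind[OF this] show ?thesis using assms by simp
qed

theorem H_independent:
  assumes "\<And>j. j < r \<Longrightarrow> (\<Sum>k<s. w k * H k j) = 0" and k: "k < s"
  shows "w k = 0"
proof -
  have "hcomp (n - b k) (w k) = 0" for n
  proof -
    have "(\<Sum>k<s. hcomp (n - b k) (w k) * H k j) = 0" if j: "j < r" for j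
      using hcomp_H[OF j, of n w] assms(1)[OF j] by simp
    from H_independent_homog[where w = "\<lambda>k. hcomp (n - b k) (w k)" and n = n, OF _ this] k show ?thesis by simp
  qed
  from this[of "n + b k" for n] have "hcomp n (w k) = 0" for n by simp
  thus ?thesis using sum_hcomp[OF order.refl, of "w k"] by simp
qed

definition coord :: "(nat \<Rightarrow> 'k poly3) \<Rightarrow> nat \<Rightarrow> 'k poly3" where
  "coord u = (SOME c. \<forall>j<r. u j = (\<Sum>k<s. c k * H k j))"

lemma coord_unique:
  assumes "\<And>j. j < r \<Longrightarrow> u j = (\<Sum>k<s. c k * H k j)" and k: "k < s"
  shows "coord u k = c k"
proof -
  have "\<forall>j<r. u j = (\<Sum>k<s. coord u k * H k j)"
    unfolding coord_def using assms(1) by (intro someI_ex[of "\<lambda>c. \<forall>j<r. u j = (\<Sum>k<s. c k * H k j)"]) blast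
  hence "(\<Sum>k<s. (coord u k - c k) * H k j) = 0" if "j < r" for j
    using assms(1)[OF that] that by (simp add: left_diff_distrib sum_subtractf)
  from H_independent[OF this k] show ?thesis by simp
qed

lemma coord:
  assumes "comb u = 0" "j < r"
  shows "u j = (\<Sum>k<s. coord u k * H k j)"
proof -
  obtain c where c: "\<forall>j<r. u j = (\<Sum>k<s. c k * H k j)" using H_gen[OF assms(1)] by blast
  have "u j = (\<Sum>k<s. c k * H k j)" using c assms(2) by blast
  also have "\<dots> = (\<Sum>k<s. coord u k * H k j)"
    by (rule sum.cong) (use coord_unique[of u c] c in auto)
  finally show ?thesis .
qed

lemma coord_homog:
  assumes "comb u = 0" "\<And>j. j < r \<Longrightarrow> u j \<in> homog (n - a j)" "k < s"
  shows "coord u k \<in> homog (n - b k)"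
proof -
  obtain c where c: "\<And>k. c k \<in> homog (n - b k)" "\<And>j. j < r \<Longrightarrow> u j = (\<Sum>k<s. c k * H k j)"
    using syzygy_homog_rep[OF assms(1,2)] by blast
  thus ?thesis using coord_unique[OF c(2) assms(3)] by simp
qed

lemma coord_H: "k < s \<Longrightarrow> l < s \<Longrightarrow> coord (H k) l = (if l = k then 1 else 0)"
proof (rule coord_unique)
  fix j assume "k < s"
  have "(\<Sum>i<s. (if i = k then 1 else 0) * H i j) = (\<Sum>i<s. if i = k then H k j else 0)"
    by (rule sum.cong) auto
  thus "H k j = (\<Sum>i<s. (if i = k then 1 else 0) * H i j)" using \<open>k < s\<close> by simp
qed

text \<open>A homomorphism from the syzygies to \<open>S\<close> becomes, after multiplication by an element \<open>F\<close> of the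
  ideal, the restriction of a homomorphism from the free module, because \<open>g\<^sub>i u\<close> is the combination of
  Koszul syzygies with coefficients \<open>u\<^sub>j\<close>.\<close>

definition extension :: "(nat \<Rightarrow> 'k poly3) \<Rightarrow> nat \<Rightarrow> nat \<Rightarrow> 'k poly3" where
  "extension w k j = (\<Sum>i<r. w i * coord (koszul i j) k)"

text \<open>The Koszul syzygies with coefficients \<open>u j * w i\<close> add up to
  \<open>comb w\<close> times u minus \<open>comb u\<close> times w. The second term vanishes since
  u is a syzygy, and coordinates are unique.\<close>

lemma extension_eq:
  assumes u: "comb u = 0" and k: "k < s"
  shows "(\<Sum>j<r. u j * extension w k j) = comb w * coord u k"
proof -
  define c where "c k = (\<Sum>j<r. u j * extension w k j) - comb w * coord u k" for k
  have "c k = 0"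
  proof (rule H_independent[OF _ k])
    fix l assume l: "l < r"
    have "(\<Sum>k<s. (\<Sum>j<r. u j * extension w k j) * H k l) = (\<Sum>j<r. \<Sum>i<r. u j * w i * (\<Sum>k<s. coord (koszul i j) k * H k l))"
    proof -
      have "(\<Sum>k<s. (\<Sum>j<r. u j * extension w k j) * H k l) = (\<Sum>k<s. \<Sum>j<r. \<Sum>i<r. u j * w i * (coord (koszul i j) k * H k l))"
        by (simp add: extension_def sum_distrib_left sum_distrib_right mult.assoc)
      also have "\<dots> = (\<Sum>j<r. \<Sum>k<s. \<Sum>i<r. u j * w i * (coord (koszul i j) k * H k l))" by (rule sum.swap)
      also have "\<dots> = (\<Sum>j<r. \<Sum>i<r. \<Sum>k<s. u j * w i * (coord (koszul i j) k * H k l))"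
        by (rule sum.cong[OF refl]) (rule sum.swap)
      finally show ?thesis by (simp add: sum_distrib_left)
    qed
    also have "\<dots> = (\<Sum>j<r. \<Sum>i<r. u j * w i * koszul i j l)"
      by (intro sum.cong refl) (use coord[OF comb_koszul _] l in simp)
    also have "\<dots> = (\<Sum>j<r. if j = l then u l * comb w else 0) - (\<Sum>j<r. w l * (u j * g j))"
    proof -
      have "(\<Sum>i<r. u j * w i * koszul i j l) = (if j = l then u l * comb w else 0) - w l * (u j * g j)" if "j < r" for j
      proof -
        have "(\<Sum>i<r. u j * w i * koszul i j l) =
          (\<Sum>i<r. u j * w i * (if l = j then g i else 0)) - (\<Sum>i<r. u j * w i * (if l = i then g j else 0))"
          by (simp add: koszul_def right_diff_distrib sum_subtractf)
        also have "(\<Sum>i<r. u j * w i * (if l = j then g i else 0)) = (if j = l then u l * comb w else 0)"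
          by (auto simp: comb_def sum_distrib_left mult.assoc)
        also have "(\<Sum>i<r. u j * w i * (if l = i then g j else 0)) = (\<Sum>i<r. if i = l then w l * (u j * g j) else 0)"
          by (rule sum.cong) (auto simp: mult_ac)
        finally show ?thesis using l by simp
      qed
      hence "(\<Sum>j<r. \<Sum>i<r. u j * w i * koszul i j l) =
          (\<Sum>j<r. (if j = l then u l * comb w else 0) - w l * (u j * g j))"
        by (intro sum.cong) auto
      thus ?thesis by (simp only: sum_subtractf)
    qed
    also have "\<dots> = u l * comb w - w l * comb u" using l by (simp add: comb_def sum_distrib_left)
    also have "\<dots> = comb w * (\<Sum>k<s. coord u k * H k l)" using u coord[OF u l] by simp
    finally show "(\<Sum>k<s. c k * H k l) = 0"
      by (simp add: c_def left_diff_distrib sum_subtractf sum_distrib_left mult.assoc)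
  qed
  thus ?thesis by (simp add: c_def)
qed

lemma extension_homog:
  assumes "\<And>i. i < r \<Longrightarrow> w i \<in> homog (d - a i)" "j < r" "k < s"
  shows "extension w k j \<in> homog (d + a j - b k)"
  unfolding extension_def
proof (rule homog_sum)
  fix i assume "i \<in> {..<r}"
  hence i: "i < r" by simp
  have "coord (koszul i j) k \<in> homog (a i + a j - b k)"
    by (rule coord_homog[OF comb_koszul[OF i assms(2)] _ assms(3)]) (rule koszul_homog[OF i assms(2)])
  from homog_mult[OF assms(1)[OF i] this] show "w i * coord (koszul i j) k \<in> homog (d + a j - b k)"
    by (simp add: algebra_simps)
qed

end

subsection \<open>Vanishing ideals of finite sets of points\<close>

lemma vanishing_ideal_homog_iff:
  assumes "X \<subseteq> proj_plane" "f \<in> homog n"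
  shows "f \<in> vanishing_ideal X \<longleftrightarrow> (\<forall>p\<in>X. eval3 f (rep p) = 0)"
  using vanishes_at_rep[OF assms(2)] assms(1) by (auto simp: vanishing_ideal_def)

lemma vanishing_ideal_closed:
  "0 \<in> vanishing_ideal X" "f \<in> vanishing_ideal X \<Longrightarrow> h \<in> vanishing_ideal X \<Longrightarrow> f + h \<in> vanishing_ideal X"
  "f \<in> vanishing_ideal X \<Longrightarrow> h * f \<in> vanishing_ideal X"
  by (auto simp: vanishing_ideal_def vanishes_at_def)

lemma vanishing_ideal_sum:
  "(\<And>x. x \<in> A \<Longrightarrow> h x \<in> vanishing_ideal X) \<Longrightarrow> sum h A \<in> vanishing_ideal X"
  by (induction A rule: infinite_finite_induct) (auto intro: vanishing_ideal_closed)

text \<open>On the multiples of a vector representing a point, f is a polynomial in the scalar c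
  whose coefficients are the values of the components of f; it vanishes for all nonzero c, and K is
  infinite.\<close>

lemma vanishing_ideal_hcomp:
  fixes f :: "'k::alg_closed_field poly3"
  assumes X: "X \<subseteq> proj_plane" and f: "f \<in> vanishing_ideal X"
  shows "hcomp n f \<in> vanishing_ideal X"
proof (subst vanishing_ideal_homog_iff[OF X hcomp_homog], rule ballI)
  fix p assume p: "p \<in> X"
  let ?v = "rep p"
  have v: "?v \<noteq> 0" "vec.span {?v} = p" using rep p X by blast+
  define C where "C = (\<Sum>i\<le>tdeg f. Polynomial.monom (eval3 (hcomp (int i) f) ?v) i)"
  have "poly C c = eval3 f (c *s ?v)" for c
  proof -
    have "eval3 f (c *s ?v) = (\<Sum>i\<le>tdeg f. eval3 (hcomp (int i) f) (c *s ?v))"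
      by (subst (1) sum_hcomp[OF order.refl, of f, symmetric]) simp
    also have "\<dots> = (\<Sum>i\<le>tdeg f. c ^ i * eval3 (hcomp (int i) f) ?v)"
      by (simp add: eval3_homog_scale[OF hcomp_homog])
    finally show ?thesis by (simp add: C_def poly_sum poly_monom mult.commute)
  qed
  moreover have "eval3 f (c *s ?v) = 0" if "c \<noteq> 0" for c
  proof -
    have "c *s ?v \<in> vec.span {?v}" by (intro vec.span_scale vec.span_base) simp
    hence "c *s ?v \<in> p - {0}" using v that by simp
    thus ?thesis using f p by (auto simp: vanishing_ideal_def vanishes_at_def)
  qed
  ultimately have "UNIV - {0} \<subseteq> {c. poly C c = 0}" by auto
  hence "infinite {c. poly C c = 0}"
    using infinite_UNIV_alg_closed[where 'k = 'k] by (metis finite.emptyI finite_Diff_insert finite_subset Diff_empty)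
  hence C0: "C = 0" using poly_roots_finite by blast
  show "eval3 (hcomp n f) ?v = 0"
  proof (cases "n < 0 \<or> int (tdeg f) < n")
    case True
    have "hcomp n f = 0"
    proof (rule poly_mapping_eqI)
      fix m
      have "mon_deg m \<le> tdeg f" if "Poly_Mapping.lookup f m \<noteq> 0"
        using that by (force simp: tdeg_def in_keys_iff)
      thus "Poly_Mapping.lookup (hcomp n f) m = Poly_Mapping.lookup 0 m"
        using True by (force simp: lookup_hcomp)
    qed
    thus ?thesis by simp
  next
    case False
    then obtain i where i: "n = int i" "i \<le> tdeg f" by (metis linorder_not_le nonneg_int_cases of_nat_le_iff)
    have "coeff C i = eval3 (hcomp (int i) f) ?v"
      using i(2) by (simp add: C_def coeff_sum)
    thus ?thesis using C0 i by simp
  qed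
qed

lemma vanishing_ideal_cancel_line:
  assumes X: "X \<subseteq> proj_plane" and t: "\<And>p. p \<in> X \<Longrightarrow> eval3 (line t) (rep p) \<noteq> 0"
    and f: "line t * f \<in> vanishing_ideal X"
  shows "f \<in> vanishing_ideal X"
  unfolding vanishing_ideal_def vanishes_at_def
proof (intro CollectI ballI)
  fix p v assume p: "p \<in> X" and v: "v \<in> p - {0}"
  have "v \<in> vec.span {rep p}" using rep(2) p X v by blast
  then obtain c where c: "v = c *s rep p" by (auto simp: vec.span_singleton)
  hence "c \<noteq> 0" using v by auto
  moreover have "line t \<in> homog (int 1)" by simp
  ultimately have "eval3 (line t) v \<noteq> 0" using t[OF p] eval3_homog_scale[of "line t" 1 c "rep p"] c by simp
  moreover have "eval3 (line t * f) v = 0" using f p v by (auto simp: vanishing_ideal_def vanishes_at_def)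
  ultimately show "eval3 f v = 0" by simp
qed

text \<open>Each component is infinite, so it has a point outside X; a form that vanishes on X and
  at none of these chosen points is divisible by no factor of F. It can be cancelled modulo F and
  serves as denominator for homomorphisms into S/F.\<close>

lemma coprime_form_through_points:
  fixes F :: "'k::alg_closed_field poly3"
  assumes S: "form_factors F S" and X: "finite X" "X \<subseteq> proj_plane"
  obtains f n where "f \<in> homog (int n)" "f \<in> vanishing_ideal X" "\<And>P. P \<in> S \<Longrightarrow> \<not> P dvd f"
proof -
  note fS = form_factorsD[OF S]
  have "\<exists>x. x \<in> zero_locus {P} \<and> x \<notin> X" if "P \<in> S" for P
  proof -
    obtain p where "p > 0" "P \<in> homog (int p)" using fS(6)[OF \<open>P \<in> S\<close>] by blast
    hence "infinite (zero_locus {P})" using zero_locus_infinite by blast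
    thus ?thesis using X(1) finite_subset[of "zero_locus {P}" X] by blast
  qed
  then obtain x where x: "\<And>P. P \<in> S \<Longrightarrow> x P \<in> zero_locus {P}" "\<And>P. P \<in> S \<Longrightarrow> x P \<notin> X" by metis
  define Y where "Y = x ` S"
  have Y: "finite Y" "Y \<subseteq> proj_plane" "Y \<inter> X = {}" using fS(1) x by (auto simp: Y_def zero_locus_def)
  define n where "n = card (X \<union> Y)"
  have "\<exists>h. h \<in> homog (int n) \<and> eval3 h (rep q) \<noteq> 0 \<and> (\<forall>q'\<in>(X \<union> Y) - {q}. eval3 h (rep q') = 0)" if q: "q \<in> Y" for q
  proof -
    have "finite (X \<union> Y)" "X \<union> Y \<subseteq> proj_plane" "q \<in> X \<union> Y" using X Y q by auto
    then obtain h where "h \<in> homog (int n)" "eval3 h (rep q) \<noteq> 0" "\<And>q'. q' \<in> (X \<union> Y) - {q} \<Longrightarrow> eval3 h (rep q') = 0"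
      using interpolating_form[of "X \<union> Y" q n] unfolding n_def by blast
    thus ?thesis by blast
  qed
  then obtain h where h: "\<And>q. q \<in> Y \<Longrightarrow> h q \<in> homog (int n)" "\<And>q. q \<in> Y \<Longrightarrow> eval3 (h q) (rep q) \<noteq> 0"
    "\<And>q q'. q \<in> Y \<Longrightarrow> q' \<in> (X \<union> Y) - {q} \<Longrightarrow> eval3 (h q) (rep q') = 0" by metis
  define f where "f = (\<Sum>q\<in>Y. h q)"
  have f: "f \<in> homog (int n)" unfolding f_def by (intro homog_sum h(1))
  moreover have "f \<in> vanishing_ideal X"
  proof (subst vanishing_ideal_homog_iff[OF X(2) f], rule ballI)
    fix p assume p: "p \<in> X"
    have "eval3 (h q) (rep p) = 0" if "q \<in> Y" for q using h(3)[OF that, of p] p that Y(3) by blast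
    thus "eval3 f (rep p) = 0" by (simp add: f_def)
  qed
  moreover have "\<not> P dvd f" if P: "P \<in> S" for P
  proof
    assume "P dvd f"
    have xP: "x P \<in> Y" using P by (simp add: Y_def)
    obtain m where m: "P \<in> homog m" using fS(6)[OF P] by blast
    have "eval3 P (rep (x P)) = 0" using x(1)[OF P] zero_locus_form[OF m] by blast
    hence "eval3 f (rep (x P)) = 0" using \<open>P dvd f\<close> by (auto simp: dvd_def)
    moreover have "eval3 f (rep (x P)) = (\<Sum>q\<in>{x P}. eval3 (h q) (rep (x P)))"
      unfolding f_def eval3_simps(7) by (rule sum.mono_neutral_right) (use Y xP h(3) in auto)
    ultimately show False using h(2)[OF xP] by simp
  qed
  ultimately show ?thesis using that by blast
qed

text \<open>Over an algebraically closed field a binary form in x and f is a product of factors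
  linear in x and powers of f; the prime P does not divide f, so it divides one of the
  former.\<close>

lemma prime_dvd_homogenize:
  fixes P :: "'k::alg_closed_field poly3"
  assumes P: "prime_elem P" "\<not> P dvd f" and C: "C \<noteq> 0" "degree C \<le> D" "P dvd homogenize x f D C"
  shows "\<exists>c. P dvd x - const3 c * f"
  using C
proof (induction D arbitrary: C)
  case 0
  then obtain c where c: "C = [:c:]" "c \<noteq> 0" by (metis degree_eq_zeroE le_zero_eq pCons_0_0)
  hence "P dvd const3 (1 / c) * const3 c" using 0 by (simp add: homogenize_def)
  hence "P dvd 1" using c(2) by (simp add: const3_mult[symmetric])
  thus ?case using P(1) by (auto simp: prime_elem_def)
next
  case (Suc D)
  show ?case
  proof (cases "degree C = 0")
    case True
    then obtain c where c: "C = [:c:]" "c \<noteq> 0" using Suc.prems by (metis degree_eq_zeroE pCons_0_0)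
    have "homogenize x f (Suc D) C = (\<Sum>j\<in>{0}. const3 (coeff C j) * x ^ j * f ^ (Suc D - j))"
      unfolding homogenize_def by (rule sum.mono_neutral_right) (auto simp: c coeff_pCons split: nat.splits)
    hence "P dvd const3 c * f ^ Suc D" using Suc.prems(3) c(1) by simp
    hence "P dvd const3 (1 / c) * (const3 c * f ^ Suc D)" by (rule dvd_mult)
    moreover have "const3 (1 / c) * (const3 c * f ^ Suc D) = f ^ Suc D"
      using c(2) by (simp add: mult.assoc[symmetric] const3_mult[symmetric])
    ultimately have "P dvd f ^ Suc D" by metis
    thus ?thesis using prime_elem_dvd_power[OF P(1)] P(2) by blast
  next
    case False
    then obtain c where "poly C c = 0" using alg_closed_imp_poly_has_root by blast
    then obtain C' where C': "C = [:- c, 1:] * C'" by (auto simp: poly_eq_0_iff_dvd dvd_def)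
    hence nz: "C' \<noteq> 0" using Suc.prems(1) by auto
    hence "degree C = Suc (degree C')" unfolding C' by (subst degree_mult_eq) auto
    hence d: "degree C' \<le> D" using Suc.prems(2) by simp
    have "P dvd (x - const3 c * f) * homogenize x f D C'"
      using Suc.prems(3) unfolding C' homogenize_linear_factor[OF d] .
    hence "P dvd x - const3 c * f \<or> P dvd homogenize x f D C'"
      by (simp add: prime_elem_dvd_mult_iff[OF P(1)])
    thus ?thesis using Suc.IH[OF nz d] by blast
  qed
qed

definition vec_pm :: "nat \<Rightarrow> (nat \<Rightarrow> 'b) \<Rightarrow> (nat \<Rightarrow>\<^sub>0 'b::comm_monoid_add)" where
  "vec_pm r u = (\<Sum>j<r. Poly_Mapping.single j (u j))"

lemma lookup_vec_pm [simp]: "Poly_Mapping.lookup (vec_pm r u) j = (if j < r then u j else 0)"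
  by (simp add: vec_pm_def lookup_sum lookup_single when_def)

lemma keys_vec_pm: "Poly_Mapping.keys (vec_pm r u) \<subseteq> {..<r}"
  by (auto simp: in_keys_iff split: if_splits)

subsection \<open>Syzygies of singular points of a plane curve\<close>

locale curve_resolution = resolution "vanishing_ideal \<Gamma>" t r a g s b H
  for \<Gamma> :: "('k::alg_closed_field ^ 3) set set" and t r a g s b H +
  fixes F :: "'k poly3" and d :: nat and S :: "'k poly3 set"
  assumes S: "form_factors F S" and F: "F \<in> homog (int d)" and S_ne: "S \<noteq> {}"
    and fin_\<Gamma>: "finite \<Gamma>" and sing: "\<Gamma> \<subseteq> singular_points F"
    and g_min: "j < r \<Longrightarrow> g j \<noteq> (\<Sum>i\<in>{..<r} - {j}. c i * g i)"
begin

abbreviation "I \<equiv> vanishing_ideal \<Gamma>"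

lemmas fS = form_factorsD[OF S]

lemma \<Gamma>_sub: "\<Gamma> \<subseteq> proj_plane"
  using sing singular_pointsD[OF _ F] by blast

lemma F_in_I: "F \<in> I"
  using vanishing_ideal_homog_iff[OF \<Gamma>_sub F] sing singular_pointsD[OF _ F] by blast

lemma F_nz: "F \<noteq> 0"
  using fS(1,2,7) by (metis prod_zero_iff)

lemma F_dvdI: "(\<And>P. P \<in> S \<Longrightarrow> P dvd x) \<Longrightarrow> F dvd x"
  by (rule form_factors_dvd[OF S])

lemma dvd_F: "P \<in> S \<Longrightarrow> P dvd F"
  using fS(1,2) by (auto intro: dvd_prodI)

definition w where "w = (SOME w. (\<forall>i. w i \<in> homog (int d - a i)) \<and> F = comb w)"

lemma w: "w i \<in> homog (int d - a i)" "comb w = F"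
proof -
  obtain c where "\<And>j. c j \<in> homog (int d - a j)" "F = comb c" using I_homog_rep[OF F_in_I F] by blast
  hence "\<exists>w. (\<forall>i. w i \<in> homog (int d - a i)) \<and> F = comb w" by blast
  hence "(\<forall>i. w i \<in> homog (int d - a i)) \<and> F = comb w" unfolding w_def by (rule someI_ex)
  thus "w i \<in> homog (int d - a i)" "comb w = F" by auto
qed

lemma coprime_form:
  obtains f n where "f \<in> homog (int n)" "f \<in> I" "\<And>P. P \<in> S \<Longrightarrow> \<not> P dvd f"
  using coprime_form_through_points[OF S fin_\<Gamma> \<Gamma>_sub] by blast

definition app :: "(nat \<Rightarrow> 'k poly3) \<Rightarrow> (nat \<Rightarrow> 'k poly3) \<Rightarrow> 'k poly3" where
  "app \<psi> u = (\<Sum>j<r. u j * \<psi> j)"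

lemma app_simps:
  "app \<psi> (\<lambda>j. u j - u' j) = app \<psi> u - app \<psi> u'" "app \<psi> (\<lambda>j. c * u j) = c * app \<psi> u"
  by (simp_all add: app_def left_diff_distrib sum_subtractf sum_distrib_left mult.assoc)

lemma app_unit: "j < r \<Longrightarrow> app \<psi> (\<lambda>l. if l = j then c else 0) = c * \<psi> j"
proof -
  assume "j < r"
  have "app \<psi> (\<lambda>l. if l = j then c else 0) = (\<Sum>l<r. if l = j then c * \<psi> j else 0)"
    unfolding app_def by (rule sum.cong) auto
  thus ?thesis using \<open>j < r\<close> by simp
qed

text \<open>The lifts of the homomorphisms of degree \<open>-\<delta>\<close> from the ideal to \<open>S/F\<close>.\<close>

definition curve_hom :: "int \<Rightarrow> (nat \<Rightarrow> 'k poly3) \<Rightarrow> bool" where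
  "curve_hom \<delta> \<psi> \<longleftrightarrow> (\<forall>j<r. \<psi> j \<in> homog (a j - \<delta>)) \<and> (\<forall>u. comb u = 0 \<longrightarrow> F dvd app \<psi> u)"

text \<open>The vector \<open>comb c\<close> times c' minus \<open>comb c'\<close> times c is a
  syzygy. The resulting symmetry makes a homomorphism into S/F the multiplication by a
  fraction.\<close>

lemma pairing:
  assumes "curve_hom \<delta> \<psi>"
  shows "F dvd comb c * app \<psi> c' - comb c' * app \<psi> c"
proof -
  have "comb (\<lambda>j. comb c * c' j - comb c' * c j) = 0" by (simp add: comb_simps)
  hence "F dvd app \<psi> (\<lambda>j. comb c * c' j - comb c' * c j)" using assms by (simp add: curve_hom_def)
  thus ?thesis by (simp only: app_simps)
qed

text \<open>At a point of \<open>\<Gamma>\<close> where some \<open>\<psi>\<^sub>j\<close> does not vanish, the gradients of all elements of the ideal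
  would be proportional, since \<open>F\<close> has gradient zero there.\<close>

lemma curve_hom_in_I:
  assumes \<psi>: "curve_hom \<delta> \<psi>" and j0: "j0 < r"
  shows "\<psi> j0 \<in> I"
proof -
  have \<psi>h: "\<psi> j0 \<in> homog (a j0 - \<delta>)" using \<psi> j0 by (simp add: curve_hom_def)
  show ?thesis
  proof (subst vanishing_ideal_homog_iff[OF \<Gamma>_sub \<psi>h], rule ballI, rule ccontr)
    fix p assume p: "p \<in> \<Gamma>" and nz: "eval3 (\<psi> j0) (rep p) \<noteq> 0"
    let ?v = "rep p"
    have pp: "p \<in> proj_plane" using p \<Gamma>_sub by blast
    obtain i where i: "?v $ i \<noteq> 0" using rep(1)[OF pp] by (auto simp: Finite_Cartesian_Product.vec_eq_iff)
    obtain j k where ijk: "j \<noteq> i" "k \<noteq> i" "k \<noteq> j"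
    proof -
      have "(1 :: 3) \<noteq> 2" "(1 :: 3) \<noteq> 3" "(2 :: 3) \<noteq> 3" by auto
      thus ?thesis using that exhaust_3[of i] by metis
    qed
    \<comment> \<open>This form isolates p within \<Gamma>: multiplied by it, the linear forms
      vanishing at p lie in I.\<close>
    obtain e where e: "e \<in> homog (int (card \<Gamma>))" "eval3 e ?v \<noteq> 0" "\<And>q. q \<in> \<Gamma> - {p} \<Longrightarrow> eval3 e (rep q) = 0"
      using interpolating_form[OF fin_\<Gamma> \<Gamma>_sub p order.refl] by blast
    have gI: "g j0 \<in> I" using comb_in_I[of "\<lambda>l. if l = j0 then 1 else 0"] comb_unit[OF j0, of 1] by simp
    have g0: "eval3 (g j0) ?v = 0" using gI vanishing_ideal_homog_iff[OF \<Gamma>_sub g_hom[OF j0]] p by blast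
    have grad: "\<exists>c. \<forall>m. deriv_at ?v m f * eval3 (\<psi> j0) ?v = deriv_at ?v m (g j0) * c" if f: "f \<in> I" "f \<in> homog n" for f n
    proof -
      obtain c where c: "f = comb c" using f(1) I_iff_comb by blast
      have f0: "eval3 f ?v = 0" using f vanishing_ideal_homog_iff[OF \<Gamma>_sub f(2)] p by blast
      have "F dvd f * \<psi> j0 - g j0 * app \<psi> c"
        using pairing[OF \<psi>, of c "\<lambda>l. if l = j0 then 1 else 0"] by (simp add: comb_unit[OF j0] app_unit[OF j0] c)
      then obtain E where E: "f * \<psi> j0 - g j0 * app \<psi> c = F * E" by (auto simp: dvd_def)
      have "deriv_at ?v m f * eval3 (\<psi> j0) ?v = deriv_at ?v m (g j0) * eval3 (app \<psi> c) ?v" for m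
      proof -
        \<comment> \<open>F and all its derivatives vanish at the point, so every multiple of F has
          derivative 0 there.\<close>
        have "deriv_at ?v m (f * \<psi> j0 - g j0 * app \<psi> c) = 0"
          unfolding E using singular_pointsD(2,3)[OF _ F] sing p by auto
        thus ?thesis by (simp add: f0 g0)
      qed
      thus ?thesis by blast
    qed
    have mem: "point_form ?v i l * e \<in> I" "point_form ?v i l * e \<in> homog (1 + int (card \<Gamma>))" for l
    proof -
      show h: "point_form ?v i l * e \<in> homog (1 + int (card \<Gamma>))" by (intro homog_mult e(1) point_form_homog)
      have "eval3 (point_form ?v i l * e) (rep q) = 0" if "q \<in> \<Gamma>" for q
        using e(3)[of q] that by (cases "q = p") (auto simp: point_form_def)
      thus "point_form ?v i l * e \<in> I" using vanishing_ideal_homog_iff[OF \<Gamma>_sub h] by blast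
    qed
    have der: "deriv_at ?v m (point_form ?v i l * e) = (if m = l then ?v $ i else 0) * eval3 e ?v" if "m \<noteq> i" for m l
      using that by (simp add: point_form_def)
    obtain c1 where c1: "\<And>m. deriv_at ?v m (point_form ?v i j * e) * eval3 (\<psi> j0) ?v = deriv_at ?v m (g j0) * c1"
      using grad[OF mem] by blast
    obtain c2 where c2: "\<And>m. deriv_at ?v m (point_form ?v i k * e) * eval3 (\<psi> j0) ?v = deriv_at ?v m (g j0) * c2"
      using grad[OF mem] by blast
    \<comment> \<open>In the coordinates j and k the gradients of the two elements of I are
      independent, yet both are proportional to the gradient of \<open>g j0\<close>.\<close>
    have "c1 \<noteq> 0" using c1[of j] der[of j j] ijk i e(2) nz by auto
    hence "deriv_at ?v k (g j0) = 0" using c1[of k] der[of k j] ijk by auto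
    thus False using c2[of k] der[of k k] ijk i e(2) nz by auto
  qed
qed

lemma app_homog:
  assumes "curve_hom \<delta> \<psi>" "\<And>j. j < r \<Longrightarrow> c j \<in> homog (n - a j)"
  shows "app \<psi> c \<in> homog (n - \<delta>)"
  unfolding app_def
proof (rule homog_sum)
  fix j assume "j \<in> {..<r}"
  hence "\<psi> j \<in> homog (a j - \<delta>)" "c j \<in> homog (n - a j)" using assms by (auto simp: curve_hom_def)
  from homog_mult[OF this(2,1)] show "c j * \<psi> j \<in> homog (n - \<delta>)" by simp
qed

lemma app_in_I:
  assumes "curve_hom \<delta> \<psi>"
  shows "app \<psi> c \<in> I"
  unfolding app_def by (intro vanishing_ideal_sum vanishing_ideal_closed(3)) (use curve_hom_in_I[OF assms] in auto)

text \<open>The values lie in I, so \<psi> can be applied repeatedly to f. Modulo F it is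
  multiplication by the fraction of \<open>fs 1\<close> and f, so the iterates come from powers of
  this fraction; denominators are cleared here.\<close>

lemma curve_hom_iterates:
  assumes \<psi>: "curve_hom \<delta> \<psi>" and f: "f \<in> I" "f \<in> homog n"
  obtains fs where "fs 0 = f" "\<And>i. fs i \<in> homog (n - int i * \<delta>)" "\<And>i. F dvd f ^ i * fs (Suc i) - fs 1 ^ Suc i"
    "\<And>j. j < r \<Longrightarrow> F dvd f * \<psi> j - g j * fs 1"
proof -
  have "\<exists>fs. fs 0 = f \<and> (\<forall>i. (fs i \<in> I \<and> fs i \<in> homog (n - int i * \<delta>)) \<and> (\<exists>c. fs i = comb c \<and> fs (Suc i) = app \<psi> c))"
  proof -
    \<comment> \<open>A representation of each iterate by the generators is chosen anew, because
      \<open>app\<close> depends on it, though only modulo F.\<close>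
    have "\<exists>fs. \<forall>i. ((fs i \<in> I \<and> fs i \<in> homog (n - int i * \<delta>)) \<and> (i = 0 \<longrightarrow> fs i = f)) \<and> (\<exists>c. fs i = comb c \<and> fs (Suc i) = app \<psi> c)"
    proof (rule dependent_nat_choice)
      show "\<exists>x. (x \<in> I \<and> x \<in> homog (n - int 0 * \<delta>)) \<and> ((0::nat) = 0 \<longrightarrow> x = f)" using f by auto
      fix x :: "'k poly3" and i :: nat
      assume "(x \<in> I \<and> x \<in> homog (n - int i * \<delta>)) \<and> (i = 0 \<longrightarrow> x = f)"
      then obtain c where c: "\<And>j. c j \<in> homog (n - int i * \<delta> - a j)" "x = comb c" using I_homog_rep by blast
      have "app \<psi> c \<in> homog (n - int i * \<delta> - \<delta>)" by (rule app_homog[OF \<psi> c(1)])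
      hence "app \<psi> c \<in> homog (n - int (Suc i) * \<delta>)" by (simp add: algebra_simps)
      thus "\<exists>y. ((y \<in> I \<and> y \<in> homog (n - int (Suc i) * \<delta>)) \<and> (Suc i = 0 \<longrightarrow> y = f)) \<and> (\<exists>c. x = comb c \<and> y = app \<psi> c)"
        using app_in_I[OF \<psi>] c(2) by blast
    qed
    thus ?thesis by blast
  qed
  then obtain fs where fs: "fs 0 = f" "\<And>i. fs i \<in> homog (n - int i * \<delta>)" "\<And>i. \<exists>c. fs i = comb c \<and> fs (Suc i) = app \<psi> c" by blast
  obtain c0 where c0: "f = comb c0" "fs 1 = app \<psi> c0" using fs(3)[of 0] fs(1) by auto
  have step: "F dvd f * fs (Suc i) - fs i * fs 1" for i
  proof -
    obtain c where "fs i = comb c" "fs (Suc i) = app \<psi> c" using fs(3) by blast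
    thus ?thesis using pairing[OF \<psi>, of c0 c] c0 by simp
  qed
  have "F dvd f ^ i * fs (Suc i) - fs 1 ^ Suc i" for i
  proof (induction i)
    case (Suc i)
    have "f ^ Suc i * fs (Suc (Suc i)) - fs 1 ^ Suc (Suc i) =
        f ^ i * (f * fs (Suc (Suc i)) - fs (Suc i) * fs 1) + fs 1 * (f ^ i * fs (Suc i) - fs 1 ^ Suc i)"
      by (simp add: algebra_simps)
    thus ?case using Suc step[of "Suc i"] by (simp only: dvd_add dvd_mult)
  qed simp
  moreover have "F dvd f * \<psi> j - g j * fs 1" if "j < r" for j
    using pairing[OF \<psi>, of c0 "\<lambda>l. if l = j then 1 else 0"] that by (simp add: c0(1) c0(2)[unfolded One_nat_def] comb_unit app_unit)
  ultimately show ?thesis using that fs by blast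
qed

text \<open>The iterate after n + 1 steps has negative degree and is 0, so F divides a power of
  \<open>fs 1\<close>. Each prime factor of F then divides \<open>fs 1\<close>, and f is
  cancelled.\<close>

lemma curve_hom_negative:
  assumes \<psi>: "curve_hom \<delta> \<psi>" and \<delta>: "\<delta> > 0" and j: "j < r"
  shows "F dvd \<psi> j"
proof -
  obtain f n where f: "f \<in> homog (int n)" "f \<in> I" "\<And>P. P \<in> S \<Longrightarrow> \<not> P dvd f" using coprime_form by blast
  obtain fs where fs: "fs 0 = f" "\<And>i. fs i \<in> homog (int n - int i * \<delta>)" "\<And>i. F dvd f ^ i * fs (Suc i) - fs 1 ^ Suc i"
    "\<And>j. j < r \<Longrightarrow> F dvd f * \<psi> j - g j * fs 1"
    using curve_hom_iterates[OF \<psi> f(2,1)] by blast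
  have "int n - int (Suc n) * \<delta> < 0"
  proof -
    have "int (Suc n) * 1 \<le> int (Suc n) * \<delta>" using \<delta> by (intro mult_left_mono) auto
    moreover have "int n < int (Suc n) * 1" by simp
    ultimately show ?thesis by (simp only: diff_less_0_iff_less)
  qed
  hence "fs (Suc n) = 0" using homog_neg fs(2) by blast
  hence Fa: "F dvd fs 1 ^ Suc n" using fs(3)[of n] by simp
  show ?thesis
  proof (rule F_dvdI)
    fix P assume P: "P \<in> S"
    have "P dvd fs 1 ^ Suc n" using dvd_F[OF P] Fa by (rule dvd_trans)
    hence "P dvd fs 1" by (rule prime_elem_dvd_power[OF fS(3)[OF P]])
    moreover have "P dvd f * \<psi> j - g j * fs 1" using dvd_F[OF P] fs(4)[OF j] by (rule dvd_trans)
    ultimately have "P dvd (f * \<psi> j - g j * fs 1) + g j * fs 1" by (intro dvd_add dvd_mult)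
    hence "P dvd f * \<psi> j" by simp
    thus "P dvd \<psi> j" using f(3)[OF P] by (simp add: prime_elem_dvd_mult_iff[OF fS(3)[OF P]])
  qed
qed

text \<open>On each component a homomorphism of degree \<open>0\<close> is a scalar, because it has a minimal polynomial
  over \<open>K\<close>.\<close>

lemma curve_hom_scalar:
  assumes \<psi>: "curve_hom 0 \<psi>" and P: "P \<in> S"
  shows "\<exists>c. \<forall>j<r. P dvd \<psi> j - const3 c * g j"
proof -
  obtain f n where f: "f \<in> homog (int n)" "f \<in> I" "\<And>P. P \<in> S \<Longrightarrow> \<not> P dvd f" using coprime_form by blast
  obtain fs where fs: "fs 0 = f" "\<And>i. fs i \<in> homog (int n - int i * 0)" "\<And>i. F dvd f ^ i * fs (Suc i) - fs 1 ^ Suc i"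
    "\<And>j. j < r \<Longrightarrow> F dvd f * \<psi> j - g j * fs 1"
    using curve_hom_iterates[OF \<psi> f(2,1)] by blast
  have prime: "prime_elem P" by (rule fS(3)[OF P])
  \<comment> \<open>The dimension of the forms of degree n, where all iterates lie; so
    \<open>?D + 1\<close> of them are dependent, and the relation C is a polynomial equation over
    K.\<close>
  let ?D = "card (monomials n :: 'k poly3 set)"
  have "\<not> card {..?D} \<le> ?D" by simp
  moreover have "fs ` {..?D} \<subseteq> pvs.span (monomials n)" using fs(2) homog_subset_span_monomials[of n, where 'k = 'k] by auto
  ultimately have "\<not> (\<forall>c. (\<Sum>i\<le>?D. const3 (c i) * fs i) = 0 \<longrightarrow> (\<forall>i\<in>{..?D}. c i = 0))"
    using pvs.independent_family_card_le[of "{..?D}" "monomials n" fs] by auto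
  then obtain c i0 where c: "(\<Sum>i\<le>?D. const3 (c i) * fs i) = 0" "i0 \<le> ?D" "c i0 \<noteq> 0" by auto
  define C where "C = (\<Sum>i\<le>?D. Polynomial.monom (c i) i)"
  have cC: "coeff C i = (if i \<le> ?D then c i else 0)" for i by (simp add: C_def coeff_sum)
  have "C \<noteq> 0" using c cC[of i0] by auto
  moreover have "degree C \<le> ?D" by (rule degree_le) (simp add: cC)
  moreover have "P dvd homogenize (fs 1) f ?D C"
  proof -
    \<comment> \<open>Multiplication by \<open>f ^ ?D\<close> turns the i-th iterate into f times a
      monomial in \<open>fs 1\<close> and f, which makes the linear relation a binary form.\<close>
    have summand: "F dvd f ^ ?D * fs i - f * (fs 1 ^ i * f ^ (?D - i))" if i: "i \<le> ?D" for i
    proof (cases i)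
      case 0
      thus ?thesis by (simp add: fs(1) mult.commute)
    next
      case (Suc m)
      have "f ^ ?D = f * (f ^ m * f ^ (?D - i))"
        using i Suc by (simp add: power_add[symmetric] power_Suc[symmetric] del: power_Suc)
      hence "f ^ ?D * fs i - f * (fs 1 ^ i * f ^ (?D - i)) = (f * f ^ (?D - i)) * (f ^ m * fs (Suc m) - fs 1 ^ Suc m)"
        by (simp add: Suc algebra_simps)
      thus ?thesis using fs(3)[of m] by simp
    qed
    have "F dvd (\<Sum>i\<le>?D. const3 (c i) * (f ^ ?D * fs i - f * (fs 1 ^ i * f ^ (?D - i))))"
      using summand by (intro dvd_sum dvd_mult) simp
    also have "(\<Sum>i\<le>?D. const3 (c i) * (f ^ ?D * fs i - f * (fs 1 ^ i * f ^ (?D - i)))) =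
        f ^ ?D * (\<Sum>i\<le>?D. const3 (c i) * fs i) - f * homogenize (fs 1) f ?D C"
      by (simp add: homogenize_def cC right_diff_distrib sum_subtractf sum_distrib_left mult_ac)
    finally have "F dvd f * homogenize (fs 1) f ?D C" by (simp add: c(1))
    hence "P dvd f * homogenize (fs 1) f ?D C" using dvd_F[OF P] dvd_trans by blast
    thus ?thesis using f(3)[OF P] by (simp add: prime_elem_dvd_mult_iff[OF prime])
  qed
  ultimately obtain e where e: "P dvd fs 1 - const3 e * f"
    using prime_dvd_homogenize[OF prime f(3)[OF P]] by blast
  have "P dvd \<psi> j - const3 e * g j" if j: "j < r" for j
  proof -
    have "f * (\<psi> j - const3 e * g j) = (f * \<psi> j - g j * fs 1) + g j * (fs 1 - const3 e * f)"
      by (simp add: algebra_simps)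
    moreover have "P dvd f * \<psi> j - g j * fs 1" using dvd_F[OF P] fs(4)[OF j] by (rule dvd_trans)
    ultimately have "P dvd f * (\<psi> j - const3 e * g j)" using e by (simp only: dvd_add dvd_mult)
    thus ?thesis using f(3)[OF P] by (simp add: prime_elem_dvd_mult_iff[OF prime])
  qed
  thus ?thesis by blast
qed

text \<open>On a syzygy u it takes the value F times the k-th coordinate of u, by
  \<open>extension_eq\<close>.\<close>

lemma curve_hom_extension:
  assumes k: "k < s"
  shows "curve_hom (b k - int d) (extension w k)"
  unfolding curve_hom_def
proof (intro conjI allI impI)
  fix j assume "j < r"
  thus "extension w k j \<in> homog (a j - (b k - int d))"
    using extension_homog[of w "int d" j k] w(1) k by (simp add: algebra_simps)
next
  fix u assume "comb u = 0"
  thus "F dvd app (extension w k) u" unfolding app_def by (simp add: extension_eq[OF _ k] w(2))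
qed

lemma g_nz: "j < r \<Longrightarrow> g j \<noteq> 0"
  using g_min[of j "\<lambda>_. 0"] by simp

text \<open>An entry of degree 0 would be a nonzero constant and would express \<open>g j\<close> by
  the other generators.\<close>

lemma H_no_unit:
  assumes "k < s" "j < r" "H k j \<noteq> 0" shows "b k > a j"
proof -
  have "b k - a j \<ge> 0" using homog_neg[OF _ H_hom[OF assms(1,2)]] assms(3) by linarith
  moreover have "b k \<noteq> a j"
  proof
    assume "b k = a j"
    then obtain c where c: "H k j = const3 c" using homog_0_const[of "H k j"] H_hom[OF assms(1,2)] by auto
    hence c0: "c \<noteq> 0" using assms(3) by auto
    have "const3 c * g j + (\<Sum>i\<in>{..<r} - {j}. H k i * g i) = 0"
      using H_syz[OF assms(1)] sum.remove[of "{..<r}" j "\<lambda>i. H k i * g i"] assms(2) c by (simp add: comb_def)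
    hence "const3 c * g j = - (\<Sum>i\<in>{..<r} - {j}. H k i * g i)" by (simp only: eq_neg_iff_add_eq_0)
    hence "const3 (1 / c) * (const3 c * g j) = const3 (1 / c) * (- (\<Sum>i\<in>{..<r} - {j}. H k i * g i))" by (rule arg_cong)
    moreover have "const3 (1 / c) * (const3 c * g j) = g j" using c0 by (simp add: mult.assoc[symmetric] const3_mult[symmetric])
    ultimately have "g j = (\<Sum>i\<in>{..<r} - {j}. (- const3 (1 / c) * H k i) * g i)"
      by (simp add: sum_distrib_left sum_negf mult.assoc)
    thus False using g_min[OF assms(2), of "\<lambda>i. - const3 (1 / c) * H k i"] by simp
  qed
  ultimately show ?thesis by simp
qed

theorem syzygy_degree_le:
  assumes k: "k < s" shows "b k \<le> int d"
proof (rule ccontr)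
  assume "\<not> b k \<le> int d"
  hence \<delta>: "b k - int d > 0" by simp
  note \<psi> = curve_hom_extension[OF k]
  have "\<forall>j\<in>{..<r}. \<exists>\<eta>. extension w k j = F * \<eta>" using curve_hom_negative[OF \<psi> \<delta>] by (auto simp: dvd_def)
  then obtain \<eta> where \<eta>: "\<And>j. j < r \<Longrightarrow> extension w k j = F * \<eta> j" using bchoice[of "{..<r}" "\<lambda>j \<eta>. extension w k j = F * \<eta>"] by auto
  \<comment> \<open>Evaluation at \<open>H k\<close> itself gives F; dividing by F writes 1 as a
    combination of the entries of \<open>H k\<close>. The nonzero entries have positive degree, so
    their cofactors \<eta> have negative degree and vanish.\<close>
  have "(\<Sum>j<r. H k j * extension w k j) = F * coord (H k) k"
    using extension_eq[OF H_syz[OF k] k] w(2) by simp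
  hence "(\<Sum>j<r. H k j * extension w k j) = F" by (simp add: coord_H[OF k k])
  moreover have "(\<Sum>j<r. H k j * extension w k j) = F * (\<Sum>j<r. H k j * \<eta> j)"
    by (simp add: \<eta> sum_distrib_left mult.left_commute)
  ultimately have "F * (\<Sum>j<r. H k j * \<eta> j) = F * 1" by simp
  hence sum1: "(\<Sum>j<r. H k j * \<eta> j) = 1" using F_nz by (simp only: mult_cancel_left) simp
  have "H k j * \<eta> j = 0" if j: "j < r" for j
  proof (cases "H k j = 0")
    case False
    have "b k > a j" by (rule H_no_unit[OF k j False])
    moreover have "hcomp (a j - b k) (\<eta> j) = \<eta> j"
    proof -
      have "F * \<eta> j \<in> homog (a j - (b k - int d))" using \<psi> j unfolding curve_hom_def \<eta>[OF j, symmetric] by blast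
      hence "F * \<eta> j = F * hcomp (a j - (b k - int d) - int d) (\<eta> j)"
        using hcomp_mult_homog[OF F, of "a j - (b k - int d)" "\<eta> j"] by simp
      thus ?thesis using F_nz by simp
    qed
    hence "\<eta> j \<in> homog (a j - b k)" using hcomp_homog by metis
    ultimately show ?thesis using homog_neg[of "a j - b k" "\<eta> j"] by simp
  qed simp
  hence "(\<Sum>j<r. H k j * \<eta> j) = 0" by (intro sum.neutral) blast
  thus False using sum1 by simp
qed

theorem generator_degree_less:
  assumes j: "j < r" shows "a j < int d"
proof (cases "\<exists>i<r. i \<noteq> j")
  case True
  then obtain i where i: "i < r" "i \<noteq> j" by blast
  \<comment> \<open>This entry is \<open>g i\<close>, which is nonzero, so some generator of the
    syzygies has a nonzero j-th entry.\<close>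
  have "koszul i j j = (\<Sum>k<s. coord (koszul i j) k * H k j)" by (rule coord[OF comb_koszul[OF i(1) j] j])
  hence "(\<Sum>k<s. coord (koszul i j) k * H k j) \<noteq> 0" using g_nz[OF i(1)] i(2) by (simp add: koszul_def)
  then obtain k where k: "k < s" "H k j \<noteq> 0" by (metis (no_types, lifting) mult_zero_right sum.not_neutral_contains_not_neutral lessThan_iff)
  thus ?thesis using H_no_unit[OF k(1) j k(2)] syzygy_degree_le[OF k(1)] by simp
next
  case False
  \<comment> \<open>With a single generator I is principal. It contains F and also a form prime to
    F, so the generator is a unit; the case of empty \<Gamma> falls here.\<close>
  hence "i = j" if "i < r" for i using that by blast
  hence "{..<r} \<subseteq> {j}" by (intro subsetI) simp
  hence "{..<r} = {j}" using j by (intro equalityI) simp_all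
  hence comb1: "comb c = c j * g j" for c by (simp add: comb_def)
  obtain f n where f: "f \<in> homog (int n)" "f \<in> I" "\<And>P. P \<in> S \<Longrightarrow> \<not> P dvd f" using coprime_form by blast
  obtain c where "f = c j * g j" using f(2) I_iff_comb comb1 by metis
  hence ng: "\<not> P dvd g j" if "P \<in> S" for P using f(3)[OF that] by (metis dvd_mult)
  have Fw: "F = w j * g j" using w(2) comb1 by metis
  have "F dvd w j"
  proof (rule F_dvdI)
    fix P assume P: "P \<in> S"
    have "P dvd w j * g j" using dvd_F[OF P] Fw by simp
    thus "P dvd w j" using ng[OF P] by (simp add: prime_elem_dvd_mult_iff[OF fS(3)[OF P]])
  qed
  then obtain x where "w j = F * x" by (auto simp: dvd_def)
  hence "F * (x * g j) = F * 1" using Fw by (simp add: mult.assoc)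
  hence "x * g j = 1" using F_nz by (simp only: mult_cancel_left) simp
  hence "g j dvd 1" by (metis dvd_triv_right)
  moreover obtain m where m: "a j = int m" using homog_pos_degree[OF g_hom[OF j] g_nz[OF j]] by blast
  ultimately have "a j = 0" using homog_unit_iff[of "g j" m] g_hom[OF j] g_nz[OF j] by simp
  moreover have "d > 0"
  proof (rule ccontr)
    assume "\<not> d > 0"
    hence "F dvd 1" using homog_unit_iff[OF F F_nz] by simp
    moreover obtain P where P: "P \<in> S" using S_ne by blast
    ultimately have "P dvd 1" using dvd_F[OF P] dvd_trans by blast
    thus False using fS(4)[OF P] by (simp add: irreducible_def)
  qed
  ultimately show ?thesis by simp
qed

end

section \<open>Two bases of the homomorphisms of degree 0\<close>

lemma family_card_le:
  fixes e :: "'i \<Rightarrow> nat \<Rightarrow> 'k::field poly3" and u :: "'l \<Rightarrow> nat \<Rightarrow> 'k poly3"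
  assumes fin: "finite A" "finite B"
    and span: "\<And>i. i \<in> A \<Longrightarrow> \<exists>x. \<forall>j<r. e i j = (\<Sum>k\<in>B. const3 (x k) * u k j)"
    and ind: "\<And>x. (\<And>j. j < r \<Longrightarrow> (\<Sum>i\<in>A. const3 (x i) * e i j) = 0) \<Longrightarrow> \<forall>i\<in>A. x i = 0"
  shows "card A \<le> card B"
proof -
  let ?u = "\<lambda>k. vec_pm r (u k)"
  have "card A \<le> card (?u ` B)"
  proof (rule fvs.independent_family_card_le[where e = "\<lambda>i. vec_pm r (e i)"])
    show "finite A" "finite (?u ` B)" using fin by simp_all
    show "(\<lambda>i. vec_pm r (e i)) ` A \<subseteq> fvs.span (?u ` B)"
    proof (rule image_subsetI)
      fix i assume "i \<in> A"
      then obtain x where x: "\<And>j. j < r \<Longrightarrow> e i j = (\<Sum>k\<in>B. const3 (x k) * u k j)" using span by blast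
      have "vec_pm r (e i) = (\<Sum>k\<in>B. free_scale (const3 (x k)) (?u k))"
        by (rule poly_mapping_eqI) (simp add: lookup_sum x)
      thus "vec_pm r (e i) \<in> fvs.span (?u ` B)" using fvs.span_image_iff[OF fin(2), of "vec_pm r (e i)" ?u] by blast
    qed
    fix x assume 0: "(\<Sum>i\<in>A. free_scale (const3 (x i)) (vec_pm r (e i))) = 0"
    have "(\<Sum>i\<in>A. const3 (x i) * e i j) = 0" if "j < r" for j
    proof -
      have "Poly_Mapping.lookup (\<Sum>i\<in>A. free_scale (const3 (x i)) (vec_pm r (e i))) j = 0" by (simp add: 0)
      thus ?thesis using that by (simp add: lookup_sum)
    qed
    thus "\<forall>i\<in>A. x i = 0" by (rule ind)
  qed
  also have "\<dots> \<le> card B" by (rule card_image_le[OF fin(2)])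
  finally show ?thesis .
qed

context curve_resolution
begin

text \<open>In degrees below d the quotient S/F agrees with S.\<close>

lemma dvd_low_degree:
  assumes "F dvd x" "x \<in> homog n" "n < int d"
  shows "x = 0"
proof -
  obtain y where y: "x = F * y" using assms(1) by (auto simp: dvd_def)
  have "x = F * hcomp (n - int d) y" using hcomp_mult_homog[OF F, of n y] assms(2) y by simp
  thus ?thesis using homog_neg[OF _ hcomp_homog[of "n - int d" y]] assms(3) by simp
qed

lemma dvd_same_degree:
  assumes "F dvd x" "x \<in> homog (int d)"
  shows "\<exists>c. x = F * const3 c"
proof -
  obtain y where y: "x = F * y" using assms(1) by (auto simp: dvd_def)
  have "x = F * hcomp 0 y" using hcomp_mult_homog[OF F, of "int d" y] assms(2) y by simp
  thus ?thesis using homog_0_const[OF hcomp_homog[of 0 y]] by metis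
qed

lemma r_pos: "r > 0"
proof (rule ccontr)
  assume "\<not> r > 0"
  hence "{..<r} = {}" by simp
  hence "comb w = 0" unfolding comb_def by (simp only: sum.empty)
  thus False using w(2) F_nz by simp
qed

definition top_gens :: "nat set" where "top_gens = {k. k < s \<and> b k = int d}"

text \<open>A basis of the homomorphisms of degree \<open>0\<close> from the ideal to \<open>S/F\<close>: the inclusion and the
  extensions of the dual basis of the syzygies of degree \<open>d\<close>.\<close>

definition syz_basis :: "nat \<Rightarrow> nat \<Rightarrow> 'k poly3" where
  "syz_basis k = (if k = s then g else extension w k)"

lemma top_gens: "finite top_gens" "s \<notin> top_gens" "k \<in> top_gens \<Longrightarrow> k < s" "k \<in> top_gens \<Longrightarrow> b k = int d"
  by (auto simp: top_gens_def)

lemma sum_syz_basis: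
  "(\<Sum>k\<in>insert s top_gens. const3 (x k) * syz_basis k j) =
    const3 (x s) * g j + (\<Sum>k\<in>top_gens. const3 (x k) * extension w k j)"
proof -
  have "(\<Sum>k\<in>top_gens. const3 (x k) * syz_basis k j) = (\<Sum>k\<in>top_gens. const3 (x k) * extension w k j)"
    by (rule sum.cong) (auto simp: syz_basis_def top_gens(2))
  thus ?thesis by (simp add: top_gens(1,2)) (simp add: syz_basis_def)
qed

lemma sum_extension_H:
  assumes l: "l < s"
  shows "(\<Sum>j<r. H l j * (\<Sum>k\<in>top_gens. const3 (x k) * extension w k j)) = (if l \<in> top_gens then const3 (x l) * F else 0)"
proof -
  have "(\<Sum>j<r. H l j * (\<Sum>k\<in>top_gens. const3 (x k) * extension w k j)) =
      (\<Sum>j<r. \<Sum>k\<in>top_gens. const3 (x k) * (H l j * extension w k j))"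
    by (simp add: sum_distrib_left mult.left_commute)
  also have "\<dots> = (\<Sum>k\<in>top_gens. const3 (x k) * (\<Sum>j<r. H l j * extension w k j))"
    by (subst sum.swap) (simp add: sum_distrib_left)
  also have "\<dots> = (\<Sum>k\<in>top_gens. if k = l then const3 (x l) * F else 0)"
  proof (rule sum.cong[OF refl])
    fix k assume "k \<in> top_gens"
    hence k: "k < s" by (rule top_gens(3))
    show "const3 (x k) * (\<Sum>j<r. H l j * extension w k j) = (if k = l then const3 (x l) * F else 0)"
      using extension_eq[OF H_syz[OF l] k] w(2) coord_H[OF l k] by simp
  qed
  finally show ?thesis by (simp add: top_gens(1))
qed

lemma curve_hom_g: "curve_hom 0 g"
  using g_hom by (simp add: curve_hom_def app_def comb_def)

lemma curve_hom_syz_basis: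
  assumes "k \<in> insert s top_gens" shows "curve_hom 0 (syz_basis k)"
proof (cases "k = s")
  case True
  thus ?thesis using curve_hom_g by (simp add: syz_basis_def)
next
  case False
  hence "k \<in> top_gens" using assms by simp
  thus ?thesis using curve_hom_extension[of k] top_gens(3,4)[of k] False by (simp add: syz_basis_def)
qed

text \<open>On \<open>H l\<close> the inclusion gives 0 and the extensions give F times the dual
  basis, which isolates every coefficient but that of the inclusion; this one is then read off at a
  generator of the ideal.\<close>

lemma syz_basis_independent:
  assumes 0: "\<And>j. j < r \<Longrightarrow> (\<Sum>k\<in>insert s top_gens. const3 (x k) * syz_basis k j) = 0"
  shows "\<forall>k\<in>insert s top_gens. x k = 0"
proof -
  have ext: "const3 (x s) * g j + (\<Sum>k\<in>top_gens. const3 (x k) * extension w k j) = 0" if "j < r" for j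
    using 0[OF that] by (simp only: sum_syz_basis)
  have x: "x l = 0" if l: "l \<in> top_gens" for l
  proof -
    have ls: "l < s" by (rule top_gens(3)[OF l])
    have "0 = (\<Sum>j<r. H l j * (const3 (x s) * g j + (\<Sum>k\<in>top_gens. const3 (x k) * extension w k j)))"
      by (rule sum.neutral[symmetric]) (simp add: ext)
    also have "\<dots> = const3 (x s) * comb (H l) + (\<Sum>j<r. H l j * (\<Sum>k\<in>top_gens. const3 (x k) * extension w k j))"
      by (simp add: distrib_left sum.distrib comb_def sum_distrib_left[of "const3 (x s)"] mult.left_commute)
    also have "\<dots> = const3 (x l) * F" unfolding sum_extension_H[OF ls] using l by (simp add: H_syz[OF ls])
    finally show ?thesis using F_nz by simp
  qed
  hence "const3 (x s) * g 0 = 0" using ext[OF r_pos] by simp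
  hence "x s = 0" using g_nz[OF r_pos] by simp
  thus ?thesis using x by blast
qed

text \<open>The values on syzygy generators of degree d are constants times F and are matched by the
  extensions; those on generators of lower degree are multiples of F of degree below d, hence 0.
  What remains kills all syzygies exactly, so it is a homomorphism from I to S, and its value on F
  shows it to be a constant multiple of the inclusion.\<close>

lemma syz_basis_span:
  assumes \<psi>: "curve_hom 0 \<psi>"
  shows "\<exists>x. \<forall>j<r. \<psi> j = (\<Sum>k\<in>insert s top_gens. const3 (x k) * syz_basis k j)"
proof -
  have Fdvd: "F dvd app \<psi> (H k)" if "k < s" for k
    using \<psi> H_syz[OF that] by (simp add: curve_hom_def)
  have hom: "app \<psi> (H k) \<in> homog (b k)" if "k < s" for k
    using app_homog[OF \<psi>, of "H k" "b k"] H_hom[OF that] by simp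
  have "\<exists>x. app \<psi> (H k) = F * const3 x" if k: "k \<in> top_gens" for k
    using dvd_same_degree[OF Fdvd] hom top_gens(3,4)[OF k] by metis
  then obtain x where x: "\<And>k. k \<in> top_gens \<Longrightarrow> app \<psi> (H k) = F * const3 (x k)" by metis
  define \<psi>' where "\<psi>' j = \<psi> j - (\<Sum>k\<in>top_gens. const3 (x k) * extension w k j)" for j
  have H0: "app \<psi>' (H l) = 0" if l: "l < s" for l
  proof -
    have e: "app \<psi>' (H l) = app \<psi> (H l) - (if l \<in> top_gens then const3 (x l) * F else 0)"
      unfolding sum_extension_H[OF l, symmetric] by (simp add: app_def \<psi>'_def right_diff_distrib sum_subtractf)
    show ?thesis
    proof (cases "l \<in> top_gens")
      case True
      thus ?thesis using e x by (simp add: mult.commute)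
    next
      case False
      hence "b l < int d" using syzygy_degree_le[OF l] l by (simp add: top_gens_def)
      thus ?thesis using e False dvd_low_degree[OF Fdvd[OF l] hom[OF l]] by simp
    qed
  qed
  have syz0: "app \<psi>' u = 0" if u: "comb u = 0" for u
  proof -
    have "app \<psi>' u = (\<Sum>j<r. \<Sum>k<s. coord u k * (H k j * \<psi>' j))"
      unfolding app_def by (rule sum.cong) (use coord[OF u] in \<open>simp_all add: sum_distrib_right mult.assoc\<close>)
    also have "\<dots> = (\<Sum>k<s. coord u k * app \<psi>' (H k))"
      by (subst sum.swap) (simp add: app_def sum_distrib_left)
    finally show ?thesis by (simp add: H0)
  qed
  have exchange: "comb c * app \<psi>' c' = comb c' * app \<psi>' c" for c c'
  proof -
    have "comb (\<lambda>j. comb c * c' j - comb c' * c j) = 0" by (simp add: comb_simps)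
    hence "app \<psi>' (\<lambda>j. comb c * c' j - comb c' * c j) = 0" by (rule syz0)
    hence "comb c * app \<psi>' c' - comb c' * app \<psi>' c = 0" by (simp only: app_simps)
    thus ?thesis by (rule eq_iff_diff_eq_0[THEN iffD2])
  qed
  obtain f n where f: "f \<in> homog (int n)" "f \<in> I" "\<And>P. P \<in> S \<Longrightarrow> \<not> P dvd f" using coprime_form by blast
  obtain c0 where c0: "f = comb c0" using f(2) I_iff_comb by blast
  \<comment> \<open>Exchanging F with a form f of I prime to F; after f is cancelled, F divides the
    value on F.\<close>
  have "F dvd f * app \<psi>' w" using exchange[of c0 w] by (simp add: c0 w(2))
  have "F dvd app \<psi>' w"
  proof (rule F_dvdI)
    fix P assume P: "P \<in> S"
    have "P dvd f * app \<psi>' w" using dvd_F[OF P] \<open>F dvd f * app \<psi>' w\<close> by (rule dvd_trans)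
    thus "P dvd app \<psi>' w" using f(3)[OF P] by (simp add: prime_elem_dvd_mult_iff[OF fS(3)[OF P]])
  qed
  moreover have "app \<psi>' w \<in> homog (int d)"
    unfolding app_def
  proof (rule homog_sum)
    fix j assume "j \<in> {..<r}"
    hence j: "j < r" by simp
    have "extension w k j \<in> homog (a j)" if "k \<in> top_gens" for k
      using extension_homog[OF w(1) j, of k] top_gens(3,4)[OF that] by simp
    moreover have "\<psi> j \<in> homog (a j)" using \<psi> j by (simp add: curve_hom_def)
    ultimately have "\<psi>' j \<in> homog (a j)"
      unfolding \<psi>'_def by (intro homog_diff homog_sum homog_const3_mult)
    from homog_mult[OF w(1)[of j] this] show "w j * \<psi>' j \<in> homog (int d)" by simp
  qed
  ultimately obtain c where c: "app \<psi>' w = F * const3 c" using dvd_same_degree by blast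
  have \<psi>'g: "\<psi>' j = const3 c * g j" if j: "j < r" for j
  proof -
    have "F * \<psi>' j = F * (const3 c * g j)"
      using exchange[of w "\<lambda>l. if l = j then 1 else 0"] j by (simp add: comb_unit app_unit w(2) c mult_ac)
    thus ?thesis using F_nz by simp
  qed
  define y where "y = x(s := c)"
  have "\<psi> j = (\<Sum>k\<in>insert s top_gens. const3 (y k) * syz_basis k j)" if j: "j < r" for j
  proof -
    have "(\<Sum>k\<in>top_gens. const3 (y k) * extension w k j) = (\<Sum>k\<in>top_gens. const3 (x k) * extension w k j)"
      by (rule sum.cong) (auto simp: y_def top_gens(2))
    thus ?thesis unfolding sum_syz_basis using \<psi>'g[OF j] by (simp add: y_def \<psi>'_def algebra_simps)
  qed
  thus ?thesis by blast
qed

text \<open>If every generator splits along the factorizations \<open>F = P * \<Prod>(S - {P})\<close>, the homomorphisms of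
  degree \<open>0\<close> have a second basis: the projections to the components.\<close>

theorem card_factors:
  assumes split: "\<And>P f n. P \<in> S \<Longrightarrow> f \<in> homog (int n) \<Longrightarrow> f \<in> I \<Longrightarrow> f \<in> ideal2 P (\<Prod>(S - {P}))"
  shows "card S = Suc (card {k. k < s \<and> b k = int d})"
proof -
  let ?G = "\<lambda>P. \<Prod>(S - {P})"
  \<comment> \<open>The second summand of the splitting of \<open>g j\<close>: it agrees with
    \<open>g j\<close> on the component P and is 0 on the others.\<close>
  have "\<exists>x. x \<in> homog (a j) \<and> ?G P dvd x \<and> P dvd x - g j" if P: "P \<in> S" and j: "j < r" for P j
  proof -
    obtain p q where pq: "P \<in> homog (int p)" "?G P \<in> homog (int q)"
      using form_factors_coprime_cofactor[OF S F P] by metis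
    obtain m where m: "a j = int m" using homog_pos_degree[OF g_hom[OF j] g_nz[OF j]] by blast
    have "g j \<in> homog (int m)" using g_hom[OF j] m by simp
    moreover have "g j \<in> I" using I_iff_comb comb_unit[OF j, of 1] by (metis mult_1)
    ultimately have "g j \<in> ideal2 P (?G P)" using split[OF P] by blast
    then obtain A B where "g j = P * A + ?G P * B" unfolding ideal2_def by blast
    from homog_decomp2[OF g_hom[OF j] pq this] obtain A B where
      AB: "A \<in> homog (a j - int p)" "B \<in> homog (a j - int q)" "g j = P * A + ?G P * B" by blast
    have "?G P * B \<in> homog (a j)" using homog_mult[OF pq(2) AB(2)] by simp
    moreover have "?G P * B - g j = P * (- A)" using AB(3) by simp
    ultimately show ?thesis by (metis dvd_triv_left)
  qed
  then obtain e where e: "\<And>P j. P \<in> S \<Longrightarrow> j < r \<Longrightarrow> e P j \<in> homog (a j)"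
    "\<And>P j. P \<in> S \<Longrightarrow> j < r \<Longrightarrow> ?G P dvd e P j" "\<And>P j. P \<in> S \<Longrightarrow> j < r \<Longrightarrow> P dvd e P j - g j"
    by metis
  have e_other: "Q dvd e P j" if "P \<in> S" "Q \<in> S" "Q \<noteq> P" "j < r" for P Q j
  proof -
    have "Q dvd ?G P" using fS(1) that by (intro dvd_prodI) auto
    thus ?thesis using e(2)[OF that(1,4)] by (rule dvd_trans)
  qed
  have e_hom: "curve_hom 0 (e P)" if P: "P \<in> S" for P
    unfolding curve_hom_def
  proof (intro conjI allI impI)
    fix u assume u: "comb u = 0"
    show "F dvd app (e P) u"
    proof (rule F_dvdI)
      fix Q assume Q: "Q \<in> S"
      show "Q dvd app (e P) u"
      proof (cases "Q = P")
        case True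
        have "app (e P) u = (\<Sum>j<r. u j * (e P j - g j))"
          using u by (simp add: app_def comb_def right_diff_distrib sum_subtractf)
        moreover have "P dvd (\<Sum>j<r. u j * (e P j - g j))" using e(3)[OF P] by (intro dvd_sum dvd_mult) simp
        ultimately show ?thesis using True by simp
      next
        case False
        thus ?thesis unfolding app_def using e_other[OF P Q] by (intro dvd_sum dvd_mult) simp
      qed
    qed
  qed (use e(1)[OF P] in simp)
  have rest: "P dvd (\<Sum>Q\<in>S. const3 (x Q) * e Q j) - const3 (x P) * e P j" if P: "P \<in> S" and j: "j < r" for x P j
  proof -
    have "(\<Sum>Q\<in>S. const3 (x Q) * e Q j) - const3 (x P) * e P j = (\<Sum>Q\<in>S - {P}. const3 (x Q) * e Q j)"
      using sum.remove[OF fS(1) P, of "\<lambda>Q. const3 (x Q) * e Q j"] by simp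
    moreover have "P dvd (\<Sum>Q\<in>S - {P}. const3 (x Q) * e Q j)"
    proof (intro dvd_sum dvd_mult)
      fix Q assume "Q \<in> S - {P}"
      thus "P dvd e Q j" using e_other[of Q P j] P j by auto
    qed
    ultimately show ?thesis by simp
  qed
  have e_span: "\<exists>x. \<forall>j<r. \<psi> j = (\<Sum>P\<in>S. const3 (x P) * e P j)" if \<psi>: "curve_hom 0 \<psi>" for \<psi>
  proof -
    obtain x where x: "\<And>P j. P \<in> S \<Longrightarrow> j < r \<Longrightarrow> P dvd \<psi> j - const3 (x P) * g j" using curve_hom_scalar[OF \<psi>] by metis
    \<comment> \<open>Divisible by every factor of F, and 0 because its degree \<open>a j\<close> is
      below d: the bound on the generators enters here.\<close>
    have "\<psi> j - (\<Sum>P\<in>S. const3 (x P) * e P j) = 0" if j: "j < r" for j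
    proof (rule dvd_low_degree[OF F_dvdI])
      fix P assume P: "P \<in> S"
      have "\<psi> j - (\<Sum>P\<in>S. const3 (x P) * e P j) = (\<psi> j - const3 (x P) * g j) - const3 (x P) * (e P j - g j)
          - ((\<Sum>Q\<in>S. const3 (x Q) * e Q j) - const3 (x P) * e P j)"
        by (simp add: algebra_simps)
      thus "P dvd \<psi> j - (\<Sum>P\<in>S. const3 (x P) * e P j)"
        using x[OF P j] e(3)[OF P j] rest[OF P j, of x] by (simp only: dvd_diff dvd_mult)
    next
      show "\<psi> j - (\<Sum>P\<in>S. const3 (x P) * e P j) \<in> homog (a j)"
        using e(1) j \<psi>[unfolded curve_hom_def, THEN conjunct1, rule_format, OF j]
        by (intro homog_diff homog_sum homog_const3_mult) simp_all
      show "a j < int d" by (rule generator_degree_less[OF j])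
    qed
    thus ?thesis by auto
  qed
  have e_ind: "\<forall>P\<in>S. x P = 0" if x: "\<And>j. j < r \<Longrightarrow> (\<Sum>P\<in>S. const3 (x P) * e P j) = 0" for x
  proof (rule ballI, rule ccontr)
    fix P assume P: "P \<in> S" and nz: "x P \<noteq> 0"
    have Pg: "P dvd g j" if j: "j < r" for j
    proof -
      have "g j = const3 (1 / x P) * (const3 (x P) * g j)"
        using nz by (simp add: mult.assoc[symmetric] const3_mult[symmetric])
      moreover have "const3 (x P) * g j = (\<Sum>Q\<in>S. const3 (x Q) * e Q j)
          - ((\<Sum>Q\<in>S. const3 (x Q) * e Q j) - const3 (x P) * e P j) - const3 (x P) * (e P j - g j)"
        by (simp add: algebra_simps)
      hence "P dvd const3 (x P) * g j"
        using x[OF j] rest[OF P j, of x] e(3)[OF P j] by (simp only: dvd_diff dvd_mult dvd_0_right)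
      ultimately show ?thesis by (metis dvd_mult)
    qed
    \<comment> \<open>P would divide all of I, which contains a form prime to F.\<close>
    obtain f n where f: "f \<in> homog (int n)" "f \<in> I" "\<And>P. P \<in> S \<Longrightarrow> \<not> P dvd f" using coprime_form by blast
    obtain c where "f = comb c" using f(2) I_iff_comb by blast
    moreover have "P dvd comb c" unfolding comb_def using Pg by (intro dvd_sum dvd_mult) simp
    ultimately have "P dvd f" by simp
    thus False using f(3)[OF P] by contradiction
  qed
  have "card S \<le> card (insert s top_gens)"
    by (rule family_card_le[where r = r and e = e and u = syz_basis])
      (use fS(1) top_gens(1) syz_basis_span[OF e_hom] e_ind in auto)
  moreover have "card (insert s top_gens) \<le> card S"
  proof (rule family_card_le[where r = r and e = syz_basis and u = e])
    show "finite (insert s top_gens)" "finite S" using fS(1) top_gens(1) by simp_all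
    show "\<exists>x. \<forall>j<r. syz_basis i j = (\<Sum>k\<in>S. const3 (x k) * e k j)" if "i \<in> insert s top_gens" for i
      by (rule e_span[OF curve_hom_syz_basis[OF that]])
    show "\<forall>i\<in>insert s top_gens. x i = 0" if "\<And>j. j < r \<Longrightarrow> (\<Sum>i\<in>insert s top_gens. const3 (x i) * syz_basis i j) = 0" for x
      by (rule syz_basis_independent[OF that])
  qed
  ultimately have "card S = card (insert s top_gens)" by simp
  thus ?thesis using top_gens(1,2) by (simp add: top_gens_def[symmetric])
qed

end

section \<open>From nodes to splittings; finite generation of ideals and syzygies\<close>

text \<open>A common zero of P and the product of the other factors lies on a second component, so
  it belongs to X and is a node of F. There f vanishes and the node gives transversality, as Max
  Noether's theorem requires. If P is the only factor, the cofactor is 1.\<close>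

lemma component_splitting:
  fixes F :: "'k::alg_closed_field poly3"
  assumes S: "form_factors F S" and F: "F \<in> homog (int d)" and X: "X \<subseteq> proj_plane"
    and nodes: "\<And>Y Z x. Y \<in> irreducible_components (curve_points F) \<Longrightarrow> Z \<in> irreducible_components (curve_points F) \<Longrightarrow>
      Y \<noteq> Z \<Longrightarrow> x \<in> Y \<Longrightarrow> x \<in> Z \<Longrightarrow> x \<in> X \<and> ordinary_node F x"
    and P: "P \<in> S" and f: "f \<in> homog (int n)" "f \<in> vanishing_ideal X"
  shows "f \<in> ideal2 P (\<Prod>(S - {P}))"
proof (cases "S = {P}")
  case True
  hence "\<Prod>(S - {P}) = 1" by simp
  thus ?thesis using ideal2I[of P 0 1 f] by simp
next
  case False
  let ?G = "\<Prod>(S - {P})"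
  note fS = form_factorsD[OF S]
  obtain p g where pg: "p > 0" "P \<in> homog (int p)" "?G \<in> homog (int g)" "coprime_forms p g P ?G" "F = P * ?G"
    "S \<noteq> {P} \<Longrightarrow> g > 0"
    using form_factors_coprime_cofactor[OF S F P] by metis
  have meet: "vec.span {w} \<in> X \<and> ordinary_node F (vec.span {w})" if w: "w \<noteq> 0" "eval3 P w = 0" "eval3 ?G w = 0" for w
  proof -
    have "(\<Prod>Q\<in>S - {P}. eval3 Q w) = 0" using w(3) by simp
    then obtain Q where Q: "Q \<in> S" "Q \<noteq> P" "eval3 Q w = 0" using fS(1) by (auto simp: prod_zero_iff)
    have on: "vec.span {w} \<in> zero_locus {R}" if R: "R \<in> S" "eval3 R w = 0" for R
    proof -
      obtain m where m: "R \<in> homog m" using fS(6)[OF R(1)] by blast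
      show ?thesis using R(2) span_in_proj_plane[OF w(1)] eval3_rep_span[OF m w(1)] by (simp add: zero_locus_form[OF m])
    qed
    have "zero_locus {P} \<noteq> zero_locus {Q}"
      using inj_onD[OF irreducible_components_curve(2)[OF S] _ P Q(1)] Q(2) by auto
    moreover have "zero_locus {P} \<in> irreducible_components (curve_points F)" "zero_locus {Q} \<in> irreducible_components (curve_points F)"
      using P Q(1) by (auto simp: irreducible_components_curve(1)[OF S])
    ultimately show ?thesis using nodes on[OF P w(2)] on[OF Q(1,3)] by blast
  qed
  show ?thesis
  proof (rule max_noether[OF pg(4,1) pg(6)[OF False] f(1)])
    fix w :: "'k ^ 3" assume w: "w \<noteq> 0" "eval3 P w = 0" "eval3 ?G w = 0"
    have "eval3 f (rep (vec.span {w})) = 0" using vanishing_ideal_homog_iff[OF X f(1)] f(2) meet[OF w] by blast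
    thus "eval3 f w = 0" using eval3_rep_span[OF f(1) w(1)] by simp
    show "transversal_at P ?G w"
      using ordinary_node_transversal[OF pg(2,3) w] meet[OF w] pg(5) by simp
  qed
qed

lemma interpolation:
  fixes X :: "('k::field ^ 3) set set"
  assumes X: "finite X" "X \<subseteq> proj_plane" "card X \<le> n"
  obtains C where "C \<in> homog (int n)" "\<And>p. p \<in> X \<Longrightarrow> eval3 C (rep p) = y p"
proof -
  have "\<exists>h. h \<in> homog (int n) \<and> eval3 h (rep p) \<noteq> 0 \<and> (\<forall>q\<in>X - {p}. eval3 h (rep q) = 0)" if p: "p \<in> X" for p
    using interpolating_form[OF X(1,2) p X(3)] by metis
  then obtain h where h: "\<And>p. p \<in> X \<Longrightarrow> h p \<in> homog (int n)" "\<And>p. p \<in> X \<Longrightarrow> eval3 (h p) (rep p) \<noteq> 0"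
    "\<And>p q. p \<in> X \<Longrightarrow> q \<in> X - {p} \<Longrightarrow> eval3 (h p) (rep q) = 0" by metis
  define C where "C = (\<Sum>p\<in>X. const3 (y p / eval3 (h p) (rep p)) * h p)"
  have "C \<in> homog (int n)" unfolding C_def by (intro homog_sum homog_const3_mult h(1))
  moreover have "eval3 C (rep q) = y q" if q: "q \<in> X" for q
  proof -
    have "eval3 C (rep q) = (\<Sum>p\<in>X. y p / eval3 (h p) (rep p) * eval3 (h p) (rep q))" by (simp add: C_def)
    also have "\<dots> = (\<Sum>p\<in>{q}. y p / eval3 (h p) (rep p) * eval3 (h p) (rep q))"
      by (rule sum.mono_neutral_right) (use X(1) q h(3) in auto)
    finally show ?thesis using h(2)[OF q] by simp
  qed
  ultimately show ?thesis using that by blast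
qed

text \<open>The coefficients A and B of \<open>form_vanishing_on_line_point\<close> need not vanish
  on X. A Koszul change by a form C that interpolates -B divided by the line makes B vanish there;
  the degree n - 2 of C has to be at least the number of points. Then A vanishes too, because the
  line misses X.\<close>

lemma vanishing_ideal_section:
  fixes X :: "('k::alg_closed_field ^ 3) set set"
  assumes X: "finite X" "X \<subseteq> proj_plane" and t: "\<And>p. p \<in> X \<Longrightarrow> eval3 (line t) (rep p) \<noteq> 0"
    and v: "v \<noteq> 0" "eval3 (line t) v = 0" and n: "n \<ge> int (card X + 2)"
    and f: "f \<in> vanishing_ideal X" "f \<in> homog n" "eval3 f v = 0"
  shows "\<exists>A B. A \<in> vanishing_ideal X \<and> A \<in> homog (n - 1) \<and> B \<in> vanishing_ideal X \<and> B \<in> homog (n - 1) \<and>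
    f = line t * A + pt_line v * B"
proof -
  obtain A B where AB: "A \<in> homog (n - 1)" "B \<in> homog (n - 1)" "f = line t * A + pt_line v * B"
    using form_vanishing_on_line_point[OF f(2) v f(3)] by blast
  have "card X \<le> nat (n - 2)" using n by simp
  then obtain C where C: "C \<in> homog (int (nat (n - 2)))" "\<And>p. p \<in> X \<Longrightarrow> eval3 C (rep p) = - eval3 B (rep p) / eval3 (line t) (rep p)"
    using interpolation[OF X, of "nat (n - 2)" "\<lambda>p. - eval3 B (rep p) / eval3 (line t) (rep p)"] by blast
  have Ch: "C \<in> homog (n - 2)" using C(1) n by simp
  define A' B' where "A' = A - pt_line v * C" and "B' = B + line t * C"
  have "pt_line v * C \<in> homog (n - 1)" "line t * C \<in> homog (n - 1)"
    using homog_mult[OF pt_line_homog Ch] homog_mult[OF line_homog Ch] by (simp_all add: algebra_simps)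
  hence hom: "A' \<in> homog (n - 1)" "B' \<in> homog (n - 1)"
    unfolding A'_def B'_def using AB(1,2) by (auto intro: homog_add homog_diff)
  have B': "B' \<in> vanishing_ideal X"
    unfolding vanishing_ideal_homog_iff[OF X(2) hom(2)] using C(2) t by (simp add: B'_def)
  have eq: "f = line t * A' + pt_line v * B'" using AB(3) by (simp add: A'_def B'_def algebra_simps)
  have "line t * A' = f + (- pt_line v) * B'" using eq by simp
  hence "line t * A' \<in> vanishing_ideal X" using vanishing_ideal_closed(2)[OF f(1) vanishing_ideal_closed(3)[OF B']] by metis
  hence "A' \<in> vanishing_ideal X" using vanishing_ideal_cancel_line[OF X(2), of t] t by blast
  thus ?thesis using B' hom eq by blast
qed

text \<open>The ideal is treated as a graded submodule of the free module of rank 1, so that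
  \<open>graded_submodule_finitely_generated\<close> applies.\<close>

theorem vanishing_ideal_finitely_generated:
  fixes X :: "('k::alg_closed_field ^ 3) set set"
  assumes X: "finite X" "X \<subseteq> proj_plane"
  shows "\<exists>G. finite G \<and> (\<forall>x\<in>G. \<exists>n. x \<in> homog n) \<and> Modules.module.span (*) G = vanishing_ideal X"
proof -
  obtain t where t: "\<And>p. p \<in> X \<Longrightarrow> eval3 (line t) (rep p) \<noteq> 0" using line_avoiding_points[OF X] by blast
  define v :: "'k ^ 3" where "v = (\<chi> i. if i = 1 then - t else if i = 2 then 1 else 0)"
  have "v $ 2 = 1" by (simp add: v_def)
  hence v: "v \<noteq> 0" "eval3 (line t) v = 0" "eval3 (var 2) v = 1"
    by (auto simp: vec3_eq_0_iff eval3_line) (simp_all add: v_def)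
  define M where "M = {u :: nat \<Rightarrow>\<^sub>0 'k poly3. Poly_Mapping.keys u \<subseteq> {..<1} \<and> Poly_Mapping.lookup u 0 \<in> vanishing_ideal X}"
  have M_iff: "u \<in> M \<longleftrightarrow> (\<forall>j. j \<noteq> 0 \<longrightarrow> Poly_Mapping.lookup u j = 0) \<and> Poly_Mapping.lookup u 0 \<in> vanishing_ideal X" for u
    by (auto simp: M_def in_keys_iff subset_iff)
  have single: "Poly_Mapping.single 0 f \<in> M \<longleftrightarrow> f \<in> vanishing_ideal X" for f
    by (simp add: M_iff lookup_single)
  have "\<exists>G. finite G \<and> (\<forall>x\<in>G. \<exists>n. x \<in> free_grading (\<lambda>_. 0) n) \<and> fm.span G = M"
  proof (rule graded_submodule_finitely_generated[where v = v and z = "var 2" and r = 1])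
    show "fm.subspace M"
      by (rule fm.subspaceI) (auto simp: M_iff lookup_add intro: vanishing_ideal_closed)
    show "Poly_Mapping.keys u \<subseteq> {..<1}" if "u \<in> M" for u using that by (simp add: M_def)
    show "fcomp (\<lambda>_. 0) n u \<in> M" if "u \<in> M" for u n
      using that vanishing_ideal_hcomp[OF X(2)] by (simp add: M_iff)
    show "var 2 \<in> homog 1" "eval3 (var 2) v = 1" by (rule homog_var, rule v(3))
    fix n q assume q: "n \<ge> int (card X + 2)" "q \<in> M" "q \<in> free_grading (\<lambda>_. 0) n" "\<And>j. eval3 (Poly_Mapping.lookup q j) v = 0"
    have "Poly_Mapping.lookup q 0 \<in> vanishing_ideal X" "Poly_Mapping.lookup q 0 \<in> homog n"
      using q(2,3) by (auto simp: M_def free_grading_def)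
    then obtain A B where AB: "A \<in> vanishing_ideal X" "A \<in> homog (n - 1)" "B \<in> vanishing_ideal X" "B \<in> homog (n - 1)"
      "Poly_Mapping.lookup q 0 = line t * A + pt_line v * B"
      using vanishing_ideal_section[OF X t v(1,2) q(1) _ _ q(4)] by blast
    have gr: "Poly_Mapping.single 0 f \<in> free_grading (\<lambda>_. 0) (n - 1)" if "f \<in> homog (n - 1)" for f :: "'k poly3"
      using that by (auto simp: free_grading_def lookup_single when_def)
    have "q = free_scale (line t) (Poly_Mapping.single 0 A) + free_scale (pt_line v) (Poly_Mapping.single 0 B)"
      using q(2) AB(5) by (intro poly_mapping_eqI) (auto simp: M_iff lookup_add lookup_single when_def)
    thus "\<exists>A\<in>M \<inter> free_grading (\<lambda>_. 0) (n - 1). \<exists>B\<in>M \<inter> free_grading (\<lambda>_. 0) (n - 1).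
        q = free_scale (line t) A + free_scale (pt_line v) B"
      using AB(1-4) single gr by blast
  qed
  then obtain G where G: "finite G" "\<And>x. x \<in> G \<Longrightarrow> \<exists>n. x \<in> free_grading (\<lambda>_. 0) n" "fm.span G = M" by blast
  let ?l = "\<lambda>u :: nat \<Rightarrow>\<^sub>0 'k poly3. Poly_Mapping.lookup u 0"
  have "Modules.module.span (*) (?l ` G) = vanishing_ideal X"
  proof (rule Set.set_eqI)
    fix f
    show "f \<in> Modules.module.span (*) (?l ` G) \<longleftrightarrow> f \<in> vanishing_ideal X"
      unfolding module.span_image_iff[OF module_poly3 G(1)]
    proof
      assume "\<exists>c. f = (\<Sum>u\<in>G. c u * ?l u)"
      moreover have "?l u \<in> vanishing_ideal X" if "u \<in> G" for u using fm.span_base[OF that] by (simp add: G(3) M_iff)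
      ultimately show "f \<in> vanishing_ideal X" by (auto intro: vanishing_ideal_sum vanishing_ideal_closed(3))
    next
      assume "f \<in> vanishing_ideal X"
      hence "Poly_Mapping.single 0 f \<in> fm.span ((\<lambda>u. u) ` G)" by (simp add: G(3) single)
      then obtain c where "Poly_Mapping.single 0 f = (\<Sum>u\<in>G. free_scale (c u) u)"
        unfolding fm.span_image_iff[OF G(1)] by blast
      hence "?l (Poly_Mapping.single 0 f) = ?l (\<Sum>u\<in>G. free_scale (c u) u)" by (rule arg_cong)
      thus "\<exists>c. f = (\<Sum>u\<in>G. c u * ?l u)" by (auto simp: lookup_sum)
    qed
  qed
  moreover have "\<forall>x\<in>?l ` G. \<exists>n. x \<in> homog n" using G(2) by (fastforce simp: free_grading_def)
  ultimately show ?thesis using G(1) by blast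
qed

lemma (in presentation) mem_syzygies_iff:
  "u \<in> syzygies (*) r g \<longleftrightarrow> Poly_Mapping.keys u \<subseteq> {..<r} \<and> comb (Poly_Mapping.lookup u) = 0"
  by (simp add: syzygies_def comb_def)

lemma (in presentation) vec_pm_syzygies: "vec_pm r u \<in> syzygies (*) r g \<longleftrightarrow> comb u = 0"
proof -
  have "comb (Poly_Mapping.lookup (vec_pm r u)) = comb u" by (rule comb_cong) simp
  thus ?thesis using keys_vec_pm[of r u] by (simp add: mem_syzygies_iff)
qed

lemma (in presentation) lookup_outside: "u \<in> syzygies (*) r g \<Longrightarrow> \<not> j < r \<Longrightarrow> Poly_Mapping.lookup u j = 0"
  by (auto simp: mem_syzygies_iff subset_iff in_keys_iff)

theorem (in presentation) syzygies_finitely_generated: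
  "\<exists>G. finite G \<and> (\<forall>x\<in>G. \<exists>n. x \<in> free_grading a n) \<and> fm.span G = syzygies (*) r g"
\<comment> \<open>\<open>syzygy_section\<close> holds in every degree, so the threshold 0 is
  arbitrary.\<close>
proof (rule graded_submodule_finitely_generated[where v = vv and z = "var 2" and r = r and l = "line t" and y = "pt_line vv" and ?n1.0 = 0])
  let ?M = "syzygies (*) r g"
  show "fm.subspace ?M"
  proof (rule fm.subspaceI)
    show "0 \<in> ?M" by (simp add: syzygies_def)
    show "x + y \<in> ?M" if "x \<in> ?M" "y \<in> ?M" for x y
      using that keys_add[of x y] comb_cong[of "Poly_Mapping.lookup (x + y)"] comb_simps(1)[of "Poly_Mapping.lookup x" "Poly_Mapping.lookup y"]
      by (auto simp: mem_syzygies_iff lookup_add)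
    show "free_scale c x \<in> ?M" if "x \<in> ?M" for c x
      using that comb_cong[of "Poly_Mapping.lookup (free_scale c x)"] comb_simps(3)[of c "Poly_Mapping.lookup x"]
      by (auto simp: mem_syzygies_iff subset_iff in_keys_iff)
  qed
  show "Poly_Mapping.keys u \<subseteq> {..<r}" if "u \<in> ?M" for u using that by (simp add: syzygies_def)
  show "fcomp a n u \<in> ?M" if u: "u \<in> ?M" for u n
  proof -
    have "Poly_Mapping.keys (fcomp a n u) \<subseteq> Poly_Mapping.keys u" by (auto simp: in_keys_iff)
    moreover have "comb (Poly_Mapping.lookup (fcomp a n u)) = hcomp n (comb (Poly_Mapping.lookup u))"
      unfolding hcomp_comb by (rule comb_cong) simp
    ultimately show ?thesis using u by (auto simp: mem_syzygies_iff)
  qed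
  show "var 2 \<in> homog 1" "eval3 (var 2) vv = 1" by (simp_all add: vv)
  fix n q assume q: "q \<in> ?M" "q \<in> free_grading a n" "\<And>j. eval3 (Poly_Mapping.lookup q j) vv = 0"
  obtain A B where AB: "comb A = 0" "comb B = 0" "\<And>j. j < r \<Longrightarrow> A j \<in> homog (n - 1 - a j)" "\<And>j. j < r \<Longrightarrow> B j \<in> homog (n - 1 - a j)"
    "\<And>j. j < r \<Longrightarrow> Poly_Mapping.lookup q j = line t * A j + pt_line vv * B j"
    using syzygy_section[of "Poly_Mapping.lookup q" n] q by (auto simp: mem_syzygies_iff free_grading_def)
  have "q = free_scale (line t) (vec_pm r A) + free_scale (pt_line vv) (vec_pm r B)"
    using lookup_outside[OF q(1)] AB(5) by (intro poly_mapping_eqI) (auto simp: lookup_add)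
  moreover have "vec_pm r A \<in> ?M \<inter> free_grading a (n - 1)" "vec_pm r B \<in> ?M \<inter> free_grading a (n - 1)"
    using AB(1-4) by (auto simp: vec_pm_syzygies free_grading_def)
  ultimately show "\<exists>A\<in>?M \<inter> free_grading a (n - 1). \<exists>B\<in>?M \<inter> free_grading a (n - 1).
      q = free_scale (line t) A + free_scale (pt_line vv) B" by blast
qed

subsection \<open>Betti numbers\<close>

lemma min_homog_gens_ideal:
  fixes I :: "'k::comm_ring_1 poly3 set"
  assumes "min_homog_gens (*) homog I r a g"
  shows "f \<in> I \<longleftrightarrow> (\<exists>c. f = (\<Sum>j<r. c j * g j))" "j < r \<Longrightarrow> g j \<in> homog (a j)"
    "j < r \<Longrightarrow> g j \<noteq> (\<Sum>i\<in>{..<r} - {j}. c i * g i)"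
proof -
  have I: "I = Modules.module.span (*) (g ` {..<r})" using assms by (simp add: min_homog_gens_def)
  show "f \<in> I \<longleftrightarrow> (\<exists>c. f = (\<Sum>j<r. c j * g j))"
    unfolding I by (rule module.span_image_iff[OF module_poly3]) simp
  show "j < r \<Longrightarrow> g j \<in> homog (a j)" using assms by (simp add: min_homog_gens_def)
  assume j: "j < r"
  hence "g j \<notin> Modules.module.span (*) (g ` ({..<r} - {j}))" using assms by (simp add: min_homog_gens_def)
  thus "g j \<noteq> (\<Sum>i\<in>{..<r} - {j}. c i * g i)"
    using module.span_image_iff[OF module_poly3, of "{..<r} - {j}" "g j" g] by blast
qed

lemma (in presentation) min_homog_gens_syzygies:
  assumes "min_homog_gens free_scale (free_grading a) (syzygies (*) r g) s b h"
  shows "resolution I t r a g s b (\<lambda>k. Poly_Mapping.lookup (h k))"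
proof
  have span: "fm.span (h ` {..<s}) = syzygies (*) r g" using assms by (simp add: min_homog_gens_def)
  have h: "h k \<in> syzygies (*) r g" if "k < s" for k using fm.span_base[of "h k" "h ` {..<s}"] span that by auto
  show "comb (Poly_Mapping.lookup (h k)) = 0" if "k < s" for k using h[OF that] by (simp add: mem_syzygies_iff)
  show "\<exists>c. \<forall>j<r. u j = (\<Sum>k<s. c k * Poly_Mapping.lookup (h k) j)" if "comb u = 0" for u
  proof -
    have "vec_pm r u \<in> fm.span (h ` {..<s})" using that by (simp add: span vec_pm_syzygies)
    then obtain c where c: "vec_pm r u = (\<Sum>k<s. free_scale (c k) (h k))"
      using fm.span_image_iff[of "{..<s}" "vec_pm r u" h] by auto
    have "u j = (\<Sum>k<s. c k * Poly_Mapping.lookup (h k) j)" if "j < r" for j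
      using that arg_cong[OF c, of "\<lambda>x. Poly_Mapping.lookup x j"] by (simp add: lookup_sum)
    thus ?thesis by blast
  qed
  show "Poly_Mapping.lookup (h k) j \<in> homog (b k - a j)" if "k < s" for k j
    using assms that by (auto simp: min_homog_gens_def free_grading_def)
  show "\<not> (\<forall>j<r. Poly_Mapping.lookup (h k) j = (\<Sum>i\<in>{..<s} - {k}. c i * Poly_Mapping.lookup (h i) j))" if k: "k < s" for k c
  proof
    assume eq: "\<forall>j<r. Poly_Mapping.lookup (h k) j = (\<Sum>i\<in>{..<s} - {k}. c i * Poly_Mapping.lookup (h i) j)"
    have "h k = (\<Sum>i\<in>{..<s} - {k}. free_scale (c i) (h i))"
    proof (rule poly_mapping_eqI)
      fix j
      show "Poly_Mapping.lookup (h k) j = Poly_Mapping.lookup (\<Sum>i\<in>{..<s} - {k}. free_scale (c i) (h i)) j"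
      proof (cases "j < r")
        case True
        thus ?thesis using eq by (simp add: lookup_sum)
      next
        case False
        have "(\<Sum>i\<in>{..<s} - {k}. c i * Poly_Mapping.lookup (h i) j) = 0"
          by (rule sum.neutral) (use lookup_outside[OF h False] in auto)
        thus ?thesis using lookup_outside[OF h[OF k] False] by (simp add: lookup_sum)
      qed
    qed
    hence "h k \<in> fm.span (h ` ({..<s} - {k}))" using fm.span_image_iff[of "{..<s} - {k}" "h k" h] by blast
    thus False using assms k by (simp add: min_homog_gens_def)
  qed
qed

lemma (in resolution) second_syzygies_trivial:
  assumes "\<And>k. k < s \<Longrightarrow> H k = Poly_Mapping.lookup (h k)"
  shows "syzygies free_scale s h = {0}"
proof (rule equalityI; rule subsetI)
  fix u assume u: "u \<in> syzygies free_scale s h"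
  have "(\<Sum>k<s. Poly_Mapping.lookup u k * H k j) = 0" for j
  proof -
    have "Poly_Mapping.lookup (\<Sum>k<s. free_scale (Poly_Mapping.lookup u k) (h k)) j = 0"
      using u by (simp add: syzygies_def)
    thus ?thesis by (simp add: lookup_sum assms)
  qed
  hence 0: "Poly_Mapping.lookup u k = 0" if "k < s" for k using H_independent[OF _ that] by blast
  have "Poly_Mapping.lookup u k = 0" if "\<not> k < s" for k
    using u that by (auto simp: syzygies_def subset_iff in_keys_iff)
  hence "u = 0" using 0 by (intro poly_mapping_eqI) (metis lookup_zero)
  thus "u \<in> {0}" by simp
qed (simp add: syzygies_def)

lemma min_homog_gens_zero_iff:
  "min_homog_gens free_scale gr {0 :: nat \<Rightarrow>\<^sub>0 'k::field poly3} r a g \<longleftrightarrow> r = 0"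
proof
  assume *: "min_homog_gens free_scale gr {0 :: nat \<Rightarrow>\<^sub>0 'k poly3} r a g"
  show "r = 0"
  proof (rule ccontr)
    assume "r \<noteq> 0"
    hence r: "0 < r" by simp
    hence "g 0 \<in> fm.span (g ` {..<r})" by (intro fm.span_base) auto
    hence "g 0 = 0" using * by (simp add: min_homog_gens_def)
    moreover have "g 0 \<notin> fm.span (g ` ({..<r} - {0}))" using * r by (simp add: min_homog_gens_def)
    moreover have "(0 :: nat \<Rightarrow>\<^sub>0 'k poly3) \<in> fm.span (g ` ({..<r} - {0}))" by (rule fm.span_zero)
    ultimately show False by simp
  qed
qed (simp add: min_homog_gens_def)

lemma syzygies_0: "syzygies free_scale 0 h = {0}"
  by (auto simp: syzygies_def)

text \<open>The definite description asks for a resolution and for one count common to all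
  resolutions. In the applications the count is forced: 0 beyond the regularity bound, and
  \<open>card S - 1\<close> for the syzygies of degree d.\<close>

lemma graded_betti_eqI:
  assumes "\<exists>r a g h. min_free_resolution s gr M r a g h"
    and "\<And>r a g h. min_free_resolution s gr M r a g h \<Longrightarrow> card {j. j < r i \<and> a i j = n} = c"
  shows "graded_betti s gr M i n = c"
  unfolding graded_betti_def using assms by (intro the_equality) blast+

section \<open>Resolutions of the ideal of a set of singular points\<close>

context
  fixes F :: "'k::alg_closed_field poly3" and d :: nat and S :: "'k poly3 set" and \<Gamma> :: "('k ^ 3) set set"
  assumes S: "form_factors F S" and F: "F \<in> homog (int d)" and S_ne: "S \<noteq> {}" and sing: "\<Gamma> \<subseteq> singular_points F"
begin

lemma \<Gamma>_finite: "finite \<Gamma>" and \<Gamma>_plane: "\<Gamma> \<subseteq> proj_plane"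
  using sing finite_subset[OF sing finite_singular_points[OF S F]] singular_pointsD(1)[OF _ F] by auto

lemma presentation_vanishing_ideal:
  assumes "min_homog_gens (*) homog (vanishing_ideal \<Gamma>) r a g"
  obtains t where "presentation (vanishing_ideal \<Gamma>) t r a g"
proof -
  obtain t where t: "\<And>p. p \<in> \<Gamma> \<Longrightarrow> eval3 (line t) (rep p) \<noteq> 0"
    using line_avoiding_points[OF \<Gamma>_finite \<Gamma>_plane] by blast
  have "presentation (vanishing_ideal \<Gamma>) t r a g"
    by unfold_locales (use min_homog_gens_ideal[OF assms] vanishing_ideal_cancel_line[OF \<Gamma>_plane t] in blast)+
  thus ?thesis by (rule that)
qed

lemma curve_resolution:
  assumes "min_homog_gens (*) homog (vanishing_ideal \<Gamma>) r a g"
    "min_homog_gens free_scale (free_grading a) (syzygies (*) r g) s b h"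
  obtains t where "curve_resolution \<Gamma> t r a g s b (\<lambda>k. Poly_Mapping.lookup (h k)) F d S"
proof -
  obtain t where "presentation (vanishing_ideal \<Gamma>) t r a g" using presentation_vanishing_ideal[OF assms(1)] .
  from presentation.min_homog_gens_syzygies[OF this assms(2)]
  have "curve_resolution \<Gamma> t r a g s b (\<lambda>k. Poly_Mapping.lookup (h k)) F d S"
    by (intro curve_resolution.intro curve_resolution_axioms.intro S F S_ne \<Gamma>_finite sing min_homog_gens_ideal(3)[OF assms(1)])
  thus ?thesis by (rule that)
qed

lemma second_syzygies:
  assumes "min_homog_gens (*) homog (vanishing_ideal \<Gamma>) r a g"
    "min_homog_gens free_scale (free_grading a) (syzygies (*) r g) s b h"
  shows "syzygies free_scale s h = {0}"
proof -
  obtain t where "curve_resolution \<Gamma> t r a g s b (\<lambda>k. Poly_Mapping.lookup (h k)) F d S" using curve_resolution[OF assms] .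
  then interpret curve_resolution \<Gamma> t r a g s b "\<lambda>k. Poly_Mapping.lookup (h k)" F d S .
  show ?thesis by (rule second_syzygies_trivial) simp
qed

lemma min_free_resolution_exists: "\<exists>r a g h. min_free_resolution (*) homog (vanishing_ideal \<Gamma>) r a g h"
proof -
  obtain G where "finite G" "\<forall>x\<in>G. \<exists>n. x \<in> homog n" "Modules.module.span (*) G = vanishing_ideal \<Gamma>"
    using vanishing_ideal_finitely_generated[OF \<Gamma>_finite \<Gamma>_plane] by blast
  from minimal_generators_exist[OF module_poly3 this]
  obtain r a g where g: "min_homog_gens (*) homog (vanishing_ideal \<Gamma>) r a g" by blast
  obtain t where t: "presentation (vanishing_ideal \<Gamma>) t r a g" using presentation_vanishing_ideal[OF g] .
  obtain G' where "finite G'" "\<forall>x\<in>G'. \<exists>n. x \<in> free_grading a n" "fm.span G' = syzygies (*) r g"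
    using presentation.syzygies_finitely_generated[OF t] by blast
  from minimal_generators_exist[OF fm.module_axioms this]
  obtain s b h where h: "min_homog_gens free_scale (free_grading a) (syzygies (*) r g) s b h" by blast
  \<comment> \<open>Freeness of the syzygies ends the resolution: from index 2 on the ranks are 0,
    and the degrees \<open>a'\<close> are mere fillers there.\<close>
  define r' where "r' i = (if i = 0 then r else if i = 1 then s else 0)" for i :: nat
  define a' where "a' i = (if i = 0 then a else b)" for i :: nat
  have "min_free_resolution (*) homog (vanishing_ideal \<Gamma>) r' a' g (\<lambda>_. h)"
    unfolding min_free_resolution_def
  proof (intro conjI allI)
    show "min_homog_gens (*) homog (vanishing_ideal \<Gamma>) (r' 0) (a' 0) g" using g by (simp add: r'_def a'_def)
    fix i
    consider "i = 0" | "i = 1" | k where "i = Suc (Suc k)" by (metis One_nat_def not0_implies_Suc)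
    thus "min_homog_gens free_scale (free_grading (a' i))
        (case i of 0 \<Rightarrow> syzygies (*) (r' 0) g | Suc k \<Rightarrow> syzygies free_scale (r' i) h) (r' (Suc i)) (a' (Suc i)) h"
      by cases (use h second_syzygies[OF g h] in \<open>simp_all add: r'_def a'_def min_homog_gens_zero_iff syzygies_0\<close>)
  qed
  thus ?thesis by blast
qed

lemma min_free_resolution_bounds:
  assumes res: "min_free_resolution (*) homog (vanishing_ideal \<Gamma>) r a g h"
  shows "j < r i \<Longrightarrow> a i j - int i \<le> int d - 1"
    and "(\<And>P f n. P \<in> S \<Longrightarrow> f \<in> homog (int n) \<Longrightarrow> f \<in> vanishing_ideal \<Gamma> \<Longrightarrow> f \<in> ideal2 P (\<Prod>(S - {P}))) \<Longrightarrow>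
      card S = Suc (card {j. j < r 1 \<and> a 1 j = int d})"
proof -
  have g: "min_homog_gens (*) homog (vanishing_ideal \<Gamma>) (r 0) (a 0) g" using res by (simp add: min_free_resolution_def)
  have h: "min_homog_gens free_scale (free_grading (a i))
        (case i of 0 \<Rightarrow> syzygies (*) (r 0) g | Suc k \<Rightarrow> syzygies free_scale (r i) (h k)) (r (Suc i)) (a (Suc i)) (h i)" for i
    using res by (simp add: min_free_resolution_def)
  have h0: "min_homog_gens free_scale (free_grading (a 0)) (syzygies (*) (r 0) g) (r 1) (a 1) (h 0)" using h[of 0] by simp
  obtain t where "curve_resolution \<Gamma> t (r 0) (a 0) g (r 1) (a 1) (\<lambda>k. Poly_Mapping.lookup (h 0 k)) F d S"
    using curve_resolution[OF g h0] .
  then interpret curve_resolution \<Gamma> t "r 0" "a 0" g "r 1" "a 1" "\<lambda>k. Poly_Mapping.lookup (h 0 k)" F d S .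
  have r0: "r (Suc (Suc k)) = 0" for k
  proof (induction k)
    case 0
    have "min_homog_gens free_scale (free_grading (a 1)) {0} (r (Suc (Suc 0))) (a (Suc (Suc 0))) (h 1)"
      using h[of 1] second_syzygies[OF g h0] by simp
    thus ?case by (simp only: min_homog_gens_zero_iff)
  next
    case (Suc k)
    have "min_homog_gens free_scale (free_grading (a (Suc (Suc k)))) {0} (r (Suc (Suc (Suc k)))) (a (Suc (Suc (Suc k)))) (h (Suc (Suc k)))"
      using h[of "Suc (Suc k)"] Suc by (simp add: syzygies_0)
    thus ?case by (simp only: min_homog_gens_zero_iff)
  qed
  show "a i j - int i \<le> int d - 1" if j: "j < r i"
  proof -
    consider "i = 0" | "i = 1" | k where "i = Suc (Suc k)" by (metis One_nat_def not0_implies_Suc)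
    thus ?thesis
    proof cases
      case 1
      thus ?thesis using generator_degree_less[of j] j by simp
    next
      case 2
      thus ?thesis using syzygy_degree_le[of j] j by simp
    next
      case 3
      thus ?thesis using r0 j by simp
    qed
  qed
  show "card S = Suc (card {j. j < r 1 \<and> a 1 j = int d})"
    if "\<And>P f n. P \<in> S \<Longrightarrow> f \<in> homog (int n) \<Longrightarrow> f \<in> vanishing_ideal \<Gamma> \<Longrightarrow> f \<in> ideal2 P (\<Prod>(S - {P}))"
    by (rule card_factors[OF that])
qed

lemma ideal_reg_le: "ideal_reg (vanishing_ideal \<Gamma>) \<le> ereal (real d - 1)"
  unfolding ideal_reg_def regularity_def
proof (rule Sup_least)
  fix x assume "x \<in> {ereal (real_of_int (n - int i)) | i n. graded_betti (*) homog (vanishing_ideal \<Gamma>) i n \<noteq> 0}"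
  then obtain i n where x: "x = ereal (real_of_int (n - int i))" and nz: "graded_betti (*) homog (vanishing_ideal \<Gamma>) i n \<noteq> 0" by blast
  have "n - int i \<le> int d - 1"
  proof (rule ccontr)
    assume big: "\<not> n - int i \<le> int d - 1"
    have "graded_betti (*) homog (vanishing_ideal \<Gamma>) i n = 0"
    proof (rule graded_betti_eqI[OF min_free_resolution_exists])
      fix r a g h assume "min_free_resolution (*) homog (vanishing_ideal \<Gamma>) r a g h"
      from min_free_resolution_bounds(1)[OF this] have "{j. j < r i \<and> a i j = n} = {}" using big by auto
      thus "card {j. j < r i \<and> a i j = n} = 0" by simp
    qed
    thus False using nz by contradiction
  qed
  hence "real_of_int (n - int i) \<le> real_of_int (int d - 1)" by (simp only: of_int_le_iff)
  thus "x \<le> ereal (real d - 1)" by (simp add: x)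
qed

lemma num_min_syzygies_eq:
  assumes "\<And>P f n. P \<in> S \<Longrightarrow> f \<in> homog (int n) \<Longrightarrow> f \<in> vanishing_ideal \<Gamma> \<Longrightarrow> f \<in> ideal2 P (\<Prod>(S - {P}))"
  shows "num_min_syzygies (vanishing_ideal \<Gamma>) (int d) = card S - 1"
  unfolding num_min_syzygies_def
proof (rule graded_betti_eqI[OF min_free_resolution_exists])
  fix r a g h assume "min_free_resolution (*) homog (vanishing_ideal \<Gamma>) r a g h"
  from min_free_resolution_bounds(2)[OF this assms]
  show "card {j. j < r 1 \<and> a 1 j = int d} = card S - 1" by simp
qed

end

theorem corollary1p2:
  fixes F :: "'k::alg_closed_field poly3" and d :: nat and \<Gamma> :: "('k ^ 3) set set"
  assumes curve: "reduced_plane_curve d F"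
    and sing: "\<Gamma> \<subseteq> singular_points F"
  shows "ideal_reg (vanishing_ideal \<Gamma>) \<le> ereal (real d - 1) \<and>
    ((\<forall>X\<in>irreducible_components (curve_points F). \<forall>Y\<in>irreducible_components (curve_points F).
        X \<noteq> Y \<longrightarrow> (\<forall>p\<in>X \<inter> Y. p \<in> \<Gamma> \<and> ordinary_node F p))
     \<longrightarrow> int (num_min_syzygies (vanishing_ideal \<Gamma>) (int d)) =
         int (card (irreducible_components (curve_points F))) - 1)"
proof -
  have d: "d > 0" "F \<in> homog (int d)" "squarefree F" using curve by (auto simp: reduced_plane_curve_def)
  obtain S where S: "form_factors F S" using form_factors_exist[OF d(2,1,3)] by blast
  note fS = form_factorsD[OF S]
  have "S \<noteq> {}"
  proof
    assume "S = {}"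
    hence "F = 1" using fS(2) by simp
    thus False using homog_unit_iff[OF d(2)] d(1) by simp
  qed
  note reg = ideal_reg_le[OF S d(2) this sing] and num = num_min_syzygies_eq[OF S d(2) this sing]
  show ?thesis
  proof (intro conjI impI)
    show "ideal_reg (vanishing_ideal \<Gamma>) \<le> ereal (real d - 1)" by (rule reg)
    assume nodes: "\<forall>X\<in>irreducible_components (curve_points F). \<forall>Y\<in>irreducible_components (curve_points F).
        X \<noteq> Y \<longrightarrow> (\<forall>p\<in>X \<inter> Y. p \<in> \<Gamma> \<and> ordinary_node F p)"
    have plane: "\<Gamma> \<subseteq> proj_plane" using sing singular_pointsD(1)[OF _ d(2)] by blast
    have "num_min_syzygies (vanishing_ideal \<Gamma>) (int d) = card S - 1"
      by (rule num, rule component_splitting[OF S d(2) plane]) (use nodes in blast)+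
    moreover have "card (irreducible_components (curve_points F)) = card S"
      unfolding irreducible_components_curve(1)[OF S] by (rule card_image[OF irreducible_components_curve(2)[OF S]])
    \<comment> \<open>Makes the truncated subtraction of natural numbers agree with the integer
      one.\<close>
    moreover have "card S > 0" using fS(1) \<open>S \<noteq> {}\<close> by (simp add: card_gt_0_iff)
    ultimately show "int (num_min_syzygies (vanishing_ideal \<Gamma>) (int d)) =
         int (card (irreducible_components (curve_points F))) - 1" by simp
  qed
qed

end
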